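(* Let $A$ be a unital associative algebra over a field $k$. Then the Tate-Hochschild cohomology $\mathrm{HH}^*_{\mathrm{sg}}(A,A)$, equipped with the cup product $\cup$ and the Lie bracket $[\cdot,\cdot]$, is a Gerstenhaber algebra. Moreover, the natural map $\rho:\mathrm{HH}^*(A,A)\to\mathrm{HH}^*_{\mathrm{sg}}(A,A)$ is a morphism of Gerstenhaber algebras.
   Context: Notation. $k$ is a field, $\otimes=\otimes_k$, $\overline A=A/(k\cdot 1)$, $s\overline A$ is $\overline A$ placed in degree $-1$, $\pi:A\to s\overline A$ the canonical projection, $\mu$ the multiplication of $A$, $s\overline a_{i,j}:=s\overline a_i\otimes\cdots\otimes s\overline a_j$ (empty tensor if $j<i$). $\Omega^p_{\mathrm{nc}}(A):=A\otimes (s\overline A)^{\otimes p}$, in degree $-p$, is an $A$-$A$-bimodule: left action by multiplication on the first factor, right action $$(a_0\otimes s\overline a_{1,p})\blacktriangleleft a_{p+1}=\sum_{i=0}^{p}(-1)^{p-i}a_0\otimes s\overline a_{1,i-1}\otimes s\overline{a_ia_{i+1}}\otimes s\overline a_{i+2,p+1}$$ (the $i=0$ term is $(-1)^pa_0a_1\otimes s\overline a_{2,p+1}$). For $m\in\mathbb Z$, $p\ge0$, $N=m+p$: $C^m(A,\Omega^p_{\mathrm{nc}}(A))=\mathrm{Hom}_k((s\overline A)^{\otimes N},A\otimes(s\overline A)^{\otimes p})$ (zero if $N<0$) with differential $$(-1)^{m+1}\delta(f)(s\overline a_{1,N+1})=a_1f(s\overline a_{2,N+1})+\sum_{j=1}^{N}(-1)^jf(s\overline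 a_{1,j-1}\otimes s\overline{a_ja_{j+1}}\otimes s\overline a_{j+2,N+1})+(-1)^{N+1}f(s\overline a_{1,N})\blacktriangleleft a_{N+1}.$$ $C^*_{\mathrm{sg}}(A,A)$ is the colimit of the complexes $C^*(A,\Omega^p_{\mathrm{nc}}(A))$ along the injective cochain maps $\theta_p(f)=f\otimes\mathrm{id}_{s\overline A}$, and $\mathrm{HH}^*_{\mathrm{sg}}(A,A)$ is its cohomology. The case $p=0$ is the normalized Hochschild cochain complex $C^*(A,A)$ with cohomology $\mathrm{HH}^*(A,A)$; the inclusion $C^*(A,A)\subset C^*_{\mathrm{sg}}(A,A)$ induces $\rho$. Operations. Let $f\in C^{m-p}(A,\Omega^p_{\mathrm{nc}}(A))$ and $g\in C^{n-q}(A,\Omega^q_{\mathrm{nc}}(A))$ with $m,n,p,q\ge0$. Tensor products of maps are evaluated without Koszul signs. $$f\cup g:=(\mu\otimes\mathrm{id}_{s\overline A}^{\otimes p+q})(\mathrm{id}_A\otimes f\otimes\mathrm{id}_{s\overline A}^{\otimes q})(g\otimes\mathrm{id}_{s\overline A}^{\otimes m})\in C^{m+n-p-q}(A,\Omega^{p+q}_{\mathrm{nc}}(A)).$$ With $\overline g:=(\pi\otimes\mathrm{id}_{s\overline A}^{\otimes q})g$, put $f\circ_ig:=(f\otimes\mathrm{id}^{\otimes q})(\mathrm{id}^{\otimes i-1}\otimes\overline g\otimes\mathrm{id}^{\otimes m-i})$ for $1\le i\le m$ and $f\circ_{-i}g:=(\mathrm{id}_A\otimes\mathrm{id}^{\otimes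 i-1}\otimes\overline g\otimes\mathrm{id}^{\otimes p-i})(f\otimes\mathrm{id}^{\otimes n-1})$ for $1\le i\le p$ (if $n=0$, first replace $g$ by $\theta_q(g)$), and $$f\circ g:=\sum_{i=1}^m(-1)^{(n-q-1)(i-1)}f\circ_ig-\sum_{i=1}^p(-1)^{(n-q-1)(i-m-p-1)}f\circ_{-i}g,$$ $[f,g]:=f\circ g-(-1)^{(m-p-1)(n-q-1)}g\circ f$. These operations are compatible with the maps $\theta$, hence are defined on $C^*_{\mathrm{sg}}(A,A)$; for $p=q=0$ they are the classical cup product (in the convention $(f\cup g)(s\overline a_{1,m+n})=g(s\overline a_{1,n})f(s\overline a_{n+1,m+n})$) and Gerstenhaber bracket on $C^*(A,A)$. A Gerstenhaber algebra is a graded vector space $G$ with (i) a graded commutative associative unital product $\cup$ of degree $0$; (ii) a bracket $[\cdot,\cdot]$ of degree $-1$ making $G^{*+1}$ a graded Lie algebra; (iii) $[f,g\cup h]=[f,g]\cup h+(-1)^{(|f|-1)|g|}g\cup[f,h]$. A morphism preserves degree, product, unit and bracket. *)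

theory Defs
  imports Complex_Main "HOL-Algebra.AbelCoset" "HOL-Algebra.Module" "HOL-Library.Poly_Mapping"
begin

section \<open>Vector spaces, quotients, linear maps, colimits\<close>

text \<open>
  A vector space over the field \<open>'k\<close> is a \<^locale>\<open>Module.module\<close> over \<open>scalar_field\<close>;
  the fields \<open>mult\<close> and \<open>one\<close> of the record are irrelevant and left unspecified.
\<close>

definition scalar_field :: "'k::field ring" where
  "scalar_field = \<lparr>carrier = UNIV, mult = (*), one = 1, zero = 0, add = (+)\<rparr>"

abbreviation vector_space_on :: "('k::field, 'v) module \<Rightarrow> bool" where
  "vector_space_on V \<equiv> Module.module scalar_field V"

definition signed :: "('k, 'v) module \<Rightarrow> int \<Rightarrow> 'v \<Rightarrow> 'v" where
  "signed V n x = (if even n then x else \<ominus>\<^bsub>V\<^esub> x)"  \<comment> \<open>\<open>(-1)\<^sup>n x\<close>\<close>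

definition zero_space :: "('k, 'v) module" where
  "zero_space = \<lparr>carrier = {undefined}, mult = undefined, one = undefined,
     zero = undefined, add = (\<lambda>_ _. undefined), smult = (\<lambda>_ _. undefined)\<rparr>"

definition quot_space :: "('k, 'v) module \<Rightarrow> 'v set \<Rightarrow> ('k, 'v set) module" where
  "quot_space V U = \<lparr>carrier = a_rcosets\<^bsub>V\<^esub> U, mult = undefined, one = undefined,
     zero = U, add = (\<lambda>X Y. X <+>\<^bsub>V\<^esub> Y), smult = (\<lambda>c X. \<Union>x\<in>X. U +>\<^bsub>V\<^esub> (c \<odot>\<^bsub>V\<^esub> x))\<rparr>"

definition linear_map :: "('k, 'v) module \<Rightarrow> ('k, 'w) module \<Rightarrow> ('v \<Rightarrow> 'w) \<Rightarrow> bool" where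
  "linear_map V W f \<longleftrightarrow> f \<in> carrier V \<rightarrow> carrier W \<and>
     (\<forall>x\<in>carrier V. \<forall>y\<in>carrier V. f (x \<oplus>\<^bsub>V\<^esub> y) = f x \<oplus>\<^bsub>W\<^esub> f y) \<and>
     (\<forall>c. \<forall>x\<in>carrier V. f (c \<odot>\<^bsub>V\<^esub> x) = c \<odot>\<^bsub>W\<^esub> f x)"

definition bilinear_map ::
  "('k, 'u) module \<Rightarrow> ('k, 'v) module \<Rightarrow> ('k, 'w) module \<Rightarrow> ('u \<Rightarrow> 'v \<Rightarrow> 'w) \<Rightarrow> bool" where
  "bilinear_map U V W b \<longleftrightarrow> (\<forall>x\<in>carrier U. linear_map V W (b x)) \<and>
     (\<forall>y\<in>carrier V. linear_map U W (\<lambda>x. b x y))"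

definition hom_space :: "('k, 'v) module \<Rightarrow> ('k, 'w) module \<Rightarrow> ('k, 'v \<Rightarrow> 'w) module" where
  "hom_space V W = \<lparr>carrier = {f \<in> extensional (carrier V). linear_map V W f},
     mult = undefined, one = undefined,
     zero = (\<lambda>x\<in>carrier V. \<zero>\<^bsub>W\<^esub>),
     add = (\<lambda>f g. \<lambda>x\<in>carrier V. f x \<oplus>\<^bsub>W\<^esub> g x),
     smult = (\<lambda>c f. \<lambda>x\<in>carrier V. c \<odot>\<^bsub>W\<^esub> f x)\<rparr>"

text \<open>Linear maps are specified by their values on generators.\<close>

definition the_linear :: "('k, 'v) module \<Rightarrow> ('k, 'w) module \<Rightarrow> (('v \<Rightarrow> 'w) \<Rightarrow> bool) \<Rightarrow> 'v \<Rightarrow> 'w" where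
  "the_linear V W P = (THE h. h \<in> carrier (hom_space V W) \<and> P h)"

definition free_space :: "'x set \<Rightarrow> ('k::field, 'x \<Rightarrow>\<^sub>0 'k) module" where
  "free_space S = \<lparr>carrier = {x. Poly_Mapping.keys x \<subseteq> S}, mult = undefined, one = undefined,
     zero = 0, add = (+), smult = (\<lambda>c. Poly_Mapping.map ((*) c))\<rparr>"

text \<open>
  The colimit of a sequence \<open>V 0 \<rightarrow> V 1 \<rightarrow> \<dots>\<close> with transition maps \<open>t p : V p \<rightarrow> V (p + 1)\<close>:
  two elements are identified iff they become equal at some later stage.
\<close>

primrec push :: "(nat \<Rightarrow> 'v \<Rightarrow> 'v) \<Rightarrow> nat \<Rightarrow> nat \<Rightarrow> 'v \<Rightarrow> 'v" where
  "push t p 0 x = x"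
| "push t p (Suc i) x = t (p + i) (push t p i x)"

definition colim_rel ::
  "(nat \<Rightarrow> ('k, 'v) module) \<Rightarrow> (nat \<Rightarrow> 'v \<Rightarrow> 'v) \<Rightarrow> ((nat \<times> 'v) \<times> (nat \<times> 'v)) set" where
  "colim_rel V t = {((p, x), (q, y)). x \<in> carrier (V p) \<and> y \<in> carrier (V q) \<and>
     (\<exists>i j. p + i = q + j \<and> push t p i x = push t q j y)}"

definition colim_class ::
  "(nat \<Rightarrow> ('k, 'v) module) \<Rightarrow> (nat \<Rightarrow> 'v \<Rightarrow> 'v) \<Rightarrow> nat \<Rightarrow> 'v \<Rightarrow> (nat \<times> 'v) set" where
  "colim_class V t p x = colim_rel V t `` {(p, x)}"

definition seq_colim ::
  "(nat \<Rightarrow> ('k, 'v) module) \<Rightarrow> (nat \<Rightarrow> 'v \<Rightarrow> 'v) \<Rightarrow> ('k, (nat \<times> 'v) set) module" where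
  "seq_colim V t = \<lparr>carrier = (SIGMA p:UNIV. carrier (V p)) // colim_rel V t,
     mult = undefined, one = undefined,
     zero = colim_class V t 0 \<zero>\<^bsub>V 0\<^esub>,
     add = (\<lambda>X Y. \<Union>{colim_class V t p (x \<oplus>\<^bsub>V p\<^esub> y) | p x y. (p, x) \<in> X \<and> (p, y) \<in> Y}),
     smult = (\<lambda>c X. \<Union>{colim_class V t p (c \<odot>\<^bsub>V p\<^esub> x) | p x. (p, x) \<in> X})\<rparr>"


section \<open>Tensor products\<close>

text \<open>
  The tensor product of a list of vector spaces: the free vector space on the words
  \<open>[v\<^sub>1, \<dots>, v\<^sub>n]\<close> with \<open>v\<^sub>i \<in> V\<^sub>i\<close>, modulo multilinearity. All factors have the same
  type of elements, so that their number can vary.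
\<close>

definition words :: "('k, 'v) module list \<Rightarrow> 'v list set" where
  "words Vs = listset (map carrier Vs)"

definition multilinear_rels :: "('k::field, 'v) module list \<Rightarrow> ('v list \<Rightarrow>\<^sub>0 'k) set" where
  "multilinear_rels Vs =
     {Poly_Mapping.single (w[i := x \<oplus>\<^bsub>Vs ! i\<^esub> y]) 1 - Poly_Mapping.single (w[i := x]) 1
        - Poly_Mapping.single (w[i := y]) 1 |
        w i x y. w \<in> words Vs \<and> i < length Vs \<and> x \<in> carrier (Vs ! i) \<and> y \<in> carrier (Vs ! i)} \<union>
     {Poly_Mapping.single (w[i := c \<odot>\<^bsub>Vs ! i\<^esub> x]) 1 - Poly_Mapping.single (w[i := x]) c |
        w i c x. w \<in> words Vs \<and> i < length Vs \<and> x \<in> carrier (Vs ! i)}"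

definition tensor_null :: "('k::field, 'v) module list \<Rightarrow> ('v list \<Rightarrow>\<^sub>0 'k) set" where
  "tensor_null Vs =
     (\<lambda>U. submodule U scalar_field (free_space (words Vs))) hull (multilinear_rels Vs)"

definition tensor :: "('k::field, 'v) module list \<Rightarrow> ('k, ('v list \<Rightarrow>\<^sub>0 'k) set) module" where
  "tensor Vs = quot_space (free_space (words Vs)) (tensor_null Vs)"

definition pure :: "('k::field, 'v) module list \<Rightarrow> 'v list \<Rightarrow> ('v list \<Rightarrow>\<^sub>0 'k) set" where
  "pure Vs w = tensor_null Vs +>\<^bsub>free_space (words Vs)\<^esub> Poly_Mapping.single w 1"

definition tensor_id ::
  "('k::field, 'v) module list \<Rightarrow> ('v list \<Rightarrow>\<^sub>0 'k) set \<Rightarrow> ('v list \<Rightarrow>\<^sub>0 'k) set" where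
  "tensor_id Vs = (\<lambda>x\<in>carrier (tensor Vs). x)"

text \<open>The canonical bilinear map from \<open>tensor Vs\<close> and \<open>tensor Ws\<close> to \<open>tensor (Vs @ Ws)\<close>.\<close>

definition tensor_mult ::
  "('k::field, 'v) module list \<Rightarrow> ('k, 'v) module list \<Rightarrow>
   ('v list \<Rightarrow>\<^sub>0 'k) set \<Rightarrow> ('v list \<Rightarrow>\<^sub>0 'k) set \<Rightarrow> ('v list \<Rightarrow>\<^sub>0 'k) set" where
  "tensor_mult Vs Ws = the_linear (tensor Vs) (hom_space (tensor Ws) (tensor (Vs @ Ws)))
     (\<lambda>h. \<forall>v\<in>words Vs. \<forall>w\<in>words Ws. h (pure Vs v) (pure Ws w) = pure (Vs @ Ws) (v @ w))"

text \<open>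
  \<open>f \<otimes> g\<close> for \<open>f : tensor Vs \<rightarrow> tensor Vs'\<close> and \<open>g : tensor Ws \<rightarrow> tensor Ws'\<close>, without Koszul signs.
\<close>

definition tensor_map ::
  "('k::field, 'v) module list \<Rightarrow> ('k, 'v) module list \<Rightarrow>
   (('v list \<Rightarrow>\<^sub>0 'k) set \<Rightarrow> ('v list \<Rightarrow>\<^sub>0 'k) set) \<Rightarrow>
   ('k, 'v) module list \<Rightarrow> ('k, 'v) module list \<Rightarrow>
   (('v list \<Rightarrow>\<^sub>0 'k) set \<Rightarrow> ('v list \<Rightarrow>\<^sub>0 'k) set) \<Rightarrow>
   ('v list \<Rightarrow>\<^sub>0 'k) set \<Rightarrow> ('v list \<Rightarrow>\<^sub>0 'k) set" where
  "tensor_map Vs Vs' f Ws Ws' g = the_linear (tensor (Vs @ Ws)) (tensor (Vs' @ Ws'))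
     (\<lambda>h. \<forall>v\<in>words Vs. \<forall>w\<in>words Ws.
        h (pure (Vs @ Ws) (v @ w)) = tensor_mult Vs' Ws' (f (pure Vs v)) (g (pure Ws w)))"

text \<open>\<open>id \<otimes> f \<otimes> id\<close>, with identities on \<open>tensor Ls\<close> and \<open>tensor Rs\<close>.\<close>

definition whisker ::
  "('k::field, 'v) module list \<Rightarrow> ('k, 'v) module list \<Rightarrow> ('k, 'v) module list \<Rightarrow>
   (('v list \<Rightarrow>\<^sub>0 'k) set \<Rightarrow> ('v list \<Rightarrow>\<^sub>0 'k) set) \<Rightarrow> ('k, 'v) module list \<Rightarrow>
   ('v list \<Rightarrow>\<^sub>0 'k) set \<Rightarrow> ('v list \<Rightarrow>\<^sub>0 'k) set" where
  "whisker Ls Vs Vs' f Rs =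
     tensor_map Ls Ls (tensor_id Ls) (Vs @ Rs) (Vs' @ Rs)
       (tensor_map Vs Vs' f Rs Rs (tensor_id Rs))"


section \<open>Cohomology and Gerstenhaber algebras\<close>

definition cocycles ::
  "(int \<Rightarrow> ('k, 'v) module) \<Rightarrow> (int \<Rightarrow> 'v \<Rightarrow> 'v) \<Rightarrow> int \<Rightarrow> ('k, 'v) module" where
  "cocycles C d n = (C n)\<lparr>carrier := {x \<in> carrier (C n). d n x = \<zero>\<^bsub>C (n + 1)\<^esub>}\<rparr>"

definition coboundaries :: "(int \<Rightarrow> ('k, 'v) module) \<Rightarrow> (int \<Rightarrow> 'v \<Rightarrow> 'v) \<Rightarrow> int \<Rightarrow> 'v set" where
  "coboundaries C d n = d (n - 1) ` carrier (C (n - 1))"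

definition cohomology ::
  "(int \<Rightarrow> ('k, 'v) module) \<Rightarrow> (int \<Rightarrow> 'v \<Rightarrow> 'v) \<Rightarrow> int \<Rightarrow> ('k, 'v set) module" where
  "cohomology C d n = quot_space (cocycles C d n) (coboundaries C d n)"

definition cohomology_class ::
  "(int \<Rightarrow> ('k, 'v) module) \<Rightarrow> (int \<Rightarrow> 'v \<Rightarrow> 'v) \<Rightarrow> int \<Rightarrow> 'v \<Rightarrow> 'v set" where
  "cohomology_class C d n x = coboundaries C d n +>\<^bsub>cocycles C d n\<^esub> x"

text \<open>
  A \<open>\<int>\<close>-graded vector space, given by its homogeneous components, with a product of degree 0,
  a unit and a bracket of degree -1, all given on homogeneous elements.
\<close>

record ('k, 'v) gerstenhaber_structure =
  gcomp :: "int \<Rightarrow> ('k, 'v) module"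
  gcup :: "int \<Rightarrow> int \<Rightarrow> 'v \<Rightarrow> 'v \<Rightarrow> 'v"
  gone :: 'v
  gbracket :: "int \<Rightarrow> int \<Rightarrow> 'v \<Rightarrow> 'v \<Rightarrow> 'v"

locale gerstenhaber_algebra =
  fixes G :: "('k::field, 'v) gerstenhaber_structure"
  assumes component: "vector_space_on (gcomp G n)"
    and cup_bilinear:
      "bilinear_map (gcomp G m) (gcomp G n) (gcomp G (m + n)) (gcup G m n)"
    and cup_assoc:
      "\<lbrakk>f \<in> carrier (gcomp G m); g \<in> carrier (gcomp G n); h \<in> carrier (gcomp G l)\<rbrakk> \<Longrightarrow>
       gcup G (m + n) l (gcup G m n f g) h = gcup G m (n + l) f (gcup G n l g h)"
    and one_closed: "gone G \<in> carrier (gcomp G 0)"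
    and cup_one_left: "f \<in> carrier (gcomp G m) \<Longrightarrow> gcup G 0 m (gone G) f = f"
    and cup_one_right: "f \<in> carrier (gcomp G m) \<Longrightarrow> gcup G m 0 f (gone G) = f"
    and cup_graded_commutative:
      "\<lbrakk>f \<in> carrier (gcomp G m); g \<in> carrier (gcomp G n)\<rbrakk> \<Longrightarrow>
       gcup G m n f g = signed (gcomp G (m + n)) (m * n) (gcup G n m g f)"
    and bracket_bilinear:
      "bilinear_map (gcomp G m) (gcomp G n) (gcomp G (m + n - 1)) (gbracket G m n)"
    and bracket_antisymmetric:
      "\<lbrakk>f \<in> carrier (gcomp G m); g \<in> carrier (gcomp G n)\<rbrakk> \<Longrightarrow>
       gbracket G m n f g =
         \<ominus>\<^bsub>gcomp G (m + n - 1)\<^esub>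
           signed (gcomp G (m + n - 1)) ((m - 1) * (n - 1)) (gbracket G n m g f)"
    and bracket_jacobi:
      "\<lbrakk>f \<in> carrier (gcomp G m); g \<in> carrier (gcomp G n); h \<in> carrier (gcomp G l)\<rbrakk> \<Longrightarrow>
       gbracket G m (n + l - 1) f (gbracket G n l g h) =
         gbracket G (m + n - 1) l (gbracket G m n f g) h
         \<oplus>\<^bsub>gcomp G (m + n + l - 2)\<^esub>
         signed (gcomp G (m + n + l - 2)) ((m - 1) * (n - 1))
           (gbracket G n (m + l - 1) g (gbracket G m l f h))"
    and bracket_cup:
      "\<lbrakk>f \<in> carrier (gcomp G m); g \<in> carrier (gcomp G n); h \<in> carrier (gcomp G l)\<rbrakk> \<Longrightarrow>
       gbracket G m (n + l) f (gcup G n l g h) =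
         gcup G (m + n - 1) l (gbracket G m n f g) h
         \<oplus>\<^bsub>gcomp G (m + n + l - 1)\<^esub>
         signed (gcomp G (m + n + l - 1)) ((m - 1) * n)
           (gcup G n (m + l - 1) g (gbracket G m l f h))"

locale gerstenhaber_morphism =
  source: gerstenhaber_algebra G + target: gerstenhaber_algebra H
  for G :: "('k::field, 'v) gerstenhaber_structure"
    and H :: "('k, 'w) gerstenhaber_structure" +
  fixes \<phi> :: "int \<Rightarrow> 'v \<Rightarrow> 'w"
  assumes morphism_linear: "linear_map (gcomp G n) (gcomp H n) (\<phi> n)"
    and morphism_one: "\<phi> 0 (gone G) = gone H"
    and morphism_cup:
      "\<lbrakk>f \<in> carrier (gcomp G m); g \<in> carrier (gcomp G n)\<rbrakk> \<Longrightarrow>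
       \<phi> (m + n) (gcup G m n f g) = gcup H m n (\<phi> m f) (\<phi> n g)"
    and morphism_bracket:
      "\<lbrakk>f \<in> carrier (gcomp G m); g \<in> carrier (gcomp G n)\<rbrakk> \<Longrightarrow>
       \<phi> (m + n - 1) (gbracket G m n f g) = gbracket H m n (\<phi> m f) (\<phi> n g)"

text \<open>
  Operations on cochains induce operations on cohomology: the union runs over all
  representatives, so it is a single cohomology class iff the operation is well defined.
\<close>

definition cohomology_structure ::
  "(int \<Rightarrow> ('k, 'v) module) \<Rightarrow> (int \<Rightarrow> 'v \<Rightarrow> 'v) \<Rightarrow> (int \<Rightarrow> int \<Rightarrow> 'v \<Rightarrow> 'v \<Rightarrow> 'v) \<Rightarrow> 'v \<Rightarrow>
   (int \<Rightarrow> int \<Rightarrow> 'v \<Rightarrow> 'v \<Rightarrow> 'v) \<Rightarrow> ('k, 'v set) gerstenhaber_structure" where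
  "cohomology_structure C d cp e br =
     \<lparr>gcomp = cohomology C d,
      gcup = (\<lambda>m n \<xi> \<eta>. \<Union>x\<in>\<xi>. \<Union>y\<in>\<eta>. cohomology_class C d (m + n) (cp m n x y)),
      gone = cohomology_class C d 0 e,
      gbracket = (\<lambda>m n \<xi> \<eta>. \<Union>x\<in>\<xi>. \<Union>y\<in>\<eta>. cohomology_class C d (m + n - 1) (br m n x y))\<rparr>"


section \<open>The singular Hochschild cochain complex\<close>

type_synonym ('k, 'a) tens = "('a set list \<Rightarrow>\<^sub>0 'k) set"
type_synonym ('k, 'a) cochain = "('k, 'a) tens \<Rightarrow> ('k, 'a) tens"

text \<open>The sort \<open>{ring, monoid_mult}\<close> is that of unital rings, the zero ring included.\<close>

locale algebra_over_field = vector_space scale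
  for scale :: "'k::field \<Rightarrow> 'a::{ring, monoid_mult} \<Rightarrow> 'a" +
  assumes scale_mult_left: "scale c (x * y) = scale c x * y"
    and scale_mult_right: "scale c (x * y) = x * scale c y"
begin

definition alg :: "('k, 'a) module" where
  "alg = \<lparr>carrier = UNIV, mult = (*), one = 1, zero = 0, add = (+), smult = scale\<rparr>"

definition scalars :: "'a set" where
  "scalars = range (\<lambda>c. scale c 1)"

text \<open>
  The two kinds of tensor factors: \<open>A\<close>, realised as \<open>A/0\<close> in order to have elements of the same
  type as the other one, and \<open>A/(k\<cdot>1)\<close>. The shift \<open>s\<close> is not part of the underlying vector
  space; it only enters through the degrees and signs below.
\<close>

definition fA :: "('k, 'a set) module" where "fA = quot_space alg {0}"
definition fS :: "('k, 'a set) module" where "fS = quot_space alg scalars"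

definition el :: "'a \<Rightarrow> 'a set" where "el a = {0} +>\<^bsub>alg\<^esub> a"
definition bar :: "'a \<Rightarrow> 'a set" where "bar a = scalars +>\<^bsub>alg\<^esub> a"

definition sA :: "nat \<Rightarrow> ('k, 'a set) module list" where "sA n = replicate n fS"
definition Om :: "nat \<Rightarrow> ('k, 'a set) module list" where "Om p = fA # sA p"

text \<open>
  \<open>bars [a\<^sub>1, \<dots>, a\<^sub>n]\<close> is \<open>sa\<^sub>1 \<otimes> \<dots> \<otimes> sa\<^sub>n\<close> and \<open>om [a\<^sub>0, \<dots>, a\<^sub>p]\<close> is
  \<open>a\<^sub>0 \<otimes> sa\<^sub>1 \<otimes> \<dots> \<otimes> sa\<^sub>p\<close>.
\<close>

definition bars :: "'a list \<Rightarrow> ('k, 'a) tens" where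
  "bars w = pure (sA (length w)) (map bar w)"

definition om :: "'a list \<Rightarrow> ('k, 'a) tens" where
  "om w = pure (Om (length w - 1)) (el (hd w) # map bar (tl w))"

text \<open>Multiplies the adjacent letters at (0-based) positions \<open>i\<close> and \<open>i + 1\<close>.\<close>

definition merge :: "nat \<Rightarrow> 'a list \<Rightarrow> 'a list" where
  "merge i w = take i w @ (w ! i * w ! (i + 1)) # drop (i + 2) w"

definition mu :: "('k, 'a) cochain" where
  "mu = the_linear (tensor [fA, fA]) (tensor [fA])
     (\<lambda>h. \<forall>a b. h (pure [fA, fA] [el a, el b]) = pure [fA] [el (a * b)])"

definition proj :: "('k, 'a) cochain" where
  "proj = the_linear (tensor [fA]) (tensor [fS])
     (\<lambda>h. \<forall>a. h (pure [fA] [el a]) = pure [fS] [bar a])"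

definition left_act :: "nat \<Rightarrow> 'a \<Rightarrow> ('k, 'a) cochain" where
  "left_act p b = the_linear (tensor (Om p)) (tensor (Om p))
     (\<lambda>h. \<forall>a w. length w = p \<longrightarrow> h (om (a # w)) = om (b * a # w))"

definition right_act :: "nat \<Rightarrow> ('k, 'a) tens \<Rightarrow> 'a \<Rightarrow> ('k, 'a) tens" where
  "right_act p x b = the_linear (tensor (Om p)) (tensor (Om p))
     (\<lambda>h. \<forall>w. length w = p + 1 \<longrightarrow>
        h (om w) = (\<Oplus>\<^bsub>tensor (Om p)\<^esub>i\<in>{0..p}.
           signed (tensor (Om p)) (int p - int i) (om (merge i (w @ [b]))))) x"

text \<open>
  The cochain operations are indexed by the number \<open>m\<close> of arguments and the exponent \<open>p\<close> of the
  target, for cochains \<open>tensor (sA m) \<rightarrow> tensor (Om p)\<close>; the degree of such a cochain is \<open>m - p\<close>.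
\<close>

definition diff :: "nat \<Rightarrow> nat \<Rightarrow> ('k, 'a) cochain \<Rightarrow> ('k, 'a) cochain" where
  "diff m p f = the_linear (tensor (sA (m + 1))) (tensor (Om p))
     (\<lambda>h. \<forall>w. length w = m + 1 \<longrightarrow>
        signed (tensor (Om p)) (int m - int p + 1) (h (bars w)) =
          left_act p (hd w) (f (bars (tl w)))
          \<oplus>\<^bsub>tensor (Om p)\<^esub>
          (\<Oplus>\<^bsub>tensor (Om p)\<^esub>j\<in>{1..m}. signed (tensor (Om p)) (int j) (f (bars (merge (j - 1) w))))
          \<oplus>\<^bsub>tensor (Om p)\<^esub>
          signed (tensor (Om p)) (int m + 1) (right_act p (f (bars (butlast w))) (last w)))"

definition theta :: "nat \<Rightarrow> nat \<Rightarrow> ('k, 'a) cochain \<Rightarrow> ('k, 'a) cochain" where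
  "theta m p f = whisker [] (sA m) (Om p) f (sA 1)"

definition cup ::
  "nat \<Rightarrow> nat \<Rightarrow> ('k, 'a) cochain \<Rightarrow> nat \<Rightarrow> nat \<Rightarrow> ('k, 'a) cochain \<Rightarrow> ('k, 'a) cochain" where
  "cup m p f n q g = (\<lambda>x\<in>carrier (tensor (sA (m + n))).
     whisker [] [fA, fA] [fA] mu (sA (p + q))
       (whisker [fA] (sA m) (Om p) f (sA q)
         (whisker [] (sA n) (Om q) g (sA m) x)))"

definition reduce :: "nat \<Rightarrow> nat \<Rightarrow> ('k, 'a) cochain \<Rightarrow> ('k, 'a) cochain" where
  "reduce n q g = (\<lambda>x\<in>carrier (tensor (sA n)). whisker [] [fA] [fS] proj (sA q) (g x))"

definition circ_pos ::
  "nat \<Rightarrow> nat \<Rightarrow> ('k, 'a) cochain \<Rightarrow> nat \<Rightarrow> nat \<Rightarrow> nat \<Rightarrow> ('k, 'a) cochain \<Rightarrow> ('k, 'a) cochain" where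
  "circ_pos m p f i n q g = (\<lambda>x\<in>carrier (tensor (sA (m + n - 1))).
     whisker [] (sA m) (Om p) f (sA q)
       (whisker (sA (i - 1)) (sA n) (sA (q + 1)) (reduce n q g) (sA (m - i)) x))"

text \<open>For \<open>n \<ge> 1\<close> only.\<close>

definition circ_neg ::
  "nat \<Rightarrow> nat \<Rightarrow> ('k, 'a) cochain \<Rightarrow> nat \<Rightarrow> nat \<Rightarrow> nat \<Rightarrow> ('k, 'a) cochain \<Rightarrow> ('k, 'a) cochain" where
  "circ_neg m p f i n q g = (\<lambda>x\<in>carrier (tensor (sA (m + n - 1))).
     whisker (fA # sA (i - 1)) (sA n) (sA (q + 1)) (reduce n q g) (sA (p - i))
       (whisker [] (sA m) (Om p) f (sA (n - 1)) x))"

text \<open>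
  The summands of \<open>f \<circ> g\<close> need not lie in the same space \<open>Hom (tensor (sA N), tensor (Om r))\<close>
  (because of the rule for \<open>n = 0\<close>), so they are added in an ambient space \<open>T\<close>, into which the
  cochains with values in \<open>tensor (Om r)\<close> are mapped by \<open>\<iota> r\<close>.
\<close>

definition circ ::
  "('k, 'v) module \<Rightarrow> (nat \<Rightarrow> ('k, 'a) cochain \<Rightarrow> 'v) \<Rightarrow>
   nat \<Rightarrow> nat \<Rightarrow> ('k, 'a) cochain \<Rightarrow> nat \<Rightarrow> nat \<Rightarrow> ('k, 'a) cochain \<Rightarrow> 'v" where
  "circ T \<iota> m p f n q g =
     (\<Oplus>\<^bsub>T\<^esub>i\<in>{1..m}. signed T ((int n - int q - 1) * (int i - 1))
        (\<iota> (p + q) (circ_pos m p f i n q g)))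
     \<ominus>\<^bsub>T\<^esub>
     (\<Oplus>\<^bsub>T\<^esub>i\<in>{1..p}. signed T ((int n - int q - 1) * (int i - int m - int p - 1))
        (if n = 0 then \<iota> (p + q + 1) (circ_neg m p f i 1 (q + 1) (theta 0 q g))
         else \<iota> (p + q) (circ_neg m p f i n q g)))"

definition bracket ::
  "('k, 'v) module \<Rightarrow> (nat \<Rightarrow> ('k, 'a) cochain \<Rightarrow> 'v) \<Rightarrow>
   nat \<Rightarrow> nat \<Rightarrow> ('k, 'a) cochain \<Rightarrow> nat \<Rightarrow> nat \<Rightarrow> ('k, 'a) cochain \<Rightarrow> 'v" where
  "bracket T \<iota> m p f n q g =
     circ T \<iota> m p f n q g \<ominus>\<^bsub>T\<^esub>
     signed T ((int m - int p - 1) * (int n - int q - 1)) (circ T \<iota> n q g m p f)"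

text \<open>The unit of \<open>A\<close> as a cochain without arguments.\<close>

definition one_cochain :: "('k, 'a) cochain" where
  "one_cochain = the_linear (tensor (sA 0)) (tensor (Om 0)) (\<lambda>h. h (bars []) = om [1])"

text \<open>
  \<open>Cnc d p\<close> is the space of cochains of degree \<open>d\<close> with values in \<open>tensor (Om p)\<close>.
\<close>

definition Cnc :: "int \<Rightarrow> nat \<Rightarrow> ('k, ('k, 'a) cochain) module" where
  "Cnc d p = (if d + int p < 0 then zero_space
     else hom_space (tensor (sA (nat (d + int p)))) (tensor (Om p)))"

definition C_diff :: "nat \<Rightarrow> int \<Rightarrow> ('k, 'a) cochain \<Rightarrow> ('k, 'a) cochain" where
  "C_diff p d f = (if d + int p < 0 then \<zero>\<^bsub>Cnc (d + 1) p\<^esub> else diff (nat (d + int p)) p f)"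

definition C_theta :: "int \<Rightarrow> nat \<Rightarrow> ('k, 'a) cochain \<Rightarrow> ('k, 'a) cochain" where
  "C_theta d p f = (if d + int p < 0 then \<zero>\<^bsub>Cnc d (p + 1)\<^esub> else theta (nat (d + int p)) p f)"

definition HC :: "int \<Rightarrow> ('k, ('k, 'a) cochain) module" where
  "HC d = Cnc d 0"

definition HC_cup :: "int \<Rightarrow> int \<Rightarrow> ('k, 'a) cochain \<Rightarrow> ('k, 'a) cochain \<Rightarrow> ('k, 'a) cochain" where
  "HC_cup m n f g =
     (if m < 0 \<or> n < 0 then \<zero>\<^bsub>HC (m + n)\<^esub> else cup (nat m) 0 f (nat n) 0 g)"

definition HC_bracket :: "int \<Rightarrow> int \<Rightarrow> ('k, 'a) cochain \<Rightarrow> ('k, 'a) cochain \<Rightarrow> ('k, 'a) cochain" where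
  "HC_bracket m n f g =
     (if m < 0 \<or> n < 0 then \<zero>\<^bsub>HC (m + n - 1)\<^esub>
      else bracket (HC (m + n - 1)) (\<lambda>_ h. h) (nat m) 0 f (nat n) 0 g)"

definition HH :: "('k, ('k, 'a) cochain set) gerstenhaber_structure" where
  "HH = cohomology_structure HC (C_diff 0) HC_cup one_cochain HC_bracket"

definition Csg :: "int \<Rightarrow> ('k, (nat \<times> ('k, 'a) cochain) set) module" where
  "Csg d = seq_colim (Cnc d) (C_theta d)"

definition sg_class :: "int \<Rightarrow> nat \<Rightarrow> ('k, 'a) cochain \<Rightarrow> (nat \<times> ('k, 'a) cochain) set" where
  "sg_class d p f = colim_class (Cnc d) (C_theta d) p f"

definition Csg_diff ::
  "int \<Rightarrow> (nat \<times> ('k, 'a) cochain) set \<Rightarrow> (nat \<times> ('k, 'a) cochain) set" where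
  "Csg_diff d X = \<Union>{sg_class (d + 1) p (C_diff p d f) | p f. (p, f) \<in> X}"

text \<open>
  Here the unions run over all representatives \<open>(p, f)\<close> whose number of arguments \<open>d + p\<close> is
  nonnegative; every element of the colimit has such representatives.
\<close>

definition Csg_cup ::
  "int \<Rightarrow> int \<Rightarrow> (nat \<times> ('k, 'a) cochain) set \<Rightarrow> (nat \<times> ('k, 'a) cochain) set \<Rightarrow>
   (nat \<times> ('k, 'a) cochain) set" where
  "Csg_cup d e X Y = \<Union>{sg_class (d + e) (p + q) (cup (nat (d + int p)) p f (nat (e + int q)) q g) |
     p f q g. (p, f) \<in> X \<and> (q, g) \<in> Y \<and> 0 \<le> d + int p \<and> 0 \<le> e + int q}"

definition Csg_bracket ::
  "int \<Rightarrow> int \<Rightarrow> (nat \<times> ('k, 'a) cochain) set \<Rightarrow> (nat \<times> ('k, 'a) cochain) set \<Rightarrow>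
   (nat \<times> ('k, 'a) cochain) set" where
  "Csg_bracket d e X Y =
     \<Union>{bracket (Csg (d + e - 1)) (sg_class (d + e - 1)) (nat (d + int p)) p f (nat (e + int q)) q g |
     p f q g. (p, f) \<in> X \<and> (q, g) \<in> Y \<and> 0 \<le> d + int p \<and> 0 \<le> e + int q}"

definition HH_sg :: "('k, (nat \<times> ('k, 'a) cochain) set set) gerstenhaber_structure" where
  "HH_sg = cohomology_structure Csg Csg_diff Csg_cup (sg_class 0 0 one_cochain) Csg_bracket"

text \<open>The map induced by the inclusion of \<open>HC\<close> into \<open>Csg\<close>.\<close>

definition rho :: "int \<Rightarrow> ('k, 'a) cochain set \<Rightarrow> (nat \<times> ('k, 'a) cochain) set set" where
  "rho d \<xi> = (\<Union>f\<in>\<xi>. cohomology_class Csg Csg_diff d (sg_class d 0 f))"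

end

end

theory Submission
 imports Defs
begin

text \<open>
 A basis of the algebra containing 1 identifies the tensor powers of \<open>A/k\<close> with subspaces \<open>V n\<close> of a
 free algebra, and \<open>A\<close> tensored with them with subspaces \<open>W n\<close>. A cochain with \<open>m\<close> arguments and values in
 p-forms becomes a left \<open>A\<close>-linear operator \<open>W N -> W (N - m + p)\<close> for every \<open>N\<close> at least \<open>m\<close>, and passing to the
 colimit means that only the germ of this operator for large \<open>N\<close> matters. On germs the cup product
 is composition, the differential is the graded commutator with the right action \<open>R\<close>, and the circle product is a
 graded commutator with the operator \<open>Sg\<close> that inserts a cochain behind every nonempty initial segment of a word. The
 differential of a circle product then gives graded commutativity, the pre-Lie identity gives
 the Jacobi identity, and the sum over the insertions at two places is the homotopy for the Poisson identity.
 The bar complex embeds into the colimit, from which its identities are inherited, unless \<open>A/k\<close> vanishes; that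
 case is trivial.
\<close>

text \<open>\<open>Sg\<close> inserts a cochain at every place of a word, while a circle product has
  only the insertions that touch arguments or outputs. Insertions further right pass the operator of
  a cochain up to a sign, so the graded commutator keeps precisely the finite part. The obstacle is
  the right end of the word. There the last insertion meets the right action, and the commutator of
  \<open>Sg\<close> with \<open>R\<close> contains, besides the expected terms, a boundary term
  \<open>rh\<close>. It is computed with the product \<open>dot\<close> and the differential
  \<open>D\<close> of noncommutative differential forms, and it cancels because operators of
  cochains commute with \<open>rh\<close> up to an insertion of their differential. The homotopy for
  the Poisson identity meets the end of the word with two insertions; this is manageable when the
  number n of arguments of the left insertion exceeds the form degree r of the right one by 1, and
  in the colimit representatives with n = r + 1 always exist. Germs also absorb the special rule for
  cochains without arguments, because \<open>theta\<close> does not change an operator on long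
  words.\<close>

type_synonym ('a, 'k) pol = "'a list \<Rightarrow>\<^sub>0 'k"
type_synonym ('a, 'k) opr = "('a, 'k) pol => ('a, 'k) pol"

section \<open>Linear algebra in the free algebra on words\<close>

instantiation list :: (type) monoid_add
begin
definition zero_list :: "'a list" where "zero_list = []"
text \<open>Convolution of finitely supported functions needs an additive index monoid. With
  concatenation as addition it becomes the product of the free associative algebra.\<close>

definition plus_list :: "'a list => 'a list => 'a list" where "plus_list xs ys = xs @ ys"
instance by standard (simp_all add: zero_list_def plus_list_def)
end

abbreviation mon :: "'x => 'x \<Rightarrow>\<^sub>0 'k::field" where "mon l \<equiv> Poly_Mapping.single l 1"

definition psc :: "'k::field => ('x \<Rightarrow>\<^sub>0 'k) => 'x \<Rightarrow>\<^sub>0 'k" where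
 "psc c = Poly_Mapping.map ((*) c)"

lemma lookup_psc [simp]: "Poly_Mapping.lookup (psc c x) k = c * Poly_Mapping.lookup x k"
 unfolding psc_def by (simp add: Poly_Mapping.map.rep_eq when_def)

lemma psc_add: "psc c (x + y) = psc c x + psc c y"
 by (rule poly_mapping_eqI) (simp add: lookup_add algebra_simps)
lemma psc_add_left: "psc (c + d) x = psc c x + psc d x"
 by (rule poly_mapping_eqI) (simp add: lookup_add algebra_simps)
lemma psc_psc [simp]: "psc c (psc d x) = psc (c * d) x"
 by (rule poly_mapping_eqI) (simp add: mult.assoc)
lemma psc_one [simp]: "psc 1 x = x"
 by (rule poly_mapping_eqI) simp
lemma psc_zero_left [simp]: "psc 0 x = 0"
 by (rule poly_mapping_eqI) simp
lemma psc_zero [simp]: "psc c 0 = 0"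
 by (rule poly_mapping_eqI) simp
lemma psc_minus: "psc c (- x) = - psc c x"
 by (rule poly_mapping_eqI) simp
lemma psc_neg_one: "psc (- 1) x = - x"
 by (rule poly_mapping_eqI) simp
lemma psc_diff: "psc c (x - y) = psc c x - psc c y"
 by (rule poly_mapping_eqI) (simp add: lookup_minus algebra_simps)
lemma psc_sum: "psc c (sum f I) = (\<Sum>i\<in>I. psc c (f i))"
 by (induct I rule: infinite_finite_induct) (simp_all add: psc_add)
lemma psc_single: "psc c (Poly_Mapping.single l d) = Poly_Mapping.single l (c * d)"
 by (rule poly_mapping_eqI) (simp add: lookup_single when_def)
lemma keys_psc: "Poly_Mapping.keys (psc c x) \<subseteq> Poly_Mapping.keys x"
 by (auto simp: in_keys_iff)

lemma psc_conv_mult: "psc c (x :: 'a list \<Rightarrow>\<^sub>0 'k::field) = Poly_Mapping.single 0 c * x"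
 unfolding psc_def by (rule mult_map_scale_conv_mult)

text \<open>The empty word commutes with every word, so scalars are central although the index
  monoid is not commutative. The argument peels one word at a time off a finite set containing the
  support.\<close>

lemma single_zero_commute:
 "Poly_Mapping.single 0 c * (x :: 'a list \<Rightarrow>\<^sub>0 'k::field) = x * Poly_Mapping.single 0 c"
proof -
 have "Poly_Mapping.single 0 c * y = y * Poly_Mapping.single 0 c"
  if "Poly_Mapping.keys y \<subseteq> S" "finite S" for S and y :: "'a list \<Rightarrow>\<^sub>0 'k"
  using that(2,1)
 proof (induct S arbitrary: y rule: finite_induct)
  case empty
  then show ?case by simp
 next
  case (insert l S)
  define z where "z = y - Poly_Mapping.single l (Poly_Mapping.lookup y l)"
  have "Poly_Mapping.keys z \<subseteq> S"
   using insert(4) by (auto simp: z_def in_keys_iff lookup_minus lookup_single when_def split: if_splits)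
  then have "Poly_Mapping.single 0 c * z = z * Poly_Mapping.single 0 c" by (rule insert(3))
  moreover have "y = z + Poly_Mapping.single l (Poly_Mapping.lookup y l)" by (simp add: z_def)
  moreover have "Poly_Mapping.single 0 c * Poly_Mapping.single l d = Poly_Mapping.single l d * Poly_Mapping.single 0 c"
   for d :: 'k by (simp add: mult_single mult.commute)
  ultimately show ?case by (metis distrib_left distrib_right)
 qed
 from this[of x "Poly_Mapping.keys x"] show ?thesis by simp
qed

lemma psc_mult_left: "psc c (x * y) = psc c x * (y :: 'a list \<Rightarrow>\<^sub>0 'k::field)"
 by (simp add: psc_conv_mult mult.assoc)
lemma psc_mult_right: "psc c (x * y) = x * psc c (y :: 'a list \<Rightarrow>\<^sub>0 'k::field)"
proof -
 have "Poly_Mapping.single 0 c * (x * y) = (Poly_Mapping.single 0 c * x) * y" by (simp add: mult.assoc)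
 also have "\<dots> = x * (Poly_Mapping.single 0 c * y)" by (simp add: single_zero_commute[of c x] mult.assoc)
 finally show ?thesis by (simp add: psc_conv_mult)
qed

lemma mon_mult: "mon xs * mon ys = (mon (xs @ ys) :: 'a list \<Rightarrow>\<^sub>0 'k::field)"
 by (simp add: mult_single plus_list_def)
lemma mon_Nil: "mon [] = (1 :: 'a list \<Rightarrow>\<^sub>0 'k::field)"
 by (metis single_one zero_list_def)

text \<open>Linear maps are total on the space of all words. A map between two subspaces is
  represented by any linear extension, and only its values on the source subspace carry
  meaning.\<close>

definition plin :: "(('x \<Rightarrow>\<^sub>0 'k::field) => ('y \<Rightarrow>\<^sub>0 'k)) => bool" where
 "plin f \<longleftrightarrow> (\<forall>x y. f (x + y) = f x + f y) & (\<forall>c x. f (psc c x) = psc c (f x))"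

named_theorems plin_intros

lemma plinI: "[| !!x y. f (x + y) = f x + f y; !!c x. f (psc c x) = psc c (f x) |] ==> plin f"
 by (simp add: plin_def)
lemma plin_add: "plin f ==> f (x + y) = f x + f y" by (simp add: plin_def)
lemma plin_psc: "plin f ==> f (psc c x) = psc c (f x)" by (simp add: plin_def)
lemma plin_0: "plin f ==> f 0 = 0" using plin_psc[of f 0 0] by simp
lemma plin_minus: "plin f ==> f (- x) = - f x" using plin_psc[of f "-1" x] by (simp add: psc_neg_one)
lemma plin_diff: "plin f ==> f (x - y) = f x - f y"
 using plin_add[of f x "- y"] by (simp add: plin_minus)
lemma plin_sum: "plin f ==> f (sum g I) = (\<Sum>i\<in>I. f (g i))"
 by (induct I rule: infinite_finite_induct) (simp_all add: plin_add plin_0)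

lemma plin_id [plin_intros]: "plin (%x. x)" by (simp add: plin_def)
lemma plin_const_0 [plin_intros]: "plin (%x. 0)" by (simp add: plin_def)
lemma plin_plus [plin_intros]: "[| plin f; plin g |] ==> plin (%x. f x + g x)"
 by (simp add: plin_def psc_add algebra_simps)
lemma plin_uminus [plin_intros]: "plin f ==> plin (%x. - f x)"
 by (simp add: plin_def psc_minus)
lemma plin_minus' [plin_intros]: "[| plin f; plin g |] ==> plin (%x. f x - g x)"
 by (simp add: plin_def psc_diff algebra_simps)
lemma plin_sum' [plin_intros]:
 assumes "!!i. i : I ==> plin (f i)"
 shows "plin (%x. \<Sum>i\<in>I. f i x)"
proof (rule plinI)
 fix x y show "(\<Sum>i\<in>I. f i (x + y)) = (\<Sum>i\<in>I. f i x) + (\<Sum>i\<in>I. f i y)"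
  by (subst sum.distrib[symmetric], rule sum.cong[OF refl], rule plin_add[OF assms])
next
 fix c x show "(\<Sum>i\<in>I. f i (psc c x)) = psc c (\<Sum>i\<in>I. f i x)"
  by (subst psc_sum, rule sum.cong[OF refl], rule plin_psc[OF assms])
qed

lemma plin_scale [plin_intros]: "plin f ==> plin (%x. psc c (f x))"
 by (simp add: plin_def psc_add mult.commute)
lemma plin_mult_left [plin_intros]: "plin f ==> plin (%x. f x * (y :: 'a list \<Rightarrow>\<^sub>0 'k::field))"
 by (simp add: plin_def psc_mult_left algebra_simps)
lemma plin_mult_right [plin_intros]: "plin f ==> plin (%x. (y :: 'a list \<Rightarrow>\<^sub>0 'k::field) * f x)"
 by (simp add: plin_def psc_mult_right algebra_simps)
lemma plin_if [plin_intros]: "[| P ==> plin f; \<not> P ==> plin g |] ==> plin (%x. if P then f x else g x)"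
 by (cases P) simp_all
lemma plin_comp: "[| plin f; plin g |] ==> plin (%x. f (g x))"
 by (simp add: plin_def)

text \<open>Linear extension from basis words. Operators are built in this way and afterwards used
  only through product formulas that no longer mention words.\<close>

definition ext :: "('x => ('y \<Rightarrow>\<^sub>0 'k)) => ('x \<Rightarrow>\<^sub>0 'k::field) => 'y \<Rightarrow>\<^sub>0 'k" where
 "ext ph x = (\<Sum>l\<in>Poly_Mapping.keys x. psc (Poly_Mapping.lookup x l) (ph l))"

lemma ext_superset:
 assumes "finite S" "Poly_Mapping.keys x \<subseteq> S"
 shows "ext ph x = (\<Sum>l\<in>S. psc (Poly_Mapping.lookup x l) (ph l))"
 unfolding ext_def using assms by (intro sum.mono_neutral_left) (auto simp: in_keys_iff)

lemma plin_ext0: "plin (ext ph)"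
proof (rule plinI)
 fix x y :: "'a \<Rightarrow>\<^sub>0 'b"
 let ?S = "Poly_Mapping.keys x \<union> Poly_Mapping.keys y"
 show "ext ph (x + y) = ext ph x + ext ph y"
  using ext_superset[of ?S "x + y" ph] ext_superset[of ?S x ph] ext_superset[of ?S y ph] keys_add[of x y]
  by (simp add: lookup_add psc_add_left sum.distrib)
next
 fix c and x :: "'a \<Rightarrow>\<^sub>0 'b"
 show "ext ph (psc c x) = psc c (ext ph x)"
  using ext_superset[of "Poly_Mapping.keys x" "psc c x" ph] keys_psc[of c x]
  by (simp add: ext_def psc_sum)
qed

lemma plin_ext [plin_intros]: "plin g ==> plin (%x. ext ph (g x))"
 by (rule plin_comp[OF plin_ext0])

lemma ext_mon [simp]: "ext ph (mon l) = ph l"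
 by (simp add: ext_def)

lemma poly_sum_mono: "x = (\<Sum>l\<in>Poly_Mapping.keys x. psc (Poly_Mapping.lookup x l) (mon l))"
 by (rule poly_mapping_eqI)
  (auto simp: lookup_sum lookup_single when_def sum.delta in_keys_iff if_distrib cong: if_cong)

lemma plin_expand: "plin f ==> f x = (\<Sum>l\<in>Poly_Mapping.keys x. psc (Poly_Mapping.lookup x l) (f (mon l)))"
 using arg_cong[OF poly_sum_mono[of x], of f] by (simp only: plin_sum[of f] plin_psc[of f])

definition Kset :: "'x set => ('x \<Rightarrow>\<^sub>0 'k::field) set" where
 "Kset L = {x. Poly_Mapping.keys x \<subseteq> L}"

lemma plin_eqI:
 assumes "plin f" "plin g" "x : Kset L" "!!l. l : L ==> f (mon l) = g (mon l)"
 shows "f x = g x"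
 using assms(3,4) by (auto simp: plin_expand[OF assms(1), of x] plin_expand[OF assms(2), of x] Kset_def intro!: sum.cong)

definition psub :: "('x \<Rightarrow>\<^sub>0 'k::field) set => bool" where
 "psub S \<longleftrightarrow> 0 : S & (\<forall>x\<in>S. \<forall>y\<in>S. x + y : S) & (\<forall>c. \<forall>x\<in>S. psc c x : S)"

lemma psub_0: "psub S ==> 0 : S" by (simp add: psub_def)
lemma psub_add: "psub S ==> x : S ==> y : S ==> x + y : S" by (simp add: psub_def)
lemma psub_psc: "psub S ==> x : S ==> psc c x : S" by (simp add: psub_def)
lemma psub_minus: "psub S ==> x : S ==> - x : S" using psub_psc[of S x "-1"] by (simp add: psc_neg_one)
lemma psub_diff: "psub S ==> x : S ==> y : S ==> x - y : S"
 using psub_add[of S x "- y"] psub_minus[of S y] by simp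
lemma psub_sum: "psub S ==> (!!i. i : I ==> f i : S) ==> sum f I : S"
 by (induct I rule: infinite_finite_induct) (auto simp: psub_0 psub_add)

lemma psub_Kset [simp]: "psub (Kset L :: ('x \<Rightarrow>\<^sub>0 'k::field) set)"
proof -
 have "Poly_Mapping.keys (x + y) \<subseteq> L" if "Poly_Mapping.keys x \<subseteq> L" "Poly_Mapping.keys y \<subseteq> L" for x y :: "'x \<Rightarrow>\<^sub>0 'k"
  using that keys_add[of x y] by blast
 moreover have "Poly_Mapping.keys (psc c x) \<subseteq> L" if "Poly_Mapping.keys x \<subseteq> L" for x :: "'x \<Rightarrow>\<^sub>0 'k" and c
  using that keys_psc[of c x] by blast
 ultimately show ?thesis by (simp add: psub_def Kset_def)
qed

lemma plin_memI:
 assumes "plin f" "psub S" "x : Kset L" "!!l. l : L ==> f (mon l) : S"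
 shows "f x : S"
 using assms(3,4) by (auto simp: plin_expand[OF assms(1), of x] Kset_def intro!: psub_sum[OF assms(2)] psub_psc[OF assms(2)])

lemma mon_in_Kset [simp]: "mon l : Kset L \<longleftrightarrow> l : L"
 by (simp add: Kset_def)

lemma Kset_mult:
 assumes "x : Kset L" "y : Kset M" "!!l m. l : L ==> m : M ==> l @ m : N"
 shows "x * (y :: 'a list \<Rightarrow>\<^sub>0 'k::field) : Kset N"
proof (rule plin_memI[OF _ _ assms(1)])
 fix l assume "l : L"
 show "mon l * y : Kset N"
  by (rule plin_memI[OF _ _ assms(2)]) (auto intro!: plin_intros simp: mon_mult assms(3) \<open>l : L\<close>)
qed (auto intro!: plin_intros)

text \<open>Signs are indexed by integers, so that degrees can be used directly.\<close>

definition eps :: "int => 'b::ab_group_add => 'b" where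
 "eps k x = (if even k then x else - x)"

lemma plin_eps [plin_intros]: "plin f ==> plin (%x. eps k (f x))"
 by (cases "even k") (simp_all add: eps_def plin_uminus)
lemma eps_0 [simp]: "eps 0 x = x" "eps k 0 = 0" by (simp_all add: eps_def)
lemma eps_add: "eps k (x + y) = eps k x + eps k y" by (simp add: eps_def)
lemma eps_diff: "eps k (x - y) = eps k x - eps k y" by (simp add: eps_def)
lemma eps_sum: "eps k (sum f I) = (\<Sum>i\<in>I. eps k (f i))"
 by (cases "even k") (simp_all add: eps_def sum_negf)
lemma eps_eps [simp]: "eps k (eps j x) = eps (k + j) x" by (simp add: eps_def)
lemma eps_cong: "even (k - j) ==> eps k x = eps j x" by (auto simp: eps_def)
lemma plin_eps_out: "plin f ==> f (eps k x) = eps k (f x)" by (simp add: eps_def plin_minus)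
lemma eps_mult_left: "eps k x * y = eps k (x * (y :: 'b::ring))" by (simp add: eps_def)
lemma eps_mult_right: "x * eps k y = eps k (x * (y :: 'b::ring))" by (simp add: eps_def)
lemma eps_psc: "psc c (eps k x) = eps k (psc c x)" by (simp add: eps_def psc_minus)
lemma psub_eps: "psub S ==> x : S ==> eps k x : S" by (simp add: eps_def psub_minus)

lemma psub_eq: "plin f ==> plin g ==> psub {x. f x = g x}"
 unfolding psub_def by (auto simp: plin_0[of f] plin_0[of g] plin_add[of f] plin_add[of g] plin_psc[of f] plin_psc[of g])

lemma psub_vimage: "plin f ==> psub S ==> psub {x. f x : S}"
 unfolding psub_def by (auto simp: plin_0[of f] plin_add[of f] plin_psc[of f])

lemma Kset_subI: "psub S ==> (!!l. l : L ==> mon l : S) ==> Kset L \<subseteq> S"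
 using plin_memI[OF plin_id, of S] by blast

lemma plin_ext_param [plin_intros]: "(!!l. plin (%y. ph y l)) ==> plin (%y. ext (ph y) z)"
 unfolding ext_def by (intro plin_intros)

section \<open>A basis containing 1, and the spaces \<open>V n\<close> and
  \<open>W n\<close>\<close>

context algebra_over_field
begin

text \<open>In the zero algebra 1 = 0 is not independent, so the basis starts from the empty set
  there. Otherwise 1 is a basis letter, and the classes of the other letters, collected in
  \<open>bS\<close>, form a basis of A/k.\<close>

definition bB :: "'a set" where "bB = extend_basis (if (1::'a) = 0 then {} else {1})"
definition bS :: "'a set" where "bS = bB - {1}"

lemma independent_bB: "independent bB" and span_bB: "span bB = UNIV"
proof -
 have "independent (if (1::'a) = 0 then {} else {1})" using independent_empty by (auto simp: dependent_single)
 then show "independent bB" "span bB = UNIV"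
  unfolding bB_def by (rule independent_extend_basis, rule span_extend_basis)
qed

lemma one_bB: "(1::'a) ~= 0 ==> 1 : bB"
 using extend_basis_superset[of "{1::'a}"] by (auto simp: bB_def)

definition alin :: "('a => ('x \<Rightarrow>\<^sub>0 'k)) => bool" where
 "alin f \<longleftrightarrow> (\<forall>a b. f (a + b) = f a + f b) & (\<forall>c a. f (scale c a) = psc c (f a))"

named_theorems alin_intros

lemma alinI: "[| !!x y. f (x + y) = f x + f y; !!c x. f (scale c x) = psc c (f x) |] ==> alin f"
 by (simp add: alin_def)
lemma alin_add: "alin f ==> f (a + b) = f a + f b" by (simp add: alin_def)
lemma alin_scale: "alin f ==> f (scale c a) = psc c (f a)" by (simp add: alin_def)
lemma alin_0: "alin f ==> f 0 = 0" using alin_scale[of f 0 0] by simp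
lemma alin_comp: "plin g ==> alin f ==> alin (%a. g (f a))"
 by (simp add: alin_def plin_def)
lemma alin_plus [alin_intros]: "alin f ==> alin g ==> alin (%a. f a + g a)"
 by (simp add: alin_def psc_add algebra_simps)
lemma alin_minus [alin_intros]: "alin f ==> alin g ==> alin (%a. f a - g a)"
 by (simp add: alin_def psc_diff algebra_simps)
lemma alin_mult_left [alin_intros]: "alin f ==> alin (%a. f a * (y :: 'a list \<Rightarrow>\<^sub>0 'k))"
 by (rule alin_comp[of "%x. x * y"]) (intro plin_intros)
lemma alin_mult_right [alin_intros]: "alin f ==> alin (%a. (y :: 'a list \<Rightarrow>\<^sub>0 'k) * f a)"
 by (rule alin_comp[of "%x. y * x"]) (intro plin_intros)
lemma alin_arg_left: "alin f ==> alin (%a. f (a * b))"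
 by (simp add: alin_def distrib_right scale_mult_left[symmetric])
lemma alin_arg_right: "alin f ==> alin (%a. f (b * a))"
 by (simp add: alin_def distrib_left scale_mult_right[symmetric])
lemma alin_const_0 [alin_intros]: "alin (%a. 0)" by (simp add: alin_def)
lemma alin_ext [alin_intros]:
 assumes "!!l. alin (%a. ph a l)" shows "alin (%a. ext (ph a) x)"
 unfolding ext_def
 by (rule alinI)
  (simp_all add: psc_sum sum.distrib[symmetric] psc_add alin_add[OF assms] alin_scale[OF assms] mult.commute)

lemma alin_memI:
 assumes "alin f" "psub S" "!!b. b : bB ==> f b : S"
 shows "f a : S"
proof -
 have "a : span bB" by (simp add: span_bB)
 then show ?thesis
  by (induct rule: span_induct_alt)
   (auto simp: alin_0[OF assms(1)] alin_add[OF assms(1)] alin_scale[OF assms(1)]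
    intro!: psub_0[OF assms(2)] psub_add[OF assms(2)] psub_psc[OF assms(2)] assms(3))
qed

lemma alin_eqI:
 assumes "alin f" "alin g" "!!b. b : bB ==> f b = g b"
 shows "f a = g a"
proof -
 have "f a - g a : {0}"
  by (rule alin_memI[where f = "%a. f a - g a"]) (auto intro!: alin_intros assms simp: psub_def)
 then show ?thesis by simp
qed

definition crd :: "'a => 'a \<Rightarrow>\<^sub>0 'k" where "crd a = Abs_poly_mapping (representation bB a)"

lemma lookup_crd: "Poly_Mapping.lookup (crd a) = representation bB a"
 unfolding crd_def by (rule lookup_Abs_poly_mapping) (rule finite_representation)
lemma alin_crd: "alin crd"
proof (rule alinI)
 show "crd (a + b) = crd a + crd b" for a b
  by (rule poly_mapping_eqI) (simp add: lookup_crd lookup_add representation_add[OF independent_bB] span_bB)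
 show "crd (scale c a) = psc c (crd a)" for c a
  by (rule poly_mapping_eqI) (simp add: lookup_crd representation_scale[OF independent_bB] span_bB)
qed
lemma crd_basis: "b : bB ==> crd b = mon b"
 by (rule poly_mapping_eqI) (simp add: lookup_crd representation_basis[OF independent_bB] lookup_single when_def)

text \<open>An element of A enters a word through \<open>u\<close> in the first slot and through
  \<open>v\<close> in all others. The map \<open>v\<close> drops the coordinate along 1 and so
  factors through A/k.\<close>

definition u :: "'a => 'a list \<Rightarrow>\<^sub>0 'k" where "u a = ext (%b. mon [b]) (crd a)"
definition v :: "'a => 'a list \<Rightarrow>\<^sub>0 'k" where "v a = ext (%b. if b = 1 then 0 else mon [b]) (crd a)"

lemma alin_u [alin_intros]: "alin u" and alin_v [alin_intros]: "alin v"
 unfolding u_def v_def by (rule alin_comp[OF plin_ext0 alin_crd])+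
lemma u_basis: "b : bB ==> u b = mon [b]" by (simp add: u_def crd_basis)
lemma v_basis: "b : bS ==> v b = mon [b]" by (simp add: v_def bS_def crd_basis)
lemma v_one [simp]: "v 1 = 0"
proof (cases "(1::'a) = 0")
 case True then show ?thesis using alin_0[OF alin_v] by metis
next
 case False then show ?thesis by (simp add: v_def crd_basis one_bB)
qed
lemma alin_u_left [alin_intros]: "alin (%a. u (a * b))" by (rule alin_arg_left[OF alin_u])
lemma alin_u_right [alin_intros]: "alin (%a. u (b * a))" by (rule alin_arg_right[OF alin_u])
lemma alin_v_left [alin_intros]: "alin (%a. v (a * b))" by (rule alin_arg_left[OF alin_v])
lemma alin_v_right [alin_intros]: "alin (%a. v (b * a))" by (rule alin_arg_right[OF alin_v])

lemma alin_bS_memI: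
 assumes "alin f" "psub S" "!!b. b : bS ==> f b : S" "f 1 : S"
 shows "f a : S"
 by (rule alin_memI[OF assms(1,2)]) (use assms(3,4) in \<open>auto simp: bS_def\<close>)
lemma alin_bS_eqI:
 assumes "alin f" "alin g" "!!b. b : bS ==> f b = g b" "f 1 = g 1"
 shows "f a = g a"
 by (rule alin_eqI[OF assms(1,2)]) (use assms(3,4) in \<open>auto simp: bS_def\<close>)

text \<open>Indices count only the letters from A/k: a word of \<open>WL n\<close> has length n + 1
  because of its first letter, the factor A.\<close>

definition VL :: "nat => 'a list set" where "VL n = {l. length l = n & set l \<subseteq> bS}"
definition WL :: "nat => 'a list set" where "WL n = {b # l |b l. b : bB & l : VL n}"
definition V :: "nat => ('a list \<Rightarrow>\<^sub>0 'k) set" where "V n = Kset (VL n)"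
definition W :: "nat => ('a list \<Rightarrow>\<^sub>0 'k) set" where "W n = Kset (WL n)"

lemma psub_V [simp]: "psub (V n)" and psub_W [simp]: "psub (W n)"
 by (simp_all add: V_def W_def)

lemma u_mem: "u a : W 0"
 by (rule alin_memI[OF alin_u]) (auto simp: u_basis W_def WL_def VL_def)
lemma v_mem: "v a : V 1"
 by (rule alin_bS_memI[OF alin_v]) (auto simp: v_basis V_def VL_def psub_0)
lemma one_mem_V: "1 : V 0"
 unfolding mon_Nil[symmetric] V_def by (simp add: VL_def)
lemma V_V_mem: "x : V n ==> y : V m ==> x * y : V (n + m)"
 unfolding V_def by (rule Kset_mult) (auto simp: VL_def)
lemma W_V_mem: "x : W n ==> y : V m ==> x * y : W (n + m)"
 unfolding V_def W_def by (rule Kset_mult) (auto simp: VL_def WL_def)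
lemma W_v_mem: "x : W n ==> x * v a : W (Suc n)" using W_V_mem[OF _ v_mem] by simp
lemma V_v_mem: "x : V n ==> x * v a : V (Suc n)" using V_V_mem[OF _ v_mem] by simp
lemma v_V_mem: "x : V n ==> v a * x : V (Suc n)" using V_V_mem[OF v_mem] by simp
lemma u_V_mem: "y : V m ==> u a * y : W m" using W_V_mem[OF u_mem] by simp

text \<open>The induction principles for \<open>V\<close> and \<open>W\<close> are inclusions into a
  subspace. It suffices to treat products with \<open>u a\<close> or \<open>v a\<close> for
  arbitrary a, which keeps basis letters out of the later arguments.\<close>

lemma V_0_subI: "psub S ==> 1 : S ==> V 0 \<subseteq> S"
 unfolding V_def by (rule Kset_subI) (auto simp: VL_def mon_Nil)
lemma V_Suc_subI:
 assumes "psub S" "!!y a. y : V n ==> y * v a : S"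
 shows "V (Suc n) \<subseteq> S"
 unfolding V_def
proof (rule Kset_subI[OF assms(1)])
 fix l assume "l : VL (Suc n)"
 then have "l ~= []" by (auto simp: VL_def)
 with \<open>l : VL (Suc n)\<close> have l: "l ~= []" "butlast l : VL n" "last l : bS"
  using last_in_set[of l] by (auto simp: VL_def dest: in_set_butlastD)
 have "mon l = mon (butlast l) * v (last l)" using l by (simp add: v_basis mon_mult)
 then show "mon l : S" using assms(2)[of "mon (butlast l)" "last l"] l(2) by (simp add: V_def)
qed
lemma V_Suc_subI':
 assumes "psub S" "!!y a. y : V n ==> v a * y : S"
 shows "V (Suc n) \<subseteq> S"
 unfolding V_def
proof (rule Kset_subI[OF assms(1)])
 fix l assume "l : VL (Suc n)"
 then obtain b l' where l: "l = b # l'" "l' : VL n" "b : bS"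
  by (cases l) (auto simp: VL_def)
 have "mon l = v b * mon l'" using l by (simp add: v_basis mon_mult)
 then show "mon l : S" using assms(2)[of "mon l'" b] l(2) by (simp add: V_def)
qed
lemma W_subI:
 assumes "psub S" "!!y a. y : V n ==> u a * y : S"
 shows "W n \<subseteq> S"
 unfolding W_def
proof (rule Kset_subI[OF assms(1)])
 fix l assume "l : WL n"
 then obtain b l' where l: "l = b # l'" "b : bB" "l' : VL n" by (auto simp: WL_def)
 have "mon l = u b * mon l'" using l by (simp add: u_basis mon_mult)
 then show "mon l : S" using assms(2)[of "mon l'" b] l(3) by (simp add: V_def)
qed
lemma W_0_subI: "psub S ==> (!!a. u a : S) ==> W 0 \<subseteq> S"
 unfolding W_def by (rule Kset_subI) (auto simp: WL_def VL_def u_basis[symmetric])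
lemma W_split_subI:
 assumes "psub S" "!!y w. y : W n ==> w : V k ==> y * w : S"
 shows "W (n + k) \<subseteq> S"
 unfolding W_def
proof (rule Kset_subI[OF assms(1)])
 fix l assume "l : WL (n + k)"
 then have "take (Suc n) l : WL n & drop (Suc n) l : VL k"
  using set_take_subset set_drop_subset by (fastforce simp: WL_def VL_def)
 then have "mon (take (Suc n) l) * mon (drop (Suc n) l) : S" using assms(2) by (simp add: V_def W_def)
 then show "mon l : S" by (simp add: mon_mult)
qed
lemma W_Suc_subI:
 assumes "psub S" "!!y a. y : W n ==> y * v a : S"
 shows "W (Suc n) \<subseteq> S"
proof -
 have "W (n + 1) \<subseteq> S"
 proof (rule W_split_subI[OF assms(1)])
  fix y w assume y: "y : W n" and w: "w : V 1"
  have "V (Suc 0) \<subseteq> {w. y * w : S}"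
  proof (rule V_Suc_subI)
   have "V 0 \<subseteq> {w. \<forall>a. y * (w * v a) : S}"
    by (rule V_0_subI)
     (auto simp: psub_def distrib_left distrib_right psc_mult_left[symmetric] psc_mult_right[symmetric]
      psub_0[OF assms(1)] psub_add[OF assms(1)] psub_psc[OF assms(1)] assms(2)[OF y])
   then show "!!z a. z : V 0 ==> z * v a : {w. y * w : S}" by blast
  qed (auto intro!: psub_vimage plin_intros assms)
  then show "y * w : S" using w by auto
 qed
 then show ?thesis by simp
qed
lemma V_split_subI:
 assumes "psub S" "!!y w. y : V n ==> w : V k ==> y * w : S"
 shows "V (n + k) \<subseteq> S"
 unfolding V_def
proof (rule Kset_subI[OF assms(1)])
 fix l assume "l : VL (n + k)"
 then have "take n l : VL n & drop n l : VL k"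
  by (auto simp: VL_def dest: in_set_takeD in_set_dropD)
 then have "mon (take n l) * mon (drop n l) : S" using assms(2) by (simp add: V_def)
 then show "mon l : S" by (simp add: mon_mult)
qed

lemma W_memI: "[| plin f; psub S; x : W n; !!y a. y : V n ==> f (u a * y) : S |] ==> f x : S"
 using W_subI[OF psub_vimage[of f S]] by blast
lemma W_eqI: "[| plin f; plin g; x : W n; !!y a. y : V n ==> f (u a * y) = g (u a * y) |] ==> f x = g x"
 using W_subI[OF psub_eq[of f g]] by blast
lemma W_0_eqI: "[| plin f; plin g; x : W 0; !!a. f (u a) = g (u a) |] ==> f x = g x"
 using W_0_subI[OF psub_eq[of f g]] by blast
lemma W_Suc_eqI: "[| plin f; plin g; x : W (Suc n); !!y a. y : W n ==> f (y * v a) = g (y * v a) |] ==> f x = g x"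
 using W_Suc_subI[OF psub_eq[of f g]] by blast
lemma W_split_eqI: "[| plin f; plin g; x : W (n + k); !!y w. y : W n ==> w : V k ==> f (y * w) = g (y * w) |] ==> f x = g x"
 using W_split_subI[OF psub_eq[of f g]] by blast
lemma V_split_eqI: "[| plin f; plin g; x : V (n + k); !!y w. y : V n ==> w : V k ==> f (y * w) = g (y * w) |] ==> f x = g x"
 using V_split_subI[OF psub_eq[of f g]] by blast
lemma V_0_eqI: "[| plin f; plin g; x : V 0; f 1 = g 1 |] ==> f x = g x"
 using V_0_subI[OF psub_eq[of f g]] by blast

text \<open>On words beginning with a basis letter this is the definition, and linearity in c
  extends it to all of A. It is the common source of \<open>dot\<close>, \<open>D\<close>,
  \<open>ba\<close> and \<open>Lm\<close>.\<close>

lemma headlin: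
 assumes "alin f"
 shows "ext (%l. f (hd l) * mon (tl l)) (u c * w) = f c * (w :: 'a list \<Rightarrow>\<^sub>0 'k)"
proof (rule alin_eqI[where a = c])
 show "alin (%c. ext (%l. f (hd l) * mon (tl l)) (u c * w))"
  by (rule alin_comp[OF plin_ext0]) (intro alin_intros)
 show "alin (%c. f c * w)" by (intro alin_intros assms)
 fix b assume b: "b : bB"
 show "ext (%l. f (hd l) * mon (tl l)) (u b * w) = f b * w"
  by (rule plin_eqI[where L = UNIV]) (auto intro!: plin_intros simp: Kset_def u_basis b mon_mult)
qed

section \<open>The right action on noncommutative forms\<close>

fun Rl :: "'a list => 'a => 'a list \<Rightarrow>\<^sub>0 'k" where
 "Rl [] a = 0"
| "Rl [b] a = u (b * a)"
| "Rl (b # c # l) a = mon (rev (c # l)) * v (b * a) - Rl (c # l) b * v a"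

text \<open>The right action changes a word from its right end, so \<open>Rl\<close> reads the word
  backwards. Acting by a on x b gives x (b a) minus (x acted on by b) a; unfolded, this recursion is
  the alternating sum over products of adjacent letters.\<close>

definition R :: "'a => ('a list \<Rightarrow>\<^sub>0 'k) => 'a list \<Rightarrow>\<^sub>0 'k" where
 "R a = ext (%l. Rl (rev l) a)"

lemma alin_Rl: "alin (Rl l)"
proof (induct l)
 case Nil
 show ?case by (simp add: alin_def)
next
 case (Cons b l)
 show ?case
 proof (cases l)
  case Nil
  then have "Rl (b # l) = (%a. u (b * a))" by auto
  then show ?thesis by (simp only:) (intro alin_intros)
 next
  case (Cons c l')
  then have "Rl (b # l) = (%a. mon (rev l) * v (b * a) - Rl l b * v a)" by auto
  then show ?thesis by (simp only:) (intro alin_intros)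
 qed
qed

lemma plin_R [plin_intros]: "plin f ==> plin (%x. R a (f x))"
 unfolding R_def by (intro plin_intros)
lemma plin_R0: "plin (R a)" using plin_R[OF plin_id] by simp
lemma alin_R [alin_intros]: "alin (%a. R a x)"
 unfolding R_def by (rule alin_ext) (rule alin_Rl)
lemma alin_R2 [alin_intros]: "alin f ==> alin (%a. R c (f a))"
 by (rule alin_comp[OF plin_R0])

lemma R_u: "R a (u b) = u (b * a)"
proof (rule alin_eqI[where a = b and f = "%b. R a (u b)"])
 show "R a (u b) = u (b * a)" if "b : bB" for b using that by (simp add: u_basis R_def)
qed (intro alin_intros)+

lemma R_basis: "l ~= [] ==> R a (mon (l @ [b])) = mon l * v (b * a) - R b (mon l) * v a"
 by (cases "rev l") (auto simp: R_def)

text \<open>The correction term of the recursion carries the factor \<open>v 1\<close>, which is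
  zero. This is what makes the recursion compatible with classes modulo scalars.\<close>

lemma R_one: "x : W n ==> R 1 x = x"
proof -
 have "R 1 (mon (b # l)) = mon (b # l)" if "b : bB" "set l \<subseteq> bS" for b l
  using that
 proof (induct l rule: rev_induct)
  case Nil
  then show ?case using R_u[of 1 b] by (simp add: u_basis)
 next
  case (snoc c l)
  then show ?case using R_basis[of "b # l" 1 c] by (simp add: v_basis mon_mult)
 qed
 then show "x : W n ==> R 1 x = x"
  unfolding W_def by (elim plin_eqI[OF plin_R0 plin_id]) (auto simp: WL_def VL_def)
qed

text \<open>Extends the recursion from basis letters to every b. For b = 1 both sides vanish, since
  \<open>v 1 = 0\<close> and \<open>R 1\<close> is the identity.\<close>

lemma R_v: "x : W n ==> R a (x * v b) = x * v (b * a) - R b x * v a"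
proof -
 assume x: "x : W n"
 show ?thesis
 proof (rule alin_bS_eqI[where a = b and f = "%b. R a (x * v b)"])
  show "alin (%b. R a (x * v b))" by (intro alin_intros)
  show "alin (%b. x * v (b * a) - R b x * v a)" by (intro alin_intros)
  show "R a (x * v 1) = x * v (1 * a) - R 1 x * v a" by (simp add: R_one[OF x] plin_0[OF plin_R0])
  fix b assume b: "b : bS"
  show "R a (x * v b) = x * v (b * a) - R b x * v a"
   using x unfolding W_def
   by (elim plin_eqI[where f = "%x. R a (x * v b)", rotated 2])
    (auto intro!: plin_intros simp: v_basis b mon_mult R_basis WL_def R_basis[of "_ # _", simplified])
 qed
qed

lemma R_mem: "x : W n ==> R a x : W n"
proof (induct n arbitrary: x a)
 case 0
 have "W 0 \<subseteq> {x. R a x : W 0}"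
  by (rule W_0_subI) (auto intro!: psub_vimage plin_R0 simp: R_u u_mem)
 then show ?case using 0 by auto
next
 case (Suc n)
 have "W (Suc n) \<subseteq> {x. R a x : W (Suc n)}"
  by (rule W_Suc_subI) (auto intro!: psub_vimage plin_R0 psub_diff[OF psub_W] W_v_mem Suc(1) simp: R_v)
 then show ?case using Suc(2) by auto
qed

text \<open>In the step the recursion is used twice; by the inductive hypothesis the two terms
  ending in \<open>v a\<close> cancel, and the others form the recursion for b a.\<close>

lemma R_R: "x : W n ==> R a (R b x) = R (b * a) x"
proof (induct n arbitrary: x a b)
 case 0
 show ?case
  by (rule W_0_eqI[OF _ _ 0, where f = "%x. R a (R b x)"]) (auto intro!: plin_intros simp: R_u mult.assoc)
next
 case (Suc n)
 show ?case
 proof (rule W_Suc_eqI[OF _ _ Suc(2), where f = "%x. R a (R b x)"])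
  fix y c assume y: "y : W n"
  show "R a (R b (y * v c)) = R (b * a) (y * v c)"
   by (simp add: R_v[OF y] plin_diff[OF plin_R0] R_v[OF R_mem[OF y]] Suc(1)[OF y] mult.assoc)
 qed (auto intro!: plin_intros)
qed

section \<open>The algebra of noncommutative differential forms\<close>

definition dot :: "('a list \<Rightarrow>\<^sub>0 'k) => ('a list \<Rightarrow>\<^sub>0 'k) => 'a list \<Rightarrow>\<^sub>0 'k" where
 "dot y = ext (%l. R (hd l) y * mon (tl l))"
text \<open>With a word a0 a1 ... ap read as the form a0 da1 ... dap, \<open>dot\<close> is the
  product of forms and \<open>D\<close> the universal differential. \<open>ba\<close> is the
  projection of the first factor from A to A/k.\<close>

definition D :: "('a list \<Rightarrow>\<^sub>0 'k) => 'a list \<Rightarrow>\<^sub>0 'k" where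
 "D = ext (%l. (u 1 * v (hd l)) * mon (tl l))"
definition ba :: "('a list \<Rightarrow>\<^sub>0 'k) => 'a list \<Rightarrow>\<^sub>0 'k" where
 "ba = ext (%l. v (hd l) * mon (tl l))"
definition Lm :: "'a => ('a list \<Rightarrow>\<^sub>0 'k) => 'a list \<Rightarrow>\<^sub>0 'k" where
 "Lm a = ext (%l. u (a * hd l) * mon (tl l))"

lemma plin_dot [plin_intros]: "plin f ==> plin (%x. dot y (f x))"
 and plin_dot_left [plin_intros]: "plin f ==> plin (%x. dot (f x) z)"
 and plin_D [plin_intros]: "plin f ==> plin (%x. D (f x))"
 and plin_ba [plin_intros]: "plin f ==> plin (%x. ba (f x))"
 and plin_Lm [plin_intros]: "plin f ==> plin (%x. Lm a (f x))"
 unfolding dot_def D_def ba_def Lm_def by (intro plin_intros; assumption)+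

lemma alin_Lm [alin_intros]: "alin (%a. Lm a x)" unfolding Lm_def by (intro alin_intros)

lemmas plin_dot0 = plin_dot[OF plin_id] and plin_D0 = plin_D[OF plin_id]
 and plin_ba0 = plin_ba[OF plin_id] and plin_Lm0 = plin_Lm[OF plin_id]
 and plin_dot_left0 = plin_dot_left[OF plin_id]

lemma dot_u: "dot y (u c * w) = R c y * w" unfolding dot_def by (rule headlin[OF alin_R])
lemma D_u: "D (u c * w) = u 1 * v c * w" unfolding D_def by (rule headlin) (intro alin_intros)
lemma ba_u: "ba (u c * w) = v c * w" unfolding ba_def by (rule headlin) (intro alin_intros)
lemma Lm_u: "Lm a (u c * w) = u (a * c) * w" unfolding Lm_def by (rule headlin) (intro alin_intros)

lemma dot_u': "dot y (u c) = R c y" using dot_u[of y c 1] by simp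
lemma D_u': "D (u c) = u 1 * v c" using D_u[of c 1] by simp
lemma ba_u': "ba (u c) = v c" using ba_u[of c 1] by simp
lemma Lm_u': "Lm a (u c) = u (a * c)" using Lm_u[of a c 1] by simp

lemma dot_mult: "z : W n ==> dot y (z * w) = dot y z * w"
 by (rule W_eqI[where f = "%z. dot y (z * w)"]) (auto intro!: plin_intros simp: mult.assoc dot_u)
lemma D_mult: "z : W n ==> D (z * w) = D z * w"
 by (rule W_eqI[where f = "%z. D (z * w)"]) (auto intro!: plin_intros simp: mult.assoc D_u)
lemma ba_mult: "z : W n ==> ba (z * w) = ba z * w"
 by (rule W_eqI[where f = "%z. ba (z * w)"]) (auto intro!: plin_intros simp: mult.assoc ba_u)
lemma Lm_mult: "z : W n ==> Lm a (z * w) = Lm a z * w"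
 by (rule W_eqI[where f = "%z. Lm a (z * w)"]) (auto intro!: plin_intros simp: mult.assoc Lm_u)

lemma D_ba: "z : W n ==> D z = u 1 * ba z"
 by (rule W_eqI[where f = "%z. D z"]) (auto intro!: plin_intros simp: mult.assoc D_u ba_u)

lemma dot_mem: "y : W n ==> z : W m ==> dot y z : W (n + m)"
 by (rule W_memI[OF plin_dot0]) (auto simp: dot_u W_V_mem R_mem)
lemma D_mem: "z : W m ==> D z : W (Suc m)"
 by (rule W_memI[OF plin_D0]) (auto simp: D_u mult.assoc intro!: u_V_mem v_V_mem)
lemma ba_mem: "z : W m ==> ba z : V (Suc m)"
 by (rule W_memI[OF plin_ba0]) (auto simp: ba_u intro!: v_V_mem)
lemma Lm_mem: "z : W m ==> Lm a z : W m"
 by (rule W_memI[OF plin_Lm0]) (auto simp: Lm_u intro!: u_V_mem)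

text \<open>The product absorbs its first factor through the right action by the first letter of the
  second, so for one letter this is \<open>R_R\<close>; the recursion \<open>R_v\<close> carries it
  to longer forms.\<close>

lemma R_dot: "z : W m ==> y : W n ==> R a (dot y z) = dot y (R a z)"
proof (induct m arbitrary: z a)
 case 0
 show ?case
  by (rule W_0_eqI[OF _ _ 0(1), where f = "%z. R a (dot y z)"])
   (auto intro!: plin_intros simp: dot_u' R_u R_R[OF 0(2)])
next
 case (Suc m)
 show ?case
 proof (rule W_Suc_eqI[OF _ _ Suc(2), where f = "%z. R a (dot y z)"])
  fix z c assume z: "z : W m"
  show "R a (dot y (z * v c)) = dot y (R a (z * v c))"
   by (simp add: R_v[OF z] dot_mult[OF z] dot_mult[OF R_mem[OF z]] R_v[OF dot_mem[OF Suc(3) z]]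
    plin_diff[OF plin_dot0] Suc(1)[OF z Suc(3)])
 qed (auto intro!: plin_intros)
qed

lemma dot_assoc: "y : W n ==> z : W m ==> t : W k ==> dot y (dot z t) = dot (dot y z) t"
 by (rule W_eqI[where f = "%t. dot y (dot z t)"])
  (auto intro!: plin_intros simp: dot_u dot_mult[OF R_mem] R_dot)

lemma dot_u_left: "z : W m ==> dot (u c) z = Lm c z"
 by (rule W_eqI[where f = "%z. dot (u c) z"]) (auto intro!: plin_intros simp: dot_u Lm_u R_u)


lemma R_Lm: "z : W m ==> R a (Lm c z) = Lm c (R a z)"
 using R_dot[of z m "u c" 0 a] by (simp add: u_mem dot_u_left dot_u_left[OF R_mem])

lemma Lm_Lm: "z : W m ==> Lm a (Lm b z) = Lm (a * b) z"
 by (rule W_eqI[where f = "%z. Lm a (Lm b z)"]) (auto intro!: plin_intros simp: Lm_u mult.assoc)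
lemma Lm_one: "z : W m ==> Lm 1 z = z"
 by (rule W_eqI[where f = "%z. Lm 1 z"]) (auto intro!: plin_intros simp: Lm_u)

text \<open>The Leibniz rule for multiplication by a on the right: d(z a) = dz a + (-1)^q z da. Its
  companion for multiplication on the left is \<open>D_Lm\<close>.\<close>

lemma D_R: "z : W q ==> D (R a z) = R a (D z) + eps (int q) (z * v a)"
proof (induct q arbitrary: z a)
 case 0
 show ?case
 proof (rule W_0_eqI[OF _ _ 0, where f = "%z. D (R a z)"])
  show "D (R a (u c)) = R a (D (u c)) + eps (int 0) (u c * v a)" for c
   \<comment> \<open>In form degree zero, d(c a) = dc a + c da is the recursion of \<open>R\<close>
     for the word 1 c.\<close>
   using R_v[OF u_mem, of a 1 c] by (simp add: R_u D_u')
 qed (auto intro!: plin_intros)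
next
 case (Suc q)
 show ?case
 proof (rule W_Suc_eqI[OF _ _ Suc(2), where f = "%z. D (R a z)"])
  fix z c assume z: "z : W q"
  show "D (R a (z * v c)) = R a (D (z * v c)) + eps (int (Suc q)) (z * v c * v a)"
   by (simp add: R_v[OF z] D_mult[OF z] D_mult[OF R_mem[OF z]] R_v[OF D_mem[OF z]]
    plin_diff[OF plin_D0] Suc(1)[OF z] eps_def algebra_simps)
 qed (auto intro!: plin_intros)
qed

lemma D_Lm: "z : W q ==> D (Lm c z) = dot (u 1 * v c) z + Lm c (D z)"
proof (rule W_eqI[where f = "%z. D (Lm c z)"])
 fix y a assume "y : V q"
 show "D (Lm c (u a * y)) = dot (u 1 * v c) (u a * y) + Lm c (D (u a * y))"
 proof -
  have "u 1 * v (c * a) = R a (u 1 * v c) + u c * v a" using R_v[OF u_mem, of a 1 c] by (simp add: R_u)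
  then have "u 1 * v (c * a) * y = R a (u 1 * v c) * y + u c * v a * y" by (simp only: distrib_right)
  then show ?thesis by (simp add: Lm_u D_u dot_u mult.assoc)
 qed
qed (auto intro!: plin_intros)

end

section \<open>Insertion of linear maps into words\<close>

definition Hh :: "nat => ('a list \<Rightarrow>\<^sub>0 'k::field) set" where "Hh n = Kset {l. length l = n}"

lemma psub_Hh [simp]: "psub (Hh n)" by (simp add: Hh_def)
lemma one_Hh: "1 : Hh 0" unfolding Hh_def mon_Nil[symmetric] by simp
lemma Hh_mult: "x : Hh n ==> y : Hh m ==> x * y : Hh (n + m)"
 unfolding Hh_def by (rule Kset_mult) auto

text \<open>This is id tensor \<open>ph\<close> tensor id with k letters in front. The value 0 on
  words that are too short allows sums over all places of a word without a bound that depends on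
  n.\<close>

definition ins :: "nat => nat => (('a list \<Rightarrow>\<^sub>0 'k::field) => 'a list \<Rightarrow>\<^sub>0 'k) => ('a list \<Rightarrow>\<^sub>0 'k) => 'a list \<Rightarrow>\<^sub>0 'k" where
 "ins k n ph = ext (%l. if k + n <= length l
  then mon (take k l) * ph (mon (take n (drop k l))) * mon (drop (k + n) l) else 0)"

lemma plin_ins [plin_intros]: "plin f ==> plin (%x. ins k n ph (f x))"
 unfolding ins_def by (rule plin_ext)
lemmas plin_ins0 = plin_ins[OF plin_id]

lemma ins_mult:
 assumes "plin ph" "x : Hh k" "y : Hh n"
 shows "ins k n ph (x * y * z) = x * ph y * z"
 using assms(2) unfolding Hh_def
proof (rule plin_eqI[where f = "%x. ins k n ph (x * y * z)", rotated 2])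
 fix l :: "'a list" assume l: "l : {l. length l = k}"
 show "ins k n ph (mon l * y * z) = mon l * ph y * z"
  using assms(3) unfolding Hh_def
 proof (rule plin_eqI[where f = "%y. ins k n ph (mon l * y * z)", rotated 2])
  fix l' :: "'a list" assume l': "l' : {l. length l = n}"
  show "ins k n ph (mon l * mon l' * z) = mon l * ph (mon l') * z"
   by (rule plin_eqI[where f = "%z. ins k n ph (mon l * mon l' * z)" and L = UNIV])
    (use l l' in \<open>auto intro!: plin_intros simp: Kset_def mon_mult ins_def\<close>)
 qed (auto intro!: plin_intros plin_comp[OF assms(1)])
qed (auto intro!: plin_intros plin_comp[OF assms(1)])

lemma ins_shift:
 assumes "x : Hh k"
 shows "ins (k + j) n ph (x * z) = x * ins j n ph z"
 using assms unfolding Hh_def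
proof (rule plin_eqI[where f = "%x. ins (k + j) n ph (x * z)", rotated 2])
 fix l :: "'a list" assume l: "l : {l. length l = k}"
 show "ins (k + j) n ph (mon l * z) = mon l * ins j n ph z"
 proof (rule plin_eqI[where f = "%z. ins (k + j) n ph (mon l * z)" and L = UNIV])
  fix m :: "'a list"
  have "take (k + j) (l @ m) = l @ take j m" "drop (k + j) (l @ m) = drop j m"
   "drop (k + j + n) (l @ m) = drop (j + n) m" using l by auto
  then have "ins (k + j) n ph (mon (l @ m)) = mon l * ins j n ph (mon m)"
   using l by (simp add: ins_def mon_mult[symmetric, of l "take j m"] mult.assoc)
  then show "ins (k + j) n ph (mon l * mon m) = mon l * ins j n ph (mon m)"
   by (simp only: mon_mult)
 qed (auto intro!: plin_intros simp: Kset_def)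
qed (auto intro!: plin_intros)

lemma ins0_mult: "plin ph ==> y : Hh n ==> ins 0 n ph (y * z) = ph y * z"
 using ins_mult[of ph 1 0 y n z] by (simp add: one_Hh)

lemma ins_short: "x : Hh j ==> j < k + n ==> ins k n ph x = 0"
 unfolding Hh_def by (rule plin_eqI[OF plin_ins0 plin_const_0]) (auto simp: ins_def)

lemma ins_right:
 assumes "x : Hh j" "k + n <= j"
 shows "ins k n ph (x * z) = ins k n ph x * z"
 using assms unfolding Hh_def
proof (elim plin_eqI[where f = "%x. ins k n ph (x * z)", rotated 2])
 fix l :: "'a list" assume l: "l : {l. length l = j}"
 show "ins k n ph (mon l * z) = ins k n ph (mon l) * z"
  by (rule plin_eqI[where f = "%z. ins k n ph (mon l * z)" and L = UNIV])
   (use l assms(2) in \<open>auto intro!: plin_intros simp: Kset_def mon_mult ins_def mult.assoc\<close>)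
qed (auto intro!: plin_intros)

text \<open>Segments are nonempty because the first letter of a word in \<open>W N\<close> is the
  factor A, in front of which nothing may be inserted. The sign is that of an operator of degree k
  passing the i - 1 letters behind the first one.\<close>

definition hs :: "int => (('a list \<Rightarrow>\<^sub>0 'k::field) => 'a list \<Rightarrow>\<^sub>0 'k) => ('a list \<Rightarrow>\<^sub>0 'k) => 'a list \<Rightarrow>\<^sub>0 'k" where
 "hs k \<psi> = ext (%l. \<Sum>i = 1..length l. eps (k * (int i - 1)) (mon (take i l) * \<psi> (mon (drop i l))))"

lemma plin_hs [plin_intros]: "plin f ==> plin (%x. hs k \<psi> (f x))"
 unfolding hs_def by (rule plin_ext)
lemmas plin_hs0 = plin_hs[OF plin_id]

lemma hs_one [simp]: "hs k \<psi> 1 = 0"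
 unfolding hs_def mon_Nil[symmetric] by simp

text \<open>Either the segment is the first letter alone, or it contains that letter and a further
  one and picks up the sign of k once more. This recursion from the left and \<open>hs_tail\<close>
  from the right carry the later inductions.\<close>

lemma hs_head:
 assumes "plin \<psi>" "x : Hh 1"
 shows "hs k \<psi> (x * z) = x * \<psi> z + eps k (x * hs k \<psi> z)"
 using assms(2) unfolding Hh_def
proof (rule plin_eqI[where f = "%x. hs k \<psi> (x * z)", rotated 2])
 fix l :: "'a list" assume "l : {l. length l = 1}"
 then obtain b where l: "l = [b]" by (auto simp: length_Suc_conv)
 show "hs k \<psi> (mon l * z) = mon l * \<psi> z + eps k (mon l * hs k \<psi> z)"
 proof (rule plin_eqI[where f = "%z. hs k \<psi> (mon l * z)" and L = UNIV])
  fix m :: "'a list"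
  have *: "(\<Sum>i = 1..Suc n. f i) = f 1 + (\<Sum>i = 1..n. f (Suc i))" for n and f :: "nat => 'a list \<Rightarrow>\<^sub>0 'b"
   using sum.atLeast_Suc_atMost[of 1 "Suc n" f] sum.atLeast_Suc_atMost_Suc_shift[of f 1 n] by simp
  define g where "g l i = eps (k * (int i - 1)) (mon (take i l) * \<psi> (mon (drop i l)))" for l :: "'a list" and i
  have g: "g (b # m) (Suc i) = eps k (mon [b] * g m i)" for i
  proof -
   have "k + k * (int i - 1) = k * (int (Suc i) - 1)" by (simp add: algebra_simps)
   moreover have "mon [b] * (mon (take i m) * \<psi> (mon (drop i m))) = mon (b # take i m) * \<psi> (mon (drop i m))"
    by (simp add: mult.assoc[symmetric] mon_mult)
   ultimately show ?thesis by (simp add: g_def eps_mult_right)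
  qed
  have "hs k \<psi> (mon (b # m)) = (\<Sum>i = 1..Suc (length m). g (b # m) i)" by (simp add: hs_def g_def)
  also have "\<dots> = g (b # m) 1 + (\<Sum>i = 1..length m. eps k (mon [b] * g m i))" by (simp only: * g)
  also have "(\<Sum>i = 1..length m. eps k (mon [b] * g m i)) = eps k (mon [b] * hs k \<psi> (mon m))"
   by (simp add: hs_def g_def[symmetric] eps_sum sum_distrib_left)
  finally show "hs k \<psi> (mon l * mon m) = mon l * \<psi> (mon m) + eps k (mon l * hs k \<psi> (mon m))"
   by (simp add: mon_mult l g_def)
 qed (auto intro!: plin_intros plin_comp[OF assms(1)] simp: Kset_def)
qed (auto intro!: plin_intros plin_comp[OF assms(1)])

text \<open>Cuts a word in front of its last n letters. It isolates the one insertion that becomes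
  possible when a last letter is appended.\<close>

definition tl2 :: "nat => (('a list \<Rightarrow>\<^sub>0 'k::field) => ('a list \<Rightarrow>\<^sub>0 'k) => 'a list \<Rightarrow>\<^sub>0 'k) => ('a list \<Rightarrow>\<^sub>0 'k) => 'a list \<Rightarrow>\<^sub>0 'k" where
 "tl2 n \<beta> = ext (%l. if n < length l then \<beta> (mon (take (length l - n) l)) (mon (drop (length l - n) l)) else 0)"

lemma plin_tl2 [plin_intros]: "plin f ==> plin (%x. tl2 k \<beta> (f x))"
 unfolding tl2_def by (rule plin_ext)
lemmas plin_tl20 = plin_tl2[OF plin_id]

lemma tl2_mult:
 assumes "!!y. plin (%x. \<beta> x y)" "!!x. plin (\<beta> x)" "x : Hh j" "0 < j" "y : Hh n"
 shows "tl2 n \<beta> (x * y) = \<beta> x y"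
 using assms(3) unfolding Hh_def
proof (rule plin_eqI[where f = "%x. tl2 n \<beta> (x * y)", rotated 2])
 fix l :: "'a list" assume l: "l : {l. length l = j}"
 show "tl2 n \<beta> (mon l * y) = \<beta> (mon l) y"
  using assms(5) unfolding Hh_def
  by (rule plin_eqI[where f = "%y. tl2 n \<beta> (mon l * y)", rotated 2])
   (use l assms(4) in \<open>auto intro!: plin_intros assms(2) simp: mon_mult tl2_def\<close>)
qed (auto intro!: plin_intros assms(1))

lemma tl2_short: "x : Hh j ==> j <= n ==> tl2 n \<beta> x = 0"
 unfolding Hh_def by (rule plin_eqI[OF plin_tl20 plin_const_0]) (auto simp: tl2_def)

text \<open>An appended letter leaves the old insertions alone and creates one new one, which
  consumes the last n letters. The segment in front of it has length j + 1 - n, whence the exponent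
  k (j - n).\<close>

lemma hs_tail:
 fixes \<psi> :: "('a list \<Rightarrow>\<^sub>0 'k::field) => 'a list \<Rightarrow>\<^sub>0 'k"
 assumes psi: "plin \<psi>"
 assumes "x : Hh j" "y : Hh 1"
 shows "hs k (ins 0 n \<psi>) (x * y) = hs k (ins 0 n \<psi>) x * y
  + eps (k * (int j - int n)) (tl2 n (%x y. x * \<psi> y) (x * y))"
proof -
 let ?S = "hs k (ins 0 n \<psi>)" and ?e = "tl2 n (%x y. x * \<psi> y)"
 have *: "?S (mon (l @ [c])) = ?S (mon l) * mon [c] + eps (k * (int (length l) - int n)) (?e (mon (l @ [c])))" for l c
 proof (induct l)
  case Nil
  show ?case
  proof -
   have "?S (mon [c]) = mon [c] * ins 0 n \<psi> (mon [])"
    using hs_head[OF plin_ins0, of "mon [c]" k 0 n \<psi> 1] by (simp add: Hh_def mon_Nil)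
   moreover have "ins 0 n \<psi> (mon []) = (if n = 0 then \<psi> (mon []) else 0)"
    by (auto simp: ins_def mon_Nil[symmetric]) (simp add: mon_Nil)
   moreover have "?S (mon []) = 0" unfolding mon_Nil by simp
   ultimately show ?thesis by (auto simp: tl2_def)
  qed
 next
  case (Cons b l)
  have h: "?S (mon (b # m)) = mon [b] * ins 0 n \<psi> (mon m) + eps k (mon [b] * ?S (mon m))" for m
   using hs_head[OF plin_ins0, of "mon [b]" k 0 n \<psi> "mon m"] by (simp add: Hh_def mon_mult)
  have i: "ins 0 n \<psi> (mon (l @ [c])) = ins 0 n \<psi> (mon l) * mon [c] + (if n = length l + 1 then \<psi> (mon (l @ [c])) else 0)"
   by (auto simp: ins_def mon_mult mult.assoc mon_Nil)
  \<comment> \<open>For n = length l + 1 the segment in front of the inserted part is b alone; the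
    shorter word has no such term, and the first summand supplies it.\<close>
  have e: "eps (k * (int (length (b # l)) - int n)) (?e (mon (b # l @ [c])))
   = mon [b] * (if n = length l + 1 then \<psi> (mon (l @ [c])) else 0)
    + eps k (mon [b] * eps (k * (int (length l) - int n)) (?e (mon (l @ [c]))))"
  proof (cases "n < length l + 1")
   case True
   then have "take (Suc (Suc (length l)) - n) (b # l @ [c]) = [b] @ take (Suc (length l) - n) (l @ [c])"
    "drop (Suc (Suc (length l)) - n) (b # l @ [c]) = drop (Suc (length l) - n) (l @ [c])"
    by (simp_all add: Suc_diff_le)
   moreover have "k * (int (length (b # l)) - int n) = k + k * (int (length l) - int n)" by (simp add: algebra_simps)
   ultimately show ?thesis using True
    by (simp only: eps_eps[symmetric] eps_mult_right) (simp add: tl2_def mon_mult[symmetric, of "[b]"] mult.assoc del: append_Cons eps_eps)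
  qed (auto simp: tl2_def)
  have "?S (mon ((b # l) @ [c])) = mon [b] * ins 0 n \<psi> (mon (l @ [c])) + eps k (mon [b] * ?S (mon (l @ [c])))"
   using h[of "l @ [c]"] by simp
  also have "\<dots> = (mon [b] * ins 0 n \<psi> (mon l) + eps k (mon [b] * ?S (mon l))) * mon [c]
   + (mon [b] * (if n = length l + 1 then \<psi> (mon (l @ [c])) else 0)
    + eps k (mon [b] * eps (k * (int (length l) - int n)) (?e (mon (l @ [c])))))"
   unfolding i Cons by (simp only: distrib_left distrib_right eps_add eps_mult_left mult.assoc add.assoc add.left_commute)
  finally show ?case by (simp only: h[symmetric] e[symmetric] append_Cons)
 qed
 show ?thesis
  using assms(2) unfolding Hh_def
 proof (rule plin_eqI[where f = "%x. ?S (x * y)", rotated 2])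
  fix l :: "'a list" assume l: "l : {l. length l = j}"
  show "?S (mon l * y) = ?S (mon l) * y + eps (k * (int j - int n)) (?e (mon l * y))"
   using assms(3) unfolding Hh_def
  proof (rule plin_eqI[where f = "%y. ?S (mon l * y)", rotated 2])
   fix m :: "'a list" assume "m : {l. length l = 1}"
   then obtain c where m: "m = [c]" by (auto simp: length_Suc_conv)
   show "?S (mon l * mon m) = ?S (mon l) * mon m + eps (k * (int j - int n)) (?e (mon l * mon m))"
    using * l by (simp add: m mon_mult)
  qed (auto intro!: plin_intros)
 qed (auto intro!: plin_intros)
qed

context algebra_over_field
begin

lemma V_H: "x : V n ==> x : Hh n" by (auto simp: V_def Hh_def Kset_def VL_def)
lemma W_H: "x : W n ==> x : Hh (Suc n)" by (auto simp: W_def Hh_def Kset_def WL_def VL_def)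

section \<open>Cochains as left linear operators, and their differential\<close>

definition coch :: "nat => nat => (('a list \<Rightarrow>\<^sub>0 'k) => 'a list \<Rightarrow>\<^sub>0 'k) => bool" where
 "coch m p ph \<longleftrightarrow> plin ph & (\<forall>x\<in>V m. ph x : W p)"

lemma coch_plin: "coch m p ph ==> plin ph" and coch_mem: "coch m p ph ==> x : V m ==> ph x : W p"
 by (simp_all add: coch_def)

text \<open>A word a0 w z, with m letters in w, goes to a0 ph(w) z. The trailing z is what makes the
  stages of the colimit indistinguishable: tensoring \<open>ph\<close> with an identity changes
  nothing as soon as z is long enough.\<close>

definition Op :: "nat => (('a list \<Rightarrow>\<^sub>0 'k) => 'a list \<Rightarrow>\<^sub>0 'k) => ('a list \<Rightarrow>\<^sub>0 'k) => 'a list \<Rightarrow>\<^sub>0 'k" where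
 "Op m ph = ext (%l. if m < length l
  then Lm (hd l) (ph (mon (take m (tl l)))) * mon (drop (Suc m) l) else 0)"

lemma plin_Op [plin_intros]: "plin f ==> plin (%x. Op m ph (f x))"
 unfolding Op_def by (rule plin_ext)
lemmas plin_Op0 = plin_Op[OF plin_id]

lemma Op_u:
 assumes "coch m p ph" "w : V m"
 shows "Op m ph (u a * w * z) = Lm a (ph w) * z"
proof (rule alin_eqI[where a = a and f = "%a. Op m ph (u a * w * z)"])
 show "alin (%a. Op m ph (u a * w * z))" by (rule alin_comp[OF plin_Op0]) (intro alin_intros)
 show "alin (%a. Lm a (ph w) * z)" by (intro alin_intros)
 fix b assume b: "b : bB"
 show "Op m ph (u b * w * z) = Lm b (ph w) * z"
  using assms(2) unfolding V_def
 proof (rule plin_eqI[where f = "%w. Op m ph (u b * w * z)", rotated 2])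
  fix l assume l: "l : VL m"
  show "Op m ph (u b * mon l * z) = Lm b (ph (mon l)) * z"
   by (rule plin_eqI[where f = "%z. Op m ph (u b * mon l * z)" and L = UNIV])
    (use l in \<open>auto intro!: plin_intros simp: Kset_def mon_mult Op_def u_basis b VL_def\<close>)
 qed (auto intro!: plin_intros plin_comp[OF coch_plin[OF assms(1)]])
qed

lemma Op_u': "coch m p ph ==> w : V m ==> Op m ph (u a * w) = Lm a (ph w)"
 using Op_u[of m p ph w a 1] by simp

lemma Op_one: "coch m p ph ==> w : V m ==> Op m ph (u 1 * w) = ph w"
 by (simp add: Op_u' Lm_one[OF coch_mem])

lemma Op_short: "x : W N ==> N < m ==> Op m ph x = 0"
 unfolding W_def by (rule plin_eqI[OF plin_Op0 plin_const_0]) (auto simp: Op_def WL_def VL_def)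

lemma Op_mem:
 assumes "coch m p ph" "x : W (m + k)"
 shows "Op m ph x : W (p + k)"
proof -
 have "W (m + k) \<subseteq> {x. Op m ph x : W (p + k)}"
 proof (rule W_split_subI)
  fix y w assume y: "y : W m" and w: "w : V k"
  show "y * w : {x. Op m ph x : W (p + k)}"
   unfolding mem_Collect_eq
  proof (rule W_memI[OF _ psub_W y, where f = "%y. Op m ph (y * w)"])
   show "plin (%y. Op m ph (y * w))" by (intro plin_intros)
  qed (auto intro!: W_V_mem w simp: Op_u[OF assms(1)] Lm_mem coch_mem[OF assms(1)])
 qed (auto intro!: psub_vimage plin_Op0)
 then show ?thesis using assms(2) by auto
qed

lemma Op_mult:
 assumes "coch m p ph" "x : W N" "m <= N"
 shows "Op m ph (x * z) = Op m ph x * z"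
proof -
 obtain k where N: "N = m + k" using assms(3) le_Suc_ex by blast
 show ?thesis
 proof (rule W_split_eqI[OF _ _ assms(2)[unfolded N], where f = "%x. Op m ph (x * z)"])
  fix y w assume y: "y : W m" and w: "w : V k"
  show "Op m ph (y * w * z) = Op m ph (y * w) * z"
  proof (rule W_eqI[OF _ _ y, where f = "%y. Op m ph (y * w * z)"])
   fix t c assume t: "t : V m"
   show "Op m ph (u c * t * w * z) = Op m ph (u c * t * w) * z"
    using Op_u[OF assms(1) t, of c "w * z"] Op_u[OF assms(1) t, of c w] by (simp add: mult.assoc)
  qed (intro plin_intros)+
 qed (auto intro!: plin_intros)
qed

lemma Op_Lm:
 assumes "coch m p ph" "x : W N" "m <= N"
 shows "Op m ph (Lm a x) = Lm a (Op m ph x)"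
proof -
 obtain k where N: "N = m + k" using assms(3) le_Suc_ex by blast
 show ?thesis
 proof (rule W_split_eqI[OF _ _ assms(2)[unfolded N], where f = "%x. Op m ph (Lm a x)"])
  fix y w assume y: "y : W m" and w: "w : V k"
  show "Op m ph (Lm a (y * w)) = Lm a (Op m ph (y * w))"
  proof (rule W_eqI[OF _ _ y, where f = "%y. Op m ph (Lm a (y * w))"])
   fix t c assume t: "t : V m"
   show "Op m ph (Lm a (u c * t * w)) = Lm a (Op m ph (u c * t * w))"
    using Op_u[OF assms(1) t, of "a * c" w] Op_u[OF assms(1) t, of c w] coch_mem[OF assms(1) t]
    by (simp add: Lm_u[of a c "t * w", folded mult.assoc] Lm_mult[OF Lm_mem] Lm_Lm)
  qed (auto intro!: plin_intros)
 qed (auto intro!: plin_intros)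
qed

text \<open>The Hochschild differential as a commutator. The right action by the last argument on 1
  w produces the products of adjacent arguments and, from 1 times the first argument, the left
  action; the right action on the value is the remaining term.\<close>

definition dop :: "nat => nat => (('a list \<Rightarrow>\<^sub>0 'k) => 'a list \<Rightarrow>\<^sub>0 'k) => ('a list \<Rightarrow>\<^sub>0 'k) => 'a list \<Rightarrow>\<^sub>0 'k" where
 "dop m p ph = ext (%l. if l = [] then 0 else eps (int p + 1)
  (Op m ph (R (last l) (u 1 * mon (butlast l))) - R (last l) (ph (mon (butlast l)))))"

lemma plin_dop [plin_intros]: "plin f ==> plin (%x. dop m p ph (f x))"
 unfolding dop_def by (rule plin_ext)
lemmas plin_dop0 = plin_dop[OF plin_id]

lemma alin_eps [alin_intros]: "alin f ==> alin (%x. eps k (f x))"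
 by (rule alin_comp[of "eps k"]) (intro plin_intros)

text \<open>Passing from basis letters to all a requires the formula for a = 1, where both sides
  vanish because \<open>R 1\<close> is the identity.\<close>

lemma dop_v:
 assumes c: "coch m p ph" and w: "w : V m"
 shows "dop m p ph (w * v a) = eps (int p + 1) (Op m ph (R a (u 1 * w)) - R a (ph w))"
proof (rule alin_bS_eqI[where a = a and f = "%a. dop m p ph (w * v a)"])
 show "alin (%a. dop m p ph (w * v a))" by (rule alin_comp[OF plin_dop0]) (intro alin_intros)
 have "alin (%a. Op m ph (R a (u 1 * w)))" by (rule alin_comp[OF plin_Op0]) (intro alin_intros)
 then show "alin (%a. eps (int p + 1) (Op m ph (R a (u 1 * w)) - R a (ph w)))" by (intro alin_intros)
 show "dop m p ph (w * v 1) = eps (int p + 1) (Op m ph (R 1 (u 1 * w)) - R 1 (ph w))"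
  by (simp add: plin_0[OF plin_dop0] R_one[OF u_V_mem[OF w]] R_one[OF coch_mem[OF c w]] Op_one[OF c w])
 fix b assume b: "b : bS"
 show "dop m p ph (w * v b) = eps (int p + 1) (Op m ph (R b (u 1 * w)) - R b (ph w))"
  using w unfolding V_def
  by (rule plin_eqI[where f = "%w. dop m p ph (w * v b)", rotated 2])
   (auto intro!: plin_intros plin_comp[OF coch_plin[OF c]] simp: b v_basis mon_mult dop_def)
qed

lemma coch_dop: "coch m p ph ==> coch (Suc m) p (dop m p ph)"
proof -
 assume c: "coch m p ph"
 have "V (Suc m) \<subseteq> {x. dop m p ph x : W p}"
  by (rule V_Suc_subI)
   (auto intro!: psub_vimage plin_dop0 psub_eps psub_diff R_mem coch_mem[OF c] Op_mem[OF c, of _ 0, simplified]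
    u_V_mem simp: dop_v[OF c])
 then show ?thesis by (auto simp: coch_def plin_dop0)
qed

text \<open>The operator of a differential is the graded commutator with the right action, the
  appended letter being the new argument. For each further letter the terms containing a product of
  letters cancel by \<open>R_v\<close>, and the rest changes sign.\<close>

lemma Op_dop:
 assumes c: "coch m p ph"
 shows "x : W (m + k) ==> Op (Suc m) (dop m p ph) (x * v a)
  = eps (int p + int k + 1) (Op m ph (R a x) - R a (Op m ph x))"
proof (induct k arbitrary: x a)
 case 0
 show ?case
 proof (rule W_eqI[where x = x and n = m])
  fix y e assume y: "y : V m"
  have "Op (Suc m) (dop m p ph) (u e * (y * v a)) = Lm e (dop m p ph (y * v a))"
   by (rule Op_u'[OF coch_dop[OF c] V_v_mem[OF y]])
  also have "\<dots> = eps (int p + 1) (Lm e (Op m ph (R a (u 1 * y))) - Lm e (R a (ph y)))"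
   by (simp add: dop_v[OF c y] plin_eps_out[OF plin_Lm0] plin_diff[OF plin_Lm0])
  also have "Lm e (Op m ph (R a (u 1 * y))) = Op m ph (R a (u e * y))"
   by (simp add: Op_Lm[OF c R_mem[OF u_V_mem[OF y]], symmetric] R_Lm[OF u_V_mem[OF y], symmetric] Lm_u)
  also have "Lm e (R a (ph y)) = R a (Op m ph (u e * y))"
   by (simp add: R_Lm[OF coch_mem[OF c y], symmetric] Op_u'[OF c y])
  finally show "Op (Suc m) (dop m p ph) (u e * y * v a)
   = eps (int p + int 0 + 1) (Op m ph (R a (u e * y)) - R a (Op m ph (u e * y)))"
   by (simp add: mult.assoc)
 qed (use 0 in \<open>auto intro!: plin_intros\<close>)
next
 case (Suc k)
 show ?case
 proof (rule W_Suc_eqI[where x = x and n = "m + k"])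
  fix y b assume y: "y : W (m + k)"
  note Ry = R_mem[OF y]
  have "Op (Suc m) (dop m p ph) (y * v b * v a) = Op (Suc m) (dop m p ph) (y * v b) * v a"
   by (rule Op_mult[OF coch_dop[OF c] W_v_mem[OF y]]) simp
  also have "\<dots> = eps (int p + int k + 1) (Op m ph (R b y) - R b (Op m ph y)) * v a"
   by (simp add: Suc(1)[OF y])
  finally show "Op (Suc m) (dop m p ph) (y * v b * v a)
   = eps (int p + int (Suc k) + 1) (Op m ph (R a (y * v b)) - R a (Op m ph (y * v b)))"
   by (simp add: R_v[OF y] plin_diff[OF plin_Op0] Op_mult[OF c y] Op_mult[OF c Ry] R_v[OF Op_mem[OF c y]]
    eps_def algebra_simps)
 qed (use Suc in \<open>auto intro!: plin_intros\<close>)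
qed

end

lemma hs_short:
 assumes "x : Hh j" "j <= n"
 shows "hs k (ins 0 n \<psi>) x = 0"
 using assms(1) unfolding Hh_def
 by (rule plin_eqI[OF plin_hs0 plin_const_0]) (use assms(2) in \<open>auto intro!: sum.neutral simp: hs_def ins_def\<close>)

section \<open>The insertion operator and its commutator with the right action\<close>

context algebra_over_field
begin

text \<open>The insertion replaces n letters by q + 1 letters, so n - q - 1 is its degree.\<close>

definition Sg :: "nat => nat => (('a list \<Rightarrow>\<^sub>0 'k) => 'a list \<Rightarrow>\<^sub>0 'k) => ('a list \<Rightarrow>\<^sub>0 'k) => 'a list \<Rightarrow>\<^sub>0 'k" where
 "Sg n q ph = hs (int n - int q - 1) (ins 0 n (%x. ba (ph x)))"
text \<open>\<open>ee\<close> is the last insertion of \<open>Sg\<close>. \<open>rh\<close> differs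
  from it in that the value on the last n letters is not projected to A/k but multiplied, as a form,
  with what precedes it.\<close>

definition ee :: "nat => (('a list \<Rightarrow>\<^sub>0 'k) => 'a list \<Rightarrow>\<^sub>0 'k) => ('a list \<Rightarrow>\<^sub>0 'k) => 'a list \<Rightarrow>\<^sub>0 'k" where
 "ee n ph = tl2 n (%x y. x * ba (ph y))"
definition rh :: "nat => (('a list \<Rightarrow>\<^sub>0 'k) => 'a list \<Rightarrow>\<^sub>0 'k) => ('a list \<Rightarrow>\<^sub>0 'k) => 'a list \<Rightarrow>\<^sub>0 'k" where
 "rh n ph = tl2 n (%x y. dot x (ph y))"

lemma plin_Sg [plin_intros]: "plin f ==> plin (%x. Sg n q ph (f x))"
 and plin_ee [plin_intros]: "plin f ==> plin (%x. ee n ph (f x))"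
 and plin_rh [plin_intros]: "plin f ==> plin (%x. rh n ph (f x))"
 unfolding Sg_def ee_def rh_def by (intro plin_intros; assumption)+
lemmas plin_Sg0 = plin_Sg[OF plin_id] and plin_ee0 = plin_ee[OF plin_id] and plin_rh0 = plin_rh[OF plin_id]

lemma plin_coch_ba: "coch n q ph ==> plin (%x. ba (ph x))"
 by (intro plin_intros coch_plin)

lemma gb_V: "coch n q ph ==> w : V n ==> ins 0 n (%x. ba (ph x)) (w * z) = ba (ph w) * z"
 by (rule ins0_mult[OF plin_coch_ba V_H])

lemma gb_mem:
 assumes c: "coch n q ph" and z: "z : V (n + j)"
 shows "ins 0 n (%x. ba (ph x)) z : V (Suc q + j)"
proof -
 have "V (n + j) \<subseteq> {z. ins 0 n (%x. ba (ph x)) z : V (Suc q + j)}"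
  by (rule V_split_subI)
   (auto intro!: psub_vimage plin_ins0 V_V_mem[of _ "Suc q", simplified] ba_mem coch_mem[OF c] simp: gb_V[OF c])
 then show ?thesis using z by auto
qed

lemma Sg_head: "coch n q ph ==> x : Hh 1 ==> Sg n q ph (x * z)
  = x * ins 0 n (%x. ba (ph x)) z + eps (int n - int q - 1) (x * Sg n q ph z)"
 unfolding Sg_def by (rule hs_head[OF plin_ins0])

lemma v_H: "v a : Hh 1" using V_H[OF v_mem] .
lemma u_H: "u a : Hh 1" using W_H[OF u_mem] by simp

lemma Sg_V_mem:
 assumes c: "coch n q ph"
 shows "z : V (n + Suc j) ==> Sg n q ph z : V (q + 2 + j)"
proof (induct j arbitrary: z)
 case 0
 have "V (Suc n) \<subseteq> {z. Sg n q ph z : V (q + 2)}"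
 proof (rule V_Suc_subI')
  fix y a assume y: "y : V n"
  have "Sg n q ph y = 0" using hs_short[OF V_H[OF y]] by (simp add: Sg_def)
  then show "v a * y : {z. Sg n q ph z : V (q + 2)}"
   using v_V_mem[OF gb_mem[OF c, of y 0], of a] y by (simp add: Sg_head[OF c v_H])
 qed (auto intro!: psub_vimage plin_Sg0)
 then show ?case using 0 by auto
next
 case (Suc j)
 have "V (Suc (n + Suc j)) \<subseteq> {z. Sg n q ph z : V (q + 2 + Suc j)}"
 proof (rule V_Suc_subI')
  fix y a assume y: "y : V (n + Suc j)"
  show "v a * y : {z. Sg n q ph z : V (q + 2 + Suc j)}"
   using v_V_mem[OF gb_mem[OF c y], of a] v_V_mem[OF Suc(1)[OF y], of a]
   by (auto simp: Sg_head[OF c v_H] intro!: psub_add psub_eps)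
 qed (auto intro!: psub_vimage plin_Sg0)
 then show ?case using Suc(2) by auto
qed

lemma Sg_mem0:
 assumes c: "coch n q ph" and x: "x : W (n + j)"
 shows "Sg n q ph x : W (q + 1 + j)"
proof (rule W_memI[OF plin_Sg0 psub_W x])
 fix y a assume y: "y : V (n + j)"
 have "Sg n q ph y : V (q + 1 + j)"
 proof (cases j)
  case 0
  then have "Sg n q ph y = 0" using hs_short[OF V_H[OF y]] by (simp add: Sg_def)
  then show ?thesis by (simp add: psub_0)
 qed (use Sg_V_mem[OF c, of y "j - 1"] y in simp)
 then show "Sg n q ph (u a * y) : W (q + 1 + j)"
  using u_V_mem[OF gb_mem[OF c y], of a] u_V_mem[of "Sg n q ph y" "q + 1 + j" a]
  by (auto simp: Sg_head[OF c u_H] intro!: psub_add psub_eps)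
qed

lemma Sg_mem: "coch n q ph ==> x : W N ==> n <= N ==> Sg n q ph x : W (N - n + q + 1)"
 using Sg_mem0[of n q ph x "N - n"] by (simp add: algebra_simps)
lemma Op_mem': "coch n q ph ==> x : W N ==> n <= N ==> Op n ph x : W (N - n + q)"
 using Op_mem[of n q ph x "N - n"] by (simp add: algebra_simps)

lemma Sg_tail: "coch n q ph ==> x : W N ==>
 Sg n q ph (x * v a) = Sg n q ph x * v a + eps ((int n - int q - 1) * (int N + 1 - int n)) (ee n ph (x * v a))"
 unfolding Sg_def ee_def using hs_tail[OF plin_coch_ba W_H v_H, of n q ph x N "int n - int q - 1" n a]
 by (simp add: algebra_simps)

lemma ee_mult: "coch n q ph ==> y : W j ==> w : V n ==> ee n ph (y * w) = y * ba (ph w)"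
 unfolding ee_def
 by (rule tl2_mult[where j = "Suc j", OF plin_mult_left[OF plin_id] plin_mult_right[OF plin_coch_ba]])
  (auto dest: W_H V_H)
lemma rh_mult: "coch n q ph ==> y : W j ==> w : V n ==> rh n ph (y * w) = dot y (ph w)"
 unfolding rh_def
 by (rule tl2_mult[where j = "Suc j", OF plin_dot_left[OF plin_id] plin_dot[OF coch_plin]])
  (auto dest: W_H V_H)

lemma Sg_base: "coch n q ph ==> x : W n ==> Sg n q ph x = ee n ph x"
proof (rule W_eqI[OF plin_Sg0 plin_ee0])
 fix y a assume c: "coch n q ph" and y: "y : V n"
 have "Sg n q ph y = 0" using hs_short[OF V_H[OF y]] by (simp add: Sg_def)
 then show "Sg n q ph (u a * y) = ee n ph (u a * y)"
  using gb_V[OF c y, of 1] by (simp add: Sg_head[OF c u_H] ee_mult[OF c u_mem y])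
qed

lemma ee_mem: "coch n q ph ==> x : W (j + n) ==> ee n ph x : W (j + q + 1)"
proof -
 assume c: "coch n q ph" and x: "x : W (j + n)"
 have "W (j + n) \<subseteq> {x. ee n ph x : W (j + q + 1)}"
  by (rule W_split_subI) (use W_V_mem[OF _ ba_mem[OF coch_mem[OF c]], of _ j] in
   \<open>auto intro!: psub_vimage plin_ee0 simp: ee_mult[OF c]\<close>)
 then show ?thesis using x by auto
qed

lemma ee_dot:
 assumes c: "coch n q ph" and y: "y : W j" and z: "z : W n"
 shows "ee n ph (dot y z) = dot y (ee n ph z)"
 by (rule W_eqI[OF _ _ z, where f = "%z. ee n ph (dot y z)"])
  (auto intro!: plin_intros simp: dot_u ee_mult[OF c R_mem[OF y]] ee_mult[OF c u_mem])

text \<open>Leibniz rule: for z = a w the left side is a d(ph w), which is d(a ph(w)) minus da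
  ph(w). It expresses an insertion through operations whose behaviour under \<open>R\<close> is
  known.\<close>

lemma ee_D:
 assumes c: "coch n q ph" and z: "z : W n"
 shows "ee n ph z = D (Op n ph z) - rh n ph (D z)"
proof (rule W_eqI[OF _ _ z, where f = "%z. ee n ph z"])
 fix y a assume y: "y : V n"
 have "Lm a (D (ph y)) = u a * ba (ph y)"
  using Lm_u[of a 1 "ba (ph y)"] by (simp add: D_ba[OF coch_mem[OF c y]])
 then show "ee n ph (u a * y) = D (Op n ph (u a * y)) - rh n ph (D (u a * y))"
  by (simp add: ee_mult[OF c u_mem y] Op_u'[OF c y] D_Lm[OF coch_mem[OF c y]] D_u
   rh_mult[OF c W_v_mem[OF u_mem] y])
qed (auto intro!: plin_intros)

lemma dot_one: "y : W j ==> dot y (u 1 * w) = y * w"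
 by (simp add: dot_u R_one)

lemma dot_rh:
 assumes c: "coch n q ph" and y: "y : W j" and t: "t : V (Suc n)"
 shows "dot y (rh n ph (u 1 * t)) = rh n ph (y * t)"
proof -
 have "V (Suc n) \<subseteq> {t. dot y (rh n ph (u 1 * t)) = rh n ph (y * t)}"
 proof (rule V_Suc_subI')
  fix w a assume w: "w : V n"
  show "v a * w : {t. dot y (rh n ph (u 1 * t)) = rh n ph (y * t)}"
   using rh_mult[OF c W_v_mem[OF u_mem] w, of 1 a] rh_mult[OF c W_v_mem[OF y] w, of a]
    dot_assoc[OF y W_v_mem[OF u_mem] coch_mem[OF c w], of 1 a]
   by (simp add: mult.assoc dot_one[OF y])
 qed (intro psub_eq plin_intros)
 then show ?thesis using t by auto
qed

text \<open>Since y w is the product of the forms y and 1 w, and all operations involved are linear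
  over forms on the left, it is enough to treat z = 1 w. Both occurrences of the right action are
  then moved across \<open>D\<close> by \<open>D_R\<close>, and each move leaves one term with
  \<open>rh\<close> or its source.\<close>

lemma ee_R:
 assumes c: "coch n q ph" and x: "x : W (j + n)"
 shows "ee n ph (R a x) - R a (ee n ph x)
  = eps (int q + 1) (ee (Suc n) (dop n q ph) (x * v a)) - eps (int n) (rh n ph (x * v a))
   + eps (int q) (rh n ph x * v a)"
proof (rule W_split_eqI[OF _ _ x, where f = "%x. ee n ph (R a x) - R a (ee n ph x)"])
 fix y w assume y: "y : W j" and w: "w : V n"
 define z where "z = u 1 * w"
 have z: "z : W n" unfolding z_def by (rule u_V_mem[OF w])
 note cw = coch_mem[OF c w]
 have yw: "y * w = dot y z" by (simp add: z_def dot_one[OF y])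
 \<comment> \<open>The first letter of z is 1, and \<open>v 1 = 0\<close>.\<close>
 have "D z = 0" by (simp add: z_def D_u)
 then have DRz: "D (R a z) = eps (int n) (z * v a)" by (simp add: D_R[OF z] plin_0[OF plin_R0])
 have 1: "ee n ph (R a (y * w)) = dot y (D (Op n ph (R a z))) - eps (int n) (dot y (rh n ph (z * v a)))"
  by (simp add: yw R_dot[OF z y] ee_dot[OF c y R_mem[OF z]] ee_D[OF c R_mem[OF z]] DRz
   plin_diff[OF plin_dot0] plin_eps_out[OF plin_rh0] plin_eps_out[OF plin_dot0])
 have "ee n ph (y * w) = dot y (D (ph w))"
  by (simp add: ee_mult[OF c y w] D_ba[OF cw] dot_one[OF y])
 then have 2: "R a (ee n ph (y * w)) = dot y (D (R a (ph w))) - eps (int q) (dot y (ph w) * v a)"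
  by (simp add: R_dot[OF D_mem[OF cw] y] D_R[OF cw] plin_add[OF plin_dot0] plin_eps_out[OF plin_dot0] dot_mult[OF cw])
 have cd: "coch (Suc n) q (dop n q ph)" by (rule coch_dop[OF c])
 note wva = V_v_mem[OF w, of a]
 have 3: "ee (Suc n) (dop n q ph) (y * w * v a) = dot y (D (eps (int q + 1) (Op n ph (R a z) - R a (ph w))))"
  unfolding z_def dop_v[OF c w, symmetric] D_ba[OF coch_mem[OF cd wva]] dot_one[OF y]
  using ee_mult[OF cd y wva] by (simp add: mult.assoc)
 have 4: "rh n ph (y * w * v a) = dot y (rh n ph (z * v a))"
  using dot_rh[OF c y wva] by (simp add: z_def mult.assoc)
 show "ee n ph (R a (y * w)) - R a (ee n ph (y * w))
  = eps (int q + 1) (ee (Suc n) (dop n q ph) (y * w * v a)) - eps (int n) (rh n ph (y * w * v a))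
   + eps (int q) (rh n ph (y * w) * v a)"
  unfolding 1 2 3 4 rh_mult[OF c y w]
  by (simp add: plin_eps_out[OF plin_dot0] plin_eps_out[OF plin_D0] plin_diff[OF plin_dot0] plin_diff[OF plin_D0] eps_def)
qed (auto intro!: plin_intros)

lemma rh_base: "coch n q ph ==> x : W n ==> rh n ph x = Op n ph x"
 by (rule W_eqI[OF plin_rh0 plin_Op0])
  (auto simp: rh_mult[OF _ u_mem] Op_u' dot_u_left[OF coch_mem])

text \<open>Induction on the letters behind the arguments of \<open>ph\<close>. A new letter adds
  the insertion \<open>ee\<close>, whose commutator with \<open>R\<close> is \<open>ee_R\<close>;
  one of its two \<open>rh\<close> terms cancels the boundary term of the shorter word, the other is
  the boundary term of the longer word.\<close>

lemma Sg_R0: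
 assumes c: "coch n q ph"
 shows "x : W (n + j) ==> Sg n q ph (R a x) - R a (Sg n q ph x)
  = eps (int j + int q) (Op n ph (x * v a) - Sg (Suc n) q (dop n q ph) (x * v a))
   - eps (int j + int q + (int n - int q) * (int j + 1)) (rh n ph (x * v a))"
proof (induct j arbitrary: x a)
 case 0
 then have x: "x : W n" by simp
 have cd: "coch (Suc n) q (dop n q ph)" by (rule coch_dop[OF c])
 show ?case
  using ee_R[OF c, of x 0 a] x
  by (simp add: Sg_base[OF c] R_mem Sg_base[OF cd W_v_mem] rh_base[OF c x] Op_mult[OF c x order_refl])
   (simp add: eps_def)
next
 case (Suc j)
 show ?case
 proof (rule W_Suc_eqI[where x = x and n = "n + j" and f = "%x. Sg n q ph (R a x) - R a (Sg n q ph x)"])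
  fix y b assume y: "y : W (n + j)"
  let ?k = "int n - int q - 1"
  have cd: "coch (Suc n) q (dop n q ph)" by (rule coch_dop[OF c])
  note Ry = R_mem[OF y]
  define x where "x = y * v b"
  have x: "x : W (Suc j + n)" using W_v_mem[OF y, of b] by (simp add: x_def add.commute)
  have "Sg n q ph (R a x) = Sg n q ph (y * v (b * a)) - Sg n q ph (R b y * v a)"
   by (simp add: x_def R_v[OF y] plin_diff[OF plin_Sg0])
  also have "\<dots> = Sg n q ph y * v (b * a) - Sg n q ph (R b y) * v a
    + eps (?k * (int j + 1)) (ee n ph (R a x))"
   by (simp add: x_def R_v[OF y] plin_diff[OF plin_ee0] Sg_tail[OF c y] Sg_tail[OF c Ry] eps_diff)
  finally have 1: "Sg n q ph (R a x) = \<dots>" .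
  have 2: "R a (Sg n q ph x) = Sg n q ph y * v (b * a) - R b (Sg n q ph y) * v a + eps (?k * (int j + 1)) (R a (ee n ph x))"
   by (simp add: x_def Sg_tail[OF c y] plin_add[OF plin_R0] R_v[OF Sg_mem0[OF c y]] plin_eps_out[OF plin_R0])
  have "Sg n q ph (R a x) - R a (Sg n q ph x) = - (Sg n q ph (R b y) - R b (Sg n q ph y)) * v a
    + eps (?k * (int j + 1)) (ee n ph (R a x) - R a (ee n ph x))"
   unfolding 1 2 by (simp add: algebra_simps eps_diff)
  also have "\<dots> = - (eps (int j + int q) (Op n ph x - Sg (Suc n) q (dop n q ph) x)
   - eps (int j + int q + (int n - int q) * (int j + 1)) (rh n ph x)) * v a
   + eps (?k * (int j + 1)) (eps (int q + 1) (ee (Suc n) (dop n q ph) (x * v a)) - eps (int n) (rh n ph (x * v a))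
   + eps (int q) (rh n ph x * v a))"
   unfolding Suc(1)[OF y, of b] ee_R[OF c x] by (simp add: x_def)
  finally have 3: "Sg n q ph (R a x) - R a (Sg n q ph x) = \<dots>" .
  have x': "x : W (Suc (n + j))" using x by (simp add: add.commute)
  have 4: "Op n ph (x * v a) = Op n ph x * v a" by (rule Op_mult[OF c x']) simp
  have 5: "Sg (Suc n) q (dop n q ph) (x * v a) = Sg (Suc n) q (dop n q ph) x * v a
    + eps ((int n - int q) * (int j + 1)) (ee (Suc n) (dop n q ph) (x * v a))"
   using Sg_tail[OF cd x', of a] by (simp add: add.commute)
  show "Sg n q ph (R a (y * v b)) - R a (Sg n q ph (y * v b))
   = eps (int (Suc j) + int q) (Op n ph (y * v b * v a) - Sg (Suc n) q (dop n q ph) (y * v b * v a))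
   - eps (int (Suc j) + int q + (int n - int q) * (int (Suc j) + 1)) (rh n ph (y * v b * v a))"
   unfolding x_def[symmetric] 3 4 5
   by (cases "even j"; cases "even q"; cases "even n") (simp_all add: eps_def algebra_simps)
 qed (use Suc in \<open>auto intro!: plin_intros\<close>)
qed

lemma Sg_R:
 assumes c: "coch n q ph" and x: "x : W N" and N: "n <= N"
 shows "Sg n q ph (R a x) = R a (Sg n q ph x)
  + eps (int N - (int n - int q)) (Op n ph (x * v a) - Sg (Suc n) q (dop n q ph) (x * v a))
   - eps (int N - (int n - int q) + (int n - int q) * (int N + 1 - int n)) (rh n ph (x * v a))"
 using Sg_R0[OF c, of x "N - n" a] x N by (simp add: of_nat_diff algebra_simps)

lemma Op_R:
 assumes c: "coch m p ph" and x: "x : W N" and N: "m <= N"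
 shows "Op m ph (R a x) = R a (Op m ph x) + eps (int N - (int m - int p) + 1) (Op (Suc m) (dop m p ph) (x * v a))"
proof -
 have "Op (Suc m) (dop m p ph) (x * v a) = eps (int N - (int m - int p) + 1) (Op m ph (R a x) - R a (Op m ph x))"
  using Op_dop[OF c, of x "N - m" a] x N by (simp add: of_nat_diff algebra_simps)
 then show ?thesis by (cases "even (int N - (int m - int p) + 1)") (simp_all only: eps_def if_True if_False, simp_all)
qed

text \<open>In a product of forms the operator acts on the first factor, to which the first letter
  of the second factor has been applied on the right. Crossing this right action costs the operator
  of the differential, evaluated on the last insertion.\<close>

lemma Op_rh:
 assumes f: "coch m p ph" and g: "coch n q ga" and x: "x : W (j + n)" and j: "m <= j"
 shows "Op m ph (rh n ga x) = rh n ga (Op m ph x)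
  + eps (int j - (int m - int p) + 1) (Op (Suc m) (dop m p ph) (ee n ga x))"
proof (rule W_split_eqI[OF _ _ x, where f = "%x. Op m ph (rh n ga x)"])
 fix y w assume y: "y : W j" and w: "w : V n"
 have "Op m ph (dot y t) = dot (Op m ph y) t + eps (int j - (int m - int p) + 1) (Op (Suc m) (dop m p ph) (y * ba t))"
  if t: "t : W q" for t
 proof (rule W_eqI[OF _ _ t, where f = "%t. Op m ph (dot y t)"])
  fix s c assume s: "s : V q"
  show "Op m ph (dot y (u c * s)) = dot (Op m ph y) (u c * s)
    + eps (int j - (int m - int p) + 1) (Op (Suc m) (dop m p ph) (y * ba (u c * s)))"
   using Op_mult[OF coch_dop[OF f] W_v_mem[OF y, of c], of s] j
   by (simp add: dot_u Op_mult[OF f R_mem[OF y] j] Op_R[OF f y j] distrib_right ba_u eps_mult_left mult.assoc)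
 qed (auto intro!: plin_intros)
 from this[OF coch_mem[OF g w]]
 show "Op m ph (rh n ga (y * w)) = rh n ga (Op m ph (y * w))
   + eps (int j - (int m - int p) + 1) (Op (Suc m) (dop m p ph) (ee n ga (y * w)))"
  by (simp add: rh_mult[OF g y w] ee_mult[OF g y w] Op_mult[OF f y j] rh_mult[OF g Op_mem'[OF f y j] w])
qed (auto intro!: plin_intros)

section \<open>The circle product as a graded commutator\<close>

definition circ0 :: "nat => nat => (('a list \<Rightarrow>\<^sub>0 'k) => 'a list \<Rightarrow>\<^sub>0 'k) => nat => nat => (('a list \<Rightarrow>\<^sub>0 'k) => 'a list \<Rightarrow>\<^sub>0 'k)
 => ('a list \<Rightarrow>\<^sub>0 'k) => 'a list \<Rightarrow>\<^sub>0 'k" where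
 "circ0 m p ph n q ga x = Op m ph (Sg n q ga x)
  - eps ((int m - int p) * (int n - int q - 1)) (Sg n q ga (Op m ph x))"

lemma plin_circ0 [plin_intros]: "plin f ==> plin (%x. circ0 m p ph n q ga (f x))"
 unfolding circ0_def by (intro plin_intros)

text \<open>Moving \<open>R\<close> through both halves of the commutator gives two terms with
  \<open>rh\<close>. By \<open>Op_rh\<close> they differ by one insertion at the end of the word,
  evaluated by the differential of \<open>ph\<close>; this is exactly what completes
  \<open>?S x * v a\<close> to \<open>?S z\<close>. The result is the differential of a circle
  product, whose defect is the graded commutator of the two operators.\<close>

lemma circ0_R:
 assumes f: "coch m p ph" and g: "coch n q ga" and x: "x : W N" and N: "m + n <= N"
 shows "circ0 m p ph n q ga (R a x) = R a (circ0 m p ph n q ga x)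
  + eps (int N - (int m - int p) - (int n - int q))
   (circ0 (Suc m) p (dop m p ph) n q ga (x * v a)
   - eps (int m - int p) (circ0 m p ph (Suc n) q (dop n q ga) (x * v a))
   + eps (int m - int p) (Op m ph (Op n ga (x * v a))
     - eps ((int m - int p) * (int n - int q)) (Op n ga (Op m ph (x * v a)))))"
proof -
 define df dg where "df = int m - int p" and "dg = int n - int q"
 define z where "z = x * v a"
 define j where "j = int N + 1 - int n"
 let ?F = "Op m ph" and ?G = "Op n ga" and ?S = "Sg n q ga" and ?Fd = "Op (Suc m) (dop m p ph)" and ?Sd = "Sg (Suc n) q (dop n q ga)"
 have mN: "m <= N" "n <= N" using N by auto
 note Sx = Sg_mem[OF g x mN(2)] and Fx = Op_mem'[OF f x mN(1)]
 have SR: "?S (R a x) = R a (?S x) + eps (int N - dg) (?G z - ?Sd z) - eps (int N - dg + dg * j) (rh n ga z)"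
  unfolding dg_def z_def j_def using Sg_R[OF g x mN(2), of a] by (simp add: algebra_simps)
 have FR: "?F (R a x) = R a (?F x) + eps (int N - df + 1) (?Fd z)"
  unfolding df_def z_def by (rule Op_R[OF f x mN(1)])
 have Fz: "?F z = ?F x * v a" unfolding z_def by (rule Op_mult[OF f x mN(1)])
 have SRF: "?S (R a (?F x)) = R a (?S (?F x)) + eps (int N - df - dg) (?G (?F z) - ?Sd (?F z))
   - eps (int N - df - dg + dg * (j - df)) (rh n ga (?F z))"
  using Sg_R[OF g Fx, of a] N unfolding df_def dg_def Fz j_def by (simp add: of_nat_diff algebra_simps)
 have FRS: "?F (R a (?S x)) = R a (?F (?S x)) + eps (int N - df - dg) (?Fd (?S x * v a))"
 proof -
  have e: "eps (int (N - n + q + 1) - df + 1) y = eps (int N - df - dg) y" for y :: "'a list \<Rightarrow>\<^sub>0 'k"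
   using mN by (intro eps_cong) (simp add: dg_def of_nat_diff)
  show ?thesis
   using Op_R[OF f Sx, of a] N unfolding df_def[symmetric] e by simp
 qed
 have Sz: "?S x * v a = ?S z - eps ((dg - 1) * j) (ee n ga z)"
  unfolding z_def dg_def j_def using Sg_tail[OF g x, of a] by simp
 have "z : W ((N + 1 - n) + n)" using W_v_mem[OF x, of a] mN by (simp add: z_def)
 from Op_rh[OF f g this] N mN have Frh: "?F (rh n ga z) = rh n ga (?F z) + eps (j - df + 1) (?Fd (ee n ga z))"
  by (simp add: df_def j_def of_nat_diff)
 have deg: "int (Suc m) - int p = df + 1" "int m - int p = df" "int (Suc n) - int q - 1 = dg" "int n - int q = dg"
  by (simp_all add: df_def dg_def)
 show ?thesis
  \<comment> \<open>Exponents matter only through their parities, so what is left is a finite check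
    of signs.\<close>
  unfolding circ0_def SR FR plin_add[OF plin_Op0] plin_diff[OF plin_Op0] plin_add[OF plin_Sg0] plin_eps_out[OF plin_Op0] plin_eps_out[OF plin_Sg0]
   FRS SRF Sz Frh plin_diff[OF plin_R0] plin_eps_out[OF plin_R0] z_def[symmetric] deg
  by (cases "even df"; cases "even dg"; cases "even N"; cases "even j") (simp_all add: eps_def algebra_simps)
qed

end

section \<open>The circle product as a finite sum of insertions\<close>

lemma Hh_Suc_eqI:
 assumes "plin f" "plin g" "x : Hh (Suc j)" "!!y c. y : Hh j ==> c : Hh 1 ==> f (y * c) = g (y * c)"
 shows "f x = g x"
 using assms(3) unfolding Hh_def
proof (rule plin_eqI[OF assms(1,2)])
 fix l :: "'a list" assume "l : {l. length l = Suc j}"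
 then have l: "l ~= []" "length (butlast l) = j" by auto
 have "f (mon (butlast l) * mon [last l]) = g (mon (butlast l) * mon [last l])"
  by (rule assms(4)) (use l in \<open>auto simp: Hh_def\<close>)
 then show "f (mon l) = g (mon l)" using l by (simp add: mon_mult)
qed

text \<open>Separates the segments ending within the first j letters from the others. The family
  \<open>\<tau>\<close> writes the insertion behind the i-th letter as an operator on whole words,
  so that the finite part does not depend on where the word is cut.\<close>

lemma hs_split:
 fixes \<psi> :: "('a list \<Rightarrow>\<^sub>0 'k::field) => 'a list \<Rightarrow>\<^sub>0 'k"
 assumes psi: "plin \<psi>" and t: "!!i x z. 0 < i ==> x : Hh i ==> \<tau> i (x * z) = x * \<psi> z" and pt: "!!i. plin (\<tau> i)"
 shows "y : Hh j ==> hs k \<psi> (y * z) = (\<Sum>i = 1..j. eps (k * (int i - 1)) (\<tau> i (y * z))) + eps (k * int j) (y * hs k \<psi> z)"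
proof (induct j arbitrary: y z)
 case 0
 show ?case
  using 0 unfolding Hh_def
  by (rule plin_eqI[where f = "%y. hs k \<psi> (y * z)", rotated 2])
   (auto intro!: plin_intros plin_comp[OF pt] simp: mon_Nil)
next
 case (Suc j)
 show ?case
 proof (rule Hh_Suc_eqI[OF _ _ Suc(2), where f = "%y. hs k \<psi> (y * z)"])
  fix y c :: "'a list \<Rightarrow>\<^sub>0 'k" assume y: "y : Hh j" and c: "c : Hh 1"
  have "hs k \<psi> (y * c * z) = (\<Sum>i = 1..j. eps (k * (int i - 1)) (\<tau> i (y * c * z)))
    + eps (k * int j) (y * (c * \<psi> z + eps k (c * hs k \<psi> z)))"
   using Suc(1)[OF y, of "c * z"] hs_head[OF psi c, of k z] by (simp add: mult.assoc)
  also have "\<dots> = (\<Sum>i = 1..Suc j. eps (k * (int i - 1)) (\<tau> i (y * c * z))) + eps (k * int (Suc j)) (y * c * hs k \<psi> z)"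
   using t[OF _ Hh_mult[OF y c], of z]
   by (simp add: distrib_left eps_add eps_mult_right mult.assoc algebra_simps)
  finally show "hs k \<psi> (y * c * z) = \<dots>" .
 qed (auto intro!: plin_intros plin_comp[OF pt])
qed

context algebra_over_field
begin

abbreviation gb :: "nat => (('a list \<Rightarrow>\<^sub>0 'k) => 'a list \<Rightarrow>\<^sub>0 'k) => ('a list \<Rightarrow>\<^sub>0 'k) => 'a list \<Rightarrow>\<^sub>0 'k" where
 "gb n ph \<equiv> ins 0 n (%x. ba (ph x))"
abbreviation gi :: "nat => nat => (('a list \<Rightarrow>\<^sub>0 'k) => 'a list \<Rightarrow>\<^sub>0 'k) => ('a list \<Rightarrow>\<^sub>0 'k) => 'a list \<Rightarrow>\<^sub>0 'k" where
 "gi i n ph \<equiv> ins i n (%x. ba (ph x))"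

lemma Sg_split: "coch n q ph ==> y : Hh j ==> Sg n q ph (y * z)
 = (\<Sum>i = 1..j. eps ((int n - int q - 1) * (int i - 1)) (gi i n ph (y * z)))
  + eps ((int n - int q - 1) * int j) (y * Sg n q ph z)"
 unfolding Sg_def using ins_shift[of _ _ 0]
 by (intro hs_split[OF plin_ins0]) (auto intro!: plin_ins0)

text \<open>Cut the word behind the arguments of \<open>ph\<close>. Insertions behind the cut occur
  in both halves of the commutator and cancel. What is left are insertions into the arguments and
  insertions into the output, the two sums in the definition of the circle product.\<close>

lemma circ0_fin:
 assumes f: "coch m p ph" and g: "coch n q ga" and x: "x : W N" and N: "m <= N"
 shows "circ0 m p ph n q ga x
  = (\<Sum>i = 1..m. eps ((int n - int q - 1) * (int i - 1)) (Op m ph (gi i n ga x)))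
   - eps ((int m - int p) * (int n - int q - 1))
     (\<Sum>i = 1..p. eps ((int n - int q - 1) * (int i - 1)) (gi i n ga (Op m ph x)))"
proof -
 obtain j where j: "N = m + j" using N le_Suc_ex by blast
 let ?F = "Op m ph"
 define k where "k = int n - int q - 1"
 define d where "d = int m - int p"
 show ?thesis
 proof (rule W_split_eqI[OF _ _ x[unfolded j], where f = "%x. circ0 m p ph n q ga x"])
  fix y z assume y: "y : W m" and z: "z : V j"
  have Fy: "?F y : W p" using Op_mem'[OF f y] by simp
  have F: "?F (y * t) = ?F y * t" for t by (rule Op_mult[OF f y order_refl])
  have 1: "?F (Sg n q ga (y * z)) = (\<Sum>i = 1..m. eps (k * (int i - 1)) (?F (gi i n ga (y * z))))
   + eps (k * int m) (?F y * gb n ga z) + eps (k * int (Suc m)) (?F y * Sg n q ga z)"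
   using ins_shift[OF W_H[OF y], of 0 n "%x. ba (ga x)" z]
   by (simp add: Sg_split[OF g W_H[OF y], folded k_def] plin_add[OF plin_Op0] plin_sum[OF plin_Op0] plin_eps_out[OF plin_Op0] F)
  have 2: "Sg n q ga (?F y * z) = (\<Sum>i = 1..p. eps (k * (int i - 1)) (gi i n ga (?F y * z)))
   + eps (k * int p) (?F y * gb n ga z) + eps (k * int (Suc p)) (?F y * Sg n q ga z)"
   using ins_shift[OF W_H[OF Fy], of 0 n "%x. ba (ga x)" z]
   by (simp add: Sg_split[OF g W_H[OF Fy], folded k_def])
  \<comment> \<open>The operator changes the number of letters in front of the cut from m + 1 to p +
    1; the resulting change of sign is the sign of the graded commutator.\<close>
  have e: "eps (d * k) (eps (k * int p) t) = eps (k * int m) t" "eps (d * k) (eps (k * int (Suc p)) t) = eps (k * int (Suc m)) t"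
   for t :: "'a list \<Rightarrow>\<^sub>0 'k"
   unfolding eps_eps by (rule eps_cong, simp add: d_def algebra_simps)+
  show "circ0 m p ph n q ga (y * z)
  = (\<Sum>i = 1..m. eps ((int n - int q - 1) * (int i - 1)) (Op m ph (gi i n ga (y * z))))
   - eps ((int m - int p) * (int n - int q - 1))
     (\<Sum>i = 1..p. eps ((int n - int q - 1) * (int i - 1)) (gi i n ga (Op m ph (y * z))))"
   unfolding circ0_def k_def[symmetric] d_def[symmetric] F 1 2 eps_add e by simp
 qed (intro plin_intros)+
qed

text \<open>Reads the inserted map off the operator of the cochain, so that insertions in front of
  many letters are determined by the germ.\<close>

lemma gb_Op: "coch n q ga ==> z : V N ==> n <= N ==> ba (Op n ga (u 1 * z)) = gb n ga z"
proof -
 assume c: "coch n q ga" and z: "z : V N" and N: "n <= N"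
 obtain j where j: "N = n + j" using N le_Suc_ex by blast
 show ?thesis
 proof (rule V_split_eqI[OF _ _ z[unfolded j], where f = "%z. ba (Op n ga (u 1 * z))"])
  fix y w assume y: "y : V n"
  show "ba (Op n ga (u 1 * (y * w))) = gb n ga (y * w)"
   using Op_u[OF c y, of 1 w] by (simp add: mult.assoc gb_V[OF c y] Lm_one[OF coch_mem[OF c y]] ba_mult[OF coch_mem[OF c y]])
 qed (intro plin_intros)+
qed

lemma gi_cong:
 assumes g: "coch n q ga" and g': "coch n' q' ga'"
  and eq: "!!N x. N0 <= N ==> x : W N ==> Op n ga x = Op n' ga' x"
  and x: "x : W N" and N: "N0 + n + n' + i <= N"
 shows "gi (Suc i) n ga x = gi (Suc i) n' ga' x"
proof -
 obtain j where j: "N = i + j" using N le_Suc_ex[of i N] by auto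
 show ?thesis
 proof (rule W_split_eqI[OF plin_ins0 plin_ins0 x[unfolded j]])
  fix y z assume y: "y : W i" and z: "z : V j"
  have "gb n ga z = gb n' ga' z"
   using N j gb_Op[OF g z] gb_Op[OF g' z] eq[of j "u 1 * z"] u_V_mem[OF z] by simp
  then show "gi (Suc i) n ga (y * z) = gi (Suc i) n' ga' (y * z)"
   using ins_shift[OF W_H[OF y], of 0] by simp
 qed
qed

text \<open>\<open>Sg\<close> also inserts near the end of a word, where a germ says nothing. In the
  finite form all places are bounded, and enough letters remain behind them once N exceeds the
  stated bound.\<close>

lemma circ0_cong:
 assumes f: "coch m p ph" and f': "coch m' p' ph'" and g: "coch n q ga" and g': "coch n' q' ga'"
  and eqf: "!!N x. N0 <= N ==> x : W N ==> Op m ph x = Op m' ph' x"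
  and eqg: "!!N x. N0 <= N ==> x : W N ==> Op n ga x = Op n' ga' x"
  and deg: "int m - int p = int m' - int p'" "int n - int q = int n' - int q'"
  and x: "x : W N" and N: "N0 + m + m' + p + p' + n + n' + q + q' <= N"
 shows "circ0 m p ph n q ga x = circ0 m' p' ph' n' q' ga' x"
proof -
 have "circ0 m p ph n q ga x = circ0 m p ph n' q' ga' x"
 proof -
  have "gi (Suc (i - 1)) n ga x = gi (Suc (i - 1)) n' ga' x" if "i : {1..m}" for i
   by (rule gi_cong[OF g g' eqg x]) (use N that in auto)
  then have 1: "gi i n ga x = gi i n' ga' x" if "i : {1..m}" for i using that by force
  have Fx: "Op m ph x : W (N - m + p)" using Op_mem'[OF f x] N by simp
  have "gi (Suc (i - 1)) n ga (Op m ph x) = gi (Suc (i - 1)) n' ga' (Op m ph x)" if "i : {1..p}" for i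
   by (rule gi_cong[OF g g' eqg Fx]) (use N that in auto)
  then have 2: "gi i n ga (Op m ph x) = gi i n' ga' (Op m ph x)" if "i : {1..p}" for i using that by force
  have mN: "m <= N" using N by simp
  show ?thesis
   unfolding circ0_fin[OF f g x mN] circ0_fin[OF f g' x mN] deg using 1 2 by simp
 qed
 also have "\<dots> = circ0 m' p' ph' n' q' ga' x"
  using eqf[of "N - n' + q' + 1" "Sg n' q' ga' x"] eqf[of N x] Sg_mem[OF g' x] N x
  unfolding circ0_def deg by simp
 finally show ?thesis .
qed

section \<open>The pre-Lie identity\<close>

lemma ba_Sg: "coch n q ga ==> y : W N ==> ba (Sg n q ga y) = Sg n q ga (ba y)"
 by (rule W_eqI[where f = "%y. ba (Sg n q ga y)"])
  (auto intro!: plin_intros simp: Sg_head[OF _ u_H] Sg_head[OF _ v_H] ba_u plin_add[OF plin_ba0] plin_eps_out[OF plin_ba0])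

text \<open>The sum \<open>x D z\<close> below is \<open>Sg (x z)\<close> for a single letter \<open>x\<close>.\<close>

definition Dg :: "nat => nat => (('a list \<Rightarrow>\<^sub>0 'k) => 'a list \<Rightarrow>\<^sub>0 'k) => ('a list \<Rightarrow>\<^sub>0 'k) => 'a list \<Rightarrow>\<^sub>0 'k" where
 "Dg n q ph z = gb n ph z + eps (int n - int q - 1) (Sg n q ph z)"

lemma plin_Dg [plin_intros]: "plin f ==> plin (%x. Dg n q ph (f x))"
 unfolding Dg_def by (intro plin_intros)

lemma Sg_Dg: "coch n q ph ==> x : Hh 1 ==> Sg n q ph (x * z) = x * Dg n q ph z"
 by (simp add: Sg_head Dg_def distrib_left eps_mult_right)

lemma Dg_mem: "coch n q ph ==> z : V (n + j) ==> Dg n q ph z : V (Suc q + j)"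
proof -
 assume c: "coch n q ph" and z: "z : V (n + j)"
 have "Sg n q ph z : V (Suc q + j)"
 proof (cases j)
  case 0
  then have "Sg n q ph z = 0" using hs_short[OF V_H[OF z]] by (simp add: Sg_def)
  then show ?thesis by (simp add: psub_0)
 qed (use Sg_V_mem[OF c, of z "j - 1"] z in simp)
 then show ?thesis unfolding Dg_def using gb_mem[OF c z] by (auto intro!: psub_add psub_eps)
qed

text \<open>Passing each letter with a fixed sign while K letters remain behind it means that Z acts
  only on the last K letters. The operator of a cochain acts in front of them, so the two commute up
  to the sign of their degrees.\<close>

lemma commute_tail:
 assumes f: "coch m p ph" and Z: "plin Z"
  and T: "!!x z N. x : Hh 1 ==> z : V N ==> K <= N ==> Z (x * z) = eps d (x * Z z)"
  and x: "x : W N" and N: "m + K <= N"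
 shows "Op m ph (Z x) = eps ((int m - int p) * d) (Z (Op m ph x))"
proof -
 have V: "V j \<subseteq> {y. \<forall>z\<in>V K. Z (y * z) = eps (d * int j) (y * Z z)}" for j
 proof (induct j)
  case 0
  have "psub {y. \<forall>z\<in>V K. Z (y * z) = y * Z z}"
   unfolding psub_def by (auto simp: plin_0[OF Z] distrib_right plin_add[OF Z] psc_mult_left[symmetric] plin_psc[OF Z])
  then show ?case using V_0_subI[of "{y. \<forall>z\<in>V K. Z (y * z) = y * Z z}"] by simp
 next
  case (Suc j)
  show ?case
  proof (rule V_Suc_subI')
   show "psub {y. \<forall>z\<in>V K. Z (y * z) = eps (d * int (Suc j)) (y * Z z)}"
    unfolding psub_def by (auto simp: plin_0[OF Z] distrib_right plin_add[OF Z] psc_mult_left[symmetric] plin_psc[OF Z] eps_add eps_psc)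
   fix y a assume y: "y : V j"
   have "Z (v a * y * z) = eps (d * int (Suc j)) (v a * y * Z z)" if z: "z : V K" for z
    using T[OF v_H V_V_mem[OF y z], of a] Suc y z by (auto simp: mult.assoc eps_mult_right algebra_simps)
   then show "v a * y : {y. \<forall>z\<in>V K. Z (y * z) = eps (d * int (Suc j)) (y * Z z)}" by simp
  qed
 qed
 have W: "Z (y * z) = eps (d * int (Suc j)) (y * Z z)" if y: "y : W j" and z: "z : V K" for y z j
 proof (rule W_eqI[OF _ _ y, where f = "%y. Z (y * z)"])
  fix y a assume y: "y : V j"
  have "Z (y * z) = eps (d * int j) (y * Z z)" using V[of j] y z by blast
  then show "Z (u a * y * z) = eps (d * int (Suc j)) (u a * y * Z z)"
   using T[OF u_H V_V_mem[OF y z], of a] by (simp add: mult.assoc eps_mult_right algebra_simps)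
 qed (auto intro!: plin_intros plin_comp[OF Z])
 obtain j where j: "N = j + K" "m <= j" using N by (metis add_le_imp_le_diff le_add_diff_inverse2 add_leD2)
 show ?thesis
 proof (rule W_split_eqI[OF _ _ x[unfolded j], where f = "%x. Op m ph (Z x)"])
  fix y z assume y: "y : W j" and z: "z : V K"
  have e: "eps ((int m - int p) * d) (eps (d * int (Suc (j - m + p))) t) = eps (d * int (Suc j)) t" for t :: "'a list \<Rightarrow>\<^sub>0 'k"
   unfolding eps_eps by (rule eps_cong) (use j(2) in \<open>simp add: of_nat_diff algebra_simps\<close>)
  show "Op m ph (Z (y * z)) = eps ((int m - int p) * d) (Z (Op m ph (y * z)))"
   unfolding W[OF y z] Op_mult[OF f y j(2)] W[OF Op_mem'[OF f y j(2)] z] e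
   by (simp add: plin_eps_out[OF plin_Op0] Op_mult[OF f y j(2)])
 qed (auto intro!: plin_intros plin_comp[OF Z])
qed

text \<open>The graded commutator of \<open>?S\<close> and \<open>?T\<close> agrees with
  \<open>?C\<close>, the insertion of the bracket, except near the end of the word. Their difference
  Z passes letters with a sign, because the terms arising at a letter are precisely the insertion of
  the bracket. By \<open>commute_tail\<close> it disappears from the commutator with
  \<open>?F\<close>, and what remains is the Jacobi identity for commutators of operators.\<close>

lemma circ0_jacobi:
 assumes f: "coch m p ph" and g: "coch n q ga" and h: "coch l r cx" and c: "coch K L \<kappa>"
  and deg: "int K - int L = (int n - int q) + (int l - int r) - 1"
  and op: "!!N x. K <= N ==> x : W N ==> Op K \<kappa> x = circ0 n q ga l r cx x
   - eps ((int n - int q - 1) * (int l - int r - 1)) (circ0 l r cx n q ga x)"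
  and K: "n + l <= K"
  and x: "x : W N" and N: "m + K <= N"
 shows "circ0 m p ph K L \<kappa> x
  = circ0 m p ph n q ga (Sg l r cx x)
    - eps ((int m - int p + int n - int q - 1) * (int l - int r - 1)) (Sg l r cx (circ0 m p ph n q ga x))
   - eps ((int n - int q - 1) * (int l - int r - 1)) (circ0 m p ph l r cx (Sg n q ga x)
    - eps ((int m - int p + int l - int r - 1) * (int n - int q - 1)) (Sg n q ga (circ0 m p ph l r cx x)))"
proof -
 define df kg kh where "df = int m - int p" and "kg = int n - int q - 1" and "kh = int l - int r - 1"
 let ?S = "Sg n q ga" and ?T = "Sg l r cx" and ?C = "Sg K L \<kappa>" and ?F = "Op m ph"
 have kc: "int K - int L - 1 = kg + kh" using deg by (simp add: kg_def kh_def)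
 define Z where "Z x = ?S (?T x) - eps (kg * kh) (?T (?S x)) - ?C x" for x
 have Z: "plin Z" unfolding Z_def by (intro plin_intros)
 have "?F (Z x) = eps (df * (kg + kh)) (Z (?F x))"
  unfolding df_def
 proof (rule commute_tail[OF f Z _ x N])
  fix x z :: "'a list \<Rightarrow>\<^sub>0 'k" and N assume x: "x : Hh 1" and z: "z : V N" and N: "K <= N"
  let ?g = "gb n ga" and ?h = "gb l cx" and ?c = "gb K \<kappa>"
  have nN: "n <= N" "l <= N" using K N by auto
  have uz: "u 1 * z : W N" by (rule u_V_mem[OF z])
  have A: "ba (Op n ga (Sg l r cx (u 1 * z))) = ?g (?h z) + eps kh (?g (?T z))"
  proof -
   have "Dg l r cx z : V (Suc r + (N - l))" using Dg_mem[OF h, of z "N - l"] z nN by simp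
   moreover have "n <= Suc r + (N - l)" using N K by linarith
   ultimately show ?thesis
    using gb_Op[OF g, of "Dg l r cx z"] by (simp add: Sg_Dg[OF h u_H] Dg_def plin_add[OF plin_ins0] plin_eps_out[OF plin_ins0] kh_def)
  qed
  have B: "ba (Op l cx (Sg n q ga (u 1 * z))) = ?h (?g z) + eps kg (?h (?S z))"
  proof -
   have "Dg n q ga z : V (Suc q + (N - n))" using Dg_mem[OF g, of z "N - n"] z nN by simp
   moreover have "l <= Suc q + (N - n)" using N K by linarith
   ultimately show ?thesis
    using gb_Op[OF h, of "Dg n q ga z"] by (simp add: Sg_Dg[OF g u_H] Dg_def plin_add[OF plin_ins0] plin_eps_out[OF plin_ins0] kg_def)
  qed
  have C: "ba (?T (Op n ga (u 1 * z))) = ?T (?g z)"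
   using ba_Sg[OF h Op_mem'[OF g uz nN(1)]] gb_Op[OF g z nN(1)] by simp
  have E: "ba (?S (Op l cx (u 1 * z))) = ?S (?h z)"
   using ba_Sg[OF g Op_mem'[OF h uz nN(2)]] gb_Op[OF h z nN(2)] by simp
  have dg: "int n - int q = kg + 1" "int l - int r = kh + 1" by (simp_all add: kg_def kh_def)
  \<comment> \<open>The inserted bracket is obtained by \<open>gb_Op\<close> from its operator on
    the word 1 z, where the two circle products have just been evaluated.\<close>
  have cz: "?c z = ?g (?h z) + eps kh (?g (?T z)) - eps ((kg + 1) * kh) (?T (?g z))
   - eps (kg * kh) (?h (?g z) + eps kg (?h (?S z)) - eps ((kh + 1) * kg) (?S (?h z)))"
   using gb_Op[OF c z N] op[OF N uz] A B C E
   by (simp add: circ0_def dg plin_diff[OF plin_ba0] plin_eps_out[OF plin_ba0])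
  have hd: "?S (x * t) = x * ?g t + eps kg (x * ?S t)" "?T (x * t) = x * ?h t + eps kh (x * ?T t)"
   "?C (x * t) = x * ?c t + eps (kg + kh) (x * ?C t)" for t
   using Sg_head[OF g x, of t] Sg_head[OF h x, of t] Sg_head[OF c x, of t] unfolding kg_def[symmetric] kh_def[symmetric] kc by simp_all
  show "Z (x * z) = eps (kg + kh) (x * Z z)"
   unfolding Z_def hd cz plin_add[OF plin_Sg0] plin_eps_out[OF plin_Sg0]
   by (cases "even kg"; cases "even kh") (simp_all add: eps_def algebra_simps)
 qed
 then have FZ: "?F (?S (?T x)) - eps (kg * kh) (?F (?T (?S x))) - ?F (?C x)
  = eps (df * (kg + kh)) (?S (?T (?F x)) - eps (kg * kh) (?T (?S (?F x))) - ?C (?F x))"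
  by (simp add: Z_def plin_diff[OF plin_Op0] plin_eps_out[OF plin_Op0])
 have *: "df + int n - int q - 1 = df + kg" "df + int l - int r - 1 = df + kh"
  by (simp_all add: kg_def kh_def)
 show ?thesis
  unfolding circ0_def kg_def[symmetric] kh_def[symmetric] kc df_def[symmetric] *
   plin_diff[OF plin_Sg0] plin_eps_out[OF plin_Sg0]
  using FZ by (cases "even df"; cases "even kg"; cases "even kh") (simp_all add: eps_def algebra_simps)
qed


section \<open>Cocycles and composites of operators\<close>

lemma Op_zero:
 assumes c: "coch m p ph" and z: "!!w. w : V m ==> ph w = 0" and x: "x : W N"
 shows "Op m ph x = 0"
proof (cases "N < m")
 case True then show ?thesis by (rule Op_short[OF x])
next
 case False
 then obtain j where j: "N = m + j" using le_Suc_ex not_less by blast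
 show ?thesis
 proof (rule W_split_eqI[OF plin_Op0 plin_const_0 x[unfolded j]])
  fix y w assume y: "y : W m"
  show "Op m ph (y * w) = 0"
   by (rule W_eqI[OF _ plin_const_0 y, where f = "%y. Op m ph (y * w)"])
    (auto intro!: plin_intros simp: Op_u[OF c] z plin_0[OF plin_Lm0])
 qed
qed

lemma gb_zero:
 assumes c: "coch m p ph" and z: "!!w. w : V m ==> ph w = 0" and x: "x : V N"
 shows "gb m ph x = 0"
proof (cases "N < m")
 case True then show ?thesis using ins_short[OF V_H[OF x]] by simp
next
 case False
 then obtain j where j: "N = m + j" using le_Suc_ex not_less by blast
 show ?thesis
  by (rule V_split_eqI[OF plin_ins0 plin_const_0 x[unfolded j]])
   (auto simp: gb_V[OF c] z plin_0[OF plin_ba0])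
qed

lemma Sg_zero:
 assumes c: "coch m p ph" and z: "!!w. w : V m ==> ph w = 0" and x: "x : W N"
 shows "Sg m p ph x = 0"
proof -
 have V: "V j \<subseteq> {y. Sg m p ph y = 0}" for j
 proof (induct j)
  case 0 then show ?case using hs_short[OF V_H] by (auto simp: Sg_def)
 next
  case (Suc j)
  show ?case
   by (rule V_Suc_subI')
    (use Suc in \<open>auto intro!: psub_eq plin_intros simp: Sg_head[OF c v_H] gb_zero[OF c z]\<close>)
 qed
 show ?thesis
  by (rule W_eqI[OF plin_Sg0 plin_const_0 x])
   (use V[of N] in \<open>auto simp: Sg_head[OF c u_H] gb_zero[OF c z] subset_iff\<close>)
qed

text \<open>The differential has to vanish on all arguments and not only as a germ: the sums in
  \<open>Sg\<close> reach the end of the word, where few letters remain.\<close>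

definition cocy :: "nat => nat => (('a list \<Rightarrow>\<^sub>0 'k) => 'a list \<Rightarrow>\<^sub>0 'k) => bool" where
 "cocy m p ph \<longleftrightarrow> coch m p ph & (\<forall>w\<in>V (Suc m). dop m p ph w = 0)"

lemma cocyD: "cocy m p ph ==> coch m p ph" by (simp add: cocy_def)

lemma cocy_zero:
 assumes c: "cocy m p ph" and x: "x : W N"
 shows "Op (Suc m) (dop m p ph) x = 0" "Sg (Suc m) p (dop m p ph) x = 0"
 using c x by (auto simp: cocy_def intro!: Op_zero[OF coch_dop] Sg_zero[OF coch_dop])

lemma ee_zero:
 assumes c: "coch m p ph" and z: "!!w. w : V m ==> ph w = 0" and x: "x : W (j + m)"
 shows "ee m ph x = 0"
 by (rule W_split_eqI[OF plin_ee0 plin_const_0 x]) (auto simp: ee_mult[OF c] z plin_0[OF plin_ba0])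

lemma Op_R_c: "cocy m p ph ==> x : W N ==> m <= N ==> Op m ph (R a x) = R a (Op m ph x)"
 by (simp add: Op_R[OF cocyD] cocy_zero[OF _ W_v_mem])

lemma Sg_R_c: "cocy n q ph ==> x : W N ==> n <= N ==> Sg n q ph (R a x) = R a (Sg n q ph x)
  + eps (int N - (int n - int q)) (Op n ph (x * v a))
  - eps (int N - (int n - int q) + (int n - int q) * (int N + 1 - int n)) (rh n ph (x * v a))"
 by (simp add: Sg_R[OF cocyD] cocy_zero[OF _ W_v_mem])

lemma ee_R_c: "cocy n q ph ==> x : W (j + n) ==> ee n ph (R a x) = R a (ee n ph x)
  - eps (int n) (rh n ph (x * v a)) + eps (int q) (rh n ph x * v a)"
 using ee_R[OF cocyD, of n q ph x j a] ee_zero[OF coch_dop, of n q ph "x * v a" j] W_v_mem[of x "j + n" a]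
 by (auto simp: cocy_def algebra_simps)

lemma Op_rh_c: "cocy m p ph ==> coch n q ga ==> x : W (j + n) ==> m <= j ==>
  Op m ph (rh n ga x) = rh n ga (Op m ph x)"
 by (simp add: Op_rh[OF cocyD] cocy_zero[OF _ ee_mem])

lemma Op_ee: "coch m p ph ==> coch n q ga ==> x : W (j + n) ==> m <= j ==>
  Op m ph (ee n ga x) = ee n ga (Op m ph x)"
proof (rule W_split_eqI[where x = x and n = j and k = n and f = "%x. Op m ph (ee n ga x)"])
 fix y w assume f: "coch m p ph" and g: "coch n q ga" and j: "m <= j" and y: "y : W j" and w: "w : V n"
 show "Op m ph (ee n ga (y * w)) = ee n ga (Op m ph (y * w))"
  by (simp add: ee_mult[OF g y w] Op_mult[OF f y j] ee_mult[OF g Op_mem'[OF f y j] w])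
qed (auto intro!: plin_intros)

text \<open>The appended letter adds to each half of the commutator one insertion \<open>ee\<close>.
  The operator of \<open>ph\<close> acts far to the left of it, so the two contributions
  cancel.\<close>

lemma circ0_right:
 assumes f: "coch m p ph" and g: "coch n q ga" and x: "x : W N" and N: "m + n <= N"
 shows "circ0 m p ph n q ga (x * v a) = circ0 m p ph n q ga x * v a"
proof -
 define df kg where "df = int m - int p" and "kg = int n - int q - 1"
 have mN: "m <= N" "n <= N" using N by auto
 have j: "x * v a : W ((N + 1 - n) + n)" using W_v_mem[OF x] mN by simp
 have e: "Op m ph (ee n ga (x * v a)) = ee n ga (Op m ph x * v a)"
  using Op_ee[OF f g j] N by (simp add: Op_mult[OF f x mN(1)])
 have "int (N - m + p) = int N - df" using N by (simp add: df_def of_nat_diff)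
 then have t: "Sg n q ga (Op m ph x * v a) = Sg n q ga (Op m ph x) * v a
   + eps (kg * (int N - df + 1 - int n)) (ee n ga (Op m ph x * v a))"
  using Sg_tail[OF g Op_mem'[OF f x mN(1)], of a] by (simp add: kg_def)
 have e2: "eps (df * kg) (eps (kg * (int N - df + 1 - int n)) y) = eps (kg * (int N + 1 - int n)) y" for y :: "'a list \<Rightarrow>\<^sub>0 'k"
  unfolding eps_eps by (rule eps_cong) (simp add: algebra_simps)
 show ?thesis
  unfolding circ0_def df_def[symmetric] kg_def[symmetric] Op_mult[OF f x mN(1)] t eps_add e2
   Sg_tail[OF g x, folded kg_def]
  using N by (simp add: plin_add[OF plin_Op0] plin_eps_out[OF plin_Op0] e Op_mult[OF f Sg_mem[OF g x mN(2)]]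
   left_diff_distrib eps_mult_left)
qed

definition cupo :: "nat => (('a list \<Rightarrow>\<^sub>0 'k) => 'a list \<Rightarrow>\<^sub>0 'k) => nat => (('a list \<Rightarrow>\<^sub>0 'k) => 'a list \<Rightarrow>\<^sub>0 'k)
 => ('a list \<Rightarrow>\<^sub>0 'k) => 'a list \<Rightarrow>\<^sub>0 'k" where
 "cupo m ph n ga w = Op m ph (ins 0 n ga w)"

lemma ins0_V: "coch n q ga ==> w : V n ==> ins 0 n ga (w * z) = ga w * z"
 by (rule ins0_mult[OF coch_plin V_H])

lemma ins0_mem:
 assumes c: "coch n q ga" and w: "w : V (n + j)"
 shows "ins 0 n ga w : W (q + j)"
proof -
 have "V (n + j) \<subseteq> {w. ins 0 n ga w : W (q + j)}"
  by (rule V_split_subI) (auto intro!: psub_vimage plin_ins0 W_V_mem coch_mem[OF c] simp: ins0_V[OF c])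
 then show ?thesis using w by auto
qed

text \<open>The composite has a representative with n + j arguments as soon as the q + j letters
  available behind the first one cover the m arguments of \<open>ph\<close>. The cup product as
  defined is the case j = m, while the Poisson homotopy uses j = 1.\<close>

lemma coch_cupo:
 assumes f: "coch m p ph" and g: "coch n q ga" and j: "m <= q + j"
 shows "coch (n + j) (q + j - m + p) (cupo m ph n ga)"
 unfolding coch_def cupo_def using Op_mem'[OF f ins0_mem[OF g] j] by (auto intro!: plin_intros)

lemma Op_cupo:
 assumes f: "coch m p ph" and g: "coch n q ga" and j: "m <= q + j" and x: "x : W N" and N: "n + j <= N"
 shows "Op (n + j) (cupo m ph n ga) x = Op m ph (Op n ga x)"
proof -
 obtain i where i: "N = (n + j) + i" using N le_Suc_ex by blast
 note c = coch_cupo[OF f g j]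
 show ?thesis
 proof (rule W_split_eqI[OF _ _ x[unfolded i], where f = "Op (n + j) (cupo m ph n ga)"])
  fix y z assume y: "y : W (n + j)" and z: "z : V i"
  show "Op (n + j) (cupo m ph n ga) (y * z) = Op m ph (Op n ga (y * z))"
  proof (rule W_eqI[OF _ _ y, where f = "%y. Op (n + j) (cupo m ph n ga) (y * z)"])
   fix t a assume t: "t : V (n + j)"
   have t1: "Op n ga (u a * t * s) = Lm a (ins 0 n ga t) * s" for s
   proof (rule V_split_eqI[OF _ _ t, where f = "%t. Op n ga (u a * t * s)"])
    fix y w assume y: "y : V n"
    show "Op n ga (u a * (y * w) * s) = Lm a (ins 0 n ga (y * w)) * s"
     using Op_u[OF g y, of a "w * s"] by (simp add: mult.assoc ins0_V[OF g y] Lm_mult[OF coch_mem[OF g y]])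
   qed (intro plin_intros)+
   have mem: "ins 0 n ga t : W (q + j)" by (rule ins0_mem[OF g t])
   show "Op (n + j) (cupo m ph n ga) (u a * t * z) = Op m ph (Op n ga (u a * t * z))"
    by (simp add: Op_u[OF c t] t1 cupo_def Op_mult[OF f Lm_mem[OF mem] j] Op_Lm[OF f mem j])
  qed (intro plin_intros)+
 qed (intro plin_intros)+
qed

section \<open>Double insertions and the homotopy for the Poisson identity\<close>

lemma Dg_short: "z : Hh j ==> j < n ==> Dg n q ph z = 0"
 using ins_short[of z j 0 n] hs_short[of z j n] by (simp add: Dg_def Sg_def)

text \<open>Inserts \<open>cx\<close> at some place and then \<open>ga\<close> at the same place or
  further left. The places of \<open>cx\<close> allowed for a given place of \<open>ga\<close> are
  collected in \<open>Dg\<close>; since \<open>cx\<close> is inserted earlier, \<open>ga\<close> may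
  consume parts of its output.\<close>

definition Yop :: "nat => nat => (('a list \<Rightarrow>\<^sub>0 'k) => 'a list \<Rightarrow>\<^sub>0 'k) => nat => nat => (('a list \<Rightarrow>\<^sub>0 'k) => 'a list \<Rightarrow>\<^sub>0 'k)
 => ('a list \<Rightarrow>\<^sub>0 'k) => 'a list \<Rightarrow>\<^sub>0 'k" where
 "Yop n q ga l r cx = hs ((int n - int q - 1) + (int l - int r - 1)) (%z. gb n ga (Dg l r cx z))"

lemma plin_Yop [plin_intros]: "plin f ==> plin (%x. Yop n q ga l r cx (f x))"
 unfolding Yop_def by (intro plin_intros)
lemmas plin_Yop0 = plin_Yop[OF plin_id]

lemma Yop_head: "x : Hh 1 ==> Yop n q ga l r cx (x * z) = x * gb n ga (Dg l r cx z)
 + eps ((int n - int q - 1) + (int l - int r - 1)) (x * Yop n q ga l r cx z)"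
 unfolding Yop_def by (rule hs_head) (intro plin_intros)

lemma Yop_short: "x : Hh j ==> j <= l ==> Yop n q ga l r cx x = 0"
 unfolding Hh_def
proof (rule plin_eqI[OF plin_Yop0 plin_const_0])
 fix w :: "'a list" assume j: "j <= l" and w: "w : {l. length l = j}"
 have "Dg l r cx (mon (drop i w)) = 0" if "i : {1..length w}" for i
  by (rule Dg_short[of _ "length w - i"]) (use that j w in \<open>auto simp: Hh_def\<close>)
 then show "Yop n q ga l r cx (mon w) = 0"
  by (simp add: Yop_def hs_def plin_0[OF plin_ins0])
qed

lemma ee_mult_H: "coch n q ph ==> y : Hh j ==> 0 < j ==> w : V n ==> ee n ph (y * w) = y * ba (ph w)"
 unfolding ee_def
 by (rule tl2_mult[OF plin_mult_left[OF plin_id] plin_mult_right[OF plin_coch_ba]])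
  (auto dest: V_H)

lemma ee_short: "x : Hh j ==> j <= n ==> ee n ph x = 0"
 unfolding ee_def by (rule tl2_short)

lemma Sg_short: "x : Hh j ==> j <= n ==> Sg n q ph x = 0"
 unfolding Sg_def by (rule hs_short)

lemma ee_letter:
 assumes c: "coch n q ph" and x: "x : Hh 1" and t: "t : V (Suc i + n)"
 shows "ee n ph (x * t) = x * ee n ph t"
proof (rule V_split_eqI[OF _ _ t, where f = "%t. ee n ph (x * t)"])
 fix y w assume y: "y : V (Suc i)" and w: "w : V n"
 show "ee n ph (x * (y * w)) = x * ee n ph (y * w)"
  using ee_mult_H[OF c Hh_mult[OF x V_H[OF y]] _ w] ee_mult_H[OF c V_H[OF y] _ w] by (simp add: mult.assoc)
qed (intro plin_intros)+

text \<open>For n = r + 1 the projected output of \<open>cx\<close> has exactly the n letters that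
  \<open>ga\<close> consumes, so on the shortest word there is a single double insertion.\<close>

lemma Yop_start:
 assumes g: "coch n q ga" and h: "coch l r cx" and n: "n = Suc r" and x: "x : Hh 1" and t: "t : V l"
 shows "Yop n q ga l r cx (x * t) = Sg n q ga (ee l cx (x * t))"
proof -
 have b: "ba (cx t) : V n" unfolding n by (rule ba_mem[OF coch_mem[OF h t]])
 have "Dg l r cx t = ba (cx t)"
  using gb_V[OF h t, of 1] Sg_short[OF V_H[OF t] order_refl] by (simp add: Dg_def)
 moreover have "ee l cx (x * t) = x * ba (cx t)" by (rule ee_mult_H[OF h x _ t]) simp
 ultimately show ?thesis
  by (simp add: Yop_head[OF x] Yop_short[OF V_H[OF t] order_refl] Sg_head[OF g x] Sg_short[OF V_H[OF b] order_refl])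
qed

text \<open>Carries the formula for an appended last letter past a first letter x, which is the
  inductive step of \<open>Yop_tailV\<close> and \<open>Yop_tail\<close>. The three cases are that
  no insertion of \<open>cx\<close> is possible, that the new letter makes the first one possible,
  and that the formula for z is available.\<close>

lemma Yop_step:
 assumes g: "coch n q ga" and h: "coch l r cx" and n: "n = Suc r" and x: "x : Hh 1" and z: "z : V j"
  and Q: "l <= j ==> Yop n q ga l r cx (z * v a) = Yop n q ga l r cx z * v a
   + eps ((int l - int r - 1) * (int j - int l)) (Sg n q ga (ee l cx (z * v a)))"
 shows "Yop n q ga l r cx (x * (z * v a)) = Yop n q ga l r cx (x * z) * v a
  + eps ((int l - int r - 1) * (int j + 1 - int l)) (Sg n q ga (ee l cx (x * (z * v a))))"
proof -
 have xz: "x * z : Hh (Suc j)" using Hh_mult[OF x V_H[OF z]] by simp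
 have zv: "z * v a : V (Suc j)" by (rule V_v_mem[OF z])
 have xzv: "x * (z * v a) : Hh (Suc (Suc j))" using Hh_mult[OF x V_H[OF zv]] by simp
 consider "Suc j < l" | "Suc j = l" | "l <= j" by linarith
 then show ?thesis
 proof cases
  case 1
  then show ?thesis
   by (simp add: Yop_short[OF xz] Yop_short[OF xzv] ee_short[OF xzv] plin_0[OF plin_Sg0])
 next
  case 2
  then have e: "int j + 1 - int l = 0" and zl: "z * v a : V l" using zv by auto
  show ?thesis
   unfolding e Yop_start[OF g h n x zl] Yop_short[OF xz eq_refl[OF 2]] by simp
 next
  case 3
  define kg kh where "kg = int n - int q - 1" and "kh = int l - int r - 1"
  have 31: "Dg l r cx (z * v a) = Dg l r cx z * v a + eps (kh * (int j + 1 - int l)) (ee l cx (z * v a))"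
  proof -
   have "gb l cx (z * v a) = gb l cx z * v a" using ins_right[OF V_H[OF z]] 3 by simp
   moreover have "Sg l r cx (z * v a) = Sg l r cx z * v a + eps (kh * (int j - int l)) (ee l cx (z * v a))"
    unfolding Sg_def ee_def kh_def using hs_tail[OF plin_coch_ba[OF h] V_H[OF z] v_H] .
   moreover have "kh + kh * (int j - int l) = kh * (int j + 1 - int l)" by (simp add: algebra_simps)
   ultimately show ?thesis by (simp add: Dg_def kh_def[symmetric] eps_add eps_mult_left distrib_right)
  qed
  have Dz: "Dg l r cx z : V (Suc r + (j - l))" using Dg_mem[OF h, of z "j - l"] z 3 by simp
  \<comment> \<open>The output of \<open>Dg\<close> has at least r + 1 = n letters, so
    \<open>ga\<close> acts without touching the appended letter. This is the point of the relation
    between n and r.\<close>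
  have 32: "gb n ga (Dg l r cx z * v a) = gb n ga (Dg l r cx z) * v a"
   by (rule ins_right[OF V_H[OF Dz]]) (simp add: n)
  have 33: "ee l cx (x * (z * v a)) = x * ee l cx (z * v a)"
   using ee_letter[OF h x, of "z * v a" "j - l"] zv 3 by (simp add: Suc_diff_le)
  have e: "eps (kg + kh) (eps (kh * (int j - int l)) y) = eps (kh * (int j + 1 - int l)) (eps kg y)" for y :: "'a list \<Rightarrow>\<^sub>0 'k"
   unfolding eps_eps by (rule eps_cong) (simp add: algebra_simps)
  show ?thesis
   unfolding Yop_head[OF x] 31 33 Q[OF 3] Sg_head[OF g x] kg_def[symmetric] kh_def[symmetric]
    plin_add[OF plin_ins0] plin_eps_out[OF plin_ins0] 32 distrib_left eps_add eps_mult_right e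
   by (simp add: distrib_right eps_mult_left mult.assoc algebra_simps)
 qed
qed

lemma Yop_tailV:
 assumes g: "coch n q ga" and h: "coch l r cx" and n: "n = Suc r"
 shows "z : V j ==> l <= j ==> Yop n q ga l r cx (z * v a) = Yop n q ga l r cx z * v a
   + eps ((int l - int r - 1) * (int j - int l)) (Sg n q ga (ee l cx (z * v a)))"
proof (induct j arbitrary: z)
 case 0
 show ?case
 proof (rule V_0_eqI[OF _ _ 0(1), where f = "%z. Yop n q ga l r cx (z * v a)"])
  have "(1 :: 'a list \<Rightarrow>\<^sub>0 'k) : V l" using one_mem_V 0 by simp
  from Yop_start[OF g h n v_H this, of a]
  show "Yop n q ga l r cx (1 * v a) = Yop n q ga l r cx 1 * v a
   + eps ((int l - int r - 1) * (int 0 - int l)) (Sg n q ga (ee l cx (1 * v a)))"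
   using Yop_short[OF one_Hh, of l n q ga r cx] 0 by simp
 qed (intro plin_intros)+
next
 case (Suc j)
 let ?P = "%z. Yop n q ga l r cx (z * v a) = Yop n q ga l r cx z * v a
   + eps ((int l - int r - 1) * (int (Suc j) - int l)) (Sg n q ga (ee l cx (z * v a)))"
 have "V (Suc j) \<subseteq> {z. ?P z}"
 proof (rule V_Suc_subI')
  fix y b assume y: "y : V j"
  show "v b * y : {z. ?P z}"
   using Yop_step[OF g h n v_H y Suc(1)[OF y], of b] by (simp add: mult.assoc algebra_simps)
 qed (intro psub_eq plin_intros)
 then show ?case using Suc(2) by blast
qed

lemma Yop_tail:
 assumes g: "coch n q ga" and h: "coch l r cx" and n: "n = Suc r" and x: "x : W N"
 shows "Yop n q ga l r cx (x * v a) = Yop n q ga l r cx x * v a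
  + eps ((int l - int r - 1) * (int N + 1 - int l)) (Sg n q ga (ee l cx (x * v a)))"
proof (rule W_eqI[OF _ _ x, where f = "%x. Yop n q ga l r cx (x * v a)"])
 fix z b assume z: "z : V N"
 show "Yop n q ga l r cx (u b * z * v a) = Yop n q ga l r cx (u b * z) * v a
  + eps ((int l - int r - 1) * (int N + 1 - int l)) (Sg n q ga (ee l cx (u b * z * v a)))"
  using Yop_step[OF g h n u_H z Yop_tailV[OF g h n z], of b] by (simp add: mult.assoc)
qed (intro plin_intros)+

lemma Yop_base:
 assumes g: "coch n q ga" and h: "coch l r cx" and n: "n = Suc r" and x: "x : W l"
 shows "Yop n q ga l r cx x = Sg n q ga (ee l cx x)"
 by (rule W_eqI[OF _ _ x, where f = "%x. Yop n q ga l r cx x"])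
  (use Yop_start[OF g h n u_H] in \<open>auto intro!: plin_intros\<close>)

lemma Yop_mem:
 assumes g: "coch n q ga" and h: "coch l r cx" and n: "n = Suc r"
 shows "x : W (l + j) ==> Yop n q ga l r cx x : W (q + 1 + j)"
proof (induct j arbitrary: x)
 case 0
 then have x: "x : W (0 + l)" and x': "x : W l" by simp_all
 show ?case
  unfolding Yop_base[OF g h n x'] using Sg_mem0[OF g, of "ee l cx x" 0] ee_mem[OF h x] by (simp add: n)
next
 case (Suc j)
 have "W (Suc (l + j)) \<subseteq> {x. Yop n q ga l r cx x : W (q + 1 + Suc j)}"
 proof (rule W_Suc_subI)
  fix y a assume y: "y : W (l + j)"
  have "y * v a : W (Suc j + l)" using W_v_mem[OF y] by (simp add: add.commute)
  from Sg_mem0[OF g, of "ee l cx (y * v a)" "Suc j"] ee_mem[OF h this]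
  have "Sg n q ga (ee l cx (y * v a)) : W (q + 1 + Suc j)" by (simp add: n add.commute)
  then show "y * v a : {x. Yop n q ga l r cx x : W (q + 1 + Suc j)}"
   using W_v_mem[OF Suc(1)[OF y], of a] by (auto simp: Yop_tail[OF g h n y] intro!: psub_add psub_eps)
 qed (intro psub_vimage plin_Yop0 psub_W)
 then show ?case using Suc(2) by auto
qed

text \<open>The value of the composite is the operator of \<open>ga\<close> applied to the form t =
  cx(w) a. The Leibniz rule \<open>ee_D\<close> splits its differential into an insertion of
  \<open>ga\<close> into t and the product of dt with the value of \<open>ga\<close>.\<close>

lemma ee_cup:
 assumes g: "coch n q ga" and h: "coch l r cx" and n: "n = Suc r" and x: "x : W (j + l)"
 shows "ee (Suc l) (cupo n ga l cx) (x * v a) = ee n ga (rh l cx x * v a) + rh n ga (ee l cx x * v a)"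
proof (rule W_split_eqI[OF _ _ x, where f = "%x. ee (Suc l) (cupo n ga l cx) (x * v a)"])
 fix y w assume y: "y : W j" and w: "w : V l"
 have k: "coch (Suc l) q (cupo n ga l cx)" using coch_cupo[OF g h, of 1] by (simp add: n)
 note cw = coch_mem[OF h w] and wa = V_v_mem[OF w, of a]
 define t where "t = cx w * v a"
 have t: "t : W n" unfolding t_def n by (rule W_v_mem[OF cw])
 have kw: "cupo n ga l cx (w * v a) = Op n ga t" by (simp add: cupo_def ins0_V[OF h w] t_def)
 have bt: "ba t : V (Suc n)" by (rule ba_mem[OF t])
 have "ee (Suc l) (cupo n ga l cx) (y * w * v a) = dot y (D (Op n ga t))"
  using ee_mult[OF k y wa] coch_mem[OF k wa] by (simp add: mult.assoc kw D_ba dot_one[OF y])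
 also have "D (Op n ga t) = ee n ga t + rh n ga (D t)" using ee_D[OF g t] by simp
 also have "dot y (ee n ga t + rh n ga (D t)) = ee n ga (dot y t) + rh n ga (y * ba t)"
  by (simp add: plin_add[OF plin_dot0] ee_dot[OF g y t] D_ba[OF t] dot_rh[OF g y bt])
 also have "dot y t = rh l cx (y * w) * v a" by (simp add: t_def dot_mult[OF cw] rh_mult[OF h y w])
 also have "y * ba t = ee l cx (y * w) * v a" by (simp add: t_def ba_mult[OF cw] ee_mult[OF h y w] mult.assoc)
 finally show "ee (Suc l) (cupo n ga l cx) (y * w * v a) = ee n ga (rh l cx (y * w) * v a) + rh n ga (ee l cx (y * w) * v a)" .
qed (intro plin_intros)+

lemma rh_mem: "coch n q ph ==> x : W (j + n) ==> rh n ph x : W (j + q)"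
proof -
 assume c: "coch n q ph" and x: "x : W (j + n)"
 have "W (j + n) \<subseteq> {x. rh n ph x : W (j + q)}"
  by (rule W_split_subI) (auto intro!: psub_vimage plin_rh0 dot_mem coch_mem[OF c] simp: rh_mult[OF c])
 then show ?thesis using x by auto
qed


text \<open>The scheme of \<open>Sg_R0\<close> one level higher: the insertion added by a new letter
  is commuted with \<open>R\<close> by \<open>ee_R_c\<close> for \<open>cx\<close> and by
  \<open>Sg_R_c\<close> for \<open>ga\<close>, and \<open>ee_cup\<close> recognises the boundary
  terms as the last insertion of the composite. One boundary term remains, the insertion of
  \<open>ga\<close> into \<open>rh\<close>.\<close>

lemma Yop_R:
 assumes g: "cocy n q ga" and h: "cocy l r cx" and n: "n = Suc r"
  and kg: "kg = int n - int q - 1" and kh: "kh = int l - int r - 1"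
 shows "x : W (l + j) ==> Yop n q ga l r cx (R a x) = R a (Yop n q ga l r cx x)
  + eps (int (l + j) - kg - kh + 1) (Op n ga (Sg l r cx x * v a)
    - eps (kg + 1) (Sg (Suc l) q (cupo n ga l cx) (x * v a)))
  + eps (kh * (int (l + j) + 1 - int l) + int r) (Sg n q ga (rh l cx (x * v a)))"
proof (induct j arbitrary: x a)
 note gc = cocyD[OF g] and hc = cocyD[OF h]
 let ?G = "Op n ga" and ?S = "Sg n q ga" and ?T = "Sg l r cx" and ?k = "cupo n ga l cx" and ?Y = "Yop n q ga l r cx"
 have k: "coch (Suc l) q ?k" using coch_cupo[OF gc hc, of 1] by (simp add: n)
 have il: "int l = kh + int r + 1" and iq: "int q = int r - kg" and i_n: "int n = int r + 1"
  using kg kh n by simp_all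
 {
  case 0
  then have x: "x : W l" and x0: "x : W (0 + l)" by simp_all
  define z where "z = ee l cx x"
  have z: "z : W (0 + n)" using ee_mem[OF hc x0] by (simp add: z_def n)
  then have z': "z : W n" by simp
  have zR: "ee l cx (R a x) = R a z - eps (int l) (rh l cx (x * v a)) + eps (int r) (rh l cx x * v a)"
   using ee_R_c[OF h x0] by (simp add: z_def)
  have x1: "x * v a : W (1 + l)" using W_v_mem[OF x] by simp
  have r1: "rh l cx (x * v a) : W n" using rh_mem[OF hc x1] by (simp add: n)
  have r2: "rh l cx x * v a : W n" using W_v_mem[OF rh_mem[OF hc x0]] by (simp add: n)
  have S1: "?S (R a z) = R a (?S z) - eps (int n) (rh n ga (z * v a)) + eps (int q) (?G z * v a)"
   using ee_R_c[OF g z, of a] by (simp add: Sg_base[OF gc z'] Sg_base[OF gc R_mem[OF z']] rh_base[OF gc z'])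
  have S2: "?S (rh l cx x * v a) = ee n ga (rh l cx x * v a)" by (rule Sg_base[OF gc r2])
  have S3: "Sg (Suc l) q ?k (x * v a) = ee n ga (rh l cx x * v a) + rh n ga (z * v a)"
   unfolding z_def ee_cup[OF gc hc n x0, symmetric] by (rule Sg_base[OF k W_v_mem[OF x]])
  have S4: "?T x = z" unfolding z_def by (rule Sg_base[OF hc x])
  have S5: "?G (z * v a) = ?G z * v a" by (rule Op_mult[OF gc z' order_refl])
  show ?case
   unfolding Yop_base[OF gc hc n x] Yop_base[OF gc hc n R_mem[OF x]] zR z_def[symmetric] plin_add[OF plin_Sg0] plin_diff[OF plin_Sg0]
    plin_eps_out[OF plin_Sg0] S1 S2 S3 S4 S5 of_nat_add il iq i_n
   by (cases "even kg"; cases "even kh"; cases "even r") (simp_all add: eps_def algebra_simps)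
 next
  case (Suc j)
  show ?case
  proof (rule W_Suc_eqI[where x = x and n = "l + j" and f = "%x. ?Y (R a x)"])
   fix y b assume y: "y : W (l + j)"
   define x where "x = y * v b"
   define N where "N = int (l + j)"
   define s where "s = kh * (N + 1 - int l)"
   have xm: "x : W (Suc j + l)" "x : W (Suc (l + j))" using W_v_mem[OF y, of b] by (simp_all add: x_def add.commute)
   define z where "z = ee l cx x"
   have z: "z : W (Suc j + r + 1)" unfolding z_def by (rule ee_mem[OF hc xm(1)])
   have tl: "?Y (x' * v c) = ?Y x' * v c + eps s (?S (ee l cx (x' * v c)))" if "x' : W (l + j)" for x' c
    using Yop_tail[OF gc hc n that] by (simp add: s_def N_def kh)
   note Ry = R_mem[OF y]
   have A: "?Y (R a x) = ?Y y * v (b * a) - ?Y (R b y) * v a + eps s (?S (ee l cx (R a x)))"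
    by (simp add: x_def R_v[OF y] plin_diff[OF plin_Yop0] plin_diff[OF plin_ee0] plin_diff[OF plin_Sg0] tl[OF y] tl[OF Ry] eps_diff)
   have B: "R a (?Y x) = ?Y y * v (b * a) - R b (?Y y) * v a + eps s (R a (?S z))"
    by (simp add: x_def z_def tl[OF y] plin_add[OF plin_R0] R_v[OF Yop_mem[OF gc hc n y]] plin_eps_out[OF plin_R0])
   have C: "?Y (R b y) = R b (?Y y) + eps (N - kg - kh + 1) (?G (?T y * v b) - eps (kg + 1) (Sg (Suc l) q ?k x))
     + eps (s + int r) (?S (rh l cx x))"
    using Suc(1)[OF y, of b] by (simp add: N_def s_def x_def)
   have Dd: "ee l cx (R a x) = R a z - eps (int l) (rh l cx (x * v a)) + eps (int r) (rh l cx x * v a)"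
    unfolding z_def by (rule ee_R_c[OF h xm(1)])
   have E: "?S (R a z) = R a (?S z) + eps (N + 1 - kh - (kg + 1)) (?G (z * v a))
     - eps (N + 1 - kh - (kg + 1) + (kg + 1) * (N + 1 - kh + 1 - int n)) (rh n ga (z * v a))"
    using Sg_R_c[OF g z, of a] by (simp add: n kg kh N_def algebra_simps)
   have F: "?S (rh l cx x * v a) = ?S (rh l cx x) * v a + eps (kg * (N + 1 - int l + int r + 1 - int n)) (ee n ga (rh l cx x * v a))"
    using Sg_tail[OF gc rh_mem[OF hc xm(1)], of a] by (simp add: kg N_def algebra_simps)
   have H: "?T x = ?T y * v b + eps s z"
    unfolding x_def z_def s_def N_def kh by (rule Sg_tail[OF hc y])
   have Ty: "?T y : W (r + 1 + j)" by (rule Sg_mem0[OF hc y])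
   have I: "?G (?T y * v b) * v a = ?G (?T y * v b * v a)"
    by (rule Op_mult[OF gc W_v_mem[OF Ty], symmetric]) (simp add: n)
   have J: "Sg (Suc l) q ?k (x * v a) = Sg (Suc l) q ?k x * v a
     + eps ((kg + kh + 1) * (N + 1 - int l)) (ee n ga (rh l cx x * v a) + rh n ga (z * v a))"
   proof -
    have "int (Suc l) - int q - 1 = kg + kh + 1" using il iq by simp
    then show ?thesis
     using Sg_tail[OF k xm(2), of a] unfolding z_def ee_cup[OF gc hc n xm(1)] by (simp add: N_def algebra_simps)
   qed
   have L: "int (l + Suc j) = N + 1" by (simp add: N_def)
   show "?Y (R a (y * v b)) = R a (?Y (y * v b))
    + eps (int (l + Suc j) - kg - kh + 1) (?G (?T (y * v b) * v a)
      - eps (kg + 1) (Sg (Suc l) q ?k (y * v b * v a)))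
    + eps (kh * (int (l + Suc j) + 1 - int l) + int r) (?S (rh l cx (y * v b * v a)))"
    unfolding x_def[symmetric] A B C Dd H J L plin_add[OF plin_Sg0] plin_diff[OF plin_Sg0] plin_eps_out[OF plin_Sg0]
     E F distrib_right left_diff_distrib eps_mult_left I plin_add[OF plin_Op0] plin_eps_out[OF plin_Op0] s_def il i_n
    by (cases "even kg"; cases "even kh"; cases "even r"; cases "even N") (simp_all add: eps_def algebra_simps I)
  qed (use Suc in \<open>auto intro!: plin_intros\<close>)
 }
qed

text \<open>In the commutator of \<open>ph\<close> with \<open>Yop\<close> the place of
  \<open>ga\<close> stays near \<open>ph\<close>, but \<open>cx\<close> still runs over the rest of
  the word. Subtracting the circle product of \<open>ph\<close> and \<open>ga\<close> applied to all
  insertions of \<open>cx\<close> removes these terms, which is what makes the result realisable by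
  cochains.\<close>

definition Kop :: "nat => nat => (('a list \<Rightarrow>\<^sub>0 'k) => 'a list \<Rightarrow>\<^sub>0 'k) => nat => nat => (('a list \<Rightarrow>\<^sub>0 'k) => 'a list \<Rightarrow>\<^sub>0 'k)
 => nat => nat => (('a list \<Rightarrow>\<^sub>0 'k) => 'a list \<Rightarrow>\<^sub>0 'k) => ('a list \<Rightarrow>\<^sub>0 'k) => 'a list \<Rightarrow>\<^sub>0 'k" where
 "Kop m p ph n q ga l r cx x = Op m ph (Yop n q ga l r cx x)
  - eps ((int m - int p) * ((int n - int q - 1) + (int l - int r - 1))) (Yop n q ga l r cx (Op m ph x))
  - circ0 m p ph n q ga (Sg l r cx x)"

lemma circ0_cocy_zero:
 assumes f: "cocy m p ph" and g: "cocy n q ga" and x: "x : W N" and N: "m + n <= N"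
 shows "circ0 (Suc m) p (dop m p ph) n q ga x = 0" "circ0 m p ph (Suc n) q (dop n q ga) x = 0"
 using N by (simp_all add: circ0_def cocy_zero[OF f Sg_mem[OF cocyD[OF g] x]] cocy_zero[OF f x] plin_0[OF plin_Sg0]
  cocy_zero[OF g x] cocy_zero[OF g Op_mem'[OF cocyD[OF f] x]] plin_0[OF plin_Op0])

text \<open>Only the defect in \<open>circ0_R\<close> survives for cocycles. Read through
  \<open>Op_dop\<close>, the circle product is a homotopy between the two orders of
  composition.\<close>

lemma circ0_R_c:
 assumes f: "cocy m p ph" and g: "cocy n q ga" and x: "x : W N" and N: "m + n <= N"
 shows "circ0 m p ph n q ga (R a x) = R a (circ0 m p ph n q ga x)
  + eps (int N - (int n - int q)) (Op m ph (Op n ga (x * v a))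
     - eps ((int m - int p) * (int n - int q)) (Op n ga (Op m ph (x * v a))))"
proof -
 have xv: "x * v a : W (Suc N)" by (rule W_v_mem[OF x])
 have N': "m + n <= Suc N" using N by simp
 have e: "eps (int N - (int m - int p) - (int n - int q)) (eps (int m - int p) y) = eps (int N - (int n - int q)) y" for y :: "'a list \<Rightarrow>\<^sub>0 'k"
  unfolding eps_eps by (rule eps_cong) simp
 show ?thesis
  using circ0_R[OF cocyD[OF f] cocyD[OF g] x N, of a] by (simp only: circ0_cocy_zero[OF f g xv N'] eps_0 diff_0_right add_0 e)
qed

text \<open>The differential of the homotopy consists of three terms, the circle product with the
  composite and the two products of the Poisson identity. The boundary terms from
  \<open>Yop_R\<close> combine into the circle product of \<open>ph\<close> and \<open>ga\<close>
  applied to \<open>rh\<close>, and this is cancelled by the boundary term of \<open>?T\<close> in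
  the subtracted part.\<close>

lemma Kop_R:
 assumes f: "cocy m p ph" and g: "cocy n q ga" and h: "cocy l r cx" and n: "n = Suc r"
  and x: "x : W N" and N: "m + n + l <= N"
 shows "Kop m p ph n q ga l r cx (R a x) = R a (Kop m p ph n q ga l r cx x)
  + eps (int N - (int l - int r - 1) - (int n - int q) + (int m - int p) * (int n - int q)) (Op n ga (circ0 m p ph l r cx (x * v a)))
  - eps (int N - (int l - int r - 1)) (circ0 m p ph (Suc l) q (cupo n ga l cx) (x * v a))
  - eps (int N - (int l - int r)) (circ0 m p ph n q ga (Op l cx (x * v a)))"
proof -
 note fc = cocyD[OF f] and gc = cocyD[OF g] and hc = cocyD[OF h]
 define df kg kh where "df = int m - int p" and "kg = int n - int q - 1" and "kh = int l - int r - 1"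
 let ?F = "Op m ph" and ?G = "Op n ga" and ?S = "Sg n q ga" and ?T = "Sg l r cx" and ?k = "cupo n ga l cx" and ?Y = "Yop n q ga l r cx"
 let ?C = "Sg (Suc l) q ?k" and ?c = "circ0 m p ph n q ga"
 define z where "z = x * v a"
 define i where "i = int N + 1 - int l"
 have le: "m <= N" "n <= N" "l <= N" using N by auto
 have xl: "x : W (l + (N - l))" "x : W ((N - l) + l)" using x le by simp_all
 have zl: "z : W ((N + 1 - l) + l)" using W_v_mem[OF x, of a] le by (simp add: z_def)
 have Fx: "?F x : W (N - m + p)" by (rule Op_mem'[OF fc x le(1)])
 have lF: "l <= N - m + p" using N by simp
 then have Fx': "?F x : W (l + (N - m + p - l))" using Fx by simp
 have Fz: "?F x * v a = ?F z" unfolding z_def by (rule Op_mult[OF fc x le(1), symmetric])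
 have kgd: "int n - int q = kg + 1" "int l - int r = kh + 1" by (simp_all add: kg_def kh_def)
 have YR: "?Y (R a x) = R a (?Y x) + eps (int N - kg - kh + 1) (?G (?T x * v a) - eps (kg + 1) (?C z))
   + eps (kh * i + int r) (?S (rh l cx z))"
  using Yop_R[OF g h n kg_def kh_def xl(1), of a] le by (simp add: z_def i_def)
 have iF: "int (N - m + p) = int N - df" using le by (simp add: df_def of_nat_diff)
 have YRF: "?Y (R a (?F x)) = R a (?Y (?F x)) + eps (int N - df - kg - kh + 1) (?G (?T (?F x) * v a) - eps (kg + 1) (?C (?F z)))
   + eps (kh * (i - df) + int r) (?S (rh l cx (?F z)))"
  using Yop_R[OF g h n kg_def kh_def Fx', of a] lF unfolding le_add_diff_inverse[OF lF] iF Fz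
  by (simp add: i_def algebra_simps)
 have Yx: "?Y x : W (q + 1 + (N - l))" by (rule Yop_mem[OF gc hc n xl(1)])
 have FY: "?F (R a (?Y x)) = R a (?F (?Y x))"
  by (rule Op_R_c[OF f Yx]) (use N in simp)
 have FRx: "?F (R a x) = R a (?F x)" by (rule Op_R_c[OF f x le(1)])
 have TR: "?T (R a x) = R a (?T x) + eps (int N - (kh + 1)) (Op l cx z) - eps (int N - (kh + 1) + (kh + 1) * i) (rh l cx z)"
  using Sg_R_c[OF h x le(3), of a] by (simp add: z_def i_def kgd)
 have Tx: "?T x : W (N - l + r + 1)" by (rule Sg_mem[OF hc x le(3)])
 have Tn: "int (N - l + r + 1) = int N - kh" using le by (simp add: kh_def of_nat_diff)
 have cR: "?c (R a (?T x)) = R a (?c (?T x)) + eps (int N - kh - (kg + 1)) (?F (?G (?T x * v a)) - eps (df * (kg + 1)) (?G (?F (?T x * v a))))"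
  using circ0_R_c[OF f g Tx, of a] N unfolding Tn kgd df_def by simp
 have Frh: "?F (rh l cx z) = rh l cx (?F z)"
  by (rule Op_rh_c[OF f hc zl]) (use N in simp)
 have Cd: "circ0 m p ph (Suc l) q ?k t = ?F (?C t) - eps (df * (kg + kh + 1)) (?C (?F t))" for t
 proof -
  have "int (Suc l) - int q - 1 = kg + kh + 1" using n by (simp add: kg_def kh_def)
  then show ?thesis by (simp add: circ0_def df_def)
 qed
 have hz: "circ0 m p ph l r cx z = ?F (?T x * v a) - eps (df * kh) (?T (?F x) * v a)"
 proof -
  have "?F (?T x * v a) = ?F (?T x) * v a" by (rule Op_mult[OF fc Tx]) (use N in simp)
  then show ?thesis
   using circ0_right[OF fc hc x, of a] N
   by (simp add: z_def circ0_def[of _ _ _ _ _ _ x] df_def kh_def left_diff_distrib eps_mult_left)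
 qed
 have cc: "?c t = ?F (?S t) - eps (df * kg) (?S (?F t))" for t by (simp add: circ0_def df_def kg_def)
 have e1: "(int m - int p) * (int n - int q - 1 + (int l - int r - 1)) = df * (kg + kh)" by (simp add: df_def kg_def kh_def)
 have ir: "i = int N - kh - int r" by (simp add: i_def kh_def)
 have main: "?F (?Y (R a x)) - eps (df * (kg + kh)) (?Y (?F (R a x))) - ?c (?T (R a x))
  = R a (?F (?Y x)) - eps (df * (kg + kh)) (R a (?Y (?F x))) - R a (?c (?T x))
  + eps (int N - kh - (kg + 1) + df * (kg + 1)) (?G (circ0 m p ph l r cx z))
  - eps (int N - kh) (circ0 m p ph (Suc l) q ?k z)
  - eps (int N - (kh + 1)) (?c (Op l cx z))"
  unfolding FRx YR YRF TR plin_add[OF plin_circ0[OF plin_id]] plin_diff[OF plin_circ0[OF plin_id]] plin_eps_out[OF plin_circ0[OF plin_id]] cR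
   plin_add[OF plin_Op0] plin_eps_out[OF plin_Op0] plin_diff[OF plin_Op0] FY Cd hz
  unfolding cc[of "rh l cx z"] Frh ir
  by (cases "even kg"; cases "even kh"; cases "even df"; cases "even N"; cases "even r")
   (simp_all add: eps_def algebra_simps)
 show ?thesis
  unfolding Kop_def e1 plin_diff[OF plin_R0] plin_eps_out[OF plin_R0] kgd df_def[symmetric] z_def[symmetric]
  using main by (simp add: kh_def[symmetric])
qed

section \<open>The Poisson homotopy as a finite sum of insertions\<close>

lemma Sg_split_last:
 assumes h: "coch l r cx" and x: "x : Hh (Suc i)" and kh: "kh = int l - int r - 1"
 shows "Sg l r cx (x * z) = (\<Sum>j = 1..i. eps (kh * (int j - 1)) (gi j l cx (x * z))) + eps (kh * int i) (x * Dg l r cx z)"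
proof (rule Hh_Suc_eqI[OF _ _ x, where f = "%x. Sg l r cx (x * z)"])
 fix y c :: "'a list \<Rightarrow>\<^sub>0 'k" assume y: "y : Hh i" and c: "c : Hh 1"
 show "Sg l r cx (y * c * z) = (\<Sum>j = 1..i. eps (kh * (int j - 1)) (gi j l cx (y * c * z))) + eps (kh * int i) (y * c * Dg l r cx z)"
  using Sg_split[OF h y, of "c * z"] by (simp add: Sg_Dg[OF h c] kh mult.assoc)
qed (intro plin_intros)+

text \<open>The places of \<open>cx\<close> at or behind the i-th letter are all places minus the
  earlier ones. In this form the terms are operators on whole words, as \<open>hs_split\<close>
  demands.\<close>

lemma Yop_split:
 assumes h: "coch l r cx" and y: "y : Hh k" and kg: "kg = int n - int q - 1" and kh: "kh = int l - int r - 1"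
 shows "Yop n q ga l r cx (y * z) = (\<Sum>i = 1..k. eps (kg * (int i - 1)) (gi i n ga
    (Sg l r cx (y * z) - (\<Sum>j = 1..<i. eps (kh * (int j - 1)) (gi j l cx (y * z))))))
   + eps ((kg + kh) * int k) (y * Yop n q ga l r cx z)"
proof -
 define \<tau> where "\<tau> i x = eps (kh * (int i - 1)) (gi i n ga
  (Sg l r cx x - (\<Sum>j = 1..<i. eps (kh * (int j - 1)) (gi j l cx x))))" for i x
 have pt: "plin (\<tau> i)" for i unfolding \<tau>_def by (intro plin_intros)
 have t: "\<tau> (Suc i) (x * z) = x * gb n ga (Dg l r cx z)" if x: "x : Hh (Suc i)" for i x z
 proof -
  have "\<tau> (Suc i) (x * z) = eps (kh * int i) (gi (Suc i) n ga (eps (kh * int i) (x * Dg l r cx z)))"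
   unfolding \<tau>_def Sg_split_last[OF h x kh] by (simp add: atLeastLessThanSuc_atLeastAtMost)
  also have "\<dots> = x * gb n ga (Dg l r cx z)"
   using ins_shift[OF x, of 0 n "%x. ba (ga x)"] by (simp only: plin_eps_out[OF plin_ins0] eps_eps) (simp add: eps_def)
  finally show ?thesis .
 qed
 have "Yop n q ga l r cx (y * z) = (\<Sum>i = 1..k. eps ((kg + kh) * (int i - 1)) (\<tau> i (y * z))) + eps ((kg + kh) * int k) (y * Yop n q ga l r cx z)"
  unfolding Yop_def kg[symmetric] kh[symmetric]
 proof (rule hs_split[OF _ _ pt y])
  show "plin (%z. gb n ga (Dg l r cx z))" by (intro plin_intros)
  show "\<tau> i (x * z) = x * gb n ga (Dg l r cx z)" if "0 < i" "x : Hh i" for i x z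
   using t[of x "i - 1" z] that by simp
 qed
 moreover have "eps ((kg + kh) * (int i - 1)) (\<tau> i x) = eps (kg * (int i - 1)) (gi i n ga
  (Sg l r cx x - (\<Sum>j = 1..<i. eps (kh * (int j - 1)) (gi j l cx x))))" for i x
  unfolding \<tau>_def eps_eps by (rule eps_cong) (simp add: algebra_simps)
 ultimately show ?thesis by simp
qed

text \<open>As in \<open>circ0_fin\<close>, the terms with \<open>ga\<close> behind the cut cancel.
  For the remaining places of \<open>ga\<close> the full sum \<open>?T\<close> is taken up by the
  subtracted circle product, up to the circle product of \<open>ph\<close> and \<open>cx\<close> in
  the second sum, and only the finitely many earlier places of \<open>cx\<close> are left.\<close>

lemma Kop_fin:
 assumes f: "coch m p ph" and g: "coch n q ga" and h: "coch l r cx" and x: "x : W N" and N: "m + l <= N"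
  and df: "df = int m - int p" and kg: "kg = int n - int q - 1" and kh: "kh = int l - int r - 1"
 shows "Kop m p ph n q ga l r cx x
  = - (\<Sum>i = 1..m. \<Sum>j = 1..<i. eps (kg * (int i - 1) + kh * (int j - 1)) (Op m ph (gi i n ga (gi j l cx x))))
   + (\<Sum>i = 1..p. eps (df * kg + kg * (int i - 1)) (gi i n ga (circ0 m p ph l r cx x)))
   + (\<Sum>i = 1..p. \<Sum>j = 1..<i. eps (df * (kg + kh) + kg * (int i - 1) + kh * (int j - 1)) (gi i n ga (gi j l cx (Op m ph x))))"
proof -
 let ?F = "Op m ph" and ?Y = "Yop n q ga l r cx" and ?T = "Sg l r cx"
 define \<tau> where "\<tau> i x = gi i n ga (?T x - (\<Sum>j = 1..<i. eps (kh * (int j - 1)) (gi j l cx x)))" for i x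
 have pt: "plin (\<tau> i)" for i unfolding \<tau>_def by (intro plin_intros)
 have le: "m <= N" "l <= N" using N by auto
 have xm: "x : W (m + (N - m))" using x le by simp
 have 1: "?F (?Y x) - eps (df * (kg + kh)) (?Y (?F x))
  = (\<Sum>i = 1..m. eps (kg * (int i - 1)) (?F (\<tau> i x))) - eps (df * (kg + kh)) (\<Sum>i = 1..p. eps (kg * (int i - 1)) (\<tau> i (?F x)))"
 proof (rule W_split_eqI[OF _ _ xm, where f = "%x. ?F (?Y x) - eps (df * (kg + kh)) (?Y (?F x))"])
  fix y z assume y: "y : W m" and z: "z : V (N - m)"
  have Fy: "?F y : W p" using Op_mem'[OF f y] by simp
  have F: "?F (y * t) = ?F y * t" for t by (rule Op_mult[OF f y order_refl])
  have s: "?Y (y' * z) = (\<Sum>i = 1..k. eps (kg * (int i - 1)) (\<tau> i (y' * z))) + eps (kg * int k) (\<tau> (Suc k) (y' * z))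
   + eps ((kg + kh) * int (Suc k)) (y' * ?Y z)" if "y' : W k" for k y'
   using Yop_split[OF h W_H[OF that] kg kh, of ga z] unfolding \<tau>_def[symmetric] by simp
  have t: "\<tau> (Suc k) (y' * z) = eps (kh * int k) (y' * gb n ga (Dg l r cx z))" if y': "y' : W k" for k y'
  proof (rule W_eqI[OF _ _ y', where f = "%y'. \<tau> (Suc k) (y' * z)"])
   fix w a assume w: "w : V k"
   have "?T (u a * w * z) = (\<Sum>j = 1..k. eps (kh * (int j - 1)) (gi j l cx (u a * w * z))) + eps (kh * int k) (u a * w * Dg l r cx z)"
    by (rule Sg_split_last[OF h W_H[OF u_V_mem[OF w]] kh])
   then show "\<tau> (Suc k) (u a * w * z) = eps (kh * int k) (u a * w * gb n ga (Dg l r cx z))"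
    using ins_shift[OF W_H[OF u_V_mem[OF w]], of 0 n "%x. ba (ga x)"]
    by (simp add: \<tau>_def atLeastLessThanSuc_atLeastAtMost plin_eps_out[OF plin_ins0])
  qed (auto intro!: plin_intros plin_comp[OF pt])
  \<comment> \<open>Two tails have to cancel: the one with \<open>ga\<close> inserted exactly at the
    cut, and the one with both insertions behind it.\<close>
  have e: "eps (df * (kg + kh)) (eps (kg * int p) (eps (kh * int p) t)) = eps (kg * int m) (eps (kh * int m) t)"
   "eps (df * (kg + kh)) (eps ((kg + kh) * int (Suc p)) t) = eps ((kg + kh) * int (Suc m)) t" for t :: "'a list \<Rightarrow>\<^sub>0 'k"
   unfolding eps_eps by (rule eps_cong, simp add: df algebra_simps)+
  show "?F (?Y (y * z)) - eps (df * (kg + kh)) (?Y (?F (y * z)))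
   = (\<Sum>i = 1..m. eps (kg * (int i - 1)) (?F (\<tau> i (y * z)))) - eps (df * (kg + kh)) (\<Sum>i = 1..p. eps (kg * (int i - 1)) (\<tau> i (?F (y * z))))"
   unfolding F s[OF y] s[OF Fy] t[OF y] t[OF Fy] eps_add e plin_add[OF plin_Op0] plin_sum[OF plin_Op0] plin_eps_out[OF plin_Op0]
   by simp
 qed (auto intro!: plin_intros plin_comp[OF pt])
 have Tx: "?T x : W (N - l + r + 1)" by (rule Sg_mem[OF h x le(2)])
 have mT: "m <= N - l + r + 1" using N by simp
 have \<tau>: "\<tau> i x = gi i n ga (?T x) - (\<Sum>j = 1..<i. eps (kh * (int j - 1)) (gi i n ga (gi j l cx x)))" for i x
  by (simp add: \<tau>_def plin_diff[OF plin_ins0] plin_sum[OF plin_ins0] plin_eps_out[OF plin_ins0])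
 have e: "(int m - int p) * (int n - int q - 1 + (int l - int r - 1)) = df * (kg + kh)" by (simp add: df kg kh)
 show ?thesis
  unfolding Kop_def e 1 circ0_fin[OF f g Tx mT] circ0_def[of m p ph l] kg[symmetric] kh[symmetric] df[symmetric] \<tau>
   plin_diff[OF plin_ins0] plin_eps_out[OF plin_ins0] plin_diff[OF plin_Op0] plin_sum[OF plin_Op0] plin_eps_out[OF plin_Op0]
   eps_sum eps_diff eps_eps sum_subtractf
  by (simp add: algebra_simps)
qed

end

section \<open>Vector spaces, linear maps and quotients over the scalar field\<close>

lemma scalar_field_simps [simp]:
 "carrier scalar_field = UNIV" "x \<otimes>\<^bsub>scalar_field\<^esub> y = x * y" "\<one>\<^bsub>scalar_field\<^esub> = 1"
 "\<zero>\<^bsub>scalar_field\<^esub> = 0" "x \<oplus>\<^bsub>scalar_field\<^esub> y = x + y"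
 by (simp_all add: scalar_field_def)

lemma cring_scalar_field: "cring (scalar_field :: 'k::field ring)"
proof (rule cringI)
 show "abelian_group (scalar_field :: 'k ring)"
 proof (rule abelian_groupI)
  show "\<exists>y\<in>carrier scalar_field. y \<oplus>\<^bsub>scalar_field\<^esub> x = \<zero>\<^bsub>scalar_field\<^esub>" for x :: 'k
   by (rule bexI[of _ "- x"]) simp_all
 qed (simp_all add: algebra_simps)
 show "Group.comm_monoid (scalar_field :: 'k ring)"
  by (rule comm_monoidI) (simp_all add: algebra_simps)
qed (simp_all add: algebra_simps)

locale vs =
 fixes V :: "('k::field, 'v) module" (structure)
 assumes vs: "vector_space_on V"

sublocale vs \<subseteq> Module.module scalar_field V by (rule vs)

lemma vsI:
 fixes V :: "('k::field, 'v) module" (structure)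
 assumes cl: "!!x y. x : carrier V ==> y : carrier V ==> x \<oplus> y : carrier V" and z: "\<zero> : carrier V"
  and as: "!!x y z. x : carrier V ==> y : carrier V ==> z : carrier V ==> (x \<oplus> y) \<oplus> z = x \<oplus> (y \<oplus> z)"
  and co: "!!x y. x : carrier V ==> y : carrier V ==> x \<oplus> y = y \<oplus> x"
  and lz: "!!x. x : carrier V ==> \<zero> \<oplus> x = x"
  and sc: "!!c x. x : carrier V ==> c \<odot> x : carrier V"
  and ne: "!!x. x : carrier V ==> (- 1) \<odot> x \<oplus> x = \<zero>"
  and s1: "!!c d x. x : carrier V ==> (c + d) \<odot> x = c \<odot> x \<oplus> d \<odot> x"
  and s2: "!!c x y. x : carrier V ==> y : carrier V ==> c \<odot> (x \<oplus> y) = c \<odot> x \<oplus> c \<odot> y"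
  and s3: "!!c d x. x : carrier V ==> (c * d) \<odot> x = c \<odot> (d \<odot> x)"
  and s4: "!!x. x : carrier V ==> 1 \<odot> x = x"
 shows "vector_space_on V"
proof (rule moduleI[OF cring_scalar_field])
 show "abelian_group V"
  by (rule abelian_groupI) (fact cl z as co lz | (rule bexI, rule ne, assumption, rule sc, assumption))+
qed (simp_all add: sc s1 s2 s3 s4)

context vs
begin

lemma smult_add_left: "x : carrier V ==> (c + d) \<odot> x = c \<odot> x \<oplus> d \<odot> x"
 using smult_l_distr[of c d x] by simp
lemma smult_add: "x : carrier V ==> y : carrier V ==> c \<odot> (x \<oplus> y) = c \<odot> x \<oplus> c \<odot> y"
 using smult_r_distr[of c x y] by simp
lemma smult_smult: "x : carrier V ==> c \<odot> (d \<odot> x) = (c * d) \<odot> x"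
 using smult_assoc1[of c d x] by simp
lemma smult_mem: "x : carrier V ==> c \<odot> x : carrier V"
 using smult_closed[of c x] by simp
lemma one_smult: "x : carrier V ==> 1 \<odot> x = x"
 using smult_one[of x] by simp
lemma zero_smult: "x : carrier V ==> 0 \<odot> x = \<zero>"
 using smult_l_null[of x] by simp
lemma smult_zero: "c \<odot> \<zero> = \<zero>"
 using smult_r_null[of c] by simp
lemma neg_smult: "x : carrier V ==> \<ominus> x = (- 1) \<odot> x"
proof -
 assume x: "x : carrier V"
 have "(- 1) \<odot> x \<oplus> x = \<zero>"
  using smult_add_left[OF x, of "-1" 1] x by (simp add: one_smult zero_smult)
 then show ?thesis using x by (simp add: minus_equality smult_mem)
qed
lemma signed_smult: "x : carrier V ==> signed V n x = (if even n then 1 else - 1) \<odot> x"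
 by (simp add: signed_def one_smult neg_smult)
lemma signed_mem: "x : carrier V ==> signed V n x : carrier V"
 by (simp add: signed_def)
lemma minus_mem: "x : carrier V ==> y : carrier V ==> x \<ominus> y : carrier V"
 by (simp add: a_minus_def)
lemma add_diff_iff: "x : carrier V ==> y : carrier V ==> z : carrier V ==> x = y \<oplus> z \<longleftrightarrow> x \<ominus> y = z"
 unfolding a_minus_def
 by (metis a_comm add.inv_solve_right add.inv_closed a_inv_closed minus_closed)
lemma diff_eq_zero: "x : carrier V ==> y : carrier V ==> x \<ominus> y = \<zero> \<longleftrightarrow> x = y"
 using add_diff_iff[of x y \<zero>] by auto
lemma signed_signed: "x : carrier V ==> signed V n (signed V n x) = x"
 by (simp add: signed_def)

end

lemma linear_mapD:
 assumes "linear_map V W f"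
 shows "x : carrier V ==> f x : carrier W"
  and "x : carrier V ==> y : carrier V ==> f (x \<oplus>\<^bsub>V\<^esub> y) = f x \<oplus>\<^bsub>W\<^esub> f y"
  and "x : carrier V ==> f (c \<odot>\<^bsub>V\<^esub> x) = c \<odot>\<^bsub>W\<^esub> f x"
 using assms by (auto simp: linear_map_def)

lemma linear_mapI:
 assumes "!!x. x : carrier V ==> f x : carrier W"
  and "!!x y. x : carrier V ==> y : carrier V ==> f (x \<oplus>\<^bsub>V\<^esub> y) = f x \<oplus>\<^bsub>W\<^esub> f y"
  and "!!c x. x : carrier V ==> f (c \<odot>\<^bsub>V\<^esub> x) = c \<odot>\<^bsub>W\<^esub> f x"
 shows "linear_map V W f"
 using assms by (auto simp: linear_map_def)

locale lin = V: vs V + W: vs W for V :: "('k::field, 'v) module" and W :: "('k, 'w) module" +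
 fixes f assumes lin: "linear_map V W f"
begin
lemma mem: "x : carrier V ==> f x : carrier W" by (rule linear_mapD(1)[OF lin])
lemma add: "x : carrier V ==> y : carrier V ==> f (x \<oplus>\<^bsub>V\<^esub> y) = f x \<oplus>\<^bsub>W\<^esub> f y" by (rule linear_mapD(2)[OF lin])
lemma smult: "x : carrier V ==> f (c \<odot>\<^bsub>V\<^esub> x) = c \<odot>\<^bsub>W\<^esub> f x" by (rule linear_mapD(3)[OF lin])
lemma zero: "f \<zero>\<^bsub>V\<^esub> = \<zero>\<^bsub>W\<^esub>"
 using smult[of "\<zero>\<^bsub>V\<^esub>" 0] mem[of "\<zero>\<^bsub>V\<^esub>"] by (simp add: V.smult_zero W.zero_smult)
lemma neg: "x : carrier V ==> f (\<ominus>\<^bsub>V\<^esub> x) = \<ominus>\<^bsub>W\<^esub> f x"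
 by (simp add: V.neg_smult W.neg_smult smult mem)
lemma minus: "x : carrier V ==> y : carrier V ==> f (x \<ominus>\<^bsub>V\<^esub> y) = f x \<ominus>\<^bsub>W\<^esub> f y"
 by (simp add: a_minus_def add neg)
lemma signed: "x : carrier V ==> f (signed V n x) = signed W n (f x)"
 by (simp add: signed_def neg)
lemma finsum: "(!!i. i : I ==> g i : carrier V) ==> f (\<Oplus>\<^bsub>V\<^esub>i\<in>I. g i) = (\<Oplus>\<^bsub>W\<^esub>i\<in>I. f (g i))"
proof (induct I rule: infinite_finite_induct)
 case (insert i I)
 then show ?case
  by (subst V.finsum_insert) (auto simp: add mem intro!: W.finsum_insert[symmetric] V.finsum_closed)
qed (simp_all add: zero)
end

locale quot = vs V for V :: "('k::field, 'v) module" (structure) +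
 fixes U
 assumes U_sub: "U \<subseteq> carrier V" and U_zero: "\<zero> : U"
  and U_add: "x : U ==> y : U ==> x \<oplus> y : U"
  and U_smult: "x : U ==> c \<odot> x : U"
begin

lemma U_neg: "x : U ==> \<ominus> x : U"
 using U_smult[of x "-1"] U_sub by (auto simp: neg_smult)

lemma submodule: "submodule U scalar_field V"
 by (rule submoduleI) (use U_sub U_zero U_add U_smult U_neg in auto)

lemma abelian_subgroup: "abelian_subgroup U V"
 by (rule abelian_subgroupI3)
  (simp_all add: additive_subgroup_def submodule.axioms(1)[OF submodule] Module.module.axioms(2)[OF vs])

lemma coset_eq:
 assumes x: "x : carrier V" and y: "y : carrier V"
 shows "U +> x = U +> y \<longleftrightarrow> x \<ominus> y : U"
 unfolding a_minus_def abelian_subgroup.a_rcos_module[OF abelian_subgroup y x, symmetric]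
 using abelian_subgroup.a_rcos_self[OF abelian_subgroup x]
  abelian_subgroup.a_repr_independence'[OF abelian_subgroup _ y, of x] by blast

lemma coset_mem: "x : carrier V ==> y : U +> x \<longleftrightarrow> y : carrier V & U +> y = U +> x"
 using abelian_subgroup.a_rcos_self[OF abelian_subgroup] abelian_subgroup.a_repr_independence'[OF abelian_subgroup, of y x]
  abelian_subgroup.a_elemrcos_carrier[OF abelian_subgroup, of x y]
  a_r_coset_subset_G[OF U_sub, of x]
 by blast

lemma Q_carrier: "carrier (quot_space V U) = (%x. U +> x) ` carrier V"
 by (auto simp: quot_space_def A_RCOSETS_def')

lemma Q_mem: "x : carrier V ==> U +> x : carrier (quot_space V U)"
 by (simp add: Q_carrier)

lemma Q_zero: "\<zero>\<^bsub>quot_space V U\<^esub> = U +> \<zero>"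
 using a_coset_add_zero[OF U_sub] by (simp add: quot_space_def)

lemma Q_add: "x : carrier V ==> y : carrier V ==> (U +> x) \<oplus>\<^bsub>quot_space V U\<^esub> (U +> y) = U +> (x \<oplus> y)"
 using abelian_subgroup.a_rcos_sum[OF abelian_subgroup, of x y] by (simp add: quot_space_def)

text \<open>The definition takes a union over the elements of a coset. All of them give the same
  coset, because U is closed under scalar multiplication.\<close>

lemma Q_smult: "x : carrier V ==> c \<odot>\<^bsub>quot_space V U\<^esub> (U +> x) = U +> (c \<odot> x)"
proof -
 assume x: "x : carrier V"
 have "U +> (c \<odot> y) = U +> (c \<odot> x)" if "y : U +> x" for y
 proof -
  from that x have y: "y : carrier V" and "U +> y = U +> x" by (simp_all add: coset_mem)
  then have "y \<ominus> x : U" using coset_eq[OF y x] by simp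
  then have "c \<odot> (y \<ominus> x) : U" by (simp add: U_smult)
  also have "c \<odot> (y \<ominus> x) = c \<odot> y \<ominus> c \<odot> x"
   using x y by (simp add: a_minus_def smult_add neg_smult smult_mem smult_smult mult.commute)
  finally show ?thesis using x y by (simp add: coset_eq smult_mem)
 qed
 moreover have "U +> x ~= {}" using abelian_subgroup.a_rcos_self[OF abelian_subgroup x] by blast
 ultimately have "(\<Union>y\<in>U +> x. U +> (c \<odot> y)) = U +> (c \<odot> x)"
  by (intro SUP_eq_const)
 then show ?thesis by (simp add: quot_space_def)
qed

lemma Q_vs: "vector_space_on (quot_space V U)"
 by (rule vsI)
  (auto simp: Q_carrier Q_zero Q_add Q_smult smult_mem smult_add smult_add_left smult_smult one_smult a_assoc
   neg_smult[symmetric] l_neg r_neg a_comm a_lcomm)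

lemma Q_neg: "x : carrier V ==> \<ominus>\<^bsub>quot_space V U\<^esub> (U +> x) = U +> (\<ominus> x)"
 using vs.neg_smult[OF vs.intro[OF Q_vs] Q_mem, of x] by (simp add: Q_smult neg_smult)

lemma Q_signed: "x : carrier V ==> signed (quot_space V U) n (U +> x) = U +> signed V n x"
 by (simp add: signed_def Q_neg)

end


section \<open>Complexes whose cohomology is a Gerstenhaber algebra\<close>

locale gerst_complex =
 fixes C :: "int => ('k::field, 'v) module" and d :: "int => 'v => 'v"
  and cp :: "int => int => 'v => 'v => 'v" and e :: 'v and br :: "int => int => 'v => 'v => 'v"
 assumes C_vs: "vector_space_on (C n)"
  and d_lin: "linear_map (C n) (C (n + 1)) (d n)"
  and d_d: "x : carrier (C n) ==> d (n + 1) (d n x) = \<zero>\<^bsub>C (n + 2)\<^esub>"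
  and cp_bil: "bilinear_map (C m) (C n) (C (m + n)) (cp m n)"
  and cp_d: "[| x : carrier (C m); y : carrier (C n) |] ==> d (m + n) (cp m n x y)
   = cp (m + 1) n (d m x) y \<oplus>\<^bsub>C (m + n + 1)\<^esub> signed (C (m + n + 1)) m (cp m (n + 1) x (d n y))"
  and cp_assoc: "[| x : carrier (C m); y : carrier (C n); z : carrier (C l) |] ==>
   cp (m + n) l (cp m n x y) z = cp m (n + l) x (cp n l y z)"
  and e_mem: "e : carrier (C 0)" and e_d: "d 0 e = \<zero>\<^bsub>C 1\<^esub>"
  and e_left: "x : carrier (C m) ==> cp 0 m e x = x"
  and e_right: "x : carrier (C m) ==> cp m 0 x e = x"
  and br_bil: "bilinear_map (C m) (C n) (C (m + n - 1)) (br m n)"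
  and br_d: "[| x : carrier (C m); y : carrier (C n) |] ==> d (m + n - 1) (br m n x y)
   = br (m + 1) n (d m x) y \<oplus>\<^bsub>C (m + n)\<^esub> signed (C (m + n)) (m - 1) (br m (n + 1) x (d n y))"
  and br_anti: "[| x : carrier (C m); y : carrier (C n) |] ==>
   br m n x y = \<ominus>\<^bsub>C (m + n - 1)\<^esub> signed (C (m + n - 1)) ((m - 1) * (n - 1)) (br n m y x)"
  and br_jacobi: "[| x : carrier (C m); y : carrier (C n); z : carrier (C l) |] ==>
   br m (n + l - 1) x (br n l y z) = br (m + n - 1) l (br m n x y) z
    \<oplus>\<^bsub>C (m + n + l - 2)\<^esub> signed (C (m + n + l - 2)) ((m - 1) * (n - 1)) (br n (m + l - 1) y (br m l x z))"
  and cp_comm: "[| x : carrier (C m); y : carrier (C n); d m x = \<zero>\<^bsub>C (m + 1)\<^esub>; d n y = \<zero>\<^bsub>C (n + 1)\<^esub> |] ==>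
   \<exists>t\<in>carrier (C (m + n - 1)). cp m n x y
    = signed (C (m + n)) (m * n) (cp n m y x) \<oplus>\<^bsub>C (m + n)\<^esub> d (m + n - 1) t"
  and br_cp: "[| x : carrier (C m); y : carrier (C n); z : carrier (C l);
    d m x = \<zero>\<^bsub>C (m + 1)\<^esub>; d n y = \<zero>\<^bsub>C (n + 1)\<^esub>; d l z = \<zero>\<^bsub>C (l + 1)\<^esub> |] ==>
   \<exists>t\<in>carrier (C (m + n + l - 2)). br m (n + l) x (cp n l y z)
    = (cp (m + n - 1) l (br m n x y) z
      \<oplus>\<^bsub>C (m + n + l - 1)\<^esub> signed (C (m + n + l - 1)) ((m - 1) * n) (cp n (m + l - 1) y (br m l x z)))
     \<oplus>\<^bsub>C (m + n + l - 1)\<^esub> d (m + n + l - 2) t"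
begin

abbreviation Z where "Z n \<equiv> cocycles C d n"
abbreviation B where "B n \<equiv> coboundaries C d n"
abbreviation cl where "cl n \<equiv> cohomology_class C d n"

sublocale C: vs "C n" for n by (rule vs.intro[OF C_vs])
sublocale dl: lin "C n" "C (n + 1)" "d n" for n by unfold_locales (rule d_lin)

lemma Z_simps: "carrier (Z n) = {x : carrier (C n). d n x = \<zero>\<^bsub>C (n + 1)\<^esub>}" "x \<oplus>\<^bsub>Z n\<^esub> y = x \<oplus>\<^bsub>C n\<^esub> y"
 "\<zero>\<^bsub>Z n\<^esub> = \<zero>\<^bsub>C n\<^esub>" "c \<odot>\<^bsub>Z n\<^esub> x = c \<odot>\<^bsub>C n\<^esub> x"
 by (simp_all add: cocycles_def)

lemma Z_vs: "vector_space_on (Z n)"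
 by (rule vsI)
  (auto simp: Z_simps dl.add dl.smult dl.zero C.smult_zero C.a_assoc C.smult_mem C.smult_add C.smult_add_left
   C.smult_smult C.one_smult C.neg_smult[symmetric] C.l_neg intro: C.a_comm)

sublocale Z: vs "Z n" for n by (rule vs.intro[OF Z_vs])

lemma Z_neg: "x : carrier (Z n) ==> \<ominus>\<^bsub>Z n\<^esub> x = \<ominus>\<^bsub>C n\<^esub> x"
 using Z.neg_smult[of x n] by (simp add: Z_simps C.neg_smult)
lemma Z_minus: "x : carrier (Z n) ==> y : carrier (Z n) ==> x \<ominus>\<^bsub>Z n\<^esub> y = x \<ominus>\<^bsub>C n\<^esub> y"
 by (simp add: a_minus_def Z_neg Z_simps(2))
lemma Z_signed: "x : carrier (Z n) ==> signed (Z n) k x = signed (C n) k x"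
 by (simp add: signed_def Z_neg)

lemma B_alt: "B (n + 1) = d n ` carrier (C n)" by (simp add: coboundaries_def)

lemma B_quot: "quot (Z n) (B n)"
proof -
 have "quot (Z (k + 1)) (B (k + 1))" for k
  unfolding B_alt
 proof (unfold_locales)
  show "d k ` carrier (C k) \<subseteq> carrier (Z (k + 1))" using d_d by (auto simp: Z_simps dl.mem add.assoc)
  show "\<zero>\<^bsub>Z (k + 1)\<^esub> : d k ` carrier (C k)" using dl.zero[of k] by (metis C.zero_closed Z_simps(3) image_eqI)
  show "x \<oplus>\<^bsub>Z (k + 1)\<^esub> y : d k ` carrier (C k)" if "x : d k ` carrier (C k)" "y : d k ` carrier (C k)" for x y
   using that by (auto simp: Z_simps dl.add[symmetric])
  show "c \<odot>\<^bsub>Z (k + 1)\<^esub> x : d k ` carrier (C k)" if "x : d k ` carrier (C k)" for c x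
   using that by (auto simp: Z_simps dl.smult[symmetric] C.smult_mem)
 qed
 from this[of "n - 1"] show ?thesis by simp
qed

sublocale Q: quot "Z n" "B n" for n by (rule B_quot)

lemma H_eq: "cohomology C d n = quot_space (Z n) (B n)" by (simp add: cohomology_def)
lemma cl_eq: "cl n x = B n +>\<^bsub>Z n\<^esub> x" by (simp add: cohomology_class_def)

lemma H_carrier: "carrier (cohomology C d n) = cl n ` carrier (Z n)"
 unfolding H_eq Q.Q_carrier by (simp add: cl_eq[abs_def])

lemma cl_cong_iff: "x : carrier (Z n) ==> y : carrier (Z n) ==>
  cl n x = cl n y \<longleftrightarrow> (\<exists>t\<in>carrier (C (n - 1)). x = y \<oplus>\<^bsub>C n\<^esub> d (n - 1) t)"
proof -
 assume x: "x : carrier (Z n)" and y: "y : carrier (Z n)"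
 have "cl n x = cl n y \<longleftrightarrow> x \<ominus>\<^bsub>C n\<^esub> y : d (n - 1) ` carrier (C (n - 1))"
  using Q.coset_eq[OF x y] by (simp add: cl_eq Z_minus[OF x y] coboundaries_def)
 also have "\<dots> \<longleftrightarrow> (\<exists>t\<in>carrier (C (n - 1)). x \<ominus>\<^bsub>C n\<^esub> y = d (n - 1) t)" by auto
 also have "\<dots> \<longleftrightarrow> (\<exists>t\<in>carrier (C (n - 1)). x = y \<oplus>\<^bsub>C n\<^esub> d (n - 1) t)"
 proof (rule bex_cong[OF refl])
  fix t assume t: "t : carrier (C (n - 1))"
  show "(x \<ominus>\<^bsub>C n\<^esub> y = d (n - 1) t) = (x = y \<oplus>\<^bsub>C n\<^esub> d (n - 1) t)"
   using C.add_diff_iff[of x n y "d (n - 1) t"] dl.mem[OF t] x y by (simp add: Z_simps)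
 qed
 finally show ?thesis .
qed

lemma cl_mem: "y : cl n x \<longleftrightarrow> y : carrier (Z n) & cl n y = cl n x" if "x : carrier (Z n)"
 using Q.coset_mem[OF that] by (simp add: cl_eq)

lemma cl_mem_iff: "y : cl n x \<longleftrightarrow> y : carrier (Z n) & (\<exists>t\<in>carrier (C (n - 1)). y = x \<oplus>\<^bsub>C n\<^esub> d (n - 1) t)"
 if "x : carrier (Z n)"
 using cl_cong_iff[OF _ that, of y] by (auto simp: cl_mem[OF that])

lemma cl_self: "x : carrier (Z n) ==> x : cl n x" by (simp add: cl_mem)

lemma cl_add: "x : carrier (Z n) ==> y : carrier (Z n) ==> cl n x \<oplus>\<^bsub>cohomology C d n\<^esub> cl n y = cl n (x \<oplus>\<^bsub>C n\<^esub> y)"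
 unfolding H_eq cl_eq by (simp add: Q.Q_add Z_simps(2))
lemma cl_smult: "x : carrier (Z n) ==> c \<odot>\<^bsub>cohomology C d n\<^esub> cl n x = cl n (c \<odot>\<^bsub>C n\<^esub> x)"
 unfolding H_eq cl_eq by (simp add: Q.Q_smult Z_simps(4))
lemma cl_neg: "x : carrier (Z n) ==> \<ominus>\<^bsub>cohomology C d n\<^esub> cl n x = cl n (\<ominus>\<^bsub>C n\<^esub> x)"
 unfolding H_eq cl_eq by (simp add: Q.Q_neg Z_neg)
lemma cl_signed: "x : carrier (Z n) ==> signed (cohomology C d n) k (cl n x) = cl n (signed (C n) k x)"
 unfolding H_eq cl_eq by (simp add: Q.Q_signed Z_signed)
lemma H_vs: "vector_space_on (cohomology C d n)" unfolding H_eq by (rule Q.Q_vs)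
lemma Z_signed_mem: "x : carrier (Z n) ==> signed (C n) k x : carrier (Z n)"
 using Z.signed_mem by (simp add: Z_signed)
lemma Z_add_mem: "x : carrier (Z n) ==> y : carrier (Z n) ==> x \<oplus>\<^bsub>C n\<^esub> y : carrier (Z n)"
 using Z.a_closed by (simp add: Z_simps(2))
lemma Z_C: "x : carrier (Z n) ==> x : carrier (C n)" by (simp add: Z_simps)
lemma Z_d: "x : carrier (Z n) ==> d n x = \<zero>\<^bsub>C (n + 1)\<^esub>" by (simp add: Z_simps)

text \<open>The shift s is 0 for the cup product and -1 for the bracket; it enters the target degree
  and the sign of the Leibniz rule. On cocycles, changing one argument by a boundary changes the
  operation by a boundary, and the arguments are changed one after the other.\<close>

lemma op_class:
 assumes bil: "!!m n. bilinear_map (C m) (C n) (C (m + n + s)) (b m n)"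
  and b_d: "!!m n x y. [| x : carrier (C m); y : carrier (C n) |] ==> d (m + n + s) (b m n x y)
   = b (m + 1) n (d m x) y \<oplus>\<^bsub>C (m + n + s + 1)\<^esub> signed (C (m + n + s + 1)) (m + s) (b m (n + 1) x (d n y))"
  and x: "x : carrier (Z m)" and y: "y : carrier (Z n)"
 shows "b m n x y : carrier (Z (m + n + s))"
  and "(\<Union>x'\<in>cl m x. \<Union>y'\<in>cl n y. cl (m + n + s) (b m n x' y')) = cl (m + n + s) (b m n x y)"
proof -
 have l: "linear_map (C n) (C (m + n + s)) (b m n x)" if "x : carrier (C m)" for m n x
  using bil[of m n] that by (auto simp: bilinear_map_def)
 have r: "linear_map (C m) (C (m + n + s)) (%x. b m n x y)" if "y : carrier (C n)" for m n y
  using bil[of m n] that by (auto simp: bilinear_map_def)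
 have bm: "b m n x y : carrier (C (m + n + s))" if "x : carrier (C m)" "y : carrier (C n)" for m n x y
  using linear_mapD(1)[OF l[OF that(1)] that(2)] .
 have l0: "b m n x \<zero>\<^bsub>C n\<^esub> = \<zero>\<^bsub>C (m + n + s)\<^esub>" if "x : carrier (C m)" for m n x
  using lin.zero[of "C n" "C (m + n + s)" "b m n x"] l[OF that] by (simp add: lin_def lin_axioms_def C.vs_axioms)
 have r0: "b m n \<zero>\<^bsub>C m\<^esub> y = \<zero>\<^bsub>C (m + n + s)\<^esub>" if "y : carrier (C n)" for m n y
  using lin.zero[of "C m" "C (m + n + s)" "%x. b m n x y"] r[OF that] by (simp add: lin_def lin_axioms_def C.vs_axioms)
 have s1: "m + 1 + n + s = m + n + s + 1" "m + (n + 1) + s = m + n + s + 1" for m n by simp_all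
 have Zb: "b m n x y : carrier (Z (m + n + s))" if x: "x : carrier (Z m)" and y: "y : carrier (Z n)" for x y
  using b_d[OF Z_C[OF x] Z_C[OF y]] l0[OF Z_C[OF x], of "n + 1"] r0[OF Z_C[OF y], of "m + 1"]
   bm[OF Z_C[OF x] Z_C[OF y]]
  by (simp add: Z_simps Z_d[OF x] Z_d[OF y] s1 signed_def)
 show "b m n x y : carrier (Z (m + n + s))" by (rule Zb[OF x y])
 have "cl (m + n + s) (b m n x' y') = cl (m + n + s) (b m n x y)" if x': "x' : cl m x" and y': "y' : cl n y" for x' y'
 proof -
  have Zx': "x' : carrier (Z m)" and Zy': "y' : carrier (Z n)" using x' y' by (simp_all add: cl_mem x y)
  obtain t where t: "t : carrier (C (m - 1))" "x' = x \<oplus>\<^bsub>C m\<^esub> d (m - 1) t"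
   using x' by (auto simp: cl_mem_iff[OF x])
  obtain w where w: "w : carrier (C (n - 1))" "y' = y \<oplus>\<^bsub>C n\<^esub> d (n - 1) w"
   using y' by (auto simp: cl_mem_iff[OF y])
  have dt: "d (m - 1) t : carrier (C m)" and dw: "d (n - 1) w : carrier (C n)"
   using dl.mem[OF t(1)] dl.mem[OF w(1)] by simp_all
  have s2: "m - 1 + n + s = m + n + s - 1" "m + (n - 1) + s = m + n + s - 1" by simp_all
  have 1: "b m n x' y' = b m n x y' \<oplus>\<^bsub>C (m + n + s)\<^esub> d (m + n + s - 1) (b (m - 1) n t y')"
  proof -
   have "b m n x' y' = b m n x y' \<oplus>\<^bsub>C (m + n + s)\<^esub> b m n (d (m - 1) t) y'"
    using linear_mapD(2)[OF r[OF Z_C[OF Zy']] Z_C[OF x] dt] t(2) by simp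
   moreover have "d (m + n + s - 1) (b (m - 1) n t y') = b m n (d (m - 1) t) y'"
    using b_d[OF t(1) Z_C[OF Zy']] l0[OF t(1), of "n + 1"] bm[OF dt Z_C[OF Zy']]
    by (simp add: s2 Z_d[OF Zy'] signed_def)
   ultimately show ?thesis by simp
  qed
  \<comment> \<open>The Leibniz rule puts a sign on the second argument; the same sign on the
    primitive removes it.\<close>
  have 2: "b m n x y' = b m n x y \<oplus>\<^bsub>C (m + n + s)\<^esub> d (m + n + s - 1) (signed (C (m + n + s - 1)) (m + s) (b m (n - 1) x w))"
  proof -
   have bw: "b m (n - 1) x w : carrier (C (m + n + s - 1))" using bm[OF Z_C[OF x] w(1)] by (simp add: s2)
   have "b m n x y' = b m n x y \<oplus>\<^bsub>C (m + n + s)\<^esub> b m n x (d (n - 1) w)"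
    using linear_mapD(2)[OF l[OF Z_C[OF x]] Z_C[OF y] dw] w(2) by simp
   moreover have "d (m + n + s - 1) (b m (n - 1) x w) = signed (C (m + n + s)) (m + s) (b m n x (d (n - 1) w))"
    using b_d[OF Z_C[OF x] w(1)] r0[OF w(1), of "m + 1"] C.signed_mem[OF bm[OF Z_C[OF x] dw]]
    by (simp add: s2 Z_d[OF x])
   moreover have "d (m + n + s - 1) (signed (C (m + n + s - 1)) k (b m (n - 1) x w))
     = signed (C (m + n + s)) k (d (m + n + s - 1) (b m (n - 1) x w))" for k
    using dl.signed[OF bw, of k] by simp
   ultimately show ?thesis by (simp only: C.signed_signed[OF bm[OF Z_C[OF x] dw]])
  qed
  have "cl (m + n + s) (b m n x' y') = cl (m + n + s) (b m n x y')"
   using cl_cong_iff[OF Zb[OF Zx' Zy'] Zb[OF x Zy']] 1 bm[OF t(1) Z_C[OF Zy']] by (auto simp: s2)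
  also have "\<dots> = cl (m + n + s) (b m n x y)"
   using cl_cong_iff[OF Zb[OF x Zy'] Zb[OF x y]] 2 C.signed_mem[OF bm[OF Z_C[OF x] w(1)]] by (auto simp: s2)
  finally show ?thesis .
 qed
 then show "(\<Union>x'\<in>cl m x. \<Union>y'\<in>cl n y. cl (m + n + s) (b m n x' y')) = cl (m + n + s) (b m n x y)"
  using cl_self[OF x] cl_self[OF y] by blast
qed


abbreviation GS where "GS \<equiv> cohomology_structure C d cp e br"

lemma GS_simps: "gcomp GS = cohomology C d" "gone GS = cl 0 e"
 "gcup GS m n \<xi> \<eta> = (\<Union>x\<in>\<xi>. \<Union>y\<in>\<eta>. cl (m + n) (cp m n x y))"
 "gbracket GS m n \<xi> \<eta> = (\<Union>x\<in>\<xi>. \<Union>y\<in>\<eta>. cl (m + n - 1) (br m n x y))"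
 by (simp_all add: cohomology_structure_def)

lemma e_Z: "e : carrier (Z 0)" using e_mem e_d by (simp add: Z_simps)

lemma cup_class:
 assumes "x : carrier (Z m)" "y : carrier (Z n)"
 shows "cp m n x y : carrier (Z (m + n))" "gcup GS m n (cl m x) (cl n y) = cl (m + n) (cp m n x y)"
 using op_class[of 0 cp, simplified, OF cp_bil cp_d assms] by (simp_all add: GS_simps)

lemma bracket_class:
 assumes "x : carrier (Z m)" "y : carrier (Z n)"
 shows "br m n x y : carrier (Z (m + n - 1))" "gbracket GS m n (cl m x) (cl n y) = cl (m + n - 1) (br m n x y)"
 using op_class[of "- 1" br, simplified, OF br_bil br_d assms] by (simp_all add: GS_simps)

lemma bil_class:
 assumes bil: "bilinear_map (C m) (C n) (C k) (b m n)"
  and cls: "!!x y. [| x : carrier (Z m); y : carrier (Z n) |] ==> b m n x y : carrier (Z k) & bb (cl m x) (cl n y) = cl k (b m n x y)"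
 shows "bilinear_map (cohomology C d m) (cohomology C d n) (cohomology C d k) bb"
proof -
 have l: "linear_map (C n) (C k) (b m n x)" if "x : carrier (C m)" for x
  using bil that by (auto simp: bilinear_map_def)
 have r: "linear_map (C m) (C k) (%x. b m n x y)" if "y : carrier (C n)" for y
  using bil that by (auto simp: bilinear_map_def)
 show ?thesis
  unfolding bilinear_map_def H_carrier
 proof (intro conjI ballI)
  fix \<xi> assume "\<xi> : cl m ` carrier (Z m)"
  then obtain x where x: "x : carrier (Z m)" "\<xi> = cl m x" by blast
  show "linear_map (cohomology C d n) (cohomology C d k) (bb \<xi>)"
   by (rule linear_mapI)
    (auto simp: H_carrier x(2) cls[OF x(1)] cl_add cl_smult Z_add_mem Z.smult_mem[unfolded Z_simps(4)]
     linear_mapD(2,3)[OF l[OF Z_C[OF x(1)]]] Z_C)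
 next
  fix \<eta> assume "\<eta> : cl n ` carrier (Z n)"
  then obtain y where y: "y : carrier (Z n)" "\<eta> = cl n y" by blast
  show "linear_map (cohomology C d m) (cohomology C d k) (%\<xi>. bb \<xi> \<eta>)"
   by (rule linear_mapI)
    (auto simp: H_carrier y(2) cls[OF _ y(1)] cl_add cl_smult Z_add_mem Z.smult_mem[unfolded Z_simps(4)]
     linear_mapD(2,3)[OF r[OF Z_C[OF y(1)]]] Z_C)
 qed
qed

lemma cl_add_d:
 assumes "x : carrier (Z n)" "y : carrier (Z n)" "k = n - 1" "t : carrier (C k)" "x = y \<oplus>\<^bsub>C n\<^esub> d k t"
 shows "cl n x = cl n y"
 using cl_cong_iff[OF assms(1,2)] assms(3-5) by auto

lemma H_obtain: assumes "\<xi> : carrier (cohomology C d n)" obtains x where "x : carrier (Z n)" "\<xi> = cl n x"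
 using assms by (auto simp: H_carrier)

text \<open>Associativity, the unit laws, antisymmetry and the Jacobi identity already hold for
  cochains. Graded commutativity and the Poisson identity are the two places where a primitive t is
  used, and there all arguments are cocycles.\<close>

theorem gerstenhaber_algebra_cohomology: "gerstenhaber_algebra GS"
proof (rule gerstenhaber_algebra.intro)
 show "vector_space_on (gcomp GS n)" for n by (simp add: GS_simps H_vs)
 show "bilinear_map (gcomp GS m) (gcomp GS n) (gcomp GS (m + n)) (gcup GS m n)" for m n
  unfolding GS_simps(1) by (rule bil_class[where b = cp, OF cp_bil]) (simp add: cup_class)
 show "bilinear_map (gcomp GS m) (gcomp GS n) (gcomp GS (m + n - 1)) (gbracket GS m n)" for m n
  unfolding GS_simps(1) by (rule bil_class[where b = br, OF br_bil]) (simp add: bracket_class)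
 show "gone GS : carrier (gcomp GS 0)" using e_Z by (simp add: GS_simps H_carrier)
next
 fix f g h m n l
 assume "f : carrier (gcomp GS m)" "g : carrier (gcomp GS n)" "h : carrier (gcomp GS l)"
 then obtain x y z where x: "x : carrier (Z m)" "f = cl m x" and y: "y : carrier (Z n)" "g = cl n y"
  and z: "z : carrier (Z l)" "h = cl l z"
  unfolding GS_simps by (metis H_obtain)
 note xyz = x(2) y(2) z(2)
 show "gcup GS (m + n) l (gcup GS m n f g) h = gcup GS m (n + l) f (gcup GS n l g h)"
  by (simp add: xyz cup_class x(1) y(1) z(1) cp_assoc[OF Z_C[OF x(1)] Z_C[OF y(1)] Z_C[OF z(1)]] add.assoc)
 have i1: "m + n + l - 2 = m + (n + l - 1) - 1" "m + n + l - 2 = m + n - 1 + l - 1" "m + n + l - 2 = n + (m + l - 1) - 1" by simp_all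
 show "gbracket GS m (n + l - 1) f (gbracket GS n l g h) =
    gbracket GS (m + n - 1) l (gbracket GS m n f g) h
    \<oplus>\<^bsub>gcomp GS (m + n + l - 2)\<^esub>
    signed (gcomp GS (m + n + l - 2)) ((m - 1) * (n - 1)) (gbracket GS n (m + l - 1) g (gbracket GS m l f h))"
 proof -
  have b1: "br m (n + l - 1) x (br n l y z) : carrier (Z (m + n + l - 2))"
   using bracket_class(1)[OF x(1) bracket_class(1)[OF y(1) z(1)]] by (simp only: i1(1))
  have b2: "br (m + n - 1) l (br m n x y) z : carrier (Z (m + n + l - 2))"
   using bracket_class(1)[OF bracket_class(1)[OF x(1) y(1)] z(1)] by (simp only: i1(2))
  have b3: "br n (m + l - 1) y (br m l x z) : carrier (Z (m + n + l - 2))"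
   using bracket_class(1)[OF y(1) bracket_class(1)[OF x(1) z(1)]] by (simp only: i1(3))
  have "gbracket GS m (n + l - 1) f (gbracket GS n l g h) = cl (m + n + l - 2) (br m (n + l - 1) x (br n l y z))"
   by (simp only: xyz bracket_class(2)[OF y(1) z(1)] bracket_class(2)[OF x(1) bracket_class(1)[OF y(1) z(1)]] i1(1))
  moreover have "gbracket GS (m + n - 1) l (gbracket GS m n f g) h = cl (m + n + l - 2) (br (m + n - 1) l (br m n x y) z)"
   by (simp only: xyz bracket_class(2)[OF x(1) y(1)] bracket_class(2)[OF bracket_class(1)[OF x(1) y(1)] z(1)] i1(2))
  moreover have "gbracket GS n (m + l - 1) g (gbracket GS m l f h) = cl (m + n + l - 2) (br n (m + l - 1) y (br m l x z))"
   by (simp only: xyz bracket_class(2)[OF x(1) z(1)] bracket_class(2)[OF y(1) bracket_class(1)[OF x(1) z(1)]] i1(3))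
  ultimately show ?thesis
   by (simp only: GS_simps(1) cl_signed[OF b3] cl_add[OF b2 Z_signed_mem[OF b3]] br_jacobi[OF Z_C[OF x(1)] Z_C[OF y(1)] Z_C[OF z(1)]])
 qed
 have i2: "m + n + l - 1 = m + (n + l) - 1" "m + n + l - 1 = m + n - 1 + l" "m + n + l - 1 = n + (m + l - 1)" by simp_all
 show "gbracket GS m (n + l) f (gcup GS n l g h) =
    gcup GS (m + n - 1) l (gbracket GS m n f g) h
    \<oplus>\<^bsub>gcomp GS (m + n + l - 1)\<^esub>
    signed (gcomp GS (m + n + l - 1)) ((m - 1) * n) (gcup GS n (m + l - 1) g (gbracket GS m l f h))"
 proof -
  have b1: "br m (n + l) x (cp n l y z) : carrier (Z (m + n + l - 1))"
   using bracket_class(1)[OF x(1) cup_class(1)[OF y(1) z(1)]] by (simp only: i2(1))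
  have b2: "cp (m + n - 1) l (br m n x y) z : carrier (Z (m + n + l - 1))"
   using cup_class(1)[OF bracket_class(1)[OF x(1) y(1)] z(1)] by (simp only: i2(2))
  have b3: "cp n (m + l - 1) y (br m l x z) : carrier (Z (m + n + l - 1))"
   using cup_class(1)[OF y(1) bracket_class(1)[OF x(1) z(1)]] by (simp only: i2(3))
  have "gbracket GS m (n + l) f (gcup GS n l g h) = cl (m + n + l - 1) (br m (n + l) x (cp n l y z))"
   by (simp only: xyz cup_class(2)[OF y(1) z(1)] bracket_class(2)[OF x(1) cup_class(1)[OF y(1) z(1)]] i2(1))
  moreover have "gcup GS (m + n - 1) l (gbracket GS m n f g) h = cl (m + n + l - 1) (cp (m + n - 1) l (br m n x y) z)"
   by (simp only: xyz bracket_class(2)[OF x(1) y(1)] cup_class(2)[OF bracket_class(1)[OF x(1) y(1)] z(1)] i2(2))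
  moreover have "gcup GS n (m + l - 1) g (gbracket GS m l f h) = cl (m + n + l - 1) (cp n (m + l - 1) y (br m l x z))"
   by (simp only: xyz bracket_class(2)[OF x(1) z(1)] cup_class(2)[OF y(1) bracket_class(1)[OF x(1) z(1)]] i2(3))
  moreover obtain t where t: "t : carrier (C (m + n + l - 2))" "br m (n + l) x (cp n l y z)
    = (cp (m + n - 1) l (br m n x y) z
      \<oplus>\<^bsub>C (m + n + l - 1)\<^esub> signed (C (m + n + l - 1)) ((m - 1) * n) (cp n (m + l - 1) y (br m l x z)))
     \<oplus>\<^bsub>C (m + n + l - 1)\<^esub> d (m + n + l - 2) t"
   using br_cp[OF Z_C[OF x(1)] Z_C[OF y(1)] Z_C[OF z(1)] Z_d[OF x(1)] Z_d[OF y(1)] Z_d[OF z(1)]] by blast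
  moreover have "cl (m + n + l - 1) (br m (n + l) x (cp n l y z)) = cl (m + n + l - 1) (cp (m + n - 1) l (br m n x y) z
      \<oplus>\<^bsub>C (m + n + l - 1)\<^esub> signed (C (m + n + l - 1)) ((m - 1) * n) (cp n (m + l - 1) y (br m l x z)))"
   by (rule cl_add_d[OF b1 Z_add_mem[OF b2 Z_signed_mem[OF b3]] _ t]) simp
  ultimately show ?thesis
   by (simp only: GS_simps(1) cl_signed[OF b3] cl_add[OF b2 Z_signed_mem[OF b3]])
 qed
next
 fix f m assume "f : carrier (gcomp GS m)"
 then obtain x where x: "x : carrier (Z m)" "f = cl m x" unfolding GS_simps by (metis H_obtain)
 show "gcup GS 0 m (gone GS) f = f"
  using cup_class(2)[OF e_Z x(1)] by (simp add: x(2) GS_simps(2) e_left[OF Z_C[OF x(1)]])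
 show "gcup GS m 0 f (gone GS) = f"
  using cup_class(2)[OF x(1) e_Z] by (simp add: x(2) GS_simps(2) e_right[OF Z_C[OF x(1)]])
next
 fix f g m n assume "f : carrier (gcomp GS m)" "g : carrier (gcomp GS n)"
 then obtain x y where x: "x : carrier (Z m)" "f = cl m x" and y: "y : carrier (Z n)" "g = cl n y"
  unfolding GS_simps by (metis H_obtain)
 have c: "cp n m y x : carrier (Z (m + n))" "br n m y x : carrier (Z (m + n - 1))"
  using cup_class(1)[OF y(1) x(1)] bracket_class(1)[OF y(1) x(1)] by (simp_all add: add.commute)
 have ca: "gcup GS n m g f = cl (m + n) (cp n m y x)" "gbracket GS n m g f = cl (m + n - 1) (br n m y x)"
  using cup_class(2)[OF y(1) x(1)] bracket_class(2)[OF y(1) x(1)] by (simp_all add: x(2) y(2) add.commute)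
 obtain t where t: "t : carrier (C (m + n - 1))" "cp m n x y
    = signed (C (m + n)) (m * n) (cp n m y x) \<oplus>\<^bsub>C (m + n)\<^esub> d (m + n - 1) t"
  using cp_comm[OF Z_C[OF x(1)] Z_C[OF y(1)] Z_d[OF x(1)] Z_d[OF y(1)]] by blast
 have "cl (m + n) (cp m n x y) = cl (m + n) (signed (C (m + n)) (m * n) (cp n m y x))"
  by (rule cl_add_d[OF cup_class(1)[OF x(1) y(1)] Z_signed_mem[OF c(1)] refl t])
 then show "gcup GS m n f g = signed (gcomp GS (m + n)) (m * n) (gcup GS n m g f)"
  unfolding ca GS_simps(1) cl_signed[OF c(1)] unfolding x(2) y(2) cup_class(2)[OF x(1) y(1)] .
 show "gbracket GS m n f g = \<ominus>\<^bsub>gcomp GS (m + n - 1)\<^esub> signed (gcomp GS (m + n - 1)) ((m - 1) * (n - 1)) (gbracket GS n m g f)"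
  unfolding ca GS_simps(1) cl_signed[OF c(2)] cl_neg[OF Z_signed_mem[OF c(2)]]
  unfolding x(2) y(2) bracket_class(2)[OF x(1) y(1)] br_anti[OF Z_C[OF x(1)] Z_C[OF y(1)]] ..
qed

end

locale gerst_complex_hom = X: gerst_complex C d cp e br + Y: gerst_complex C' d' cp' e' br'
 for C :: "int => ('k::field, 'v) module" and d cp e br
  and C' :: "int => ('k, 'w) module" and d' cp' e' br' +
 fixes \<iota> :: "int => 'v => 'w"
 assumes i_lin: "linear_map (C n) (C' n) (\<iota> n)"
  and i_d: "x : carrier (C n) ==> \<iota> (n + 1) (d n x) = d' n (\<iota> n x)"
  and i_e: "\<iota> 0 e = e'"
  and i_cp: "[| x : carrier (C m); y : carrier (C n) |] ==> \<iota> (m + n) (cp m n x y) = cp' m n (\<iota> m x) (\<iota> n y)"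
  and i_br: "[| x : carrier (C m); y : carrier (C n) |] ==> \<iota> (m + n - 1) (br m n x y) = br' m n (\<iota> m x) (\<iota> n y)"
begin

sublocale il: lin "C n" "C' n" "\<iota> n" for n by unfold_locales (rule i_lin)

lemma i_Z: "x : carrier (X.Z n) ==> \<iota> n x : carrier (Y.Z n)"
 by (simp add: X.Z_simps Y.Z_simps il.mem i_d[symmetric] il.zero)

lemma i_class: "x : carrier (X.Z n) ==> (\<Union>x'\<in>X.cl n x. Y.cl n (\<iota> n x')) = Y.cl n (\<iota> n x)"
proof (rule SUP_eq_const)
 assume x: "x : carrier (X.Z n)"
 show "X.cl n x ~= {}" using X.cl_self[OF x] by blast
 fix x' assume "x' : X.cl n x"
 then obtain t where x': "x' : carrier (X.Z n)" and t: "t : carrier (C (n - 1))" "x' = x \<oplus>\<^bsub>C n\<^esub> d (n - 1) t"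
  by (auto simp: X.cl_mem_iff[OF x])
 have "\<iota> n x' = \<iota> n x \<oplus>\<^bsub>C' n\<^esub> d' (n - 1) (\<iota> (n - 1) t)"
  using il.add[OF X.Z_C[OF x], of "d (n - 1) t"] i_d[OF t(1)] X.dl.mem[OF t(1)] t(2) by simp
 then show "Y.cl n (\<iota> n x') = Y.cl n (\<iota> n x)"
  by (intro Y.cl_add_d[OF i_Z[OF x'] i_Z[OF x] refl il.mem[OF t(1)]])
qed

theorem gerstenhaber_morphism_cohomology:
 "gerstenhaber_morphism X.GS Y.GS (%n \<xi>. \<Union>x\<in>\<xi>. Y.cl n (\<iota> n x))"
proof (intro gerstenhaber_morphism.intro gerstenhaber_morphism_axioms.intro
  X.gerstenhaber_algebra_cohomology Y.gerstenhaber_algebra_cohomology)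
 let ?ph = "%n \<xi>. \<Union>x\<in>\<xi>. Y.cl n (\<iota> n x)"
 show "linear_map (gcomp X.GS n) (gcomp Y.GS n) (?ph n)" for n
  unfolding X.GS_simps Y.GS_simps
 proof (rule linear_mapI)
  fix \<xi> assume "\<xi> : carrier (cohomology C d n)"
  then obtain x where x: "x : carrier (X.Z n)" "\<xi> = X.cl n x" by (rule X.H_obtain)
  note ix = i_class[OF x(1)] i_Z[OF x(1)]
  show "?ph n \<xi> : carrier (cohomology C' d' n)"
   unfolding x(2) ix(1) Y.H_carrier by (rule imageI[OF ix(2)])
  show "?ph n (c \<odot>\<^bsub>cohomology C d n\<^esub> \<xi>) = c \<odot>\<^bsub>cohomology C' d' n\<^esub> ?ph n \<xi>" for c
  proof -
   have "c \<odot>\<^bsub>C n\<^esub> x : carrier (X.Z n)" using X.Z.smult_mem[OF x(1)] by (simp add: X.Z_simps(4))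
   from i_class[OF this] show ?thesis
    unfolding x(2) ix(1) X.cl_smult[OF x(1)] Y.cl_smult[OF ix(2)] by (simp only: il.smult[OF X.Z_C[OF x(1)]])
  qed
  fix \<eta> assume "\<eta> : carrier (cohomology C d n)"
  then obtain y where y: "y : carrier (X.Z n)" "\<eta> = X.cl n y" by (rule X.H_obtain)
  note iy = i_class[OF y(1)] i_Z[OF y(1)]
  show "?ph n (\<xi> \<oplus>\<^bsub>cohomology C d n\<^esub> \<eta>) = ?ph n \<xi> \<oplus>\<^bsub>cohomology C' d' n\<^esub> ?ph n \<eta>"
   using i_class[OF X.Z_add_mem[OF x(1) y(1)]]
   unfolding x(2) y(2) ix(1) iy(1) X.cl_add[OF x(1) y(1)] Y.cl_add[OF ix(2) iy(2)]
   by (simp only: il.add[OF X.Z_C[OF x(1)] X.Z_C[OF y(1)]])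
 qed
 show "?ph 0 (gone X.GS) = gone Y.GS"
  using i_class[OF X.e_Z] by (simp only: X.GS_simps Y.GS_simps i_e)
 fix f g m n assume "f : carrier (gcomp X.GS m)" "g : carrier (gcomp X.GS n)"
 then obtain x y where x: "x : carrier (X.Z m)" "f = X.cl m x" and y: "y : carrier (X.Z n)" "g = X.cl n y"
  unfolding X.GS_simps by (metis X.H_obtain)
 show "?ph (m + n) (gcup X.GS m n f g) = gcup Y.GS m n (?ph m f) (?ph n g)"
  unfolding x(2) y(2) X.cup_class(2)[OF x(1) y(1)] i_class[OF X.cup_class(1)[OF x(1) y(1)]] i_class[OF x(1)] i_class[OF y(1)]
   Y.cup_class(2)[OF i_Z[OF x(1)] i_Z[OF y(1)]] i_cp[OF X.Z_C[OF x(1)] X.Z_C[OF y(1)]] ..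
 show "?ph (m + n - 1) (gbracket X.GS m n f g) = gbracket Y.GS m n (?ph m f) (?ph n g)"
  unfolding x(2) y(2) X.bracket_class(2)[OF x(1) y(1)] i_class[OF X.bracket_class(1)[OF x(1) y(1)]] i_class[OF x(1)] i_class[OF y(1)]
   Y.bracket_class(2)[OF i_Z[OF x(1)] i_Z[OF y(1)]] i_br[OF X.Z_C[OF x(1)] X.Z_C[OF y(1)]] ..
qed

end

section \<open>Coordinates on tensor products\<close>

lemma free_space_simps [simp]:
 "carrier (free_space S) = Kset S" "\<zero>\<^bsub>free_space S\<^esub> = 0" "x \<oplus>\<^bsub>free_space S\<^esub> y = x + y"
 "c \<odot>\<^bsub>free_space S\<^esub> x = psc c x"
 by (simp_all add: free_space_def Kset_def psc_def)

lemma free_vs: "vector_space_on (free_space S :: ('k::field, 'x \<Rightarrow>\<^sub>0 'k) module)"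
 by (rule vsI) (auto simp: algebra_simps psc_add psc_add_left psub_add[OF psub_Kset] psub_psc[OF psub_Kset] psub_0[OF psub_Kset] psc_neg_one)

lemma submodule_free: "submodule U scalar_field (free_space S) \<longleftrightarrow> psub U & U \<subseteq> Kset S"
proof -
 interpret F: vs "free_space S" by (rule vs.intro[OF free_vs])
 have neg: "\<ominus>\<^bsub>free_space S\<^esub> x = - x" if "x : Kset S" for x
  using F.neg_smult[of x] that by (simp add: psc_neg_one)
 show ?thesis
 proof
  assume U: "submodule U scalar_field (free_space S)"
  show "psub U & U \<subseteq> Kset S"
   using F.submoduleE[OF U] unfolding psub_def by (auto dest: submodule.smult_closed[OF U])
    (use subgroup.one_closed[OF submodule.axioms(1)[OF U]] in simp)
 next
  assume U: "psub U & U \<subseteq> Kset S"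
  show "submodule U scalar_field (free_space S)"
   by (rule F.submoduleI) (use U in \<open>auto simp: neg subset_iff intro: psub_0 psub_add psub_psc psub_minus\<close>)
 qed
qed

lemma listset_iff: "w : listset As \<longleftrightarrow> list_all2 (\<in>) w As"
 by (induct As arbitrary: w) (auto simp: set_Cons_def list_all2_Cons2)

lemma tensor_null_least: "psub U ==> U \<subseteq> Kset (words Vs) ==> multilinear_rels Vs \<subseteq> U ==> tensor_null Vs \<subseteq> U"
 unfolding tensor_null_def submodule_free by (rule hull_minimal) auto
lemma tensor_null_rels: "multilinear_rels Vs \<subseteq> tensor_null Vs"
 unfolding tensor_null_def by (rule hull_subset)
lemma tensor_null_psub: "psub (tensor_null Vs)"
 unfolding tensor_null_def submodule_free hull_def psub_def by auto

lemma tensor_quot: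
 fixes Vs :: "('k::field, 'v) module list"
 assumes "!!V. V : set Vs ==> vector_space_on V"
 shows "quot (free_space (words Vs)) (tensor_null Vs)"
proof -
 have upd: "w[i := x] : words Vs" if "w : words Vs" "i < length Vs" "x : carrier (Vs ! i)" for w i x
  using that by (auto simp: words_def listset_iff list_all2_conv_all_nth nth_list_update)
 have V: "vs (Vs ! i)" if "i < length Vs" for i using assms that by (simp add: vs_def)
 have "multilinear_rels Vs \<subseteq> Kset (words Vs)"
  unfolding multilinear_rels_def
 proof (safe)
  fix w i x y assume a: "w : words Vs" "i < length Vs" "x : carrier (Vs ! i)" "y : carrier (Vs ! i)"
  interpret V: vs "Vs ! i" by (rule V[OF a(2)])
  show "mon (w[i := x \<oplus>\<^bsub>Vs ! i\<^esub> y]) - mon (w[i := x]) - mon (w[i := y]) : Kset (words Vs)"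
   using a by (auto intro!: psub_diff[OF psub_Kset] upd)
 next
  fix w i x and c :: 'k assume a: "w : words Vs" "i < length Vs" "x : carrier (Vs ! i)"
  interpret V: vs "Vs ! i" by (rule V[OF a(2)])
  have "Poly_Mapping.single (w[i := x]) c = psc c (mon (w[i := x]))" by (simp add: psc_single)
  then show "mon (w[i := c \<odot>\<^bsub>Vs ! i\<^esub> x]) - Poly_Mapping.single (w[i := x]) c : Kset (words Vs)"
   using a V.smult_mem[of x c] by (auto intro!: psub_diff[OF psub_Kset] psub_psc[OF psub_Kset] upd)
 qed
 then have sub: "tensor_null Vs \<subseteq> Kset (words Vs)" by (intro tensor_null_least) auto
 interpret F: vs "free_space (words Vs)" by (rule vs.intro[OF free_vs])
 show ?thesis
  by unfold_locales
   (use sub in \<open>auto simp: psub_0[OF tensor_null_psub] psub_add[OF tensor_null_psub] psub_psc[OF tensor_null_psub]\<close>)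
qed

context algebra_over_field
begin

lemma alg_simps [simp]: "carrier alg = UNIV" "\<zero>\<^bsub>alg\<^esub> = 0" "x \<oplus>\<^bsub>alg\<^esub> y = x + y" "c \<odot>\<^bsub>alg\<^esub> x = scale c x"
 by (simp_all add: alg_def)

lemma alg_vs: "vector_space_on alg"
 by (rule vsI) (auto simp: algebra_simps scale_left_distrib scale_right_distrib)

lemma alg_neg: "\<ominus>\<^bsub>alg\<^esub> x = - x" and alg_minus: "x \<ominus>\<^bsub>alg\<^esub> y = x - y"
proof -
 interpret A: vs alg by (rule vs.intro[OF alg_vs])
 show n: "\<ominus>\<^bsub>alg\<^esub> x = - x" for x using A.neg_smult[of x] by simp
 show "x \<ominus>\<^bsub>alg\<^esub> y = x - y" by (simp add: a_minus_def n)
qed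

text \<open>The flag True stands for a factor A, realised as the quotient by zero, and False for a
  factor A/k. Lists of flags then describe all the tensor products that occur.\<close>

definition su :: "bool => 'a set" where "su b = (if b then {0} else scalars)"
definition sp :: "bool => ('k, 'a set) module" where "sp b = quot_space alg (su b)"
definition cf :: "bool => 'a => 'a set" where "cf b a = su b +>\<^bsub>alg\<^esub> a"
definition uv :: "bool => 'a => 'a list \<Rightarrow>\<^sub>0 'k" where "uv b = (if b then u else v)"
definition bb :: "bool => 'a set" where "bb b = (if b then bB else bS)"

lemma sp_eqs: "sp True = fA" "sp False = fS" "cf True = el" "cf False = bar"
 by (simp_all add: sp_def su_def fA_def fS_def cf_def el_def bar_def fun_eq_iff)

lemma su_quot: "quot alg (su b)"
proof -
 interpret A: vs alg by (rule vs.intro[OF alg_vs])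
 show ?thesis
 proof unfold_locales
  show "\<zero>\<^bsub>alg\<^esub> : su b" using scale_zero_left[of 1] by (auto simp: su_def scalars_def intro: range_eqI[of _ _ 0])
  show "x \<oplus>\<^bsub>alg\<^esub> y : su b" if "x : su b" "y : su b" for x y
   using that by (auto simp: su_def scalars_def scale_left_distrib[symmetric] split: if_splits)
  show "c \<odot>\<^bsub>alg\<^esub> x : su b" if "x : su b" for c x
   using that by (auto simp: su_def scalars_def split: if_splits)
 qed simp
qed

lemma sp_vs: "vector_space_on (sp b)" unfolding sp_def by (rule quot.Q_vs[OF su_quot])
lemma sp_carrier: "carrier (sp b) = range (cf b)" unfolding sp_def cf_def by (simp add: quot.Q_carrier[OF su_quot])
lemma cf_add: "cf b a \<oplus>\<^bsub>sp b\<^esub> cf b a' = cf b (a + a')"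
 unfolding sp_def cf_def using quot.Q_add[OF su_quot, of a a'] by simp
lemma cf_scale: "c \<odot>\<^bsub>sp b\<^esub> cf b a = cf b (scale c a)"
 unfolding sp_def cf_def using quot.Q_smult[OF su_quot, of a b c] by simp
lemma cf_eq: "cf b a = cf b a' \<longleftrightarrow> a - a' : su b"
 unfolding cf_def using quot.coset_eq[OF su_quot, of a a'] by (simp add: alg_minus)
lemma alin_uv: "alin (uv b)" by (simp add: uv_def alin_u alin_v)

lemma uv_cong: "cf b a = cf b a' ==> uv b a = uv b a'"
proof -
 assume "cf b a = cf b a'"
 then have "a - a' : su b" by (simp add: cf_eq)
 moreover have "uv b x = 0" if "x : su b" for x
  using that alin_0[OF alin_u] by (auto simp: su_def uv_def scalars_def alin_scale[OF alin_v] split: if_splits)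
 ultimately have "uv b (a - a') = 0" by blast
 then show ?thesis using alin_add[OF alin_uv, of b "a - a'" a'] by simp
qed

definition co :: "bool => 'a set => 'a list \<Rightarrow>\<^sub>0 'k" where "co b X = uv b (SOME a. X = cf b a)"

lemma co_cf [simp]: "co b (cf b a) = uv b a"
 unfolding co_def by (rule uv_cong) (metis (mono_tags) someI)

lemma uv_basis: "c : bb b ==> uv b c = mon [c]"
 by (auto simp: uv_def bb_def u_basis v_basis split: if_splits)
lemma uv_mem: "uv b a : Kset {[c] |c. c : bb b}"
 by (cases b; simp add: uv_def bb_def)
  (rule alin_memI[OF alin_u] alin_bS_memI[OF alin_v]; auto simp: u_basis v_basis psub_0)+

definition Ts :: "bool list => ('k, ('k, 'a) tens) module" where "Ts fs = tensor (map sp fs)"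
definition nl :: "bool list => ('a set list \<Rightarrow>\<^sub>0 'k) set" where "nl fs = tensor_null (map sp fs)"
definition ws :: "bool list => 'a set list set" where "ws fs = words (map sp fs)"
definition pr :: "bool list => 'a set list => ('k, 'a) tens" where "pr fs w = pure (map sp fs) w"

lemma ws_iff: "w : ws fs \<longleftrightarrow> list_all2 (%X b. X : range (cf b)) w fs"
 by (simp add: ws_def words_def listset_iff list_all2_map2 sp_carrier)
lemma ws_Nil [simp]: "w : ws [] \<longleftrightarrow> w = []" by (simp add: ws_iff)
lemma ws_Cons: "w : ws (b # fs) \<longleftrightarrow> (\<exists>a w'. w = cf b a # w' & w' : ws fs)"
 by (auto simp: ws_iff list_all2_Cons2)
lemma ws_append: "s : ws fs ==> t : ws gs ==> s @ t : ws (fs @ gs)"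
 by (simp add: ws_iff list_all2_appendI)
lemma ws_split: "w : ws (fs @ gs) ==> \<exists>s t. w = s @ t & s : ws fs & t : ws gs"
 by (auto simp: ws_iff list_all2_append2)
lemma ws_length: "w : ws fs ==> length w = length fs" by (auto simp: ws_iff list_all2_lengthD)

lemma nl_quot: "quot (free_space (ws fs)) (nl fs)"
 unfolding ws_def nl_def by (rule tensor_quot) (auto simp: sp_vs)
lemma Ts_eq: "Ts fs = quot_space (free_space (ws fs)) (nl fs)"
 by (simp add: Ts_def tensor_def ws_def nl_def)
lemma pr_eq: "pr fs w = nl fs +>\<^bsub>free_space (ws fs)\<^esub> mon w"
 by (simp add: pr_def pure_def ws_def nl_def)
lemma psub_nl: "psub (nl fs)" by (simp add: nl_def tensor_null_psub)
lemma Ts_vs: "vector_space_on (Ts fs)" unfolding Ts_eq by (rule quot.Q_vs[OF nl_quot])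
lemma vs_Ts: "vs (Ts fs)" by (rule vs.intro[OF Ts_vs])

lemma nl_add: "s : ws fs ==> t : ws gs ==>
 mon (s @ cf b (a + a') # t) - mon (s @ cf b a # t) - mon (s @ cf b a' # t) : nl (fs @ b # gs)"
proof -
 assume s: "s : ws fs" and t: "t : ws gs"
 let ?Vs = "map sp (fs @ b # gs)" and ?i = "length fs" and ?w = "s @ cf b a # t"
 have w: "?w : words ?Vs" unfolding ws_def[symmetric] using ws_append[OF s, of "cf b a # t" "b # gs"] t by (auto simp: ws_Cons)
 have nth: "?Vs ! ?i = sp b" by (simp add: nth_append)
 have "mon (?w[?i := cf b a \<oplus>\<^bsub>?Vs ! ?i\<^esub> cf b a']) - mon (?w[?i := cf b a]) - mon (?w[?i := cf b a']) : multilinear_rels ?Vs"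
  unfolding multilinear_rels_def using w
  by (intro UnI1, simp only: mem_Collect_eq) (intro exI conjI, rule refl, auto simp: nth_append sp_carrier)
 then have "mon (?w[?i := cf b a \<oplus>\<^bsub>?Vs ! ?i\<^esub> cf b a']) - mon (?w[?i := cf b a]) - mon (?w[?i := cf b a']) : nl (fs @ b # gs)"
  using tensor_null_rels[of ?Vs] by (auto simp: nl_def)
 then show ?thesis using ws_length[OF s] unfolding nth cf_add by (simp add: list_update_append)
qed

lemma nl_scale: "s : ws fs ==> t : ws gs ==>
 mon (s @ cf b (scale c a) # t) - psc c (mon (s @ cf b a # t)) : nl (fs @ b # gs)"
proof -
 assume s: "s : ws fs" and t: "t : ws gs"
 let ?Vs = "map sp (fs @ b # gs)" and ?i = "length fs" and ?w = "s @ cf b a # t"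
 have w: "?w : words ?Vs" unfolding ws_def[symmetric] using ws_append[OF s, of "cf b a # t" "b # gs"] t by (auto simp: ws_Cons)
 have nth: "?Vs ! ?i = sp b" by (simp add: nth_append)
 have "mon (?w[?i := c \<odot>\<^bsub>?Vs ! ?i\<^esub> cf b a]) - Poly_Mapping.single (?w[?i := cf b a]) c : multilinear_rels ?Vs"
  unfolding multilinear_rels_def using w
  by (intro UnI2, simp only: mem_Collect_eq) (intro exI conjI, rule refl, auto simp: nth_append sp_carrier)
 then have "mon (?w[?i := c \<odot>\<^bsub>?Vs ! ?i\<^esub> cf b a]) - Poly_Mapping.single (?w[?i := cf b a]) c : nl (fs @ b # gs)"
  using tensor_null_rels[of ?Vs] by (auto simp: nl_def)
 then show ?thesis using ws_length[OF s] unfolding nth cf_scale by (simp add: list_update_append psc_single)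
qed

text \<open>The product in the free algebra of the coordinates of the letters. It is multilinear and
  therefore descends to the tensor product.\<close>

fun cw :: "bool list => 'a set list => 'a list \<Rightarrow>\<^sub>0 'k" where
 "cw (b # fs) (X # w) = co b X * cw fs w"
| "cw _ _ = 1"

lemma cw_append: "length s = length fs ==> cw (fs @ gs) (s @ t) = cw fs s * cw gs t"
 by (induct fs s rule: list_induct2') (auto simp: mult.assoc)

definition Jf :: "bool list => ('a set list \<Rightarrow>\<^sub>0 'k) => 'a list \<Rightarrow>\<^sub>0 'k" where "Jf fs = ext (cw fs)"
definition BL :: "bool list => 'a list set" where "BL fs = {l. list_all2 (%c b. c : bb b) l fs}"
definition sec :: "bool list => ('a list \<Rightarrow>\<^sub>0 'k) => 'a set list \<Rightarrow>\<^sub>0 'k" where "sec fs = ext (%l. mon (map2 cf fs l))"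

lemma plin_Jf: "plin (Jf fs)" and plin_sec: "plin (sec fs)" by (simp_all add: Jf_def sec_def plin_ext0)

text \<open>As a function of the letter in position i the product is p times its coordinate times q,
  which is linear.\<close>

lemma cw_update:
 assumes "w : ws fs" "i < length fs" "x : carrier (sp (fs ! i))" "y : carrier (sp (fs ! i))"
 shows "cw fs (w[i := x \<oplus>\<^bsub>sp (fs ! i)\<^esub> y]) = cw fs (w[i := x]) + cw fs (w[i := y])"
  and "cw fs (w[i := c \<odot>\<^bsub>sp (fs ! i)\<^esub> x]) = psc c (cw fs (w[i := x]))"
proof -
 obtain a a' where xy: "x = cf (fs ! i) a" "y = cf (fs ! i) a'" using assms(3,4) by (auto simp: sp_carrier)
 have "\<exists>p q. \<forall>X. cw fs (w[i := X]) = p * co (fs ! i) X * q"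
  using assms(1,2)
 proof (induct fs arbitrary: w i)
  case (Cons b fs)
  then obtain X w' where w: "w = X # w'" "w' : ws fs" by (auto simp: ws_Cons)
  show ?case
  proof (cases i)
   case 0
   then show ?thesis by (intro exI[of _ 1] exI[of _ "cw fs w'"]) (simp add: w)
  next
   case (Suc i')
   then obtain p q where "\<forall>X. cw fs (w'[i' := X]) = p * co (fs ! i') X * q" using Cons(1)[OF w(2), of i'] Cons(3) by auto
   then show ?thesis using Suc by (intro exI[of _ "co b X * p"] exI[of _ q]) (simp add: w mult.assoc)
  qed
 qed simp
 then obtain p q where pq: "!!X. cw fs (w[i := X]) = p * co (fs ! i) X * q" by blast
 show "cw fs (w[i := x \<oplus>\<^bsub>sp (fs ! i)\<^esub> y]) = cw fs (w[i := x]) + cw fs (w[i := y])"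
  unfolding pq xy cf_add co_cf alin_add[OF alin_uv] by (simp add: algebra_simps)
 show "cw fs (w[i := c \<odot>\<^bsub>sp (fs ! i)\<^esub> x]) = psc c (cw fs (w[i := x]))"
  unfolding pq xy cf_scale co_cf alin_scale[OF alin_uv] by (simp only: psc_mult_left[symmetric] psc_mult_right[symmetric])
qed

text \<open>The null space is the smallest subspace containing the multilinearity relations, so
  checking these is enough.\<close>

lemma Jf_nl: "x : nl fs ==> Jf fs x = 0"
proof -
 let ?U = "Kset (ws fs) \<inter> {x. Jf fs x = 0}"
 have "psub {x. Jf fs x = 0}" using psub_eq[OF plin_Jf plin_const_0] .
 then have U: "psub ?U" using psub_Kset[of "ws fs"] unfolding psub_def by auto
 have "multilinear_rels (map sp fs) \<subseteq> Kset (ws fs)"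
  using tensor_null_rels quot.U_sub[OF nl_quot, of fs] by (auto simp: nl_def)
 moreover have "Jf fs r = 0" if "r : multilinear_rels (map sp fs)" for r
 proof -
  have m: "Jf fs (mon w) = cw fs w" for w by (simp add: Jf_def)
  have s: "Jf fs (Poly_Mapping.single w c) = psc c (cw fs w)" for w c
   using plin_psc[OF plin_Jf, of fs c "mon w"] by (simp add: psc_single m)
  show ?thesis
   using that unfolding multilinear_rels_def
   by (auto simp: ws_def[symmetric] plin_diff[OF plin_Jf] m s cw_update)
 qed
 ultimately have "nl fs \<subseteq> ?U"
  unfolding nl_def ws_def by (intro tensor_null_least) (use U in \<open>auto simp: ws_def\<close>)
 then show "x : nl fs ==> Jf fs x = 0" by auto
qed

lemma cw_mem: "w : ws fs ==> cw fs w : Kset (BL fs)"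
proof (induct fs arbitrary: w)
 case Nil
 then show ?case by (simp add: mon_Nil[symmetric] BL_def)
next
 case (Cons b fs)
 then obtain a w' where w: "w = cf b a # w'" "w' : ws fs" by (auto simp: ws_Cons)
 show ?case
  unfolding w by (simp, rule Kset_mult[OF uv_mem Cons(1)[OF w(2)]]) (auto simp: BL_def)
qed

lemma Jf_mem: "x : Kset (ws fs) ==> Jf fs x : Kset (BL fs)"
 by (rule plin_memI[OF plin_Jf psub_Kset]) (auto simp: Jf_def cw_mem)

lemma map2_cf_ws: "l : BL fs ==> map2 cf fs l : ws fs"
 unfolding BL_def mem_Collect_eq by (induct rule: list_all2_induct) (auto simp: ws_Cons)

lemma cw_basis: "l : BL fs ==> cw fs (map2 cf fs l) = mon l"
 unfolding BL_def mem_Collect_eq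
 by (induct rule: list_all2_induct) (auto simp: uv_basis mon_mult mon_Nil)

lemma Jf_sec: "y : Kset (BL fs) ==> Jf fs (sec fs y) = y"
 by (rule plin_eqI[OF plin_comp[OF plin_Jf plin_sec] plin_id]) (auto simp: sec_def Jf_def cw_basis)
lemma sec_mem: "y : Kset (BL fs) ==> sec fs y : Kset (ws fs)"
 by (rule plin_memI[OF plin_sec psub_Kset]) (auto simp: sec_def map2_cf_ws)

text \<open>Words in basis letters span the tensor product. Modulo the relations the letters of w
  are expanded in the basis from left to right; s collects the letters that have already been
  replaced.\<close>

lemma nl_expand: "s : ws fs ==> w : ws gs ==>
 mon (s @ w) - ext (%l. mon (s @ map2 cf gs l)) (cw gs w) : nl (fs @ gs)"
proof (induct gs arbitrary: fs s w)
 case Nil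
 then show ?case by (simp add: mon_Nil[symmetric] psub_0[OF psub_nl] del: mon_Nil)
next
 case (Cons b gs)
 then obtain a w' where w: "w = cf b a # w'" "w' : ws gs" by (auto simp: ws_Cons)
 note s = Cons(2)
 let ?N = "nl (fs @ b # gs)"
 define E :: "('a list \<Rightarrow>\<^sub>0 'k) => 'a set list \<Rightarrow>\<^sub>0 'k" where "E = ext (%l. mon (s @ map2 cf (b # gs) l))"
 have E: "plin E" unfolding E_def by (rule plin_ext0)
 define \<Phi> where "\<Phi> a = mon (s @ cf b a # w') - E (uv b a * cw gs w')" for a
 have add: "\<Phi> (x + y) : ?N" if "\<Phi> x : ?N" "\<Phi> y : ?N" for x y
 proof -
  have "\<Phi> (x + y) = (mon (s @ cf b (x + y) # w') - mon (s @ cf b x # w') - mon (s @ cf b y # w')) + \<Phi> x + \<Phi> y"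
   by (simp add: \<Phi>_def alin_add[OF alin_uv] distrib_right plin_add[OF E])
  then show ?thesis using nl_add[OF s w(2)] that by (simp only:) (intro psub_add[OF psub_nl])
 qed
 have scl: "\<Phi> (scale c x) : ?N" if "\<Phi> x : ?N" for c x
 proof -
  have "\<Phi> (scale c x) = (mon (s @ cf b (scale c x) # w') - psc c (mon (s @ cf b x # w'))) + psc c (\<Phi> x)"
   by (simp add: \<Phi>_def alin_scale[OF alin_uv] psc_mult_left[symmetric] plin_psc[OF E] psc_diff)
  then show ?thesis using nl_scale[OF s w(2)] that by (simp only:) (intro psub_add[OF psub_nl] psub_psc[OF psub_nl])
 qed
 \<comment> \<open>A word with a letter that represents zero is null, by homogeneity with the scalar
   0.\<close>
 have zero: "\<Phi> x : ?N" if "uv b x = 0" "cf b x = cf b 0" for x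
 proof -
  have "\<Phi> x = mon (s @ cf b (scale 0 0) # w') - psc 0 (mon (s @ cf b 0 # w'))"
   using that by (simp add: \<Phi>_def plin_0[OF E])
  then show ?thesis using nl_scale[OF s w(2), of b 0 0] by simp
 qed
 have bas: "\<Phi> c : ?N" if c: "c : bb b" for c
 proof -
  have EE: "E (mon [c] * y) = ext (%l. mon ((s @ [cf b c]) @ map2 cf gs l)) y" for y
   by (rule plin_eqI[where f = "%y. E (mon [c] * y)" and L = UNIV])
    (auto simp: E_def mon_mult Kset_def intro!: plin_intros)
  have "s @ [cf b c] : ws (fs @ [b])" by (rule ws_append[OF s]) (auto simp: ws_Cons)
  from Cons(1)[OF this w(2)] show ?thesis by (simp add: \<Phi>_def uv_basis[OF c] EE)
 qed
 have "\<Phi> c : ?N" if c: "c : bB" for c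
 proof (cases "c : bb b")
  case False
  \<comment> \<open>The only basis element outside \<open>bb b\<close> is 1 in a factor A/k, and
    there its class is zero.\<close>
  then have "b = False" "c = 1" using c by (auto simp: bb_def bS_def split: if_splits)
  then show ?thesis
   by (intro zero) (auto simp: uv_def cf_eq su_def scalars_def intro!: range_eqI[of _ _ 1])
 qed (rule bas)
 moreover have "\<Phi> 0 : ?N" by (rule zero) (simp_all add: alin_0[OF alin_uv])
 moreover have "a : span bB" by (simp add: span_bB)
 then have "\<Phi> a : ?N"
  by (induct rule: span_induct_alt) (use calculation add scl in auto)
 then show ?case by (simp add: w \<Phi>_def E_def)
qed

text \<open>Together with \<open>Jf_sec\<close> and \<open>Jf_nl\<close> this makes
  \<open>Jf\<close> an isomorphism from the tensor product onto the span of the admissible words,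
  with the inverse induced by \<open>sec\<close>.\<close>

lemma sec_Jf: "x : Kset (ws fs) ==> x - sec fs (Jf fs x) : nl fs"
 by (rule plin_memI[where f = "%x. x - sec fs (Jf fs x)", OF plin_minus'[OF plin_id plin_comp[OF plin_sec plin_Jf]] psub_nl])
  (use nl_expand[of "[]" "[]"] in \<open>auto simp: Jf_def sec_def\<close>)

definition J :: "bool list => ('k, 'a) tens => 'a list \<Rightarrow>\<^sub>0 'k" where "J fs X = Jf fs (SOME x. x : X)"
definition Ji :: "bool list => ('a list \<Rightarrow>\<^sub>0 'k) => ('k, 'a) tens" where "Ji fs y = nl fs +>\<^bsub>free_space (ws fs)\<^esub> sec fs y"

lemma free_minus: "x : Kset S ==> y : Kset S ==> x \<ominus>\<^bsub>free_space S\<^esub> y = x - y"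
 using vs.neg_smult[OF vs.intro[OF free_vs], of y S] by (simp add: a_minus_def psc_neg_one)

lemma nl_coset_eq: "x : Kset (ws fs) ==> y : Kset (ws fs) ==>
  nl fs +>\<^bsub>free_space (ws fs)\<^esub> x = nl fs +>\<^bsub>free_space (ws fs)\<^esub> y \<longleftrightarrow> x - y : nl fs"
 using quot.coset_eq[OF nl_quot, of x fs y] by (simp add: free_minus)

lemma J_coset: "x : Kset (ws fs) ==> J fs (nl fs +>\<^bsub>free_space (ws fs)\<^esub> x) = Jf fs x"
proof -
 assume x: "x : Kset (ws fs)"
 define y where "y = (SOME y. y : nl fs +>\<^bsub>free_space (ws fs)\<^esub> x)"
 have "x : nl fs +>\<^bsub>free_space (ws fs)\<^esub> x" using x by (simp add: quot.coset_mem[OF nl_quot])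
 then have "y : nl fs +>\<^bsub>free_space (ws fs)\<^esub> x" unfolding y_def by (rule someI)
 then have y: "y : Kset (ws fs)" "y - x : nl fs"
  using quot.coset_mem[OF nl_quot, of x fs y] x nl_coset_eq[OF _ x, of y] by auto
 have "Jf fs y - Jf fs x = 0" using Jf_nl[OF y(2)] by (simp add: plin_diff[OF plin_Jf])
 then show ?thesis by (simp add: J_def y_def[symmetric])
qed

lemma Ts_obtain: assumes "X : carrier (Ts fs)" obtains x where "x : Kset (ws fs)" "X = nl fs +>\<^bsub>free_space (ws fs)\<^esub> x"
 using assms unfolding Ts_eq quot.Q_carrier[OF nl_quot] by auto

lemma J_pr: "w : ws fs ==> J fs (pr fs w) = cw fs w"
 by (simp add: pr_eq J_coset) (simp add: Jf_def)
lemma pr_mem: "w : ws fs ==> pr fs w : carrier (Ts fs)"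
 unfolding pr_eq Ts_eq by (rule quot.Q_mem[OF nl_quot]) simp
lemma J_mem: "X : carrier (Ts fs) ==> J fs X : Kset (BL fs)"
 by (elim Ts_obtain) (simp add: J_coset Jf_mem)
lemma Ji_mem: "y : Kset (BL fs) ==> Ji fs y : carrier (Ts fs)"
 unfolding Ji_def Ts_eq by (rule quot.Q_mem[OF nl_quot]) (simp add: sec_mem)
lemma J_Ji: "y : Kset (BL fs) ==> J fs (Ji fs y) = y"
 by (simp add: Ji_def J_coset sec_mem Jf_sec)
lemma Ji_J: "X : carrier (Ts fs) ==> Ji fs (J fs X) = X"
proof (elim Ts_obtain)
 fix x assume x: "x : Kset (ws fs)" "X = nl fs +>\<^bsub>free_space (ws fs)\<^esub> x"
 have "sec fs (Jf fs x) - x : nl fs" using psub_minus[OF psub_nl sec_Jf[OF x(1)]] by simp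
 then show "Ji fs (J fs X) = X"
  unfolding x(2) J_coset[OF x(1)] Ji_def using nl_coset_eq[OF sec_mem[OF Jf_mem[OF x(1)]] x(1)] by simp
qed
lemma J_inj: "X : carrier (Ts fs) ==> Y : carrier (Ts fs) ==> J fs X = J fs Y ==> X = Y"
 using Ji_J by metis
lemma J_add: "X : carrier (Ts fs) ==> Y : carrier (Ts fs) ==> J fs (X \<oplus>\<^bsub>Ts fs\<^esub> Y) = J fs X + J fs Y"
 by (elim Ts_obtain, simp add: Ts_eq) (use quot.Q_add[OF nl_quot] in \<open>simp add: J_coset psub_add[OF psub_Kset] plin_add[OF plin_Jf]\<close>)
lemma J_smult: "X : carrier (Ts fs) ==> J fs (c \<odot>\<^bsub>Ts fs\<^esub> X) = psc c (J fs X)"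
 by (elim Ts_obtain, simp add: Ts_eq) (use quot.Q_smult[OF nl_quot] in \<open>simp add: J_coset psub_psc[OF psub_Kset] plin_psc[OF plin_Jf]\<close>)
lemma J_zero: "J fs \<zero>\<^bsub>Ts fs\<^esub> = 0"
 using J_smult[of "\<zero>\<^bsub>Ts fs\<^esub>" fs 0] abelian_monoid.zero_closed vs.zero_smult[OF vs_Ts, of "\<zero>\<^bsub>Ts fs\<^esub>" fs]
 by (metis Module.module.axioms(2) Ts_vs abelian_group.axioms(1) psc_zero_left)
lemma J_neg: "X : carrier (Ts fs) ==> J fs (\<ominus>\<^bsub>Ts fs\<^esub> X) = - J fs X"
 by (simp add: vs.neg_smult[OF vs_Ts] J_smult psc_neg_one)
lemma J_signed: "X : carrier (Ts fs) ==> J fs (signed (Ts fs) k X) = eps k (J fs X)"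
 by (simp add: signed_def eps_def J_neg)
lemma J_finsum: "(!!i. i : I ==> g i : carrier (Ts fs)) ==> J fs (\<Oplus>\<^bsub>Ts fs\<^esub>i\<in>I. g i) = (\<Sum>i\<in>I. J fs (g i))"
proof (induct I rule: infinite_finite_induct)
 interpret T: vs "Ts fs" by (rule vs_Ts)
 {
  case (infinite I) then show ?case by (simp add: J_zero)
 next
  case empty then show ?case by (simp add: J_zero)
 next
  case (insert i I)
  then show ?case
   by (subst T.finsum_insert) (auto simp: J_add intro!: T.finsum_closed)
 }
qed

end

section \<open>Transport of linear maps to coordinates\<close>

lemma hom_iff: "f : carrier (hom_space V W) \<longleftrightarrow> f : extensional (carrier V) & linear_map V W f"
 by (simp add: hom_space_def)

context algebra_over_field
begin

lemma Ji_add: "x : Kset (BL fs) ==> y : Kset (BL fs) ==> Ji fs (x + y) = Ji fs x \<oplus>\<^bsub>Ts fs\<^esub> Ji fs y"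
 by (rule J_inj[of _ fs])
  (auto simp: J_add J_Ji Ji_mem psub_add[OF psub_Kset] intro!: abelian_monoid.a_closed[OF abelian_group.axioms(1)[OF Module.module.axioms(2)[OF Ts_vs]]])
lemma Ji_psc: "x : Kset (BL fs) ==> Ji fs (psc c x) = c \<odot>\<^bsub>Ts fs\<^esub> Ji fs x"
 by (rule J_inj[of _ fs])
  (auto simp: J_smult J_Ji Ji_mem psub_psc[OF psub_Kset] intro!: vs.smult_mem[OF vs_Ts])

text \<open>\<open>lft\<close> takes a map between tensor products to coordinates, and
  \<open>low\<close> goes back. The value 0 on words that are not admissible turns it into a linear
  map on all words.\<close>

definition lft :: "bool list => bool list => ('k, 'a) cochain => ('a list \<Rightarrow>\<^sub>0 'k) => 'a list \<Rightarrow>\<^sub>0 'k" where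
 "lft fs gs f = ext (%l. if l : BL fs then J gs (f (Ji fs (mon l))) else 0)"

lemma plin_lft [plin_intros]: "plin g ==> plin (%x. lft fs gs f (g x))"
 unfolding lft_def by (rule plin_ext)
lemmas plin_lft0 = plin_lft[OF plin_id]

lemma lft_Ji:
 assumes f: "linear_map (Ts fs) (Ts gs) f" and y: "y : Kset (BL fs)"
 shows "lft fs gs f y = J gs (f (Ji fs y))"
proof -
 let ?S = "Kset (BL fs) \<inter> {y. lft fs gs f y = J gs (f (Ji fs y))}"
 have 0: "lft fs gs f 0 = J gs (f (Ji fs 0))"
 proof -
  have z: "0 : Kset (BL fs)" by (rule psub_0[OF psub_Kset])
  have "J gs (f (Ji fs (psc 0 0))) = psc 0 (J gs (f (Ji fs 0)))"
   by (simp only: Ji_psc[OF z] linear_mapD(3)[OF f Ji_mem[OF z]] J_smult[OF linear_mapD(1)[OF f Ji_mem[OF z]]])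
  then show ?thesis by (simp add: plin_0[OF plin_lft0])
 qed
 have "psub ?S"
  unfolding psub_def
  by (auto simp: 0 psub_0[OF psub_Kset] psub_add[OF psub_Kset] psub_psc[OF psub_Kset] plin_add[OF plin_lft0] plin_psc[OF plin_lft0]
   Ji_add Ji_psc Ji_mem linear_mapD[OF f] J_add J_smult)
 then have "Kset (BL fs) \<subseteq> ?S" by (rule Kset_subI) (simp add: lft_def)
 then show ?thesis using y by blast
qed

lemma lft_J: "linear_map (Ts fs) (Ts gs) f ==> X : carrier (Ts fs) ==> lft fs gs f (J fs X) = J gs (f X)"
 by (simp add: lft_Ji J_mem Ji_J)
lemma lft_mem: "linear_map (Ts fs) (Ts gs) f ==> y : Kset (BL fs) ==> lft fs gs f y : Kset (BL gs)"
 by (simp add: lft_Ji J_mem Ji_mem linear_mapD(1)[of "Ts fs" "Ts gs"])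

lemma linear_eqI:
 assumes f: "linear_map (Ts fs) (Ts gs) f" and g: "linear_map (Ts fs) (Ts gs) g"
  and eq: "!!w. w : ws fs ==> J gs (f (pr fs w)) = J gs (g (pr fs w))" and X: "X : carrier (Ts fs)"
 shows "f X = g X"
proof (rule J_inj[of _ gs])
 have "lft fs gs f (J fs X) = lft fs gs g (J fs X)"
 proof (rule plin_eqI[OF plin_lft0 plin_lft0 J_mem[OF X]])
  fix l assume l: "l : BL fs"
  have m: "mon l = J fs (pr fs (map2 cf fs l))" using l by (simp add: J_pr map2_cf_ws cw_basis)
  show "lft fs gs f (mon l) = lft fs gs g (mon l)"
   unfolding m using eq[OF map2_cf_ws[OF l]] by (simp add: lft_J[OF f] lft_J[OF g] pr_mem map2_cf_ws l)
 qed
 then show "J gs (f X) = J gs (g X)" by (simp add: lft_J[OF f X] lft_J[OF g X])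
qed (use linear_mapD(1)[OF f X] linear_mapD(1)[OF g X] in auto)

definition low :: "bool list => bool list => (('a list \<Rightarrow>\<^sub>0 'k) => 'a list \<Rightarrow>\<^sub>0 'k) => ('k, 'a) cochain" where
 "low fs gs \<Phi> = (\<lambda>X\<in>carrier (Ts fs). Ji gs (\<Phi> (J fs X)))"

lemma low_hom:
 assumes "plin \<Phi>" "!!y. y : Kset (BL fs) ==> \<Phi> y : Kset (BL gs)"
 shows "low fs gs \<Phi> : carrier (hom_space (Ts fs) (Ts gs))"
  and "X : carrier (Ts fs) ==> J gs (low fs gs \<Phi> X) = \<Phi> (J fs X)"
proof -
 interpret T: vs "Ts fs" by (rule vs_Ts)
 show "low fs gs \<Phi> : carrier (hom_space (Ts fs) (Ts gs))"
  unfolding hom_iff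
  by (auto simp: low_def Ji_mem assms(2) J_mem J_add J_smult plin_add[OF assms(1)] plin_psc[OF assms(1)] Ji_add Ji_psc T.smult_mem
   intro!: linear_mapI)
 show "X : carrier (Ts fs) ==> J gs (low fs gs \<Phi> X) = \<Phi> (J fs X)"
  by (simp add: low_def J_Ji assms(2) J_mem)
qed

lemma hom_eqI:
 assumes f: "f : carrier (hom_space (Ts fs) (Ts gs))" and g: "g : carrier (hom_space (Ts fs) (Ts gs))"
  and eq: "!!w. w : ws fs ==> J gs (f (pr fs w)) = J gs (g (pr fs w))"
 shows "f = g"
 using f g linear_eqI[of fs gs f g] eq by (auto simp: hom_iff intro: extensionalityI[of _ "carrier (Ts fs)"])

text \<open>Pure tensors span, so a description by values on generators has at most one solution; if
  it amounts to the values of a coordinate operator, that operator provides one. In this way every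
  map introduced by a unique description gets an explicit form.\<close>

lemma the_linear_eq:
 assumes \<Phi>: "plin \<Phi>" "!!y. y : Kset (BL fs) ==> \<Phi> y : Kset (BL gs)"
  and P: "!!h. h : carrier (hom_space (Ts fs) (Ts gs)) ==> P h \<longleftrightarrow> (\<forall>w\<in>ws fs. J gs (h (pr fs w)) = \<Phi> (cw fs w))"
 shows "the_linear (Ts fs) (Ts gs) P = low fs gs \<Phi>"
 unfolding the_linear_def
proof (rule the_equality)
 note l = low_hom[OF \<Phi>]
 show "low fs gs \<Phi> : carrier (hom_space (Ts fs) (Ts gs)) & P (low fs gs \<Phi>)"
  using l P[OF l(1)] by (simp add: J_pr pr_mem)
 fix h assume h: "h : carrier (hom_space (Ts fs) (Ts gs)) & P h"
 then show "h = low fs gs \<Phi>"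
  using P[of h] by (intro hom_eqI[of h fs gs]) (auto simp: l J_pr pr_mem)
qed

text \<open>In coordinates the canonical pairing is multiplication in the free algebra. The
  description concerns a linear map into a space of linear maps, so existence and uniqueness are
  checked one argument at a time.\<close>

lemma tensor_mult_J:
 assumes X: "X : carrier (Ts fs)" and Y: "Y : carrier (Ts gs)"
 shows "tensor_mult (map sp fs) (map sp gs) X Y : carrier (Ts (fs @ gs))"
  and "J (fs @ gs) (tensor_mult (map sp fs) (map sp gs) X Y) = J fs X * J gs Y"
proof -
 let ?H = "hom_space (Ts gs) (Ts (fs @ gs))"
 interpret F: vs "Ts fs" by (rule vs_Ts)
 interpret G: vs "Ts gs" by (rule vs_Ts)
 interpret FG: vs "Ts (fs @ gs)" by (rule vs_Ts)
 have m: "x * y : Kset (BL (fs @ gs))" if "x : Kset (BL fs)" "y : Kset (BL gs)" for x y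
  by (rule Kset_mult[OF that]) (simp add: BL_def list_all2_appendI)
 define h where "h = (\<lambda>X\<in>carrier (Ts fs). low gs (fs @ gs) (%y. J fs X * y))"
 have pl: "plin (%y. J fs X * y)" for X by (intro plin_intros)
 have l: "low gs (fs @ gs) (%y. J fs X * y) : carrier ?H" if "X : carrier (Ts fs)" for X
  using low_hom(1)[OF pl] m J_mem[OF that] by blast
 have hJ: "J (fs @ gs) (h X Y) = J fs X * J gs Y" if "X : carrier (Ts fs)" "Y : carrier (Ts gs)" for X Y
  unfolding h_def using that low_hom(2)[OF pl m[OF J_mem[OF that(1)]] that(2)] by simp
 have hm: "h X Y : carrier (Ts (fs @ gs))" if "X : carrier (Ts fs)" "Y : carrier (Ts gs)" for X Y
  using l[OF that(1)] that by (auto simp: h_def hom_iff linear_mapD(1)[of "Ts gs" "Ts (fs @ gs)"])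
 have hX: "h X : carrier ?H" if "X : carrier (Ts fs)" for X using l[OF that] that by (simp add: h_def)
 have hhom: "h : carrier (hom_space (Ts fs) ?H)"
  unfolding hom_iff
 proof
  show "h : extensional (carrier (Ts fs))" by (simp add: h_def)
  show "linear_map (Ts fs) ?H h"
  proof (rule linear_mapI)
   fix X X' assume X: "X : carrier (Ts fs)" and X': "X' : carrier (Ts fs)"
   show "h (X \<oplus>\<^bsub>Ts fs\<^esub> X') = h X \<oplus>\<^bsub>?H\<^esub> h X'"
   proof (rule extensionalityI[of _ "carrier (Ts gs)"])
    show "h (X \<oplus>\<^bsub>Ts fs\<^esub> X') : extensional (carrier (Ts gs))" using hX X X' by (auto simp: hom_iff)
    show "h X \<oplus>\<^bsub>?H\<^esub> h X' : extensional (carrier (Ts gs))" by (simp add: hom_space_def)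
    fix Y assume Y: "Y : carrier (Ts gs)"
    show "h (X \<oplus>\<^bsub>Ts fs\<^esub> X') Y = (h X \<oplus>\<^bsub>?H\<^esub> h X') Y"
     using X X' Y by (intro J_inj[of _ "fs @ gs"]) (auto simp: hom_space_def hm hJ J_add distrib_right)
   qed
  next
   fix c X assume X: "X : carrier (Ts fs)"
   show "h (c \<odot>\<^bsub>Ts fs\<^esub> X) = c \<odot>\<^bsub>?H\<^esub> h X"
   proof (rule extensionalityI[of _ "carrier (Ts gs)"])
    show "h (c \<odot>\<^bsub>Ts fs\<^esub> X) : extensional (carrier (Ts gs))" using hX[of "c \<odot>\<^bsub>Ts fs\<^esub> X"] X by (auto simp: hom_iff F.smult_mem)
    show "c \<odot>\<^bsub>?H\<^esub> h X : extensional (carrier (Ts gs))" by (simp add: hom_space_def)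
    fix Y assume Y: "Y : carrier (Ts gs)"
    show "h (c \<odot>\<^bsub>Ts fs\<^esub> X) Y = (c \<odot>\<^bsub>?H\<^esub> h X) Y"
     using X Y by (intro J_inj[of _ "fs @ gs"]) (auto simp: hom_space_def hm hJ J_smult F.smult_mem FG.smult_mem psc_mult_left)
   qed
  qed (rule hX)
 qed
 have "tensor_mult (map sp fs) (map sp gs) = h"
  unfolding tensor_mult_def map_append[symmetric] the_linear_def Ts_def[symmetric] ws_def[symmetric] pr_def[symmetric]
 proof (rule the_equality)
  have "h (pr fs v) (pr gs w) = pr (fs @ gs) (v @ w)" if "v : ws fs" "w : ws gs" for v w
   using that by (intro J_inj[of _ "fs @ gs"]) (auto simp: hm hJ pr_mem J_pr ws_append cw_append ws_length)
  then show "h : carrier (hom_space (Ts fs) ?H) & (\<forall>v\<in>ws fs. \<forall>w\<in>ws gs. h (pr fs v) (pr gs w) = pr (fs @ gs) (v @ w))"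
   using hhom by blast
  fix k assume k: "k : carrier (hom_space (Ts fs) ?H) & (\<forall>v\<in>ws fs. \<forall>w\<in>ws gs. k (pr fs v) (pr gs w) = pr (fs @ gs) (v @ w))"
  then have kl: "linear_map (Ts fs) ?H k" and ke: "k : extensional (carrier (Ts fs))" by (auto simp: hom_iff)
  have kX: "k X : carrier ?H" if "X : carrier (Ts fs)" for X by (rule linear_mapD(1)[OF kl that])
  have kX': "linear_map (Ts gs) (Ts (fs @ gs)) (k X)" if "X : carrier (Ts fs)" for X using kX[OF that] by (simp add: hom_iff)
  have kY: "linear_map (Ts fs) (Ts (fs @ gs)) (%X. k X Y)" if Y: "Y : carrier (Ts gs)" for Y
   by (rule linear_mapI)
    (auto simp: linear_mapD[OF kl] linear_mapD(1)[OF kX' Y] hom_space_def Y)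
  show "k = h"
  proof (rule extensionalityI[OF ke])
   show "h : extensional (carrier (Ts fs))" by (simp add: h_def)
   fix X assume X: "X : carrier (Ts fs)"
   show "k X = h X"
   proof (rule hom_eqI[OF kX[OF X] hX[OF X]])
    fix w assume w: "w : ws gs"
    have hY: "linear_map (Ts fs) (Ts (fs @ gs)) (%X. h X (pr gs w))"
     by (rule linear_mapI)
      (use hhom in \<open>auto simp: hom_iff hm pr_mem w linear_mapD(2,3)[of "Ts fs" ?H h] hom_space_def\<close>)
    have "k X (pr gs w) = h X (pr gs w)"
     by (rule linear_eqI[OF kY[OF pr_mem[OF w]] hY _ X])
      (use k w in \<open>auto simp: hJ pr_mem J_pr ws_append cw_append ws_length\<close>)
    then show "J (fs @ gs) (k X (pr gs w)) = J (fs @ gs) (h X (pr gs w))" by simp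
   qed
  qed
 qed
 then show "tensor_mult (map sp fs) (map sp gs) X Y : carrier (Ts (fs @ gs))"
  "J (fs @ gs) (tensor_mult (map sp fs) (map sp gs) X Y) = J fs X * J gs Y"
  using hm[OF X Y] hJ[OF X Y] by simp_all
qed

definition par :: "nat => (('a list \<Rightarrow>\<^sub>0 'k) => 'a list \<Rightarrow>\<^sub>0 'k) => (('a list \<Rightarrow>\<^sub>0 'k) => 'a list \<Rightarrow>\<^sub>0 'k)
 => ('a list \<Rightarrow>\<^sub>0 'k) => 'a list \<Rightarrow>\<^sub>0 'k" where
 "par n ph \<psi> = ext (%l. ph (mon (take n l)) * \<psi> (mon (drop n l)))"

lemma par_mult:
 assumes "plin ph" "plin \<psi>" "x : Hh n"
 shows "par n ph \<psi> (x * y) = ph x * \<psi> y"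
 using assms(3) unfolding Hh_def
proof (rule plin_eqI[where f = "%x. par n ph \<psi> (x * y)", rotated 2])
 fix l :: "'a list" assume l: "l : {l. length l = n}"
 show "par n ph \<psi> (mon l * y) = ph (mon l) * \<psi> y"
  by (rule plin_eqI[where f = "%y. par n ph \<psi> (mon l * y)" and L = UNIV])
   (use l in \<open>auto intro!: plin_intros plin_comp[OF assms(2)] simp: Kset_def mon_mult par_def\<close>)
qed (auto intro!: plin_intros plin_comp[OF assms(1)] simp: par_def)

lemma BL_append: "l : BL (fs @ gs) ==> take (length fs) l : BL fs & drop (length fs) l : BL gs"
 by (auto simp: BL_def list_all2_append2 list_all2_lengthD)
lemma BL_appendI: "s : BL fs ==> t : BL gs ==> s @ t : BL (fs @ gs)"
 by (simp add: BL_def list_all2_appendI)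
lemma BL_H: "x : Kset (BL fs) ==> x : Hh (length fs)"
 by (auto simp: Kset_def Hh_def BL_def dest: list_all2_lengthD)

lemma tensor_map_J:
 assumes f: "linear_map (Ts fs) (Ts fs') f" and g: "linear_map (Ts gs) (Ts gs') g"
 shows "tensor_map (map sp fs) (map sp fs') f (map sp gs) (map sp gs') g
  : carrier (hom_space (Ts (fs @ gs)) (Ts (fs' @ gs')))"
  and "X : carrier (Ts (fs @ gs)) ==> J (fs' @ gs') (tensor_map (map sp fs) (map sp fs') f (map sp gs) (map sp gs') g X)
   = par (length fs) (lft fs fs' f) (lft gs gs' g) (J (fs @ gs) X)"
proof -
 let ?P = "par (length fs) (lft fs fs' f) (lft gs gs' g)"
 have p: "plin ?P" by (simp add: par_def plin_ext0)
 have m: "?P y : Kset (BL (fs' @ gs'))" if "y : Kset (BL (fs @ gs))" for y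
 proof (rule plin_memI[OF p psub_Kset that])
  fix l assume l: "l : BL (fs @ gs)"
  show "?P (mon l) : Kset (BL (fs' @ gs'))"
   unfolding par_def ext_mon using BL_append[OF l]
   by (intro Kset_mult[OF lft_mem[OF f] lft_mem[OF g] BL_appendI]) auto
 qed
 have e: "tensor_map (map sp fs) (map sp fs') f (map sp gs) (map sp gs') g = low (fs @ gs) (fs' @ gs') ?P"
  unfolding tensor_map_def map_append[symmetric] Ts_def[symmetric] ws_def[symmetric] pr_def[symmetric]
 proof (rule the_linear_eq[OF p m])
  fix h assume h: "h : carrier (hom_space (Ts (fs @ gs)) (Ts (fs' @ gs')))"
  have hm: "h X : carrier (Ts (fs' @ gs'))" if "X : carrier (Ts (fs @ gs))" for X
   using h that by (auto simp: hom_iff linear_mapD(1)[of "Ts (fs @ gs)"])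
  have iff: "h (pr (fs @ gs) (v @ w)) = tensor_mult (map sp fs') (map sp gs') (f (pr fs v)) (g (pr gs w))
   \<longleftrightarrow> J (fs' @ gs') (h (pr (fs @ gs) (v @ w))) = ?P (cw (fs @ gs) (v @ w))" if v: "v : ws fs" and w: "w : ws gs" for v w
  proof -
   note fv = linear_mapD(1)[OF f pr_mem[OF v]] and gw = linear_mapD(1)[OF g pr_mem[OF w]]
   have "?P (cw (fs @ gs) (v @ w)) = lft fs fs' f (cw fs v) * lft gs gs' g (cw gs w)"
    by (simp add: cw_append ws_length[OF v] par_mult plin_lft0 BL_H cw_mem[OF v])
   also have "\<dots> = J (fs' @ gs') (tensor_mult (map sp fs') (map sp gs') (f (pr fs v)) (g (pr gs w)))"
    unfolding tensor_mult_J(2)[OF fv gw] using lft_J[OF f pr_mem[OF v]] lft_J[OF g pr_mem[OF w]] by (simp add: J_pr v w)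
   finally show ?thesis
    using J_inj[OF hm[OF pr_mem[OF ws_append[OF v w]]] tensor_mult_J(1)[OF fv gw]] by auto
  qed
  show "(\<forall>v\<in>ws fs. \<forall>w\<in>ws gs. h (pr (fs @ gs) (v @ w)) = tensor_mult (map sp fs') (map sp gs') (f (pr fs v)) (g (pr gs w)))
   \<longleftrightarrow> (\<forall>w\<in>ws (fs @ gs). J (fs' @ gs') (h (pr (fs @ gs) w)) = ?P (cw (fs @ gs) w))"
   using iff ws_split[of _ fs gs] ws_append[of _ fs _ gs] by blast
 qed
 show "tensor_map (map sp fs) (map sp fs') f (map sp gs) (map sp gs') g : carrier (hom_space (Ts (fs @ gs)) (Ts (fs' @ gs')))"
  "X : carrier (Ts (fs @ gs)) ==> J (fs' @ gs') (tensor_map (map sp fs) (map sp fs') f (map sp gs) (map sp gs') g X) = ?P (J (fs @ gs) X)"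
  unfolding e by (rule low_hom[OF p m]; assumption)+
qed

lemma tensor_id_J:
 shows "linear_map (Ts fs) (Ts fs) (tensor_id (map sp fs))"
  and "y : Kset (BL fs) ==> lft fs fs (tensor_id (map sp fs)) y = y"
proof -
 interpret T: vs "Ts fs" by (rule vs_Ts)
 show l: "linear_map (Ts fs) (Ts fs) (tensor_id (map sp fs))"
  by (rule linear_mapI) (auto simp: tensor_id_def Ts_def[symmetric] T.smult_mem)
 show "y : Kset (BL fs) ==> lft fs fs (tensor_id (map sp fs)) y = y"
  using lft_Ji[OF l] by (simp add: tensor_id_def Ts_def[symmetric] Ji_mem J_Ji)
qed

text \<open>A tensor product with identities on both sides becomes insertion behind the letters that
  belong to \<open>ls\<close>.\<close>

lemma whisker_J:
 assumes f: "linear_map (Ts fs) (Ts gs) f"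
 shows "whisker (map sp ls) (map sp fs) (map sp gs) f (map sp rs) : carrier (hom_space (Ts (ls @ fs @ rs)) (Ts (ls @ gs @ rs)))"
  and "X : carrier (Ts (ls @ fs @ rs)) ==> J (ls @ gs @ rs) (whisker (map sp ls) (map sp fs) (map sp gs) f (map sp rs) X)
   = ins (length ls) (length fs) (lft fs gs f) (J (ls @ fs @ rs) X)"
proof -
 define k where "k = tensor_map (map sp fs) (map sp gs) f (map sp rs) (map sp rs) (tensor_id (map sp rs))"
 note k1 = tensor_map_J[OF f tensor_id_J(1)[of rs], folded k_def]
 have kl: "linear_map (Ts (fs @ rs)) (Ts (gs @ rs)) k" using k1(1) by (simp add: hom_iff)
 have w: "whisker (map sp ls) (map sp fs) (map sp gs) f (map sp rs)
  = tensor_map (map sp ls) (map sp ls) (tensor_id (map sp ls)) (map sp (fs @ rs)) (map sp (gs @ rs)) k"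
  by (simp add: whisker_def k_def)
 note w1 = tensor_map_J[OF tensor_id_J(1)[of ls] kl, folded w]
 show "whisker (map sp ls) (map sp fs) (map sp gs) f (map sp rs) : carrier (hom_space (Ts (ls @ fs @ rs)) (Ts (ls @ gs @ rs)))"
  by (rule w1(1))
 assume X: "X : carrier (Ts (ls @ fs @ rs))"
 have "par (length ls) (lft ls ls (tensor_id (map sp ls))) (lft (fs @ rs) (gs @ rs) k) y = ins (length ls) (length fs) (lft fs gs f) y"
  if y: "y : Kset (BL (ls @ fs @ rs))" for y
 proof (rule plin_eqI[OF _ plin_ins0 y])
  fix l assume l: "l : BL (ls @ fs @ rs)"
  note l1 = BL_append[OF l] and l2 = BL_append[OF conjunct2[OF BL_append[OF l]]]
  have len: "length l = length ls + (length fs + length rs)" using l by (auto simp: BL_def dest: list_all2_lengthD)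
  let ?t = "drop (length ls) l"
  have "lft (fs @ rs) (gs @ rs) k (mon ?t) = J (gs @ rs) (k (Ji (fs @ rs) (mon ?t)))"
   using l1 by (intro lft_Ji[OF kl]) simp
  also have "\<dots> = par (length fs) (lft fs gs f) (lft rs rs (tensor_id (map sp rs))) (mon ?t)"
   using l1 by (simp add: k1(2) Ji_mem J_Ji)
  also have "\<dots> = lft fs gs f (mon (take (length fs) ?t)) * mon (drop (length fs) ?t)"
   using l2 by (simp add: par_def tensor_id_J(2))
  finally show "par (length ls) (lft ls ls (tensor_id (map sp ls))) (lft (fs @ rs) (gs @ rs) k) (mon l)
   = ins (length ls) (length fs) (lft fs gs f) (mon l)"
   using l1 len by (simp add: par_def ins_def tensor_id_J(2) mult.assoc add.commute)
 qed (simp add: par_def plin_ext0)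
 then show "J (ls @ gs @ rs) (whisker (map sp ls) (map sp fs) (map sp gs) f (map sp rs) X)
   = ins (length ls) (length fs) (lft fs gs f) (J (ls @ fs @ rs) X)"
  using w1(2)[OF X] J_mem[OF X] by simp
qed


section \<open>The cochain operations in coordinates\<close>

definition sf :: "nat => bool list" where "sf n = replicate n False"
definition fo :: "nat => bool list" where "fo p = True # sf p"

lemma sf_append: "sf m @ sf n = sf (m + n)" by (simp add: sf_def replicate_add)
lemma fo_append: "fo m @ sf n = fo (m + n)" by (simp add: fo_def sf_append)
lemma length_sf [simp]: "length (sf n) = n" and length_fo [simp]: "length (fo n) = Suc n" by (simp_all add: sf_def fo_def)
lemma map_sf: "map sp (sf n) = sA n" and map_fo: "map sp (fo n) = Om n"
 by (simp_all add: sf_def fo_def sA_def Om_def sp_eqs)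
lemma T_sA: "tensor (sA n) = Ts (sf n)" and T_Om: "tensor (Om n) = Ts (fo n)"
 by (simp_all add: Ts_def map_sf map_fo)

lemma BL_sf: "BL (sf n) = VL n"
proof -
 have "list_all2 (%c b. c : bb b) l (replicate n False) \<longleftrightarrow> length l = n & set l \<subseteq> bS" for l
  by (induct n arbitrary: l) (auto simp: list_all2_Cons2 length_Suc_conv bb_def)
 then show ?thesis by (simp add: BL_def VL_def sf_def)
qed
lemma BL_fo: "BL (fo n) = WL n"
proof -
 have "BL (fo n) = {b # l |b l. b : bB & l : BL (sf n)}"
  by (auto simp: BL_def fo_def bb_def list_all2_Cons2)
 then show ?thesis by (simp add: BL_sf WL_def)
qed
lemma K_sf: "Kset (BL (sf n)) = V n" and K_fo: "Kset (BL (fo n)) = W n"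
 by (simp_all add: BL_sf BL_fo V_def W_def)

definition cch :: "nat => nat => ('k, 'a) cochain set" where
 "cch m p = carrier (hom_space (tensor (sA m)) (tensor (Om p)))"
definition lf :: "nat => nat => ('k, 'a) cochain => ('a list \<Rightarrow>\<^sub>0 'k) => 'a list \<Rightarrow>\<^sub>0 'k" where
 "lf m p f = lft (sf m) (fo p) f"

lemma cch_lin: "f : cch m p ==> linear_map (Ts (sf m)) (Ts (fo p)) f"
 by (simp add: cch_def hom_iff T_sA T_Om)
lemma cch_mem: "f : cch m p ==> X : carrier (Ts (sf m)) ==> f X : carrier (Ts (fo p))"
 by (rule linear_mapD(1)[OF cch_lin])
lemma coch_lf: "f : cch m p ==> coch m p (lf m p f)"
 unfolding coch_def lf_def using lft_mem[OF cch_lin, of f m p] by (auto simp: K_sf K_fo plin_lft0)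
lemma lf_J: "f : cch m p ==> X : carrier (Ts (sf m)) ==> lf m p f (J (sf m) X) = J (fo p) (f X)"
 unfolding lf_def by (rule lft_J[OF cch_lin])
lemma lf_eqI:
 assumes "f : cch m p" "!!X. X : carrier (Ts (sf m)) ==> J (fo p) (f X) = \<Phi> (J (sf m) X)" "w : V m"
 shows "lf m p f w = \<Phi> w"
 using lf_J[OF assms(1) Ji_mem, of w] assms(2)[OF Ji_mem, of w] assms(3) by (simp add: K_sf J_Ji)
lemma cch_eqI:
 assumes "f : cch m p" "g : cch m p" "!!w. w : V m ==> lf m p f w = lf m p g w"
 shows "f = g"
proof (rule extensionalityI[of _ "carrier (Ts (sf m))"])
 fix X assume X: "X : carrier (Ts (sf m))"
 show "f X = g X"
  using assms(3)[of "J (sf m) X"] J_mem[OF X]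
  by (intro J_inj[of _ "fo p"] cch_mem[OF assms(1) X] cch_mem[OF assms(2) X]) (simp add: K_sf lf_J[OF assms(1) X] lf_J[OF assms(2) X])
qed (use assms in \<open>auto simp: cch_def hom_iff T_sA T_Om\<close>)

lemma linear_compose: "linear_map U' V' f ==> linear_map V' W' g ==> linear_map U' W' (%x. g (f x))"
 by (auto simp: linear_map_def Pi_iff)
lemma linear_restrict: "vs U' ==> linear_map U' V' f ==> linear_map U' V' (\<lambda>x\<in>carrier U'. f x)"
 by (rule linear_mapI) (auto simp: linear_mapD vs.smult_mem intro!: abelian_monoid.a_closed[OF abelian_group.axioms(1)[OF Module.module.axioms(2)[OF vs.vs]]])

lemma ins_cong_V:
 assumes eq: "!!w. w : V n ==> ph w = \<psi> w" and y: "y : V j"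
 shows "ins k n ph y = ins k n \<psi> y"
 using y unfolding V_def
proof (rule plin_eqI[OF plin_ins0 plin_ins0])
 fix l assume l: "l : VL j"
 have "mon (take n (drop k l)) : V n" if "k + n <= length l"
  using that l set_take_subset[of n "drop k l"] set_drop_subset[of k l] by (auto simp: V_def VL_def)
 then show "ins k n ph (mon l) = ins k n \<psi> (mon l)" using eq by (simp add: ins_def)
qed
lemma ins_cong_W:
 assumes eq: "!!w. w : V n ==> ph w = \<psi> w" and y: "y : W j"
 shows "ins (Suc k) n ph y = ins (Suc k) n \<psi> y"
 using y unfolding W_def
proof (rule plin_eqI[OF plin_ins0 plin_ins0])
 fix l assume l: "l : WL j"
 obtain b l' where l': "l = b # l'" "l' : VL j" using l by (auto simp: WL_def)
 have "mon (take n (drop (Suc k) l)) : V n" if "Suc k + n <= length l"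
  using that l' set_take_subset[of n "drop k l'"] set_drop_subset[of k l'] by (auto simp: V_def VL_def)
 then show "ins (Suc k) n ph (mon l) = ins (Suc k) n \<psi> (mon l)" using eq by (simp add: ins_def)
qed
lemma Op_cong_V:
 assumes eq: "!!w. w : V n ==> ph w = \<psi> w" and y: "y : W j"
 shows "Op n ph y = Op n \<psi> y"
 using y unfolding W_def
proof (rule plin_eqI[OF plin_Op0 plin_Op0])
 fix l assume l: "l : WL j"
 have "mon (take n (tl l)) : V n" if "n < length l"
  using that l by (auto simp: V_def VL_def WL_def dest!: in_set_takeD)
 then show "Op n ph (mon l) = Op n \<psi> (mon l)" using eq by (simp add: Op_def)
qed

lemma theta_cch: "f : cch m p ==> theta m p f : cch (Suc m) (Suc p)"
 and theta_lf: "f : cch m p ==> w : V (Suc m) ==> lf (Suc m) (Suc p) (theta m p f) w = ins 0 m (lf m p f) w"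
proof -
 have e: "theta m p f = whisker (map sp []) (map sp (sf m)) (map sp (fo p)) f (map sp (sf 1))"
  by (simp add: theta_def map_sf map_fo)
 assume f: "f : cch m p"
 note w = whisker_J[OF cch_lin[OF f], where ls = "[]" and rs = "sf 1", folded e, unfolded append_Nil sf_append fo_append]
 show c: "theta m p f : cch (Suc m) (Suc p)" using w(1) by (simp add: cch_def T_sA T_Om)
 show "w : V (Suc m) ==> lf (Suc m) (Suc p) (theta m p f) w = ins 0 m (lf m p f) w"
  by (rule lf_eqI[OF c]) (use w(2) in \<open>simp add: lf_def\<close>)
qed

text \<open>The operator carries the letters behind the arguments along anyway, so tensoring with
  one more identity does not change it on words that have this extra letter. This is the reason why
  elements of the colimit correspond to germs.\<close>

lemma theta_Op:
 assumes f: "f : cch m p" and x: "x : W N" and N: "Suc m <= N"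
 shows "Op (Suc m) (lf (Suc m) (Suc p) (theta m p f)) x = Op m (lf m p f) x"
proof -
 obtain k where k: "N = Suc m + k" using N le_Suc_ex by blast
 note c = coch_lf[OF f]
 have "Op (Suc m) (lf (Suc m) (Suc p) (theta m p f)) x = Op (Suc m) (ins 0 m (lf m p f)) x"
  by (rule Op_cong_V[OF theta_lf[OF f] x])
 also have "\<dots> = Op m (lf m p f) x"
 proof (rule W_split_eqI[OF plin_Op0 plin_Op0 x[unfolded k]])
  fix y z assume y: "y : W (Suc m)" and z: "z : V k"
  have ic: "coch (Suc m) (Suc p) (ins 0 m (lf m p f))"
   unfolding coch_def using ins0_mem[OF c, of _ 1] by (auto simp: plin_ins0)
  show "Op (Suc m) (ins 0 m (lf m p f)) (y * z) = Op m (lf m p f) (y * z)"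
  proof (rule W_Suc_eqI[OF _ _ y, where f = "%y. Op (Suc m) (ins 0 m (lf m p f)) (y * z)"])
   fix y a assume y: "y : W m"
   show "Op (Suc m) (ins 0 m (lf m p f)) (y * v a * z) = Op m (lf m p f) (y * v a * z)"
   proof (rule W_eqI[OF _ _ y, where f = "%y. Op (Suc m) (ins 0 m (lf m p f)) (y * v a * z)"])
    fix t b assume t: "t : V m"
    show "Op (Suc m) (ins 0 m (lf m p f)) (u b * t * v a * z) = Op m (lf m p f) (u b * t * v a * z)"
     using Op_u[OF ic V_v_mem[OF t], of b a z] Op_u[OF c t, of b "v a * z"]
     by (simp add: mult.assoc ins0_V[OF c t] Lm_mult[OF coch_mem[OF c t]])
   qed (intro plin_intros)+
  qed (intro plin_intros)+
 qed
 finally show ?thesis .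
qed

text \<open>\<open>vv\<close> and \<open>ov\<close> are the coordinates of the generators
  \<open>bars w\<close> and \<open>om w\<close>.\<close>

definition vv :: "'a list => 'a list \<Rightarrow>\<^sub>0 'k" where "vv w = prod_list (map v w)"
definition ov :: "'a list => 'a list \<Rightarrow>\<^sub>0 'k" where "ov w = u (hd w) * vv (tl w)"

lemma cw_sf: "cw (sf (length w)) (map bar w) = vv w"
 by (induct w) (simp_all add: sf_def vv_def uv_def flip: sp_eqs)
lemma bar_ws: "map bar w : ws (sf (length w))"
 by (simp add: ws_iff sf_def list_all2_conv_all_nth sp_eqs(4)[symmetric])
lemma bars_pr: "bars w = pr (sf (length w)) (map bar w)"
 by (simp add: bars_def pr_def map_sf)
lemma J_bars: "length w = n ==> J (sf n) (bars w) = vv w" and bars_mem: "length w = n ==> bars w : carrier (Ts (sf n))"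
 using bar_ws[of w] by (auto simp: bars_pr J_pr cw_sf pr_mem)
lemma om_ws: "length w = Suc p ==> el (hd w) # map bar (tl w) : ws (fo p)"
 using bar_ws[of "tl w"] by (auto simp: fo_def ws_Cons sp_eqs(3)[symmetric])
lemma om_pr: "length w = Suc p ==> om w = pr (fo p) (el (hd w) # map bar (tl w))"
 by (simp add: om_def pr_def map_fo)
lemma J_om: "length w = Suc p ==> J (fo p) (om w) = ov w" and om_mem: "length w = Suc p ==> om w : carrier (Ts (fo p))"
proof -
 assume w: "length w = Suc p"
 have "cw (fo p) (el (hd w) # map bar (tl w)) = ov w"
  using cw_sf[of "tl w"] w by (simp add: fo_def ov_def uv_def flip: sp_eqs)
 then show "J (fo p) (om w) = ov w" "om w : carrier (Ts (fo p))"
  using om_ws[OF w] by (simp_all add: om_pr[OF w] J_pr pr_mem)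
qed
lemma ws_sf: "x : ws (sf n) \<longleftrightarrow> (\<exists>w. length w = n & x = map bar w)"
proof
 have "x : ws (sf n) ==> \<exists>w. length w = n & x = map bar w"
 proof (induct n arbitrary: x)
  case (Suc n)
  then obtain a x' where "x = bar a # x'" "x' : ws (sf n)" by (auto simp: sf_def ws_Cons sp_eqs)
  moreover then obtain w where "length w = n" "x' = map bar w" using Suc by blast
  ultimately show ?case by (intro exI[of _ "a # w"]) simp
 qed (simp add: sf_def)
 then show "x : ws (sf n) ==> \<exists>w. length w = n & x = map bar w" .
qed (use bar_ws in auto)
lemma ws_fo: "x : ws (fo p) \<longleftrightarrow> (\<exists>w. length w = Suc p & x = el (hd w) # map bar (tl w))"
proof
 assume "x : ws (fo p)"
 then obtain a w where "length w = p" "x = el a # map bar w" by (auto simp: fo_def ws_Cons ws_sf sp_eqs)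
 then show "\<exists>w. length w = Suc p & x = el (hd w) # map bar (tl w)" by (intro exI[of _ "a # w"]) simp
qed (use om_ws in auto)
text \<open>Relates quantification over pure tensors, as in \<open>the_linear_eq\<close>, to
  quantification over lists of algebra elements, as in the descriptions of the structure
  maps.\<close>

lemma ball_ws_sf: fixes P :: "_ => ('a list \<Rightarrow>\<^sub>0 'k) => bool" shows "(\<forall>x\<in>ws (sf n). P (pr (sf n) x) (cw (sf n) x)) \<longleftrightarrow> (\<forall>w. length w = n --> P (bars w) (vv w))"
proof (intro iffI allI impI ballI)
 fix w :: "'a list" assume a: "\<forall>x\<in>ws (sf n). P (pr (sf n) x) (cw (sf n) x)" and l: "length w = n"
 have "map bar w : ws (sf n)" using bar_ws[of w] l by simp
 with a have "P (pr (sf n) (map bar w)) (cw (sf n) (map bar w))" by blast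
 then show "P (bars w) (vv w)" using cw_sf[of w] by (simp add: bars_pr l)
next
 fix x assume "\<forall>w. length w = n --> P (bars w) (vv w)" "x : ws (sf n)"
 then show "P (pr (sf n) x) (cw (sf n) x)" by (auto simp: ws_sf bars_pr cw_sf)
qed
lemma ball_ws_fo: fixes P :: "_ => ('a list \<Rightarrow>\<^sub>0 'k) => bool" shows "(\<forall>x\<in>ws (fo p). P (pr (fo p) x) (cw (fo p) x)) \<longleftrightarrow> (\<forall>w. length w = Suc p --> P (om w) (ov w))"
proof -
 have "cw (fo p) (el (hd w) # map bar (tl w)) = ov w" if "length w = Suc p" for w
  using J_om[OF that] om_ws[OF that] by (simp add: om_pr[OF that] J_pr)
 note * = this
 show ?thesis
 proof (intro iffI allI impI ballI)
  fix w :: "'a list" assume a: "\<forall>x\<in>ws (fo p). P (pr (fo p) x) (cw (fo p) x)" and l: "length w = Suc p"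
  show "P (om w) (ov w)" using bspec[OF a om_ws[OF l]] by (simp add: * l om_pr)
 next
  fix x assume "\<forall>w. length w = Suc p --> P (om w) (ov w)" "x : ws (fo p)"
  then show "P (pr (fo p) x) (cw (fo p) x)" by (auto simp: ws_fo om_pr *)
 qed
qed

lemma vv_mem: "vv w : V (length w)"
 by (induct w) (simp_all add: vv_def one_mem_V v_V_mem)
lemma ov_mem: "length w = Suc p ==> ov w : W p"
 using u_V_mem[OF vv_mem, of "hd w" "tl w"] by (simp add: ov_def)
lemma ov_snoc: "w ~= [] ==> ov (w @ [c]) = ov w * v c"
 by (cases w) (simp_all add: ov_def vv_def mult.assoc)

lemma merge_snoc: "Suc i < length w ==> merge i (w @ [b]) = merge i w @ [b]"
 by (simp add: merge_def nth_append)
lemma length_merge: "Suc i < length w ==> length (merge i w) = length w - 1"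
 by (simp add: merge_def)

text \<open>The last summand is the product at the right end. In all the others b is carried along
  as an untouched last letter, and together they are the sum for the shorter word with the opposite
  sign; this is the recursion \<open>R_v\<close>.\<close>

lemma R_ov: "length w = Suc p ==> R b (ov w) = (\<Sum>i = 0..p. eps (int p - int i) (ov (merge i (w @ [b]))))"
proof (induct p arbitrary: w b)
 case 0
 then obtain a where "w = [a]" by (auto simp: length_Suc_conv)
 then show ?case by (simp add: ov_def vv_def merge_def R_u)
next
 case (Suc p)
 define c where "c = last w"
 define w' where "w' = butlast w"
 have "w ~= []" using Suc(2) by auto
 then have w: "w = w' @ [c]" by (simp add: w'_def c_def)
 have l: "length w' = Suc p" using Suc(2) by (simp add: w'_def)
 then have ne: "w' ~= []" by auto
 have m1: "merge (Suc p) (w @ [b]) = w' @ [c * b]" using l by (simp add: w merge_def nth_append)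
 have m2: "merge i (w @ [b]) = merge i (w' @ [c]) @ [b]" "merge i (w' @ [c]) ~= []" if "i <= p" for i
  using that l merge_snoc[of i "w' @ [c]" b] by (auto simp: w merge_def)
 have "(\<Sum>i = 0..p. eps (int (Suc p) - int i) (ov (merge i (w @ [b])))) = - (R c (ov w') * v b)"
 proof -
  have "(\<Sum>i = 0..p. eps (int (Suc p) - int i) (ov (merge i (w @ [b])))) = (\<Sum>i = 0..p. - (eps (int p - int i) (ov (merge i (w' @ [c]))) * v b))"
   by (intro sum.cong refl) (auto simp: m2 ov_snoc eps_def)
  then show ?thesis by (simp add: Suc(1)[OF l] sum_negf sum_distrib_right)
 qed
 then show ?case
  using R_v[OF ov_mem[OF l], of b c] m1 ne by (simp add: w ov_snoc)
qed

lemma left_act_low: "left_act p b = low (fo p) (fo p) (Lm b)"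
 unfolding left_act_def T_Om
proof (rule the_linear_eq[OF plin_Lm0])
 show "Lm b y : Kset (BL (fo p))" if "y : Kset (BL (fo p))" for y
  using that by (simp add: K_fo Lm_mem)
 fix h assume h: "h : carrier (hom_space (Ts (fo p)) (Ts (fo p)))"
 have "(h (om (a # w)) = om (b * a # w)) \<longleftrightarrow> J (fo p) (h (om (a # w))) = Lm b (ov (a # w))" if "length w = p" for a w
 proof -
  have m: "h (om (a # w)) : carrier (Ts (fo p))" "om (b * a # w) : carrier (Ts (fo p))"
   using h that om_mem[of "a # w" p] om_mem[of "b * a # w" p] by (auto simp: hom_iff linear_mapD(1)[of "Ts (fo p)"])
  show ?thesis using J_inj[OF m] J_om[of "b * a # w" p] that by (auto simp: ov_def Lm_u)
 qed
 then have "(\<forall>a w. length w = p --> h (om (a # w)) = om (b * a # w)) \<longleftrightarrow>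
  (\<forall>a w. length w = p --> J (fo p) (h (om (a # w))) = Lm b (ov (a # w)))" by blast
 also have "\<dots> \<longleftrightarrow> (\<forall>w. length w = Suc p --> J (fo p) (h (om w)) = Lm b (ov w))" by (auto simp: length_Suc_conv)
 finally show "(\<forall>a w. length w = p --> h (om (a # w)) = om (b * a # w))
  \<longleftrightarrow> (\<forall>w\<in>ws (fo p). J (fo p) (h (pr (fo p) w)) = Lm b (cw (fo p) w))"
  unfolding ball_ws_fo[where P = "%x y. J (fo p) (h x) = Lm b y"] .
qed

lemma left_act_J: "X : carrier (Ts (fo p)) ==> J (fo p) (left_act p b X) = Lm b (J (fo p) X)"
 and left_act_mem: "X : carrier (Ts (fo p)) ==> left_act p b X : carrier (Ts (fo p))"
proof -
 note l = low_hom[OF plin_Lm0, of "fo p" b "fo p", folded left_act_low]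
 show "X : carrier (Ts (fo p)) ==> J (fo p) (left_act p b X) = Lm b (J (fo p) X)"
  by (rule l(2)) (simp_all add: K_fo Lm_mem)
 have "left_act p b : carrier (hom_space (Ts (fo p)) (Ts (fo p)))" by (rule l(1)) (simp add: K_fo Lm_mem)
 then show "X : carrier (Ts (fo p)) ==> left_act p b X : carrier (Ts (fo p))"
  by (auto simp: hom_iff linear_mapD(1)[of "Ts (fo p)"])
qed

lemma right_act_low: "right_act p X b = low (fo p) (fo p) (R b) X"
 unfolding right_act_def T_Om
proof (rule fun_cong[of _ _ X], rule the_linear_eq[OF plin_R0])
 show "R b y : Kset (BL (fo p))" if "y : Kset (BL (fo p))" for y
  using that by (simp add: K_fo R_mem)
 interpret T: vs "Ts (fo p)" by (rule vs_Ts)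
 fix h assume h: "h : carrier (hom_space (Ts (fo p)) (Ts (fo p)))"
 have "(h (om w) = (\<Oplus>\<^bsub>Ts (fo p)\<^esub>i\<in>{0..p}. signed (Ts (fo p)) (int p - int i) (om (merge i (w @ [b])))))
   \<longleftrightarrow> J (fo p) (h (om w)) = R b (ov w)" if w: "length w = Suc p" for w
 proof -
  have o: "om (merge i (w @ [b])) : carrier (Ts (fo p))" "J (fo p) (om (merge i (w @ [b]))) = ov (merge i (w @ [b]))" if "i : {0..p}" for i
   using length_merge[of i "w @ [b]"] w that by (auto intro: om_mem J_om)
  have m: "h (om w) : carrier (Ts (fo p))" using h om_mem[OF w] by (auto simp: hom_iff linear_mapD(1)[of "Ts (fo p)"])
  have s: "(\<Oplus>\<^bsub>Ts (fo p)\<^esub>i\<in>{0..p}. signed (Ts (fo p)) (int p - int i) (om (merge i (w @ [b])))) : carrier (Ts (fo p))"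
   by (rule T.finsum_closed) (auto intro: T.signed_mem o)
  have "J (fo p) (\<Oplus>\<^bsub>Ts (fo p)\<^esub>i\<in>{0..p}. signed (Ts (fo p)) (int p - int i) (om (merge i (w @ [b])))) = R b (ov w)"
   unfolding R_ov[OF w] by (subst J_finsum) (auto intro!: T.signed_mem sum.cong simp: o J_signed)
  then show ?thesis using J_inj[OF m s] by auto
 qed
 then show "(\<forall>w. length w = p + 1 --> h (om w) = (\<Oplus>\<^bsub>Ts (fo p)\<^esub>i\<in>{0..p}. signed (Ts (fo p)) (int p - int i) (om (merge i (w @ [b])))))
  \<longleftrightarrow> (\<forall>w\<in>ws (fo p). J (fo p) (h (pr (fo p) w)) = R b (cw (fo p) w))"
  unfolding ball_ws_fo[where P = "%x y. J (fo p) (h x) = R b y"] by simp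
qed

lemma right_act_J: "X : carrier (Ts (fo p)) ==> J (fo p) (right_act p X b) = R b (J (fo p) X)"
 and right_act_mem: "X : carrier (Ts (fo p)) ==> right_act p X b : carrier (Ts (fo p))"
proof -
 have "low (fo p) (fo p) (R b) : carrier (hom_space (Ts (fo p)) (Ts (fo p)))" by (rule low_hom(1)[OF plin_R0]) (simp add: K_fo R_mem)
 then show "X : carrier (Ts (fo p)) ==> right_act p X b : carrier (Ts (fo p))"
  unfolding right_act_low by (auto simp: hom_iff linear_mapD(1)[of "Ts (fo p)"])
 show "X : carrier (Ts (fo p)) ==> J (fo p) (right_act p X b) = R b (J (fo p) X)"
  unfolding right_act_low by (rule low_hom(2)[OF plin_R0]) (simp_all add: K_fo R_mem)
qed


lemma whisker_lin:
 assumes "linear_map (Ts fs) (Ts gs) f"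
 shows "linear_map (Ts (ls @ fs @ rs)) (Ts (ls @ gs @ rs)) (whisker (map sp ls) (map sp fs) (map sp gs) f (map sp rs))"
 using whisker_J(1)[OF assms, of ls rs] by (simp add: hom_iff)

lemma sA_flags: "sA n = map sp (sf n)" "Om n = map sp (fo n)" "[fA] = map sp [True]" "[fA, fA] = map sp [True, True]"
 "[fS] = map sp [False]" "fA # sA n = map sp (fo n)"
 by (simp_all add: map_sf map_fo sp_eqs Om_def)

lemma wA: assumes f: "f : cch m p"
 shows "linear_map (Ts (sf (m + k))) (Ts (fo (p + k))) (whisker [] (sA m) (Om p) f (sA k))"
  and "X : carrier (Ts (sf (m + k))) ==> J (fo (p + k)) (whisker [] (sA m) (Om p) f (sA k) X) = ins 0 m (lf m p f) (J (sf (m + k)) X)"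
 using whisker_lin[OF cch_lin[OF f], of "[]" "sf k"] whisker_J(2)[OF cch_lin[OF f], where ls = "[]" and rs = "sf k"]
 by (simp_all add: sA_flags(1,2) sf_append fo_append lf_def)

lemma wB: assumes f: "f : cch m p"
 shows "linear_map (Ts (fo (m + k))) (Ts (True # fo (p + k))) (whisker [fA] (sA m) (Om p) f (sA k))"
  and "X : carrier (Ts (fo (m + k))) ==> J (True # fo (p + k)) (whisker [fA] (sA m) (Om p) f (sA k) X) = ins 1 m (lf m p f) (J (fo (m + k)) X)"
 using whisker_lin[OF cch_lin[OF f], of "[True]" "sf k"] whisker_J(2)[OF cch_lin[OF f], where ls = "[True]" and rs = "sf k"]
 unfolding sA_flags(1,2,3)
 by (simp_all add: sf_append fo_append lf_def flip: fo_def)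

definition mul2 :: "('a list \<Rightarrow>\<^sub>0 'k) => 'a list \<Rightarrow>\<^sub>0 'k" where "mul2 = ext (%l. Lm (hd l) (mon (tl l)))"

lemma plin_mul2: "plin mul2" unfolding mul2_def by (rule plin_ext0)
lemma mul2_u: "mul2 (u a * y) = Lm a y"
proof (rule alin_eqI[where a = a and f = "%a. mul2 (u a * y)"])
 show "alin (%a. mul2 (u a * y))" by (rule alin_comp[OF plin_mul2]) (intro alin_intros)
 show "alin (%a. Lm a y)" by (rule alin_Lm)
 fix b assume b: "b : bB"
 show "mul2 (u b * y) = Lm b y"
  by (rule plin_eqI[where f = "%y. mul2 (u b * y)" and L = UNIV])
   (auto intro!: plin_intros plin_comp[OF plin_mul2] simp: Kset_def u_basis b mon_mult mul2_def)
qed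

lemma BL_True: "Kset (BL [True]) = W 0" using K_fo[of 0] by (simp add: fo_def sf_def)

lemma mu_lin: "linear_map (Ts [True, True]) (Ts [True]) mu"
 and mu_lft: "y : W 0 ==> lft [True, True] [True] mu (u a * y) = Lm a y"
proof -
 have m: "mul2 y : W 0" if y: "y : Kset (BL [True, True])" for y
 proof (rule plin_memI[OF plin_mul2 psub_W y])
  fix l assume "l : BL [True, True]"
  then obtain b c where l: "l = [b, c]" "b : bB" "c : bB" by (auto simp: BL_def bb_def list_all2_Cons2)
  have "mon l = u b * u c" using l by (simp add: u_basis mon_mult)
  then show "mul2 (mon l) : W 0" by (simp add: mul2_u Lm_u' u_mem)
 qed
 have e: "mu = low [True, True] [True] mul2"
  unfolding mu_def unfolding sA_flags(4) unfolding sA_flags(3) Ts_def[symmetric]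
 proof (rule the_linear_eq[OF plin_mul2])
  show "mul2 y : Kset (BL [True])" if "y : Kset (BL [True, True])" for y using m[OF that] by (simp add: BL_True)
  fix h assume h: "h : carrier (hom_space (Ts [True, True]) (Ts [True]))"
  have w2: "[cf True a, cf True b] : ws [True, True]" and w1: "[cf True a] : ws [True]" for a b by (auto simp: ws_Cons)
  have *: "(h (pr [True, True] [cf True a, cf True b]) = pr [True] [cf True (a * b)]) \<longleftrightarrow>
   J [True] (h (pr [True, True] [cf True a, cf True b])) = mul2 (cw [True, True] [cf True a, cf True b])" for a b
  proof -
   have "h (pr [True, True] [cf True a, cf True b]) : carrier (Ts [True])"
    using h pr_mem[OF w2] by (auto simp: hom_iff linear_mapD(1)[of "Ts [True, True]"])
   note i = J_inj[OF this pr_mem[OF w1]]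
   have e: "mul2 (cw [True, True] [cf True a, cf True b]) = J [True] (pr [True] [cf True (a * b)])"
    unfolding J_pr[OF w1] by (simp add: mul2_u uv_def Lm_u')
   show ?thesis unfolding e using i by (intro iffI arg_cong[of _ _ "J [True]"])
  qed
  show "(\<forall>a b. h (pure (map sp [True, True]) [el a, el b]) = pure (map sp [True]) [el (a * b)]) \<longleftrightarrow>
   (\<forall>w\<in>ws [True, True]. J [True] (h (pr [True, True] w)) = mul2 (cw [True, True] w))"
  proof -
   have "(\<forall>w\<in>ws [True, True]. Q w) \<longleftrightarrow> (\<forall>a b. Q [cf True a, cf True b])" for Q
    by (rule iffI) (use w2 in blast, auto simp: ws_Cons)
   then show ?thesis unfolding sp_eqs(3)[symmetric] pr_def[symmetric] by (simp only: *)
  qed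
 qed
 have l: "mu : carrier (hom_space (Ts [True, True]) (Ts [True]))"
  unfolding e by (rule low_hom(1)[OF plin_mul2]) (simp add: BL_True m)
 then show lin: "linear_map (Ts [True, True]) (Ts [True]) mu" by (simp add: hom_iff)
 assume y: "y : W 0"
 have uy: "u a * y : Kset (BL [True, True])"
  by (rule Kset_mult[OF u_mem[of a, folded BL_True] y[folded BL_True]]) (auto simp: BL_def list_all2_Cons2)
 show "lft [True, True] [True] mu (u a * y) = Lm a y"
  unfolding lft_Ji[OF lin uy] unfolding e
  by (subst low_hom(2)[OF plin_mul2]) (simp_all add: BL_True m Ji_mem uy J_Ji mul2_u)
qed

lemma wM:
 shows "linear_map (Ts (True # fo k)) (Ts (fo k)) (whisker [] [fA, fA] [fA] mu (sA k))"
  and "X : carrier (Ts (True # fo k)) ==> J (fo k) (whisker [] [fA, fA] [fA] mu (sA k) X) = ins 0 2 (lft [True, True] [True] mu) (J (True # fo k) X)"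
 using whisker_lin[OF mu_lin, of "[]" "sf k"] whisker_J(2)[OF mu_lin, where ls = "[]" and rs = "sf k"]
 unfolding sA_flags(4) unfolding sA_flags(1,3) by (simp_all add: fo_def numeral_2_eq_2)

text \<open>The cup product passes through a space with two factors A. Inserting the cochain behind
  the first factor and then multiplying the two is its left linear operator.\<close>

lemma mu_Op:
 assumes c: "coch m p ph" and y: "y : W (m + k)"
 shows "ins 0 2 (lft [True, True] [True] mu) (ins 1 m ph y) = Op m ph y"
proof (rule W_split_eqI[OF _ plin_Op0 y, where f = "%y. ins 0 2 (lft [True, True] [True] mu) (ins 1 m ph y)"])
 fix y z assume y: "y : W m" and z: "z : V k"
 show "ins 0 2 (lft [True, True] [True] mu) (ins 1 m ph (y * z)) = Op m ph (y * z)"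
 proof (rule W_eqI[OF _ _ y, where f = "%y. ins 0 2 (lft [True, True] [True] mu) (ins 1 m ph (y * z))"])
  fix t a assume t: "t : V m"
  have 1: "ins 1 m ph (u a * t * z) = u a * ph t * z"
   by (rule ins_mult[OF coch_plin[OF c] _ V_H[OF t]]) (use W_H[OF u_mem] in simp)
  have 2: "ins 0 2 (lft [True, True] [True] mu) (u a * s * z) = Lm a s * z" if "s : W p" for s
  proof (rule W_eqI[OF _ _ that, where f = "%s. ins 0 2 (lft [True, True] [True] mu) (u a * s * z)"])
   fix r b assume "r : V p"
   have "u a * u b : Hh 2" using Hh_mult[OF W_H[OF u_mem] W_H[OF u_mem], of a b] by (simp add: numeral_2_eq_2)
   from ins0_mult[OF plin_lft0 this, of "[True, True]" "[True]" mu "r * z"]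
   show "ins 0 2 (lft [True, True] [True] mu) (u a * (u b * r) * z) = Lm a (u b * r) * z"
    by (simp add: mult.assoc mu_lft[OF u_mem] Lm_u Lm_u')
  qed (intro plin_intros)+
  show "ins 0 2 (lft [True, True] [True] mu) (ins 1 m ph (u a * t * z)) = Op m ph (u a * t * z)"
   unfolding 1 2[OF coch_mem[OF c t]] Op_u[OF c t] ..
 qed (intro plin_intros)+
qed (intro plin_intros)+

lemma cch_restrictI: "linear_map (Ts (sf m)) (Ts (fo p)) h ==> (\<lambda>x\<in>carrier (tensor (sA m)). h x) : cch m p"
 by (simp add: cch_def hom_iff T_sA T_Om linear_restrict[OF vs_Ts])

lemma cup_cch: "f : cch m p ==> g : cch n q ==> cup m p f n q g : cch (m + n) (p + q)"
 and cup_lf: "f : cch m p ==> g : cch n q ==> w : V (m + n) ==>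
  lf (m + n) (p + q) (cup m p f n q g) w = cupo m (lf m p f) n (lf n q g) w"
proof -
 assume f: "f : cch m p" and g: "g : cch n q"
 note a = wA[OF g, where k = m] and b = wB[OF f, where k = q] and c = wM[where k = "p + q"]
 note l = linear_compose[OF linear_compose[OF a(1) b(1)[unfolded add.commute[of m q]]] c(1)]
 show c': "cup m p f n q g : cch (m + n) (p + q)"
  unfolding cup_def by (rule cch_restrictI) (use l in \<open>simp add: add.commute\<close>)
 assume w: "w : V (m + n)"
 show "lf (m + n) (p + q) (cup m p f n q g) w = cupo m (lf m p f) n (lf n q g) w"
 proof (rule lf_eqI[OF c' _ w])
  fix X assume X: "X : carrier (Ts (sf (m + n)))"
  then have X': "X : carrier (Ts (sf (n + m)))" by (simp add: add.commute)
  note Xa = linear_mapD(1)[OF a(1) X', unfolded add.commute[of q m]]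
  note Xb = linear_mapD(1)[OF b(1) Xa]
  have JX: "J (sf (n + m)) X : V (n + m)" using J_mem[OF X'] by (simp add: K_sf)
  show "J (fo (p + q)) (cup m p f n q g X) = cupo m (lf m p f) n (lf n q g) (J (sf (m + n)) X)"
   using X mu_Op[OF coch_lf[OF f], of _ q] ins0_mem[OF coch_lf[OF g] JX]
   by (simp add: cup_def T_sA c(2)[OF Xb] b(2)[OF Xa] a(2)[OF X', unfolded add.commute[of q m]] cupo_def add.commute)
 qed
qed

lemma cup_Op:
 assumes f: "f : cch m p" and g: "g : cch n q" and x: "x : W N" and N: "m + n <= N"
 shows "Op (m + n) (lf (m + n) (p + q) (cup m p f n q g)) x = Op m (lf m p f) (Op n (lf n q g) x)"
 using Op_cong_V[OF cup_lf[OF f g] x] Op_cupo[OF coch_lf[OF f] coch_lf[OF g], of m x N] x N by (simp add: add.commute)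

lemma BL_False: "Kset (BL [False]) = V 1" using K_sf[of 1] by (simp add: sf_def)

lemma proj_lin: "linear_map (Ts [True]) (Ts [False]) proj"
 and proj_lft: "y : W 0 ==> lft [True] [False] proj y = ba y"
proof -
 have m: "ba y : Kset (BL [False])" if y: "y : Kset (BL [True])" for y using y ba_mem[of y 0] unfolding BL_True BL_False by simp
 have e: "proj = low [True] [False] ba"
  unfolding proj_def sA_flags(3,5) Ts_def[symmetric]
 proof (rule the_linear_eq[OF plin_ba0])
  show "ba y : Kset (BL [False])" if "y : Kset (BL [True])" for y using m[OF that] .
  fix h assume h: "h : carrier (hom_space (Ts [True]) (Ts [False]))"
  have w2: "[cf True a] : ws [True]" and w1: "[cf False a] : ws [False]" for a b by (auto simp: ws_Cons)
  have *: "(h (pr [True] [cf True a]) = pr [False] [cf False a]) \<longleftrightarrow>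
   J [False] (h (pr [True] [cf True a])) = ba (cw [True] [cf True a])" for a
  proof -
   have "h (pr [True] [cf True a]) : carrier (Ts [False])"
    using h pr_mem[OF w2] by (auto simp: hom_iff linear_mapD(1)[of "Ts [True]"])
   note i = J_inj[OF this pr_mem[OF w1]]
   have e: "ba (cw [True] [cf True a]) = J [False] (pr [False] [cf False a])"
    unfolding J_pr[OF w1] by (simp add: uv_def ba_u')
   show ?thesis unfolding e using i by (intro iffI arg_cong[of _ _ "J [False]"])
  qed
  show "(\<forall>a. h (pure (map sp [True]) [el a]) = pure (map sp [False]) [bar a]) \<longleftrightarrow>
   (\<forall>w\<in>ws [True]. J [False] (h (pr [True] w)) = ba (cw [True] w))"
  proof -
   have "(\<forall>w\<in>ws [True]. Q w) \<longleftrightarrow> (\<forall>a. Q [cf True a])" for Q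
    by (rule iffI) (use w2 in blast, auto simp: ws_Cons)
   then show ?thesis unfolding sp_eqs(3,4)[symmetric] pr_def[symmetric] by (simp only: *)
  qed
 qed
 have l: "proj : carrier (hom_space (Ts [True]) (Ts [False]))"
  unfolding e by (rule low_hom(1)[OF plin_ba0]) (simp add: m)
 then show lin: "linear_map (Ts [True]) (Ts [False]) proj" by (simp add: hom_iff)
 assume "y : W 0"
 then have y: "y : Kset (BL [True])" by (simp add: BL_True)
 show "lft [True] [False] proj y = ba y"
  unfolding lft_Ji[OF lin y] unfolding e
  by (subst low_hom(2)[OF plin_ba0]) (simp_all add: m Ji_mem y J_Ji)
qed

lemma wP:
 shows "linear_map (Ts (fo q)) (Ts (sf (Suc q))) (whisker [] [fA] [fS] proj (sA q))"
  and "X : carrier (Ts (fo q)) ==> J (sf (Suc q)) (whisker [] [fA] [fS] proj (sA q) X) = ba (J (fo q) X)"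
proof -
 note s = fo_def sf_def
 show "linear_map (Ts (fo q)) (Ts (sf (Suc q))) (whisker [] [fA] [fS] proj (sA q))"
  using whisker_lin[OF proj_lin, of "[]" "sf q"] unfolding sA_flags(1,3,5) by (simp add: s)
 assume X: "X : carrier (Ts (fo q))"
 have 1: "J (sf (Suc q)) (whisker [] [fA] [fS] proj (sA q) X) = ins 0 1 (lft [True] [False] proj) (J (fo q) X)"
  using whisker_J(2)[OF proj_lin, where ls = "[]" and rs = "sf q"] X unfolding sA_flags(1,3,5) by (simp add: s)
 have JX: "J (fo q) X : W q" using J_mem[OF X] by (simp add: K_fo)
 show "J (sf (Suc q)) (whisker [] [fA] [fS] proj (sA q) X) = ba (J (fo q) X)"
  unfolding 1
 proof (rule W_eqI[OF _ _ JX, where f = "ins 0 1 (lft [True] [False] proj)"])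
  fix y a assume "y : V q"
  show "ins 0 1 (lft [True] [False] proj) (u a * y) = ba (u a * y)"
   using ins0_mult[OF plin_lft0, of "u a" 1 "[True]" "[False]" proj y] W_H[OF u_mem, of a] by (simp add: proj_lft u_mem ba_u ba_u')
 qed (intro plin_intros)+
qed

lemma red_lin: "g : cch n q ==> linear_map (Ts (sf n)) (Ts (sf (Suc q))) (reduce n q g)"
 and red_lft: "g : cch n q ==> w : V n ==> lft (sf n) (sf (Suc q)) (reduce n q g) w = ba (lf n q g w)"
proof -
 assume g: "g : cch n q"
 show l: "linear_map (Ts (sf n)) (Ts (sf (Suc q))) (reduce n q g)"
  unfolding reduce_def T_sA by (rule linear_restrict[OF vs_Ts linear_compose[OF cch_lin[OF g] wP(1)]])
 assume "w : V n"
 then have w: "w : Kset (BL (sf n))" by (simp add: K_sf)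
 note gm = cch_mem[OF g Ji_mem[OF w]]
 show "lft (sf n) (sf (Suc q)) (reduce n q g) w = ba (lf n q g w)"
  unfolding lft_Ji[OF l w] using lf_J[OF g Ji_mem[OF w]] by (simp add: reduce_def T_sA Ji_mem[OF w] wP(2)[OF gm] J_Ji[OF w])
qed

lemma wR1: assumes g: "g : cch n q"
 shows "linear_map (Ts (sf (k + n + l))) (Ts (sf (k + Suc q + l))) (whisker (sA k) (sA n) (sA (q + 1)) (reduce n q g) (sA l))"
  and "X : carrier (Ts (sf (k + n + l))) ==> J (sf (k + Suc q + l)) (whisker (sA k) (sA n) (sA (q + 1)) (reduce n q g) (sA l) X)
   = gi k n (lf n q g) (J (sf (k + n + l)) X)"
proof -
 show "linear_map (Ts (sf (k + n + l))) (Ts (sf (k + Suc q + l))) (whisker (sA k) (sA n) (sA (q + 1)) (reduce n q g) (sA l))"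
  using whisker_lin[OF red_lin[OF g], of "sf k" "sf l"] by (simp add: sA_flags(1) sf_append add.assoc)
 assume X: "X : carrier (Ts (sf (k + n + l)))"
 then have JX: "J (sf (k + n + l)) X : V (k + n + l)" using J_mem[OF X] by (simp add: K_sf)
 have "J (sf (k + Suc q + l)) (whisker (sA k) (sA n) (sA (q + 1)) (reduce n q g) (sA l) X)
   = ins k n (lft (sf n) (sf (Suc q)) (reduce n q g)) (J (sf (k + n + l)) X)"
  using whisker_J(2)[OF red_lin[OF g], where ls = "sf k" and rs = "sf l"] X by (simp add: sA_flags(1) sf_append add.assoc)
 then show "J (sf (k + Suc q + l)) (whisker (sA k) (sA n) (sA (q + 1)) (reduce n q g) (sA l) X)
   = gi k n (lf n q g) (J (sf (k + n + l)) X)"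
  using ins_cong_V[OF red_lft[OF g] JX] by simp
qed

lemma wR2: assumes g: "g : cch n q"
 shows "linear_map (Ts (fo (k + n + l))) (Ts (fo (k + Suc q + l))) (whisker (fA # sA k) (sA n) (sA (q + 1)) (reduce n q g) (sA l))"
  and "X : carrier (Ts (fo (k + n + l))) ==> J (fo (k + Suc q + l)) (whisker (fA # sA k) (sA n) (sA (q + 1)) (reduce n q g) (sA l) X)
   = gi (Suc k) n (lf n q g) (J (fo (k + n + l)) X)"
proof -
 show "linear_map (Ts (fo (k + n + l))) (Ts (fo (k + Suc q + l))) (whisker (fA # sA k) (sA n) (sA (q + 1)) (reduce n q g) (sA l))"
  using whisker_lin[OF red_lin[OF g], of "fo k" "sf l"] unfolding sA_flags(6) unfolding sA_flags(1) by (simp add: sf_append fo_append add.assoc)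
 assume X: "X : carrier (Ts (fo (k + n + l)))"
 then have JX: "J (fo (k + n + l)) X : W (k + n + l)" using J_mem[OF X] by (simp add: K_fo)
 have "J (fo (k + Suc q + l)) (whisker (fA # sA k) (sA n) (sA (q + 1)) (reduce n q g) (sA l) X)
   = ins (Suc k) n (lft (sf n) (sf (Suc q)) (reduce n q g)) (J (fo (k + n + l)) X)"
  using whisker_J(2)[OF red_lin[OF g], where ls = "fo k" and rs = "sf l"] X unfolding sA_flags(6) unfolding sA_flags(1) by (simp add: sf_append fo_append add.assoc)
 then show "J (fo (k + Suc q + l)) (whisker (fA # sA k) (sA n) (sA (q + 1)) (reduce n q g) (sA l) X)
   = gi (Suc k) n (lf n q g) (J (fo (k + n + l)) X)"
  using ins_cong_W[OF red_lft[OF g] JX] by simp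
qed

lemma gi_V_mem: "coch n q ga ==> w : V (k + n + l) ==> gi k n ga w : V (k + Suc q + l)"
proof -
 assume c: "coch n q ga" and w: "w : V (k + n + l)"
 note p = plin_comp[OF plin_ba0 coch_plin[OF c]]
 have "V (k + n + l) \<subseteq> {w. gi k n ga w : V (k + Suc q + l)}"
 proof (rule V_split_subI)
  fix y z assume y: "y : V (k + n)" and z: "z : V l"
  have "V (k + n) \<subseteq> {y. gi k n ga (y * z) : V (k + Suc q + l)}"
  proof (rule V_split_subI)
   show "y * w : {y. gi k n ga (y * z) : V (k + Suc q + l)}" if "y : V k" "w : V n" for y w
    using V_V_mem[OF V_V_mem[OF that(1) ba_mem[OF coch_mem[OF c that(2)]]] z]
    by (simp add: ins_mult[OF p V_H[OF that(1)] V_H[OF that(2)]])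
  qed (intro psub_vimage plin_intros psub_V)
  then show "y * z : {w. gi k n ga w : V (k + Suc q + l)}" using y by blast
 qed (auto intro!: psub_vimage plin_ins0)
 then show ?thesis using w by auto
qed

lemma gi_W_mem: "coch n q ga ==> x : W (k + n + l) ==> gi (Suc k) n ga x : W (k + Suc q + l)"
proof (rule W_memI[where f = "gi (Suc k) n ga"])
 fix y a assume c: "coch n q ga" and y: "y : V (k + n + l)"
 show "gi (Suc k) n ga (u a * y) : W (k + Suc q + l)"
  using ins_shift[of "u a" 1 k n _ y] W_H[OF u_mem, of a] u_V_mem[OF gi_V_mem[OF c y]] by simp
qed (auto intro: plin_ins0)

lemma gi_u: "gi (Suc k) n ga (u a * y) = u a * gi k n ga y"
 using ins_shift[of "u a" 1 k n _ y] W_H[OF u_mem, of a] by simp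

lemma gi_Lm: "x : W N ==> gi (Suc k) n ga (Lm a x) = Lm a (gi (Suc k) n ga x)"
 by (rule W_eqI[where f = "%x. gi (Suc k) n ga (Lm a x)"]) (auto intro!: plin_intros simp: gi_u Lm_u)

text \<open>Left linearity reduces the claim to words beginning with 1, and right multiplicativity
  to words with exactly M arguments. It serves to identify the operators of cochains that are built
  from others.\<close>

lemma Op_crit:
 assumes c: "coch M P \<eta>" and p: "plin \<Phi>" and eq: "!!w. w : V M ==> \<eta> w = \<Phi> (u 1 * w)"
  and L: "!!x a. x : W M ==> \<Phi> (Lm a x) = Lm a (\<Phi> x)"
  and r: "!!x z. x : W M ==> \<Phi> (x * z) = \<Phi> x * z"
  and x: "x : W N" and N: "M <= N"
 shows "Op M \<eta> x = \<Phi> x"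
proof -
 obtain k where k: "N = M + k" using N le_Suc_ex by blast
 show ?thesis
 proof (rule W_split_eqI[OF plin_Op0 p x[unfolded k]])
  fix y z assume y: "y : W M" and z: "z : V k"
  have "Op M \<eta> y = \<Phi> y"
  proof (rule W_eqI[OF plin_Op0 p y])
   fix t a assume t: "t : V M"
   have "u a * t = Lm a (u 1 * t)" by (simp add: Lm_u)
   then have "\<Phi> (u a * t) = Lm a (\<Phi> (u 1 * t))" by (simp only: L[OF u_V_mem[OF t]])
   then show "Op M \<eta> (u a * t) = \<Phi> (u a * t)" by (simp add: Op_u'[OF c t] eq[OF t])
  qed
  then show "Op M \<eta> (y * z) = \<Phi> (y * z)" by (simp add: r[OF y] Op_mult[OF c y])
 qed
qed

lemma Op_ins0: "coch m p ph ==> y : V (m + k) ==> Op m ph (u 1 * y) = ins 0 m ph y"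
proof (rule V_split_eqI[where f = "%y. Op m ph (u 1 * y)"])
 fix y w assume c: "coch m p ph" and y: "y : V m"
 show "Op m ph (u 1 * (y * w)) = ins 0 m ph (y * w)"
  using Op_u[OF c y, of 1 w] by (simp add: mult.assoc ins0_V[OF c y] Lm_one[OF coch_mem[OF c y]])
qed (auto intro!: plin_intros)

lemma circ_pos_cch: "f : cch m p ==> g : cch n q ==> 1 <= i ==> i <= m ==> circ_pos m p f i n q g : cch (m + n - 1) (p + q)"
 and circ_pos_lf: "f : cch m p ==> g : cch n q ==> 1 <= i ==> i <= m ==> w : V (m + n - 1) ==>
  lf (m + n - 1) (p + q) (circ_pos m p f i n q g) w = ins 0 m (lf m p f) (gi (i - 1) n (lf n q g) w)"
proof -
 assume f: "f : cch m p" and g: "g : cch n q" and i: "1 <= i" "i <= m"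
 have e1: "i - 1 + n + (m - i) = m + n - 1" and e2: "i - 1 + Suc q + (m - i) = m + q" using i by auto
 note a = wR1[OF g, where k = "i - 1" and l = "m - i", unfolded e1 e2] and b = wA[OF f, where k = q]
 show c: "circ_pos m p f i n q g : cch (m + n - 1) (p + q)"
  unfolding circ_pos_def by (rule cch_restrictI) (rule linear_compose[OF a(1) b(1)])
 assume w: "w : V (m + n - 1)"
 show "lf (m + n - 1) (p + q) (circ_pos m p f i n q g) w = ins 0 m (lf m p f) (gi (i - 1) n (lf n q g) w)"
  by (rule lf_eqI[OF c _ w]) (simp add: circ_pos_def T_sA b(2) linear_mapD(1)[OF a(1)] a(2) del: One_nat_def)
qed

text \<open>In a word of \<open>W N\<close> the factor A precedes the arguments, so the i - 1
  identities in front of the inserted cochain become place i.\<close>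

lemma circ_pos_Op:
 assumes f: "f : cch m p" and g: "g : cch n q" and i: "1 <= i" "i <= m" and x: "x : W N" and N: "m + n - 1 <= N"
 shows "Op (m + n - 1) (lf (m + n - 1) (p + q) (circ_pos m p f i n q g)) x = Op m (lf m p f) (gi i n (lf n q g) x)"
proof (rule Op_crit[OF coch_lf[OF circ_pos_cch[OF f g i]] _ _ _ _ x N, where \<Phi> = "%x. Op m (lf m p f) (gi i n (lf n q g) x)"])
 note fc = coch_lf[OF f] and gc = coch_lf[OF g]
 define k l where "k = i - 1" and "l = m - i"
 have e: "i = Suc k" "m + n - 1 = k + n + l" "k + Suc q + l = m + q" using i by (auto simp: k_def l_def)
 note gm = gi_W_mem[OF gc, of _ k l, unfolded e(3)]
 fix w assume w: "w : V (m + n - 1)"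
 then have w': "w : V (k + n + l)" by (simp only: e(2))
 show "lf (m + n - 1) (p + q) (circ_pos m p f i n q g) w = Op m (lf m p f) (gi i n (lf n q g) (u 1 * w))"
  unfolding circ_pos_lf[OF f g i w] k_def[symmetric] unfolding e(1) gi_u
  by (rule Op_ins0[OF fc gi_V_mem[OF gc w', unfolded e(3)], symmetric])
next
 note fc = coch_lf[OF f] and gc = coch_lf[OF g]
 define k l where "k = i - 1" and "l = m - i"
 have e: "i = Suc k" "m + n - 1 = k + n + l" "k + Suc q + l = m + q" using i by (auto simp: k_def l_def)
 note gm = gi_W_mem[OF gc, of _ k l, unfolded e(3)]
 fix x assume x: "x : W (m + n - 1)"
 note gx = gm[OF x[unfolded e(2)]]
 show "Op m (lf m p f) (gi i n (lf n q g) (Lm a x)) = Lm a (Op m (lf m p f) (gi i n (lf n q g) x))" for a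
  unfolding e(1) gi_Lm[OF x] by (rule Op_Lm[OF fc gx]) simp
 show "Op m (lf m p f) (gi i n (lf n q g) (x * z)) = Op m (lf m p f) (gi i n (lf n q g) x) * z" for z
  using ins_right[OF W_H[OF x], of i n _ z] i Op_mult[OF fc gx, of z] by (simp add: e)
qed (intro plin_intros)

lemma circ_neg_cch: "f : cch m p ==> g : cch n q ==> 1 <= i ==> i <= p ==> 1 <= n ==> circ_neg m p f i n q g : cch (m + n - 1) (p + q)"
 and circ_neg_lf: "f : cch m p ==> g : cch n q ==> 1 <= i ==> i <= p ==> 1 <= n ==> w : V (m + n - 1) ==>
  lf (m + n - 1) (p + q) (circ_neg m p f i n q g) w = gi i n (lf n q g) (ins 0 m (lf m p f) w)"
proof -
 assume f: "f : cch m p" and g: "g : cch n q" and i: "1 <= i" "i <= p" and n: "1 <= n"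
 have e1: "i - 1 + n + (p - i) = p + (n - 1)" and e2: "i - 1 + Suc q + (p - i) = p + q" and e3: "m + (n - 1) = m + n - 1"
  and e4: "Suc (i - 1) = i" using i n by auto
 note a = wR2[OF g, where k = "i - 1" and l = "p - i", unfolded e1 e2 e4] and b = wA[OF f, where k = "n - 1", unfolded e3]
 show c: "circ_neg m p f i n q g : cch (m + n - 1) (p + q)"
  unfolding circ_neg_def by (rule cch_restrictI) (rule linear_compose[OF b(1) a(1)])
 assume w: "w : V (m + n - 1)"
 show "lf (m + n - 1) (p + q) (circ_neg m p f i n q g) w = gi i n (lf n q g) (ins 0 m (lf m p f) w)"
  by (rule lf_eqI[OF c _ w]) (simp add: circ_neg_def T_sA a(2) linear_mapD(1)[OF b(1)] b(2) del: One_nat_def)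
qed

text \<open>The cochain acts first, on m of the m + n - 1 arguments; the factor A of its output is
  the first of the i letters in front of the insertion.\<close>

lemma circ_neg_Op:
 assumes f: "f : cch m p" and g: "g : cch n q" and i: "1 <= i" "i <= p" and n: "1 <= n" and x: "x : W N" and N: "m + n - 1 <= N"
 shows "Op (m + n - 1) (lf (m + n - 1) (p + q) (circ_neg m p f i n q g)) x = gi i n (lf n q g) (Op m (lf m p f) x)"
proof (rule Op_crit[OF coch_lf[OF circ_neg_cch[OF f g i n]] _ _ _ _ x N, where \<Phi> = "%x. gi i n (lf n q g) (Op m (lf m p f) x)"])
 note fc = coch_lf[OF f] and gc = coch_lf[OF g]
 define k where "k = i - 1"
 have e: "i = Suc k" "m + n - 1 = m + (n - 1)" using i n by (auto simp: k_def)
 fix w assume w: "w : V (m + n - 1)"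
 show "lf (m + n - 1) (p + q) (circ_neg m p f i n q g) w = gi i n (lf n q g) (Op m (lf m p f) (u 1 * w))"
  unfolding circ_neg_lf[OF f g i n w] Op_ins0[OF fc w[unfolded e(2)]] ..
next
 note fc = coch_lf[OF f] and gc = coch_lf[OF g]
 define k where "k = i - 1"
 have e: "i = Suc k" "m + n - 1 = m + (n - 1)" using i n by (auto simp: k_def)
 fix x assume x: "x : W (m + n - 1)"
 have Fx: "Op m (lf m p f) x : W (p + (n - 1))" using Op_mem[OF fc x[unfolded e(2)]] .
 have mn: "m <= m + n - 1" using n by simp
 show "gi i n (lf n q g) (Op m (lf m p f) (Lm a x)) = Lm a (gi i n (lf n q g) (Op m (lf m p f) x))" for a
  unfolding e(1) Op_Lm[OF fc x mn] by (rule gi_Lm[OF Fx])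
 show "gi i n (lf n q g) (Op m (lf m p f) (x * z)) = gi i n (lf n q g) (Op m (lf m p f) x) * z" for z
  unfolding Op_mult[OF fc x mn] by (rule ins_right[OF W_H[OF Fx]]) (use i n in simp)
qed (intro plin_intros)

lemma one_cch: "one_cochain : cch 0 0" and one_lf: "lf 0 0 one_cochain 1 = u 1"
proof -
 have p: "plin (%x. u 1 * x)" by (intro plin_intros)
 have e: "one_cochain = low (sf 0) (fo 0) (%x. u 1 * x)"
  unfolding one_cochain_def T_sA T_Om
 proof (rule the_linear_eq[OF p])
  fix h assume h: "h : carrier (hom_space (Ts (sf 0)) (Ts (fo 0)))"
  have m: "h (bars []) : carrier (Ts (fo 0))" "om [1] : carrier (Ts (fo 0))"
   using h bars_mem[of "[]" 0] om_mem[of "[1]" 0] by (auto simp: hom_iff linear_mapD(1)[of "Ts (sf 0)"])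
  have "(h (bars []) = om [1]) \<longleftrightarrow> J (fo 0) (h (bars [])) = u 1 * vv []"
   using J_inj[OF m] J_om[of "[1]" 0] by (auto simp: ov_def vv_def)
  then show "(h (bars []) = om [1]) \<longleftrightarrow> (\<forall>w\<in>ws (sf 0). J (fo 0) (h (pr (sf 0) w)) = u 1 * cw (sf 0) w)"
   unfolding ball_ws_sf[where P = "%x y. J (fo 0) (h x) = u 1 * y"] by simp
 qed (simp add: K_sf K_fo u_V_mem)
 note l = low_hom[OF p, of "sf 0" "fo 0", folded e]
 show c: "one_cochain : cch 0 0" unfolding cch_def T_sA T_Om by (rule l(1)) (simp add: K_sf K_fo u_V_mem)
 have "lf 0 0 one_cochain 1 = u 1 * 1"
  by (rule lf_eqI[OF c _ one_mem_V]) (rule l(2); simp add: K_sf K_fo u_V_mem)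
 then show "lf 0 0 one_cochain 1 = u 1" by simp
qed

lemma one_Op: "x : W N ==> Op 0 (lf 0 0 one_cochain) x = x"
 using Op_u'[OF coch_lf[OF one_cch] one_mem_V]
 by (intro Op_crit[OF coch_lf[OF one_cch] plin_id, of x N])
  (auto elim!: V_0_eqI[OF plin_lft0[of "sf 0" "fo 0" one_cochain, folded lf_def], rotated] simp: one_lf intro!: plin_intros)


text \<open>All terms of the differential except the right action on the value come from one
  application of the operator to the word 1 w' acted on by the last argument, and this is the form
  in which \<open>dop\<close> was defined.\<close>

lemma diff_eq: "f : cch m p ==> diff m p f = low (sf (m + 1)) (fo p) (dop m p (lf m p f))"
proof -
 assume f: "f : cch m p"
 note c = coch_lf[OF f] and cd = coch_dop[OF coch_lf[OF f]]
 let ?T = "Ts (fo p)" and ?f = "lf m p f"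
 interpret T: vs ?T by (rule vs_Ts)
 show ?thesis
  unfolding diff_def T_sA T_Om
 proof (rule the_linear_eq[OF plin_dop0])
  show "dop m p ?f y : Kset (BL (fo p))" if "y : Kset (BL (sf (m + 1)))" for y
   using that coch_mem[OF cd, of y] by (simp add: K_sf K_fo)
  fix h assume h: "h : carrier (hom_space (Ts (sf (m + 1))) ?T)"
  let ?rhs = "%w. left_act p (hd w) (f (bars (tl w))) \<oplus>\<^bsub>?T\<^esub>
    (\<Oplus>\<^bsub>?T\<^esub>j\<in>{1..m}. signed ?T (int j) (f (bars (merge (j - 1) w)))) \<oplus>\<^bsub>?T\<^esub>
    signed ?T (int m + 1) (right_act p (f (bars (butlast w))) (last w))"
  have "(signed ?T (int m - int p + 1) (h (bars w)) = ?rhs w) \<longleftrightarrow> J (fo p) (h (bars w)) = dop m p ?f (vv w)" if w: "length w = m + 1" for w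
  proof -
   define w' a where "w' = butlast w" and "a = last w"
   have "w ~= []" using w by auto
   then have wa: "w = w' @ [a]" "length w' = m" using w by (simp_all add: w'_def a_def)
   have fb: "f (bars x) : carrier ?T" "J (fo p) (f (bars x)) = ?f (vv x)" if "length x = m" for x
    using cch_mem[OF f bars_mem[OF that]] lf_J[OF f bars_mem[OF that]] J_bars[OF that] by simp_all
   have hb: "h (bars w) : carrier ?T"
    using h bars_mem[OF w] by (auto simp: hom_iff linear_mapD(1)[of "Ts (sf (m + 1))"])
   have lm: "length (merge (j - 1) w) = m" if "j : {1..m}" for j using that w length_merge[of "j - 1" w] by auto
   have lt: "length (tl w) = m" and lw: "length (butlast w) = m" using w by auto
   have tm: "signed ?T (int j) (f (bars (merge (j - 1) w))) : carrier ?T"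
     "J (fo p) (signed ?T (int j) (f (bars (merge (j - 1) w)))) = eps (int j) (?f (vv (merge (j - 1) w)))" if "j : {1..m}" for j
    by (rule T.signed_mem[OF fb(1)[OF lm[OF that]]]) (simp only: J_signed[OF fb(1)[OF lm[OF that]]] fb(2)[OF lm[OF that]])
   have s: "(\<Oplus>\<^bsub>?T\<^esub>j\<in>{1..m}. signed ?T (int j) (f (bars (merge (j - 1) w)))) : carrier ?T"
    by (rule T.finsum_closed) (rule Pi_I, rule tm(1))
   have rm: "?rhs w : carrier ?T"
    by (intro T.a_closed left_act_mem s T.signed_mem right_act_mem fb lt lw)
   have "J (fo p) (?rhs w) = Lm (hd w) (?f (vv (tl w))) + (\<Sum>j = 1..m. eps (int j) (?f (vv (merge (j - 1) w))))
     + eps (int m + 1) (R a (?f (vv w')))"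
   proof -
    have "J (fo p) (\<Oplus>\<^bsub>?T\<^esub>j\<in>{1..m}. signed ?T (int j) (f (bars (merge (j - 1) w)))) = (\<Sum>j = 1..m. eps (int j) (?f (vv (merge (j - 1) w))))"
     by (subst J_finsum, erule tm(1), rule sum.cong[OF refl tm(2)])
    then show ?thesis
     unfolding J_add[OF T.a_closed[OF left_act_mem[OF fb(1)[OF lt]] s] T.signed_mem[OF right_act_mem[OF fb(1)[OF lw]]]]
      J_add[OF left_act_mem[OF fb(1)[OF lt]] s] J_signed[OF right_act_mem[OF fb(1)[OF lw]]]
      left_act_J[OF fb(1)[OF lt]] right_act_J[OF fb(1)[OF lw]] fb(2)[OF lt] fb(2)[OF lw] w'_def a_def by simp
   qed
   also have "\<dots> = eps (int m - int p + 1) (dop m p ?f (vv w))"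
   proof -
    have vw: "vv w' : V m" using vv_mem[of w'] wa by simp
    have ne: "w ~= []" using w by auto
    \<comment> \<open>In the word 1 w' a the product of 1 with the first argument moves that
      argument into the factor A, which gives the left action; the other products stay behind the
      letter 1.\<close>
    have "R a (u 1 * vv w') = (\<Sum>i = 0..m. eps (int m - int i) (ov (merge i ((1 # w') @ [a]))))"
     using R_ov[of "1 # w'" m a] wa(2) by (simp add: ov_def)
    also have "\<dots> = eps (int m) (u (hd w) * vv (tl w)) + (\<Sum>i = 1..m. eps (int m - int i) (u 1 * vv (merge (i - 1) w)))"
    proof -
     have 0: "ov (merge 0 (1 # w)) = u (hd w) * vv (tl w)" using ne by (cases w) (simp_all add: merge_def ov_def)
     have S: "ov (merge i (1 # w)) = u 1 * vv (merge (i - 1) w)" if i: "i : {1..m}" for i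
     proof -
      obtain j where "i = Suc j" using i by (cases i) auto
      then show ?thesis by (simp add: merge_def ov_def)
     qed
     have "(\<Sum>i = 0..m. eps (int m - int i) (ov (merge i (1 # w)))) = eps (int m) (ov (merge 0 (1 # w))) + (\<Sum>i = 1..m. eps (int m - int i) (ov (merge i (1 # w))))"
      using sum.atLeast_Suc_atMost[of 0 m "%i. eps (int m - int i) (ov (merge i (1 # w)))"] by simp
     then show ?thesis using S by (simp add: wa(1)[symmetric] 0)
    qed
    finally have R: "R a (u 1 * vv w') = eps (int m) (u (hd w) * vv (tl w)) + (\<Sum>i = 1..m. eps (int m - int i) (u 1 * vv (merge (i - 1) w)))" .
    have "Op m ?f (R a (u 1 * vv w')) = eps (int m) (Lm (hd w) (?f (vv (tl w)))) + (\<Sum>i = 1..m. eps (int m - int i) (?f (vv (merge (i - 1) w))))"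
    proof -
     have mo: "Op m ?f (u 1 * vv (merge (i - 1) w)) = ?f (vv (merge (i - 1) w))" if "i : {1..m}" for i
      using Op_one[OF c, of "vv (merge (i - 1) w)"] vv_mem[of "merge (i - 1) w"] lm[OF that] by simp
     have to: "Op m ?f (u (hd w) * vv (tl w)) = Lm (hd w) (?f (vv (tl w)))"
      using Op_u'[OF c, of "vv (tl w)" "hd w"] vv_mem[of "tl w"] lt by simp
     have "(\<Sum>i = 1..m. eps (int m - int i) (Op m ?f (u 1 * vv (merge (i - 1) w)))) = (\<Sum>i = 1..m. eps (int m - int i) (?f (vv (merge (i - 1) w))))"
      by (rule sum.cong[OF refl]) (simp only: mo)
     then show ?thesis unfolding R plin_add[OF plin_Op0] plin_sum[OF plin_Op0] plin_eps_out[OF plin_Op0] to by (simp only:)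
    qed
    then have "dop m p ?f (vv w) = eps (int p + 1) (eps (int m) (Lm (hd w) (?f (vv (tl w)))) + (\<Sum>i = 1..m. eps (int m - int i) (?f (vv (merge (i - 1) w)))) - R a (?f (vv w')))"
     using dop_v[OF c vw, of a] by (simp add: wa(1) vv_def)
    moreover have "Lm (hd w) (?f (vv (tl w))) + (\<Sum>j = 1..m. eps (int j) (?f (vv (merge (j - 1) w)))) + eps (int m + 1) (R a (?f (vv w')))
     = eps (int m - int p + 1) (eps (int p + 1) (eps (int m) (Lm (hd w) (?f (vv (tl w)))) + (\<Sum>i = 1..m. eps (int m - int i) (?f (vv (merge (i - 1) w)))) - R a (?f (vv w'))))"
    proof -
     have "eps (int m - int p + 1) (eps (int p + 1) (eps (int m) A + (\<Sum>i = 1..m. eps (int m - int i) (F i)) - B))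
      = A + (\<Sum>j = 1..m. eps (int j) (F j)) + eps (int m + 1) B" for A B and F :: "nat => 'a list \<Rightarrow>\<^sub>0 'k"
     proof -
      have "eps (int m) (\<Sum>i = 1..m. eps (int m - int i) (F i)) = (\<Sum>j = 1..m. eps (int j) (F j))"
       unfolding eps_sum eps_eps by (intro sum.cong refl eps_cong) simp
      then show ?thesis by (cases "even m"; cases "even p"; simp add: eps_def)
     qed
     then show ?thesis by (simp only:)
    qed
    ultimately show ?thesis by (simp only:)
   qed
   finally have JR: "J (fo p) (?rhs w) = eps (int m - int p + 1) (dop m p ?f (vv w))" .
   have "(signed ?T (int m - int p + 1) (h (bars w)) = ?rhs w) \<longleftrightarrow> J (fo p) (signed ?T (int m - int p + 1) (h (bars w))) = J (fo p) (?rhs w)"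
    using J_inj[OF T.signed_mem[OF hb] rm] by (intro iffI arg_cong[of _ _ "J (fo p)"])
   also have "\<dots> \<longleftrightarrow> J (fo p) (h (bars w)) = dop m p ?f (vv w)"
    unfolding J_signed[OF hb] JR by (simp add: eps_def)
   finally show ?thesis .
  qed
  then show "(\<forall>w. length w = m + 1 --> signed ?T (int m - int p + 1) (h (bars w)) = ?rhs w)
   \<longleftrightarrow> (\<forall>w\<in>ws (sf (m + 1)). J (fo p) (h (pr (sf (m + 1)) w)) = dop m p ?f (cw (sf (m + 1)) w))"
   unfolding ball_ws_sf[where P = "%x y. J (fo p) (h x) = dop m p ?f y"] by blast
 qed
qed

lemma diff_cch: "f : cch m p ==> diff m p f : cch (Suc m) p"
 and diff_lf: "f : cch m p ==> w : V (Suc m) ==> lf (Suc m) p (diff m p f) w = dop m p (lf m p f) w"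
proof -
 assume f: "f : cch m p"
 note cd = coch_dop[OF coch_lf[OF f]]
 note l = low_hom[OF plin_dop0, of "sf (m + 1)" m p "lf m p f" "fo p", folded diff_eq[OF f], unfolded Suc_eq_plus1[symmetric] K_sf K_fo, OF coch_mem[OF cd]]
 show c: "diff m p f : cch (Suc m) p" unfolding cch_def T_sA T_Om using l(1) by simp
 show "w : V (Suc m) ==> lf (Suc m) p (diff m p f) w = dop m p (lf m p f) w"
  by (rule lf_eqI[OF c]) (simp_all add: l(2))
qed

lemma diff_Op:
 assumes f: "f : cch m p" and x: "x : W N" and N: "m <= N"
 shows "Op (Suc m) (lf (Suc m) p (diff m p f)) (x * v a)
  = eps (int N - (int m - int p) + 1) (Op m (lf m p f) (R a x) - R a (Op m (lf m p f) x))"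
proof -
 obtain k where k: "N = m + k" using N le_Suc_ex by blast
 show ?thesis
  using Op_cong_V[OF diff_lf[OF f] W_v_mem[OF x], where a1 = a] Op_dop[OF coch_lf[OF f] x[unfolded k], of a] by (simp add: k add.commute)
qed

end

section \<open>Spaces of linear maps and sequential colimits\<close>

lemma hom_vs:
 assumes V: "vector_space_on V" and W: "vector_space_on W"
 shows "vector_space_on (hom_space V W)"
proof -
 interpret V: vs V by (rule vs.intro[OF V])
 interpret W: vs W by (rule vs.intro[OF W])
 have s: "carrier (hom_space V W) = {f : extensional (carrier V). linear_map V W f}"
  "\<zero>\<^bsub>hom_space V W\<^esub> = (\<lambda>x\<in>carrier V. \<zero>\<^bsub>W\<^esub>)"
  "f \<oplus>\<^bsub>hom_space V W\<^esub> g = (\<lambda>x\<in>carrier V. f x \<oplus>\<^bsub>W\<^esub> g x)"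
  "c \<odot>\<^bsub>hom_space V W\<^esub> f = (\<lambda>x\<in>carrier V. c \<odot>\<^bsub>W\<^esub> f x)" for f g c
  by (simp_all add: hom_space_def)
 note d = linear_mapD[of V W]
 show ?thesis
 proof (rule vsI, unfold s mem_Collect_eq, goal_cases)
  case (1 f g)
  then show ?case by (auto intro!: linear_mapI simp: d W.add.m_ac V.smult_mem W.smult_add)
 next
  case 2
  show ?case by (auto intro!: linear_mapI simp: V.smult_mem W.smult_zero)
 next
  case (6 c f)
  then show ?case
   by (auto intro!: linear_mapI simp: d V.smult_mem W.smult_mem W.smult_add W.smult_smult mult.commute)
 next
  case (4 f g)
  then show ?case by (auto intro!: restrict_ext simp: d W.a_comm)
 qed (auto intro!: extensionalityI[of _ "carrier V"] restrict_ext
    simp: d W.a_assoc W.l_neg W.smult_add W.smult_add_left W.smult_smult W.one_smult W.smult_mem W.neg_smult[symmetric])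
qed

lemma zero_space_vs: "vector_space_on zero_space"
 by (rule vsI) (simp_all add: zero_space_def)

locale seqc =
 fixes V :: "nat => ('k::field, 'v) module" and t :: "nat => 'v => 'v"
 assumes V_vs: "vector_space_on (V p)" and t_lin: "linear_map (V p) (V (p + 1)) (t p)"
begin

sublocale V: vs "V p" for p by (rule vs.intro[OF V_vs])
abbreviation "cls \<equiv> colim_class V t"
abbreviation "L \<equiv> seq_colim V t"

lemma push_lin: "linear_map (V p) (V (p + i)) (push t p i)"
proof (induct i)
 case 0
 show ?case by (auto intro!: linear_mapI)
next
 case (Suc i)
 show ?case using linear_mapD[OF Suc] linear_mapD[OF t_lin, of _ "p + i"] by (auto intro!: linear_mapI)
qed
lemma push_lin': "p + i = r ==> linear_map (V p) (V r) (push t p i)" using push_lin by blast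

lemma push_push: "push t p (i + j) x = push t (p + i) j (push t p i x)"
 by (induct j) (simp_all add: add.assoc)

lemma push_up: "push t p i x = push t q j y ==> p + i = q + j ==> push t p (i + k) x = push t q (j + k) y"
 by (simp add: push_push)

lemma rel_refl: "x : carrier (V p) ==> ((p, x), (p, x)) : colim_rel V t"
 unfolding colim_rel_def by blast
lemma rel_sym: "((p, x), (q, y)) : colim_rel V t ==> ((q, y), (p, x)) : colim_rel V t"
 unfolding colim_rel_def by clarsimp (metis)
lemma rel_trans:
 assumes "((p, x), (q, y)) : colim_rel V t" "((q, y), (r, z)) : colim_rel V t"
 shows "((p, x), (r, z)) : colim_rel V t"
proof -
 obtain i j where 1: "p + i = q + j" "push t p i x = push t q j y" "x : carrier (V p)" using assms(1) by (auto simp: colim_rel_def)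
 obtain k l where 2: "q + k = r + l" "push t q k y = push t r l z" "z : carrier (V r)" using assms(2) by (auto simp: colim_rel_def)
 have "push t p (i + k) x = push t q (j + k) y" by (rule push_up[OF 1(2,1)])
 also have "\<dots> = push t r (l + j) z" using push_up[OF 2(2,1), of j] by (simp add: add.commute)
 finally have "push t p (i + k) x = push t r (l + j) z" .
 moreover have "p + (i + k) = r + (l + j)" using 1(1) 2(1) by simp
 ultimately show ?thesis using 1(3) 2(3) unfolding colim_rel_def by blast
qed

lemma cls_mem: "(q, y) : cls p x \<longleftrightarrow> ((p, x), (q, y)) : colim_rel V t"
 by (simp add: colim_class_def)
lemma cls_eq_rel: "x : carrier (V p) ==> cls p x = cls q y \<longleftrightarrow> ((p, x), (q, y)) : colim_rel V t"
proof
 assume "x : carrier (V p)" "cls p x = cls q y"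
 then have "(p, x) : cls q y" using cls_mem[of p x p x] rel_refl by simp
 then show "((p, x), (q, y)) : colim_rel V t" unfolding cls_mem by (rule rel_sym)
next
 assume r: "((p, x), (q, y)) : colim_rel V t"
 show "cls p x = cls q y"
 proof (rule Set.set_eqI)
  fix z :: "nat \<times> 'v"
  obtain s w where z: "z = (s, w)" by (cases z)
  show "z : cls p x \<longleftrightarrow> z : cls q y"
   unfolding z cls_mem using rel_trans[OF r, of s w] rel_trans[OF rel_sym[OF r], of s w] by blast
 qed
qed
lemma cls_mem_eq: "x : carrier (V p) ==> (q, y) : cls p x \<longleftrightarrow> y : carrier (V q) & cls q y = cls p x"
 using cls_eq_rel[of x p q y] by (auto simp: cls_mem colim_rel_def)
lemma cls_eq: "x : carrier (V p) ==> y : carrier (V q) ==> cls p x = cls q y \<longleftrightarrow> (\<exists>i j. p + i = q + j & push t p i x = push t q j y)"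
 by (simp add: cls_eq_rel) (simp add: colim_rel_def)
lemma cls_push: "x : carrier (V p) ==> cls (p + i) (push t p i x) = cls p x"
 by (subst cls_eq) (auto intro!: linear_mapD(1)[OF push_lin], rule exI[of _ 0], auto)

lemma L_carrier: "X : carrier L \<longleftrightarrow> (\<exists>p. \<exists>x\<in>carrier (V p). X = cls p x)"
 by (auto simp: seq_colim_def quotient_def colim_class_def)
lemma L_mem: "x : carrier (V p) ==> cls p x : carrier L" by (auto simp: L_carrier)
text \<open>Representatives exist at all late stages, so finitely many elements have representatives
  at a common one.\<close>

lemma L_reps: assumes "X : carrier L" obtains p0 where "!!p. p0 <= p ==> \<exists>x\<in>carrier (V p). X = cls p x"
proof -
 obtain p0 x where x: "x : carrier (V p0)" "X = cls p0 x" using assms by (auto simp: L_carrier)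
 show ?thesis
 proof (rule that)
  fix p assume "p0 <= p"
  then obtain i where p: "p = p0 + i" using le_Suc_ex by blast
  show "\<exists>x\<in>carrier (V p). X = cls p x"
   unfolding p x(2) cls_push[OF x(1), of i, symmetric] using linear_mapD(1)[OF push_lin x(1)] by blast
 qed
qed

lemma L_simps: "X \<oplus>\<^bsub>L\<^esub> Y = \<Union>{cls p (x \<oplus>\<^bsub>V p\<^esub> y) |p x y. (p, x) : X & (p, y) : Y}"
 "c \<odot>\<^bsub>L\<^esub> X = \<Union>{cls p (c \<odot>\<^bsub>V p\<^esub> x) |p x. (p, x) : X}" "\<zero>\<^bsub>L\<^esub> = cls 0 \<zero>\<^bsub>V 0\<^esub>"
 by (simp_all add: seq_colim_def)

text \<open>Any two choices of representatives of x agree at some later stage, and likewise for y.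
  Pushing far enough for both agreements shows that the union in the definition consists of a single
  class.\<close>

lemma L_add: assumes x: "x : carrier (V p)" and y: "y : carrier (V p)"
 shows "cls p x \<oplus>\<^bsub>L\<^esub> cls p y = cls p (x \<oplus>\<^bsub>V p\<^esub> y)"
proof -
 have eq: "cls r (a \<oplus>\<^bsub>V r\<^esub> b) = cls p (x \<oplus>\<^bsub>V p\<^esub> y)" if a: "(r, a) : cls p x" and b: "(r, b) : cls p y" for r a b
 proof -
  have ac: "a : carrier (V r)" and bc: "b : carrier (V r)" using a b x y by (auto simp: cls_mem_eq)
  obtain i j where i: "p + i = r + j" "push t p i x = push t r j a" using a by (auto simp: cls_mem colim_rel_def)
  obtain k l where k: "p + k = r + l" "push t p k y = push t r l b" using b by (auto simp: cls_mem colim_rel_def)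
  have 1: "push t p (i + k) x = push t r (j + k) a" by (rule push_up[OF i(2,1)])
  have 2: "push t p (i + k) y = push t r (j + k) b"
  proof -
   have "l + i = j + k" using i(1) k(1) by simp
   then show ?thesis using push_up[OF k(2,1), of i] by (simp add: add.commute)
  qed
  have 3: "p + (i + k) = r + (j + k)" using i(1) by simp
  have "push t p (i + k) (x \<oplus>\<^bsub>V p\<^esub> y) = push t r (j + k) (a \<oplus>\<^bsub>V r\<^esub> b)"
   unfolding linear_mapD(2)[OF push_lin' [OF 3] x y] linear_mapD(2)[OF push_lin ac bc] 1 2 ..
  then have "\<exists>i j. r + i = p + j & push t r i (a \<oplus>\<^bsub>V r\<^esub> b) = push t p j (x \<oplus>\<^bsub>V p\<^esub> y)" using 3 by metis
  then show ?thesis using x y ac bc by (subst cls_eq) auto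
 qed
 have *: "{cls r (a \<oplus>\<^bsub>V r\<^esub> b) |r a b. (r, a) : cls p x & (r, b) : cls p y} = {cls p (x \<oplus>\<^bsub>V p\<^esub> y)}"
  using eq cls_mem_eq[OF x, of p x] cls_mem_eq[OF y, of p y] x y by blast
 show ?thesis unfolding L_simps * by simp
qed

lemma L_smult: assumes x: "x : carrier (V p)" shows "c \<odot>\<^bsub>L\<^esub> cls p x = cls p (c \<odot>\<^bsub>V p\<^esub> x)"
proof -
 have eq: "cls r (c \<odot>\<^bsub>V r\<^esub> a) = cls p (c \<odot>\<^bsub>V p\<^esub> x)" if a: "(r, a) : cls p x" for r a
 proof -
  have ac: "a : carrier (V r)" using a x by (auto simp: cls_mem_eq)
  obtain i j where i: "p + i = r + j" "push t p i x = push t r j a" using a by (auto simp: cls_mem colim_rel_def)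
  have "push t p i (c \<odot>\<^bsub>V p\<^esub> x) = push t r j (c \<odot>\<^bsub>V r\<^esub> a)"
   unfolding linear_mapD(3)[OF push_lin'[OF i(1)] x] linear_mapD(3)[OF push_lin ac] i(2) ..
  then have "\<exists>i j. r + i = p + j & push t r i (c \<odot>\<^bsub>V r\<^esub> a) = push t p j (c \<odot>\<^bsub>V p\<^esub> x)" using i(1) by metis
  then show ?thesis using x ac by (subst cls_eq) (auto intro: V.smult_mem)
 qed
 have *: "{cls r (c \<odot>\<^bsub>V r\<^esub> a) |r a. (r, a) : cls p x} = {cls p (c \<odot>\<^bsub>V p\<^esub> x)}"
  using eq cls_mem_eq[OF x, of p x] x by blast
 show ?thesis unfolding L_simps * by simp
qed

lemma L_zero: "cls p \<zero>\<^bsub>V p\<^esub> = \<zero>\<^bsub>L\<^esub>"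
proof -
 have l: "linear_map (V 0) (V p) (push t 0 p)" by (rule push_lin') simp
 have z: "\<zero>\<^bsub>V 0\<^esub> : carrier (V 0)" by simp
 have "push t 0 p \<zero>\<^bsub>V 0\<^esub> = \<zero>\<^bsub>V p\<^esub>"
  using linear_mapD(3)[OF l z, of 0] V.zero_smult[OF z] V.zero_smult[OF linear_mapD(1)[OF l z]] by simp
 then show ?thesis using cls_push[OF z, of p] unfolding L_simps by simp
qed

lemma L_vs: "vector_space_on L"
proof (rule vsI)
 fix X Y assume X: "X : carrier L" and Y: "Y : carrier L"
 from X obtain p0 where p0: "!!p. p0 <= p ==> \<exists>x\<in>carrier (V p). X = cls p x" by (rule L_reps) blast
 from Y obtain q0 where q0: "!!p. q0 <= p ==> \<exists>x\<in>carrier (V p). Y = cls p x" by (rule L_reps) blast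
 from p0[of "p0 + q0"] obtain x where x: "x : carrier (V (p0 + q0))" "X = cls (p0 + q0) x" by auto
 from q0[of "p0 + q0"] obtain y where y: "y : carrier (V (p0 + q0))" "Y = cls (p0 + q0) y" by auto
 show "X \<oplus>\<^bsub>L\<^esub> Y : carrier L" using x y by (auto simp: L_add intro: L_mem)
 show "X \<oplus>\<^bsub>L\<^esub> Y = Y \<oplus>\<^bsub>L\<^esub> X" using x y by (simp add: L_add V.a_comm)
 show "c \<odot>\<^bsub>L\<^esub> (X \<oplus>\<^bsub>L\<^esub> Y) = c \<odot>\<^bsub>L\<^esub> X \<oplus>\<^bsub>L\<^esub> c \<odot>\<^bsub>L\<^esub> Y" for c
  using x y by (simp add: L_add L_smult V.smult_mem V.smult_add)
 fix Z assume Z: "Z : carrier L"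
 from Z obtain r0 where r0: "!!p. r0 <= p ==> \<exists>x\<in>carrier (V p). Z = cls p x" by (rule L_reps) blast
 define s where "s = p0 + q0 + r0"
 from p0[of s] obtain x where x: "x : carrier (V s)" "X = cls s x" by (auto simp: s_def)
 from q0[of s] obtain y where y: "y : carrier (V s)" "Y = cls s y" by (auto simp: s_def)
 from r0[of s] obtain z where z: "z : carrier (V s)" "Z = cls s z" by (auto simp: s_def)
 show "X \<oplus>\<^bsub>L\<^esub> Y \<oplus>\<^bsub>L\<^esub> Z = X \<oplus>\<^bsub>L\<^esub> (Y \<oplus>\<^bsub>L\<^esub> Z)" using x y z by (simp add: L_add V.a_assoc)
next
 show "\<zero>\<^bsub>L\<^esub> : carrier L" using L_mem[of "\<zero>\<^bsub>V 0\<^esub>" 0] by (simp add: L_zero)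
 fix X assume "X : carrier L"
 then obtain p x where x: "x : carrier (V p)" "X = cls p x" by (auto simp: L_carrier)
 show "c \<odot>\<^bsub>L\<^esub> X : carrier L" for c using x by (auto simp: L_smult intro: L_mem V.smult_mem)
 show "\<zero>\<^bsub>L\<^esub> \<oplus>\<^bsub>L\<^esub> X = X" using x by (simp add: L_zero[symmetric, of p] L_add)
 show "(- 1) \<odot>\<^bsub>L\<^esub> X \<oplus>\<^bsub>L\<^esub> X = \<zero>\<^bsub>L\<^esub>"
  using x by (simp add: L_zero[symmetric, of p] L_add L_smult V.smult_mem V.neg_smult[symmetric] V.l_neg)
 show "(c + d) \<odot>\<^bsub>L\<^esub> X = c \<odot>\<^bsub>L\<^esub> X \<oplus>\<^bsub>L\<^esub> d \<odot>\<^bsub>L\<^esub> X" for c d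
  using x by (simp add: L_add L_smult V.smult_mem V.smult_add_left)
 show "(c * d) \<odot>\<^bsub>L\<^esub> X = c \<odot>\<^bsub>L\<^esub> (d \<odot>\<^bsub>L\<^esub> X)" for c d
  using x by (simp add: L_smult V.smult_mem V.smult_smult)
 show "1 \<odot>\<^bsub>L\<^esub> X = X" using x by (simp add: L_smult V.one_smult)
qed

end

section \<open>Elements of the colimit as germs of operators\<close>

context algebra_over_field
begin

abbreviation OP where "OP m p f \<equiv> Op m (lf m p f)"
abbreviation Hc where "Hc m p \<equiv> hom_space (tensor (sA m)) (tensor (Om p))"

lemma Hc_vs: "vs (Hc m p)" by (rule vs.intro[OF hom_vs]) (simp_all add: T_sA T_Om Ts_vs)
lemma Hc_carrier: "carrier (Hc m p) = cch m p" by (simp add: cch_def)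

lemma Hc_mem:
 shows "f : cch m p ==> g : cch m p ==> f \<oplus>\<^bsub>Hc m p\<^esub> g : cch m p"
  and "f : cch m p ==> c \<odot>\<^bsub>Hc m p\<^esub> f : cch m p" and "\<zero>\<^bsub>Hc m p\<^esub> : cch m p"
proof -
 interpret H: vs "Hc m p" by (rule Hc_vs)
 show "f : cch m p ==> g : cch m p ==> f \<oplus>\<^bsub>Hc m p\<^esub> g : cch m p"
  "f : cch m p ==> c \<odot>\<^bsub>Hc m p\<^esub> f : cch m p" "\<zero>\<^bsub>Hc m p\<^esub> : cch m p"
  unfolding cch_def by (auto intro: H.smult_mem)
qed

lemma lf_Hc:
 shows "f : cch m p ==> g : cch m p ==> w : V m ==> lf m p (f \<oplus>\<^bsub>Hc m p\<^esub> g) w = lf m p f w + lf m p g w"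
  and "f : cch m p ==> w : V m ==> lf m p (c \<odot>\<^bsub>Hc m p\<^esub> f) w = psc c (lf m p f w)"
  and "w : V m ==> lf m p \<zero>\<^bsub>Hc m p\<^esub> w = 0"
proof -
 interpret H: vs "Hc m p" by (rule Hc_vs)
 have s: "X : carrier (Ts (sf m)) ==> (f \<oplus>\<^bsub>Hc m p\<^esub> g) X = f X \<oplus>\<^bsub>Ts (fo p)\<^esub> g X"
  "X : carrier (Ts (sf m)) ==> (c \<odot>\<^bsub>Hc m p\<^esub> f) X = c \<odot>\<^bsub>Ts (fo p)\<^esub> f X"
  "X : carrier (Ts (sf m)) ==> \<zero>\<^bsub>Hc m p\<^esub> X = \<zero>\<^bsub>Ts (fo p)\<^esub>" for X f g
  by (simp_all add: hom_space_def T_sA T_Om)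
 show "f : cch m p ==> g : cch m p ==> w : V m ==> lf m p (f \<oplus>\<^bsub>Hc m p\<^esub> g) w = lf m p f w + lf m p g w"
  by (rule lf_eqI[OF Hc_mem(1)]) (simp_all add: s J_add cch_mem lf_J)
 show "f : cch m p ==> w : V m ==> lf m p (c \<odot>\<^bsub>Hc m p\<^esub> f) w = psc c (lf m p f w)"
  by (rule lf_eqI[OF Hc_mem(2)]) (simp_all add: s J_smult cch_mem lf_J)
 show "w : V m ==> lf m p \<zero>\<^bsub>Hc m p\<^esub> w = 0"
  by (rule lf_eqI[OF Hc_mem(3)]) (simp_all add: s J_zero)
qed

lemma OP_Hc:
 assumes f: "f : cch m p" and g: "g : cch m p" and x: "x : W N" and N: "m <= N"
 shows "OP m p (f \<oplus>\<^bsub>Hc m p\<^esub> g) x = OP m p f x + OP m p g x"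
  and "OP m p (c \<odot>\<^bsub>Hc m p\<^esub> f) x = psc c (OP m p f x)" and "OP m p \<zero>\<^bsub>Hc m p\<^esub> x = 0"
proof -
 note fc = coch_lf[OF f] and gc = coch_lf[OF g]
 note a = Op_one[OF fc] Op_one[OF gc] Op_Lm[OF fc _ order_refl] Op_Lm[OF gc _ order_refl] Op_mult[OF fc _ order_refl] Op_mult[OF gc _ order_refl]
 show "OP m p (f \<oplus>\<^bsub>Hc m p\<^esub> g) x = OP m p f x + OP m p g x"
  by (rule Op_crit[OF coch_lf[OF Hc_mem(1)[OF f g]] _ _ _ _ x N, where \<Phi> = "%x. OP m p f x + OP m p g x"])
   (auto intro!: plin_intros simp: lf_Hc(1)[OF f g] a distrib_right plin_add[OF plin_Lm0])
 show "OP m p (c \<odot>\<^bsub>Hc m p\<^esub> f) x = psc c (OP m p f x)"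
  by (rule Op_crit[OF coch_lf[OF Hc_mem(2)[OF f]] _ _ _ _ x N, where \<Phi> = "%x. psc c (OP m p f x)"])
   (auto intro!: plin_intros simp: lf_Hc(2)[OF f] a psc_mult_left plin_psc[OF plin_Lm0])
 show "OP m p \<zero>\<^bsub>Hc m p\<^esub> x = 0"
  by (rule Op_crit[OF coch_lf[OF Hc_mem(3)] _ _ _ _ x N, where \<Phi> = "%x. 0"])
   (auto intro!: plin_intros simp: lf_Hc(3) plin_0[OF plin_Lm0])
qed

lemma cch_eqI_OP:
 assumes f: "f : cch m p" and g: "g : cch m p" and eq: "!!x. x : W m ==> OP m p f x = OP m p g x"
 shows "f = g"
 by (rule cch_eqI[OF f g]) (use eq[OF u_V_mem] Op_one[OF coch_lf[OF f]] Op_one[OF coch_lf[OF g]] in auto)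

lemma theta_lin: "linear_map (Hc m p) (Hc (Suc m) (Suc p)) (theta m p)"
proof (rule linear_mapI; unfold Hc_carrier)
 fix f assume f: "f : cch m p"
 show "theta m p f : cch (Suc m) (Suc p)" by (rule theta_cch[OF f])
 show "theta m p (c \<odot>\<^bsub>Hc m p\<^esub> f) = c \<odot>\<^bsub>Hc (Suc m) (Suc p)\<^esub> theta m p f" for c
  by (rule cch_eqI_OP[of _ "Suc m" "Suc p"])
   (simp_all add: theta_cch Hc_mem f theta_Op OP_Hc(2)[OF f f, of _ "Suc m"] OP_Hc(2)[OF theta_cch[OF f] theta_cch[OF f], of _ "Suc m"])
 fix g assume g: "g : cch m p"
 show "theta m p (f \<oplus>\<^bsub>Hc m p\<^esub> g) = theta m p f \<oplus>\<^bsub>Hc (Suc m) (Suc p)\<^esub> theta m p g"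
  by (rule cch_eqI_OP[of _ "Suc m" "Suc p"])
   (simp_all add: theta_cch Hc_mem f g theta_Op OP_Hc(1)[OF f g, of _ "Suc m"] OP_Hc(1)[OF theta_cch[OF f] theta_cch[OF g], of _ "Suc m"])
qed

lemma Cnc_eq: "d = int m - int p ==> Cnc d p = Hc m p"
 by (simp add: Cnc_def)
lemma Cnc_vs: "vector_space_on (Cnc d p)"
 using vs.vs[OF Hc_vs] by (simp add: Cnc_def zero_space_vs)
lemma C_theta_lin: "linear_map (Cnc d p) (Cnc d (p + 1)) (C_theta d p)"
proof (cases "d + int p < 0")
 case True
 interpret T: vs "Cnc d (Suc p)" by (rule vs.intro[OF Cnc_vs])
 show ?thesis using True by (auto intro!: linear_mapI simp: C_theta_def T.smult_zero)
next
 case False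
 define m where "m = nat (d + int p)"
 have d: "d = int m - int p" "d = int (Suc m) - int (p + 1)" using False by (auto simp: m_def)
 have "C_theta d p = theta m p" using False by (simp add: fun_eq_iff C_theta_def m_def)
 then show ?thesis using theta_lin[of m p] unfolding Cnc_eq[OF d(1)] Cnc_eq[OF d(2)] by simp
qed

sublocale cl: seqc "Cnc d" "C_theta d" for d by (rule seqc.intro, rule Cnc_vs, rule C_theta_lin)

text \<open>Since m is a natural number, this selects the representatives with a nonnegative number
  of arguments; the others lie in the zero space.\<close>

definition rp :: "int => nat => nat => ('k, 'a) cochain => bool" where
 "rp d m p f \<longleftrightarrow> d = int m - int p & f : cch m p"

lemma push_rp: "rp d m p f ==> rp d (m + i) (p + i) (push (C_theta d) p i f)"
 and push_OP: "rp d m p f ==> x : W N ==> m + i <= N ==> OP (m + i) (p + i) (push (C_theta d) p i f) x = OP m p f x"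
proof -
 assume r: "rp d m p f"
 have "rp d (m + i) (p + i) (push (C_theta d) p i f) & (\<forall>N x. x : W N --> m + i <= N --> OP (m + i) (p + i) (push (C_theta d) p i f) x = OP m p f x)"
 proof (induct i)
  case (Suc i)
  let ?g = "push (C_theta d) p i f"
  have g: "?g : cch (m + i) (p + i)" and d: "d = int (m + i) - int (p + i)" using Suc by (auto simp: rp_def)
  have n: "nat (d + int (p + i)) = m + i" "\<not> d + int (p + i) < 0" using d by auto
  have "C_theta d (p + i) ?g = theta (m + i) (p + i) ?g" by (simp only: C_theta_def n if_False)
  then show ?case using Suc d theta_cch[OF g] theta_Op[OF g] by (auto simp: rp_def)
 qed (use r in auto)
 then show "rp d (m + i) (p + i) (push (C_theta d) p i f)" "x : W N ==> m + i <= N ==> OP (m + i) (p + i) (push (C_theta d) p i f) x = OP m p f x"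
  by auto
qed

text \<open>Cutting off the last \<open>length l\<close> letters is a left inverse of multiplication
  by the word l.\<close>

lemma mon_cancel: "x * mon l = y * mon l ==> x = (y :: 'a list \<Rightarrow>\<^sub>0 'k)"
proof -
 let ?D = "ext (%m. mon (take (length m - length l) m)) :: ('a list \<Rightarrow>\<^sub>0 'k) => _"
 have D: "?D (x * mon l) = x" for x
 proof (rule plin_eqI[where f = "%x. ?D (x * mon l)" and L = UNIV])
  show "plin (%x. ?D (x * mon l))" by (rule plin_ext) (intro plin_intros)
  show "?D (mon m * mon l) = mon m" for m by (simp add: mon_mult)
  show "plin (%x. x)" by (rule plin_id)
  show "x : Kset UNIV" by (simp add: Kset_def)
 qed
 assume e: "x * mon l = y * mon l"
 have "x = ?D (x * mon l)" by (rule D[symmetric])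
 also have "\<dots> = ?D (y * mon l)" by (rule arg_cong[OF e])
 also have "\<dots> = y" by (rule D)
 finally show "x = y" .
qed

lemma rp_carrier: "rp d m p f ==> f : carrier (Cnc d p)"
 by (auto simp: rp_def Cnc_eq Hc_carrier)

text \<open>A germ sees the values of a cochain only with long words attached. If \<open>bS\<close>
  has a letter, its powers can be attached and cancelled; if it has none, \<open>W p\<close> is zero
  for positive p. For A/k = 0 and p = 0 germs do not determine a cochain, because there are no long
  words at all.\<close>

lemma ev_inj:
 assumes c: "coch m p ph" and c': "coch m p \<psi>" and ev: "!!N x. N0 <= N ==> x : W N ==> Op m ph x = Op m \<psi> x"
  and P: "bS ~= {} | 1 <= p" and w: "w : V m"
 shows "ph w = \<psi> w"
proof (cases "bS = {}")
 case True
 then have "WL p = {}" using P by (auto simp: WL_def VL_def)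
 then have "W p = {0}" by (auto simp: W_def Kset_def)
 then show ?thesis using coch_mem[OF c w] coch_mem[OF c' w] by simp
next
 case False
 then obtain b where b: "b : bS" by blast
 have z: "(mon (replicate N0 b) :: 'a list \<Rightarrow>\<^sub>0 'k) : V N0" using b by (auto simp: V_def VL_def)
 have "u 1 * w * mon (replicate N0 b) : W (m + N0)" by (rule W_V_mem[OF u_V_mem[OF w] z])
 from ev[OF _ this] have "ph w * mon (replicate N0 b) = \<psi> w * mon (replicate N0 b)"
  unfolding Op_u[OF c w] Op_u[OF c' w] Lm_one[OF coch_mem[OF c w]] Lm_one[OF coch_mem[OF c' w]] by simp
 then show ?thesis by (rule mon_cancel)
qed

text \<open>Equality in the colimit is equality of germs. The representatives are pushed by
  \<open>Suc q\<close> and \<open>Suc p\<close> steps, not by q and p, so that the common stage is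
  positive and \<open>ev_inj\<close> applies even when A/k = 0.\<close>

lemma sg_eq:
 assumes f: "rp d m p f" and g: "rp d n q g"
 shows "sg_class d p f = sg_class d q g \<longleftrightarrow> (\<exists>N0. \<forall>N\<ge>N0. \<forall>x\<in>W N. OP m p f x = OP n q g x)"
 unfolding sg_class_def cl.cls_eq[OF rp_carrier[OF f] rp_carrier[OF g]]
proof
 assume "\<exists>i j. p + i = q + j & push (C_theta d) p i f = push (C_theta d) q j g"
 then obtain i j where ij: "p + i = q + j" "push (C_theta d) p i f = push (C_theta d) q j g" by blast
 then have m: "m + i = n + j" using f g by (auto simp: rp_def)
 have "OP m p f x = OP n q g x" if "x : W N" "m + i <= N" for N x
  using push_OP[OF f that] push_OP[OF g that(1), of j] that m ij by simp
 then show "\<exists>N0. \<forall>N\<ge>N0. \<forall>x\<in>W N. OP m p f x = OP n q g x" by blast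
next
 assume "\<exists>N0. \<forall>N\<ge>N0. \<forall>x\<in>W N. OP m p f x = OP n q g x"
 then obtain N0 where N0: "!!N x. N0 <= N ==> x : W N ==> OP m p f x = OP n q g x" by blast
 let ?f = "push (C_theta d) p (Suc q) f" and ?g = "push (C_theta d) q (Suc p) g"
 define M P where "M = m + Suc q" and "P = p + Suc q"
 have e: "n + Suc p = M" "q + Suc p = P" using f g by (auto simp: rp_def M_def P_def)
 have fc: "?f : cch M P" using push_rp[OF f, of "Suc q"] unfolding rp_def M_def[symmetric] P_def[symmetric] by blast
 have gc: "?g : cch M P" using push_rp[OF g, of "Suc p"] unfolding e rp_def by blast
 have eq: "OP M P ?f x = OP M P ?g x" if "x : W N" "N0 + M <= N" for N x
  using push_OP[OF f that(1), of "Suc q"] push_OP[OF g that(1), of "Suc p"] N0[OF _ that(1)] that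
  unfolding e M_def[symmetric] P_def[symmetric] by simp
 have "?f = ?g"
 proof (rule cch_eqI[OF fc gc])
  fix w assume w: "w : V M"
  show "lf M P ?f w = lf M P ?g w"
   by (rule ev_inj[OF coch_lf[OF fc] coch_lf[OF gc] eq[OF _ _] _ w, where ?N0.0 = "N0 + M"]) (simp_all add: P_def)
 qed
 then show "\<exists>i j. p + i = q + j & push (C_theta d) p i f = push (C_theta d) q j g"
  by (intro exI[of _ "Suc q"] exI[of _ "Suc p"]) auto
qed

lemma Csg_vs: "vector_space_on (Csg d)" unfolding Csg_def by (rule cl.L_vs)
sublocale Csg: vs "Csg d" for d by (rule vs.intro[OF Csg_vs])

lemma sg_mem: "rp d m p f ==> sg_class d p f : carrier (Csg d)"
 unfolding Csg_def sg_class_def by (rule cl.L_mem[OF rp_carrier])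

lemma Csg_rep: assumes "X : carrier (Csg d)" obtains m p f where "rp d m p f" "X = sg_class d p f" "P0 <= m" "P0 <= p"
proof -
 from assms obtain p0 where p0: "!!p. p0 <= p ==> \<exists>x\<in>carrier (Cnc d p). X = sg_class d p x"
  unfolding Csg_def sg_class_def by (rule cl.L_reps) blast
 define p where "p = p0 + nat \<bar>d\<bar> + P0"
 define m where "m = nat (d + int p)"
 have d: "d = int m - int p" "P0 <= m" by (auto simp: m_def p_def)
 from p0[of p] obtain f where f: "f : carrier (Cnc d p)" "X = sg_class d p f" by (auto simp: p_def)
 have "rp d m p f" using d f(1) unfolding rp_def cch_def Cnc_eq[OF d(1)] by blast
 then show ?thesis by (rule that[OF _ f(2) d(2)]) (simp add: p_def)
qed

text \<open>The function \<open>ph\<close> only has to agree with the operator of a representative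
  on long words. Sums, composites and commutators of operators can therefore describe elements of
  the colimit before any cochain for them has been named.\<close>

definition gop :: "int => (nat \<times> ('k, 'a) cochain) set => (('a list \<Rightarrow>\<^sub>0 'k) => 'a list \<Rightarrow>\<^sub>0 'k) => bool" where
 "gop d X ph \<longleftrightarrow> (\<exists>m p f N0. rp d m p f & X = sg_class d p f & (\<forall>N\<ge>N0. \<forall>x\<in>W N. ph x = OP m p f x))"

lemma gop_rp: "rp d m p f ==> gop d (sg_class d p f) (OP m p f)" unfolding gop_def by blast

lemma gop_carrier: "gop d X ph ==> X : carrier (Csg d)" by (auto simp: gop_def intro: sg_mem)

lemma gop_cong: "gop d X ph ==> (!!N x. N1 <= N ==> x : W N ==> \<psi> x = ph x) ==> gop d X \<psi>"
proof -
 assume "gop d X ph" and eq: "!!N x. N1 <= N ==> x : W N ==> \<psi> x = ph x"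
 then obtain m p f N0 where f: "rp d m p f" "X = sg_class d p f" "!!N x. N0 <= N ==> x : W N ==> ph x = OP m p f x"
  unfolding gop_def by blast
 have "\<psi> x = OP m p f x" if "N0 + N1 <= N" "x : W N" for N x using that f(3)[of N x] eq[of N x] by simp
 then show ?thesis unfolding gop_def using f(1,2) by blast
qed

text \<open>Identities in the colimit are reduced by this to identities between functions on long
  words.\<close>

lemma gop_eqI: assumes "gop d X ph" "gop d Y \<psi>" "!!N x. N1 <= N ==> x : W N ==> ph x = \<psi> x" shows "X = Y"
proof -
 obtain m p f N0 where f: "rp d m p f" "X = sg_class d p f" "!!N x. N0 <= N ==> x : W N ==> ph x = OP m p f x"
  using assms(1) unfolding gop_def by blast
 obtain n q g N2 where g: "rp d n q g" "Y = sg_class d q g" "!!N x. N2 <= N ==> x : W N ==> \<psi> x = OP n q g x"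
  using assms(2) unfolding gop_def by blast
 have "OP m p f x = OP n q g x" if "N0 + N1 + N2 <= N" "x : W N" for N x
  using that f(3)[of N x] g(3)[of N x] assms(3)[of N x] by simp
 then show ?thesis unfolding f(2) g(2) sg_eq[OF f(1) g(1)] by blast
qed

lemma gop_at:
 assumes "gop d X ph" obtains m p f N1 where "rp d m p f" "X = sg_class d p f" "P0 <= m" "P0 <= p"
  "!!N x. N1 <= N ==> x : W N ==> ph x = OP m p f x"
proof -
 obtain m p f where f: "rp d m p f" "X = sg_class d p f" "P0 <= m" "P0 <= p" by (rule Csg_rep[OF gop_carrier[OF assms]])
 obtain n q g N2 where g: "rp d n q g" "X = sg_class d q g" "!!N x. N2 <= N ==> x : W N ==> ph x = OP n q g x"
  using assms unfolding gop_def by blast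
 obtain N0 where N0: "!!N x. N0 <= N ==> x : W N ==> OP m p f x = OP n q g x"
  using sg_eq[OF f(1) g(1)] f(2) g(2) by auto
 have "ph x = OP m p f x" if "N0 + N2 <= N" "x : W N" for N x using that N0[of N x] g(3)[of N x] by simp
 then show ?thesis by (rule that[OF f])
qed

lemma gop_add: assumes "gop d X ph" "gop d Y \<psi>" shows "gop d (X \<oplus>\<^bsub>Csg d\<^esub> Y) (%x. ph x + \<psi> x)"
proof -
 obtain m p f N1 where f: "rp d m p f" "X = sg_class d p f" "!!N x. N1 <= N ==> x : W N ==> ph x = OP m p f x"
  by (rule gop_at[OF assms(1), of 0]) blast
 obtain n q g N2 where g: "rp d n q g" "Y = sg_class d q g" "p <= q" "!!N x. N2 <= N ==> x : W N ==> \<psi> x = OP n q g x"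
  by (rule gop_at[OF assms(2), of p]) blast
 obtain i where i: "q = p + i" using g(3) le_Suc_ex by blast
 then have n: "n = m + i" using f g by (auto simp: rp_def)
 let ?f = "push (C_theta d) p i f"
 note f' = push_rp[OF f(1), of i, folded i n]
 have X: "X = sg_class d q ?f" using cl.cls_push[OF rp_carrier[OF f(1)], of i] by (simp add: f(2) i sg_class_def)
 have d: "d = int n - int q" and fg: "?f : cch n q" "g : cch n q" using g(1) f' by (simp_all add: rp_def)
 have s: "X \<oplus>\<^bsub>Csg d\<^esub> Y = sg_class d q (?f \<oplus>\<^bsub>Hc n q\<^esub> g)"
  unfolding X g(2) using cl.L_add[OF rp_carrier[OF f'] rp_carrier[OF g(1)]] by (simp add: Csg_def sg_class_def Cnc_eq[OF d])
 have r: "rp d n q (?f \<oplus>\<^bsub>Hc n q\<^esub> g)" using d Hc_mem(1)[OF fg] by (simp add: rp_def)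
 show ?thesis
  unfolding s
 proof (rule gop_cong[OF gop_rp[OF r], of "N1 + N2 + n"])
  fix N x assume N: "N1 + N2 + n <= N" and x: "x : W N"
  show "ph x + \<psi> x = OP n q (?f \<oplus>\<^bsub>Hc n q\<^esub> g) x"
   using N f(3)[OF _ x] g(4)[OF _ x] OP_Hc(1)[OF fg x] push_OP[OF f(1) x, of i, folded i n] by simp
 qed
qed

lemma gop_smult: assumes "gop d X ph" shows "gop d (c \<odot>\<^bsub>Csg d\<^esub> X) (%x. psc c (ph x))"
proof -
 obtain m p f N1 where f: "rp d m p f" "X = sg_class d p f" "!!N x. N1 <= N ==> x : W N ==> ph x = OP m p f x"
  by (rule gop_at[OF assms(1), of 0]) blast
 have d: "d = int m - int p" and fc: "f : cch m p" using f(1) by (simp_all add: rp_def)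
 have s: "c \<odot>\<^bsub>Csg d\<^esub> X = sg_class d p (c \<odot>\<^bsub>Hc m p\<^esub> f)"
  unfolding f(2) using cl.L_smult[OF rp_carrier[OF f(1)]] by (simp add: Csg_def sg_class_def Cnc_eq[OF d])
 have r: "rp d m p (c \<odot>\<^bsub>Hc m p\<^esub> f)" using d Hc_mem(2)[OF fc] by (simp add: rp_def)
 show ?thesis
  unfolding s
 proof (rule gop_cong[OF gop_rp[OF r], of "N1 + m"])
  fix N x assume N: "N1 + m <= N" and x: "x : W N"
  show "psc c (ph x) = OP m p (c \<odot>\<^bsub>Hc m p\<^esub> f) x" using N f(3)[OF _ x] OP_Hc(2)[OF fc fc x] by simp
 qed
qed

lemma gop_ex: assumes "X : carrier (Csg d)" obtains ph where "gop d X ph"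
 by (rule Csg_rep[OF assms, of 0]) (use that gop_rp in blast)

lemma gop_zero: "gop d \<zero>\<^bsub>Csg d\<^esub> (%x. 0)"
proof -
 obtain ph where "gop d \<zero>\<^bsub>Csg d\<^esub> ph" by (rule gop_ex[OF Csg.zero_closed])
 from gop_smult[OF this, of 0] show ?thesis by (simp add: Csg.smult_zero)
qed
lemma gop_neg: "gop d X ph ==> gop d (\<ominus>\<^bsub>Csg d\<^esub> X) (%x. - ph x)"
 using gop_smult[of d X ph "-1"] by (simp add: Csg.neg_smult[OF gop_carrier] psc_neg_one)
lemma gop_signed: "gop d X ph ==> gop d (signed (Csg d) k X) (%x. eps k (ph x))"
 using gop_neg[of d X ph] by (simp add: signed_def eps_def)
lemma gop_minus: "gop d X ph ==> gop d Y \<psi> ==> gop d (X \<ominus>\<^bsub>Csg d\<^esub> Y) (%x. ph x - \<psi> x)"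
 using gop_add[OF _ gop_neg, of d X ph Y \<psi>] by (simp add: a_minus_def)
lemma gop_finsum: "finite I ==> (!!i. i : I ==> gop d (X i) (ph i)) ==> gop d (\<Oplus>\<^bsub>Csg d\<^esub>i\<in>I. X i) (%x. \<Sum>i\<in>I. ph i x)"
proof (induct I rule: finite_induct)
 case (insert i I)
 have "(\<Oplus>\<^bsub>Csg d\<^esub>i\<in>insert i I. X i) = X i \<oplus>\<^bsub>Csg d\<^esub> (\<Oplus>\<^bsub>Csg d\<^esub>i\<in>I. X i)"
  by (rule Csg.finsum_insert) (use insert in \<open>auto intro: gop_carrier\<close>)
 then show ?case using gop_add[OF insert(4)[of i] insert(3)] insert by simp
qed (simp add: gop_zero)

end

section \<open>Germs of the differential, the cup product and the bracket\<close>

lemma linear_combI: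
 assumes V: "vector_space_on V" and W: "vector_space_on W" and mem: "!!x. x : carrier V ==> f x : carrier W"
  and comb: "!!c x y. x : carrier V ==> y : carrier V ==> f (c \<odot>\<^bsub>V\<^esub> x \<oplus>\<^bsub>V\<^esub> y) = c \<odot>\<^bsub>W\<^esub> f x \<oplus>\<^bsub>W\<^esub> f y"
 shows "linear_map V W f"
proof -
 interpret V: vs V by (rule vs.intro[OF V])
 interpret W: vs W by (rule vs.intro[OF W])
 have add: "f (x \<oplus>\<^bsub>V\<^esub> y) = f x \<oplus>\<^bsub>W\<^esub> f y" if "x : carrier V" "y : carrier V" for x y
  using comb[OF that, of 1] that by (simp add: V.one_smult W.one_smult mem)
 have zero: "f \<zero>\<^bsub>V\<^esub> = \<zero>\<^bsub>W\<^esub>"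
  using add[of "\<zero>\<^bsub>V\<^esub>" "\<zero>\<^bsub>V\<^esub>"] mem[of "\<zero>\<^bsub>V\<^esub>"] by simp
 show ?thesis
 proof (rule linear_mapI[OF mem add])
  fix c x assume x: "x : carrier V"
  show "f (c \<odot>\<^bsub>V\<^esub> x) = c \<odot>\<^bsub>W\<^esub> f x"
   using comb[OF x V.zero_closed, of c] x by (simp add: zero V.smult_mem W.smult_mem mem)
 qed
qed

lemma Union_const: "S ~= {} ==> (!!X. X : S ==> X = C) ==> \<Union>S = C" by blast

context algebra_over_field
begin

lemma sg_memD: "rp d m p f ==> (q, g) : sg_class d p f ==> g : carrier (Cnc d q) & sg_class d q g = sg_class d p f"
 unfolding sg_class_def using cl.cls_mem_eq[OF rp_carrier] by blast
lemma sg_self: "rp d m p f ==> (p, f) : sg_class d p f"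
 unfolding sg_class_def using cl.cls_mem_eq[OF rp_carrier] rp_carrier by blast
lemma rp_nonneg: "g : carrier (Cnc d q) ==> 0 <= d + int q ==> rp d (nat (d + int q)) q g"
 by (simp add: rp_def Cnc_def cch_def)
lemma sg_rp: "rp d m p f ==> (q, g) : sg_class d p f ==> 0 <= d + int q ==> rp d (nat (d + int q)) q g & sg_class d q g = sg_class d p f"
 using sg_memD rp_nonneg by blast
lemma rp_nat: "rp d m p f ==> nat (d + int p) = m & 0 <= d + int p" by (simp add: rp_def)
lemma rp_coch: "rp d m p f ==> coch m p (lf m p f)" by (simp add: rp_def coch_lf)

lemma gop_uniq: assumes "gop d X ph" "gop d X \<psi>" obtains N0 where "!!N x. N0 <= N ==> x : W N ==> ph x = \<psi> x"
proof -
 obtain m p f N0 where f: "rp d m p f" "X = sg_class d p f" "!!N x. N0 <= N ==> x : W N ==> ph x = OP m p f x"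
  using assms(1) unfolding gop_def by blast
 obtain n q g N2 where g: "rp d n q g" "X = sg_class d q g" "!!N x. N2 <= N ==> x : W N ==> \<psi> x = OP n q g x"
  using assms(2) unfolding gop_def by blast
 obtain N1 where N1: "!!N x. N1 <= N ==> x : W N ==> OP m p f x = OP n q g x"
  using sg_eq[OF f(1) g(1)] f(2) g(2) by auto
 have "ph x = \<psi> x" if "N0 + N1 + N2 <= N" "x : W N" for N x
  using that f(3)[of N x] g(3)[of N x] N1[of N x] by simp
 then show ?thesis by (rule that)
qed

text \<open>Words with a last letter span, so a linear function on long words is known from its
  values on y followed by \<open>v a\<close>; there the differential is the graded commutator with
  the right action.\<close>

lemma diff_ev:
 assumes f: "rp d m p f" and eq: "!!N x. N0 <= N ==> x : W N ==> ph x = OP m p f x" and psi: "plin \<psi>"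
  and d: "!!N x a. N1 <= N ==> x : W N ==> \<psi> (x * v a) = eps (int N - d + 1) (ph (R a x) - R a (ph x))"
  and x: "x : W N" and N: "N0 + N1 + m + 1 <= N"
 shows "\<psi> x = OP (Suc m) p (diff m p f) x"
proof -
 obtain K where K: "N = Suc K" using N by (cases N) auto
 show ?thesis
 proof (rule W_Suc_eqI[OF psi plin_Op0 x[unfolded K]])
  fix y a assume y: "y : W K"
  have f': "f : cch m p" "d = int m - int p" using f by (simp_all add: rp_def)
  show "\<psi> (y * v a) = OP (Suc m) p (diff m p f) (y * v a)"
   using N d[of K y a] y K eq[of K y] eq[of K "R a y"] diff_Op[OF f'(1) y, of a] by (simp add: R_mem f'(2))
 qed
qed

lemma rp_diff: "rp d m p f ==> rp (d + 1) (Suc m) p (diff m p f)" by (simp add: rp_def diff_cch)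

lemma Csg_diff_rp: assumes r: "rp d m p f" shows "Csg_diff d (sg_class d p f) = sg_class (d + 1) p (diff m p f)"
 unfolding Csg_diff_def
proof (rule Union_const)
 show "{sg_class (d + 1) q (C_diff q d g) |q g. (q, g) : sg_class d p f} ~= {}" using sg_self[OF r] by blast
 fix Y assume "Y : {sg_class (d + 1) q (C_diff q d g) |q g. (q, g) : sg_class d p f}"
 then obtain q g where Y: "Y = sg_class (d + 1) q (C_diff q d g)" and g: "(q, g) : sg_class d p f" by blast
 show "Y = sg_class (d + 1) p (diff m p f)"
 proof (cases "d + int q < 0")
  \<comment> \<open>A representative with a negative number of arguments is zero, so the class is
    zero too, and its differential must be shown to vanish for the other representative.\<close>
  case True
  have g0: "g = \<zero>\<^bsub>Cnc d q\<^esub>" using sg_memD[OF r g] True by (simp add: Cnc_def zero_space_def)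
  have z: "sg_class d p f = \<zero>\<^bsub>Csg d\<^esub>"
   using sg_memD[OF r g] cl.L_zero[of d q] unfolding g0 by (simp add: Csg_def sg_class_def)
  have Y0: "Y = \<zero>\<^bsub>Csg (d + 1)\<^esub>" using cl.L_zero[of "d + 1" q] True by (simp add: Y C_diff_def Csg_def sg_class_def)
  obtain N0 where N0: "!!N x. N0 <= N ==> x : W N ==> 0 = OP m p f x"
   using gop_uniq[OF gop_zero[of d] gop_rp[OF r, unfolded z]] by metis
  have "(0 :: 'a list \<Rightarrow>\<^sub>0 'k) = OP (Suc m) p (diff m p f) x" if "N0 + 0 + m + 1 <= N" "x : W N" for N x
   by (rule diff_ev[where ph = "%x. 0" and \<psi> = "%x. 0", OF r N0 plin_const_0 _ that(2,1)]) (auto simp: plin_0[OF plin_R0])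
  then show ?thesis unfolding Y0 by (intro gop_eqI[OF gop_zero gop_rp[OF rp_diff[OF r]]])
 next
  case False
  define n where "n = nat (d + int q)"
  have g': "rp d n q g" "sg_class d q g = sg_class d p f" using sg_rp[OF r g] False by (simp_all add: n_def)
  obtain N0 where N0: "!!N x. N0 <= N ==> x : W N ==> OP n q g x = OP m p f x"
   using sg_eq[OF g'(1) r] g'(2) by auto
  have n': "n <= N" "int N - (int n - int q) + 1 = int N - d + 1" if "n <= N" for N using that g'(1) by (simp_all add: rp_def)
  have "OP (Suc n) q (diff n q g) x = OP (Suc m) p (diff m p f) x" if "N0 + n + m + 1 <= N" "x : W N" for N x
  proof (rule diff_ev[where ?N1.0 = n, OF r N0 plin_Op0 _ that(2,1)])
   fix N x a assume "n <= N" "x : W N"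
   then show "OP (Suc n) q (diff n q g) (x * v a) = eps (int N - d + 1) (OP n q g (R a x) - R a (OP n q g x))"
    using diff_Op[of g n q x N a] g'(1) by (simp add: rp_def)
  qed
  moreover have "C_diff q d g = diff n q g" using False by (simp add: C_diff_def n_def)
  ultimately show ?thesis
   unfolding Y by (simp only:) (rule gop_eqI[OF gop_rp[OF rp_diff[OF g'(1)]] gop_rp[OF rp_diff[OF r]]])
 qed
qed

lemma gop_diff:
 assumes X: "gop d X ph" and psi: "plin \<psi>"
  and d: "!!N x a. N1 <= N ==> x : W N ==> \<psi> (x * v a) = eps (int N - d + 1) (ph (R a x) - R a (ph x))"
 shows "gop (d + 1) (Csg_diff d X) \<psi>"
proof -
 obtain m p f N0 where f: "rp d m p f" "X = sg_class d p f" "!!N x. N0 <= N ==> x : W N ==> ph x = OP m p f x"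
  using X unfolding gop_def by blast
 show ?thesis
  unfolding f(2) Csg_diff_rp[OF f(1)]
  by (rule gop_cong[OF gop_rp[OF rp_diff[OF f(1)]]]) (rule diff_ev[OF f(1) f(3) psi d])
qed

text \<open>Here \<open>ph\<close> is a coordinate cochain rather than the coordinate form of a
  chosen element. This admits the composite \<open>cupo\<close> with fewer arguments than the
  definition of the cup product provides.\<close>

definition cg where "cg d m p ph X \<longleftrightarrow> d = int m - int p & coch m p ph & gop d X (Op m ph)"

lemma cgD: "cg d m p ph X ==> d = int m - int p" "cg d m p ph X ==> coch m p ph" "cg d m p ph X ==> gop d X (Op m ph)"
 unfolding cg_def by blast+
lemma cg_rp: "rp d m p f ==> cg d m p (lf m p f) (sg_class d p f)"
 using rp_coch gop_rp by (simp add: cg_def rp_def)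
lemma cg_ex: assumes "X : carrier (Csg d)" obtains m p ph where "cg d m p ph X" "P0 <= m" "P0 <= p"
 by (rule Csg_rep[OF assms, of P0]) (use cg_rp that in blast)

lemma Csg_rep_at: assumes "X : carrier (Csg d)" obtains p0 where "!!p. p0 <= p ==> \<exists>m f. rp d m p f & X = sg_class d p f"
proof -
 from assms obtain p0 where p0: "!!p. p0 <= p ==> \<exists>x\<in>carrier (Cnc d p). X = sg_class d p x"
  unfolding Csg_def sg_class_def by (rule cl.L_reps) blast
 show ?thesis
 proof (rule that[of "p0 + nat \<bar>d\<bar>"])
  fix p assume p: "p0 + nat \<bar>d\<bar> <= p"
  then obtain f where f: "f : carrier (Cnc d p)" "X = sg_class d p f" using p0[of p] by auto
  have "rp d (nat (d + int p)) p f" by (rule rp_nonneg[OF f(1)]) (use p in simp)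
  then show "\<exists>m f. rp d m p f & X = sg_class d p f" using f(2) by blast
 qed
qed

lemma cg_diff: "cg d m p ph X ==> cg (d + 1) (Suc m) p (dop m p ph) (Csg_diff d X)"
 unfolding cg_def
proof (intro conjI; (elim conjE)?)
 assume d: "d = int m - int p" and c: "coch m p ph" and g: "gop d X (Op m ph)"
 show "d + 1 = int (Suc m) - int p" using d by simp
 show "coch (Suc m) p (dop m p ph)" by (rule coch_dop[OF c])
 show "gop (d + 1) (Csg_diff d X) (Op (Suc m) (dop m p ph))"
 proof (rule gop_diff[OF g plin_Op0, where ?N1.0 = m])
  fix N x a assume "m <= N" and x: "x : W N"
  then obtain k where k: "N = m + k" using le_Suc_ex by blast
  show "Op (Suc m) (dop m p ph) (x * v a) = eps (int N - d + 1) (Op m ph (R a x) - R a (Op m ph x))"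
   using Op_dop[OF c x[unfolded k], of a] by (simp add: k d add.commute)
 qed
qed

text \<open>Operations on the colimit are unions over all pairs of representatives. If every pair
  yields an element with the same germ, these elements coincide and the union is that element, so
  well-definedness and value come out together.\<close>

lemma gop_Union:
 assumes X: "X : carrier (Csg d)" and Y: "Y : carrier (Csg e)"
  and mem: "!!m p f n q g. [| rp d m p f; X = sg_class d p f; rp e n q g; Y = sg_class e q g |] ==> gop k (B m p f n q g) \<Phi>"
 shows "gop k (\<Union>{B (nat (d + int p)) p f (nat (e + int q)) q g |p f q g.
   (p, f) : X & (q, g) : Y & 0 <= d + int p & 0 <= e + int q}) \<Phi>" (is "gop k (\<Union>?S) \<Phi>")
proof -
 obtain m p f where f: "rp d m p f" "X = sg_class d p f" by (rule Csg_rep[OF X, of 0])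
 obtain n q g where g: "rp e n q g" "Y = sg_class e q g" by (rule Csg_rep[OF Y, of 0])
 have "\<Union>?S = B m p f n q g"
 proof (rule Union_const)
  have "B (nat (d + int p)) p f (nat (e + int q)) q g : ?S"
   using sg_self[OF f(1)] sg_self[OF g(1)] rp_nat[OF f(1)] rp_nat[OF g(1)] unfolding f(2) g(2) by blast
  then show "?S ~= {}" by blast
  fix Z assume "Z : ?S"
  then obtain p1 f1 q1 g1 where Z: "Z = B (nat (d + int p1)) p1 f1 (nat (e + int q1)) q1 g1"
   "(p1, f1) : X" "(q1, g1) : Y" "0 <= d + int p1" "0 <= e + int q1" by blast
  have f1: "rp d (nat (d + int p1)) p1 f1" "X = sg_class d p1 f1" using sg_rp[OF f(1) Z(2)[unfolded f(2)] Z(4)] f(2) by auto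
  have g1: "rp e (nat (e + int q1)) q1 g1" "Y = sg_class e q1 g1" using sg_rp[OF g(1) Z(3)[unfolded g(2)] Z(5)] g(2) by auto
  show "Z = B m p f n q g" unfolding Z(1) by (rule gop_eqI[OF mem[OF f1 g1] mem[OF f g] refl])
 qed
 then show ?thesis using mem[OF f g] by simp
qed

lemma gop_cup:
 assumes X: "cg d m p ph X" and Y: "cg e n q ga Y"
 shows "gop (d + e) (Csg_cup d e X Y) (%x. Op m ph (Op n ga x))"
proof -
 have mem: "gop (d + e) (sg_class (d + e) (p' + q') (cup m' p' f n' q' g)) (%x. Op m ph (Op n ga x))"
  if f: "rp d m' p' f" "X = sg_class d p' f" and g: "rp e n' q' g" "Y = sg_class e q' g" for m' p' f n' q' g
 proof -
  have r: "rp (d + e) (m' + n') (p' + q') (cup m' p' f n' q' g)" using f(1) g(1) cup_cch by (auto simp: rp_def)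
  obtain N1 where N1: "!!N x. N1 <= N ==> x : W N ==> Op m ph x = OP m' p' f x"
   using gop_uniq[OF cgD(3)[OF X] gop_rp[OF f(1), folded f(2)]] by blast
  obtain N2 where N2: "!!N x. N2 <= N ==> x : W N ==> Op n ga x = OP n' q' g x"
   using gop_uniq[OF cgD(3)[OF Y] gop_rp[OF g(1), folded g(2)]] by blast
  show ?thesis
  proof (rule gop_cong[OF gop_rp[OF r], of "N1 + N2 + m' + n + n'"])
   fix N x assume N: "N1 + N2 + m' + n + n' <= N" and x: "x : W N"
   have "Op n ga x : W (N - n + q)" using Op_mem'[OF cgD(2)[OF Y] x] N by simp
   then have "Op m ph (Op n ga x) = OP m' p' f (OP n' q' g x)" using N1[of "N - n + q"] N N2[of N x] x by simp
   then show "Op m ph (Op n ga x) = OP (m' + n') (p' + q') (cup m' p' f n' q' g) x"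
    using cup_Op[of f m' p' g n' q' x N] f(1) g(1) x N by (simp add: rp_def)
  qed
 qed
 show ?thesis
  unfolding Csg_cup_def
  by (rule gop_Union[OF gop_carrier[OF cgD(3)[OF X]] gop_carrier[OF cgD(3)[OF Y]],
    where B = "%m p f n q g. sg_class (d + e) (p + q) (cup m p f n q g)"]) (rule mem)
qed

text \<open>The summands may come from different stages, but each one has a germ, and
  \<open>circ0_fin\<close> says that these germs add up to the commutator. The sign of the
  commutator accounts for the shift by m + p in the exponents of the negative insertions.\<close>

lemma gop_circ:
 assumes f: "rp d m p f" and g: "rp e n q g"
 shows "gop (d + e - 1) (circ (Csg (d + e - 1)) (sg_class (d + e - 1)) m p f n q g) (circ0 m p (lf m p f) n q (lf n q g))"
proof -
 let ?f = "lf m p f" and ?g = "lf n q g" and ?k = "int n - int q - 1" and ?D = "d + e - 1"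
 have fc: "f : cch m p" and gc: "g : cch n q" and d: "d = int m - int p" and e: "e = int n - int q" using f g by (simp_all add: rp_def)
 note F = coch_lf[OF fc] and G = coch_lf[OF gc]
 have pos: "gop ?D (signed (Csg ?D) (?k * (int i - 1)) (sg_class ?D (p + q) (circ_pos m p f i n q g)))
   (%x. eps (?k * (int i - 1)) (Op m ?f (gi i n ?g x)))" if i: "i : {1..m}" for i
 proof (rule gop_signed)
  have i': "1 <= i" "i <= m" using i by auto
  have r: "rp ?D (m + n - 1) (p + q) (circ_pos m p f i n q g)"
   using circ_pos_cch[OF fc gc i'] i' d e by (simp add: rp_def of_nat_diff)
  show "gop ?D (sg_class ?D (p + q) (circ_pos m p f i n q g)) (%x. Op m ?f (gi i n ?g x))"
   by (rule gop_cong[OF gop_rp[OF r], of "m + n - 1"]) (rule circ_pos_Op[OF fc gc i', symmetric])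
 qed
 have neg: "gop ?D (signed (Csg ?D) (?k * (int i - int m - int p - 1)) (if n = 0 then sg_class ?D (p + q + 1) (circ_neg m p f i 1 (q + 1) (theta 0 q g))
    else sg_class ?D (p + q) (circ_neg m p f i n q g)))
   (%x. eps (?k * (int i - int m - int p - 1)) (gi i n ?g (Op m ?f x)))" if i: "i : {1..p}" for i
 proof (rule gop_signed)
  have i': "1 <= i" "i <= p" using i by auto
  show "gop ?D (if n = 0 then sg_class ?D (p + q + 1) (circ_neg m p f i 1 (q + 1) (theta 0 q g))
    else sg_class ?D (p + q) (circ_neg m p f i n q g)) (%x. gi i n ?g (Op m ?f x))"
  proof (cases "n = 0")
   case False
   have r: "rp ?D (m + n - 1) (p + q) (circ_neg m p f i n q g)"
    using circ_neg_cch[OF fc gc i'] False d e by (simp add: rp_def of_nat_diff)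
   have "gop ?D (sg_class ?D (p + q) (circ_neg m p f i n q g)) (%x. gi i n ?g (Op m ?f x))"
    by (rule gop_cong[OF gop_rp[OF r], of "m + n - 1"]) (rule circ_neg_Op[OF fc gc i', symmetric], use False in auto)
   then show ?thesis using False by simp
  next
   \<comment> \<open>A cochain without arguments is replaced by its next stage, which has one. Both
     have the same operator on long words, and the insertion depends on nothing else by
     \<open>gi_cong\<close>.\<close>
   case True
   note gc0 = gc[unfolded True] 
   have tc: "theta 0 q g : cch 1 (q + 1)" using theta_cch[OF gc0] by simp
   let ?t = "lf 1 (q + 1) (theta 0 q g)"
   have r: "rp ?D (m + 1 - 1) (p + (q + 1)) (circ_neg m p f i 1 (q + 1) (theta 0 q g))"
    using circ_neg_cch[OF fc tc i'] d e True by (simp add: rp_def)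
   have "gop ?D (sg_class ?D (p + (q + 1)) (circ_neg m p f i 1 (q + 1) (theta 0 q g))) (%x. gi i n ?g (Op m ?f x))"
   proof (rule gop_cong[OF gop_rp[OF r], of "2 * m + i + 5"])
    fix N x assume N: "2 * m + i + 5 <= N" and x: "x : W N"
    have y: "Op m ?f x : W (N - m + p)" using Op_mem'[OF F x] N by simp
    have "gi (Suc (i - 1)) n ?g (Op m ?f x) = gi (Suc (i - 1)) 1 ?t (Op m ?f x)"
     by (rule gi_cong[OF G coch_lf[OF tc] _ y, where ?N0.0 = 1]) (use N True theta_Op[OF gc0] in auto)
    then show "gi i n ?g (Op m ?f x) = OP (m + 1 - 1) (p + (q + 1)) (circ_neg m p f i 1 (q + 1) (theta 0 q g)) x"
     using circ_neg_Op[OF fc tc i' order_refl x] N i' by simp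
   qed
   then show ?thesis using True by (simp add: add.assoc)
  qed
 qed
 show ?thesis
  unfolding circ_def
 proof (rule gop_cong[OF gop_minus[OF gop_finsum[OF _ pos] gop_finsum[OF _ neg]], where ?N1.0 = m])
  fix N x assume N: "m <= N" and x: "x : W N"
  have "eps ((int m - int p) * ?k) (\<Sum>i = 1..p. eps (?k * (int i - 1)) (gi i n ?g (Op m ?f x)))
   = (\<Sum>i = 1..p. eps (?k * (int i - int m - int p - 1)) (gi i n ?g (Op m ?f x)))"
   unfolding eps_sum eps_eps by (intro sum.cong refl eps_cong) (simp add: algebra_simps)
  then show "circ0 m p ?f n q ?g x = (\<Sum>i = 1..m. eps (?k * (int i - 1)) (Op m ?f (gi i n ?g x)))
   - (\<Sum>i = 1..p. eps (?k * (int i - int m - int p - 1)) (gi i n ?g (Op m ?f x)))"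
   unfolding circ0_fin[OF F G x N] by simp
 qed auto
qed

lemma gop_bracket:
 assumes X: "cg d m p ph X" and Y: "cg e n q ga Y"
 shows "gop (d + e - 1) (Csg_bracket d e X Y) (%x. circ0 m p ph n q ga x - eps ((d - 1) * (e - 1)) (circ0 n q ga m p ph x))"
proof -
 let ?B = "bracket (Csg (d + e - 1)) (sg_class (d + e - 1))"
 have mem: "gop (d + e - 1) (?B m' p' f n' q' g) (%x. circ0 m p ph n q ga x - eps ((d - 1) * (e - 1)) (circ0 n q ga m p ph x))"
  if f: "rp d m' p' f" "X = sg_class d p' f" and g: "rp e n' q' g" "Y = sg_class e q' g" for m' p' f n' q' g
 proof -
  have d: "d = int m' - int p'" "e = int n' - int q'" using f(1) g(1) by (simp_all add: rp_def)
  obtain N1 where N1: "!!N x. N1 <= N ==> x : W N ==> Op m ph x = OP m' p' f x"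
   using gop_uniq[OF cgD(3)[OF X] gop_rp[OF f(1), folded f(2)]] by blast
  obtain N2 where N2: "!!N x. N2 <= N ==> x : W N ==> Op n ga x = OP n' q' g x"
   using gop_uniq[OF cgD(3)[OF Y] gop_rp[OF g(1), folded g(2)]] by blast
  have eq1: "!!N x. N1 + N2 <= N ==> x : W N ==> Op m ph x = OP m' p' f x"
   and eq2: "!!N x. N1 + N2 <= N ==> x : W N ==> Op n ga x = OP n' q' g x"
   using N1 N2 add_leD1 add_leD2 by blast+
  have deg: "int m - int p = int m' - int p'" "int n - int q = int n' - int q'" using d cgD(1)[OF X] cgD(1)[OF Y] by simp_all
  note c1 = circ0_cong[OF cgD(2)[OF X] rp_coch[OF f(1)] cgD(2)[OF Y] rp_coch[OF g(1)] eq1 eq2 deg]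
  note c2 = circ0_cong[OF cgD(2)[OF Y] rp_coch[OF g(1)] cgD(2)[OF X] rp_coch[OF f(1)] eq2 eq1 deg(2,1)]
  have e2: "e + d - 1 = d + e - 1" by simp
  show ?thesis
   unfolding bracket_def
   by (rule gop_cong[OF gop_minus[OF gop_circ[OF f(1) g(1)] gop_signed[OF gop_circ[OF g(1) f(1), unfolded e2]]],
     of "N1 + N2 + m + m' + p + p' + n + n' + q + q'"])
    (simp add: c1 c2 d)
 qed
 show ?thesis
  unfolding Csg_bracket_def
  by (rule gop_Union[OF gop_carrier[OF cgD(3)[OF X]] gop_carrier[OF cgD(3)[OF Y]], where B = ?B]) (rule mem)
qed

lemma gi_comb:
 assumes eq: "!!w. w : V n ==> \<eta> w = psc c (ga w) + ga' w" and y: "y : W j"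
 shows "gi (Suc k) n \<eta> y = psc c (gi (Suc k) n ga y) + gi (Suc k) n ga' y"
proof (rule plin_eqI[OF plin_ins0 _ y[unfolded W_def]])
 show "plin (%y. psc c (gi (Suc k) n ga y) + gi (Suc k) n ga' y)" by (intro plin_intros)
 fix l assume l: "l : WL j"
 obtain b l' where l': "l = b # l'" "l' : VL j" using l by (auto simp: WL_def)
 have "mon (take n (drop (Suc k) l)) : V n" if "Suc k + n <= length l"
  using that l' set_take_subset[of n "drop k l'"] set_drop_subset[of k l'] by (auto simp: V_def VL_def)
 then show "gi (Suc k) n \<eta> (mon l) = psc c (gi (Suc k) n ga (mon l)) + gi (Suc k) n ga' (mon l)"
  using eq by (simp add: ins_def plin_add[OF plin_ba0] plin_psc[OF plin_ba0] distrib_left distrib_right psc_mult_left[symmetric] psc_mult_right[symmetric])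
qed

lemma Op_comb:
 assumes g: "coch n q ga" and g': "coch n q ga'" and h: "coch n q \<eta>"
  and eq: "!!w. w : V n ==> \<eta> w = psc c (ga w) + ga' w" and y: "y : W j" "n <= j"
 shows "Op n \<eta> y = psc c (Op n ga y) + Op n ga' y"
 by (rule Op_crit[OF h _ _ _ _ y, where \<Phi> = "%y. psc c (Op n ga y) + Op n ga' y"])
  (auto intro!: plin_intros simp: eq Op_one[OF g] Op_one[OF g'] Op_Lm[OF g _ order_refl] Op_Lm[OF g' _ order_refl] Op_mult[OF g _ order_refl] Op_mult[OF g' _ order_refl]
   distrib_right plin_add[OF plin_Lm0] plin_psc[OF plin_Lm0] psc_mult_left)

lemma circ0_comb:
 assumes f: "coch m p ph" and g: "coch n q ga" and g': "coch n q ga'" and h: "coch n q \<eta>"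
  and eq: "!!w. w : V n ==> \<eta> w = psc c (ga w) + ga' w" and x: "x : W N" and N: "m + n <= N"
 shows "circ0 m p ph n q \<eta> x = psc c (circ0 m p ph n q ga x) + circ0 m p ph n q ga' x"
  and "circ0 n q \<eta> m p ph x = psc c (circ0 n q ga m p ph x) + circ0 n q ga' m p ph x"
proof -
 have mN: "m <= N" "n <= N" using N by auto
 have gi: "gi i n \<eta> y = psc c (gi i n ga y) + gi i n ga' y" if "1 <= i" "y : W j" for i y j
  using gi_comb[OF eq that(2), where k = "i - 1"] that(1) by simp
 note Fx = Op_mem'[OF f x mN(1)]
 note Fp = plin_add[OF plin_Op0] plin_psc[OF plin_Op0]
 have "(\<Sum>i = 1..m. eps (k * (int i - 1)) (Op m ph (gi i n \<eta> x))) = psc c (\<Sum>i = 1..m. eps (k * (int i - 1)) (Op m ph (gi i n ga x))) + (\<Sum>i = 1..m. eps (k * (int i - 1)) (Op m ph (gi i n ga' x)))" for k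
  unfolding psc_sum sum.distrib[symmetric] by (rule sum.cong[OF refl]) (simp add: gi[OF _ x] Fp eps_add eps_psc)
 moreover have "(\<Sum>i = 1..p. eps (k * (int i - 1)) (gi i n \<eta> (Op m ph x))) = psc c (\<Sum>i = 1..p. eps (k * (int i - 1)) (gi i n ga (Op m ph x))) + (\<Sum>i = 1..p. eps (k * (int i - 1)) (gi i n ga' (Op m ph x)))" for k
  unfolding psc_sum sum.distrib[symmetric] by (rule sum.cong[OF refl]) (simp add: gi[OF _ Fx] eps_add eps_psc)
 ultimately show "circ0 m p ph n q \<eta> x = psc c (circ0 m p ph n q ga x) + circ0 m p ph n q ga' x"
  unfolding circ0_fin[OF f g x mN(1)] circ0_fin[OF f g' x mN(1)] circ0_fin[OF f h x mN(1)]
  by (simp add: eps_add eps_psc psc_diff)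
 have O: "Op n \<eta> y = psc c (Op n ga y) + Op n ga' y" if "y : W j" "n <= j" for y j
  by (rule Op_comb[OF g g' h _ that]) (rule eq)
 have Sx: "Sg m p ph x : W (N - m + p + 1)" by (rule Sg_mem[OF f x mN(1)])
 show "circ0 n q \<eta> m p ph x = psc c (circ0 n q ga m p ph x) + circ0 n q ga' m p ph x"
  unfolding circ0_def O[OF x mN(2)] using N
  by (simp add: O[OF Sx] plin_add[OF plin_Sg0] plin_psc[OF plin_Sg0] eps_add eps_psc psc_diff)
qed


section \<open>The strict identities on the colimit\<close>

lemma gop_deg: "gop d X ph ==> d = d' ==> gop d' X ph" by simp

lemma cg_dop: "cg d m p ph X ==> x : W N ==> m <= N ==>
 Op (Suc m) (dop m p ph) (x * v a) = eps (int N - d + 1) (Op m ph (R a x) - R a (Op m ph x))"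
proof -
 assume c: "cg d m p ph X" and x: "x : W N" and "m <= N"
 then obtain k where k: "N = m + k" using le_Suc_ex by blast
 show ?thesis using Op_dop[OF cgD(2)[OF c] x[unfolded k], of a] cgD(1)[OF c] by (simp add: k add.commute)
qed

text \<open>Pushing the representative beyond the point from which the germ is valid gives equality
  for every length at which the cochain has enough letters.\<close>

lemma cg_exact: assumes "gop d X ph" obtains m p f where "rp d m p f" "X = sg_class d p f" "P0 <= m" "P0 <= p"
  "!!N x. m <= N ==> x : W N ==> ph x = OP m p f x"
proof -
 obtain m p f N1 where f: "rp d m p f" "X = sg_class d p f" "P0 <= m" "P0 <= p" "!!N x. N1 <= N ==> x : W N ==> ph x = OP m p f x"
  by (rule gop_at[OF assms, of P0]) blast
 let ?f = "push (C_theta d) p N1 f"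
 have e: "ph x = OP (m + N1) (p + N1) ?f x" if "m + N1 <= N" "x : W N" for N x
  using f(5)[OF _ that(2)] push_OP[OF f(1) that(2,1)] that(1) by simp
 have "X = sg_class d (p + N1) ?f" using cl.cls_push[OF rp_carrier[OF f(1)], of N1] by (simp add: f(2) sg_class_def)
 then show ?thesis by (rule that[OF push_rp[OF f(1)] _ _ _ e]) (use f(3,4) in auto)
qed

text \<open>Both elements and their combination are represented at one stage, which makes linearity
  of the operations a pointwise matter.\<close>

lemma cg_comb:
 assumes "X : carrier (Csg d)" "Y : carrier (Csg d)"
 obtains m p ph ga \<eta> where "cg d m p ph X" "cg d m p ga Y" "cg d m p \<eta> (c \<odot>\<^bsub>Csg d\<^esub> X \<oplus>\<^bsub>Csg d\<^esub> Y)"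
  "!!w. w : V m ==> \<eta> w = psc c (ph w) + ga w"
proof -
 obtain p0 where p0: "!!p. p0 <= p ==> \<exists>m f. rp d m p f & X = sg_class d p f" by (rule Csg_rep_at[OF assms(1)]) blast
 obtain p1 where p1: "!!p. p1 <= p ==> \<exists>m f. rp d m p f & Y = sg_class d p f" by (rule Csg_rep_at[OF assms(2)]) blast
 define p where "p = p0 + p1"
 obtain m f where f: "rp d m p f" "X = sg_class d p f" using p0[of p] by (auto simp: p_def)
 obtain n g where g: "rp d n p g" "Y = sg_class d p g" using p1[of p] by (auto simp: p_def)
 have n: "n = m" "d = int m - int p" using f(1) g(1) by (auto simp: rp_def)
 have fg: "f : cch m p" "g : cch m p" using f(1) g(1) n by (auto simp: rp_def)
 let ?h = "c \<odot>\<^bsub>Hc m p\<^esub> f \<oplus>\<^bsub>Hc m p\<^esub> g"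
 note cf = Hc_mem(2)[OF fg(1), of c]
 have h: "rp d m p ?h" using Hc_mem(1)[OF cf fg(2)] n by (simp add: rp_def)
 have rc: "rp d m p (c \<odot>\<^bsub>Hc m p\<^esub> f)" using cf n by (simp add: rp_def)
 have "c \<odot>\<^bsub>Csg d\<^esub> X \<oplus>\<^bsub>Csg d\<^esub> Y = sg_class d p ?h"
  using cl.L_smult[OF rp_carrier[OF f(1)], of c] cl.L_add[OF rp_carrier[OF rc] rp_carrier[OF g(1)]]
  by (simp add: f(2) g(2) Csg_def sg_class_def Cnc_eq[OF n(2)])
 then show ?thesis
  using cg_rp[OF f(1)] cg_rp[OF g(1)] cg_rp[OF h] f(2) g(2) n(1) lf_Hc(1)[OF cf fg(2)] lf_Hc(2)[OF fg(1)]
  by (intro that[of m p "lf m p f" "lf m p g" "lf m p ?h"]) simp_all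
qed

lemma gop_cup': assumes X: "gop d X ph" and Y: "gop e Y \<psi>" shows "gop (d + e) (Csg_cup d e X Y) (%x. ph (\<psi> x))"
proof -
 obtain m p f N1 where f: "rp d m p f" "X = sg_class d p f" "!!N x. N1 <= N ==> x : W N ==> ph x = OP m p f x"
  by (rule gop_at[OF X, of 0]) blast
 obtain n q g N2 where g: "rp e n q g" "Y = sg_class e q g" "!!N x. N2 <= N ==> x : W N ==> \<psi> x = OP n q g x"
  by (rule gop_at[OF Y, of 0]) blast
 show ?thesis
 proof (rule gop_cong[OF gop_cup[OF cg_rp[OF f(1), folded f(2)] cg_rp[OF g(1), folded g(2)]], of "N1 + N2 + n"])
  fix N x assume N: "N1 + N2 + n <= N" and x: "x : W N"
  have "OP n q g x : W (N - n + q)" using Op_mem'[OF rp_coch[OF g(1)] x] N by simp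
  then show "ph (\<psi> x) = OP m p f (OP n q g x)" using g(3)[OF _ x] f(3)[of "N - n + q"] N by simp
 qed
qed

lemma Csg_cup_mem: "X : carrier (Csg d) ==> Y : carrier (Csg e) ==> Csg_cup d e X Y : carrier (Csg (d + e))"
 by (meson gop_ex gop_cup' gop_carrier)

lemma Csg_bracket_mem: "X : carrier (Csg d) ==> Y : carrier (Csg e) ==> Csg_bracket d e X Y : carrier (Csg (d + e - 1))"
 by (rule cg_ex[of X d 0], assumption, rule cg_ex[of Y e 0], assumption) (rule gop_carrier[OF gop_bracket])

lemma Csg_diff_lin: "linear_map (Csg d) (Csg (d + 1)) (Csg_diff d)"
proof (rule linear_combI[OF Csg_vs Csg_vs])
 fix X assume "X : carrier (Csg d)"
 then obtain m p ph where "cg d m p ph X" by (rule cg_ex[where ?P0.0 = 0])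
 then show "Csg_diff d X : carrier (Csg (d + 1))" using gop_carrier[OF cgD(3)[OF cg_diff]] by blast
next
 fix c X Y assume "X : carrier (Csg d)" "Y : carrier (Csg d)"
 then obtain m p ph ga \<eta> where c: "cg d m p ph X" "cg d m p ga Y" "cg d m p \<eta> (c \<odot>\<^bsub>Csg d\<^esub> X \<oplus>\<^bsub>Csg d\<^esub> Y)"
  and eq: "!!w. w : V m ==> \<eta> w = psc c (ph w) + ga w" by (rule cg_comb[where c = c]) blast
 have "gop (d + 1) (Csg_diff d (c \<odot>\<^bsub>Csg d\<^esub> X \<oplus>\<^bsub>Csg d\<^esub> Y)) (%x. psc c (Op (Suc m) (dop m p ph) x) + Op (Suc m) (dop m p ga) x)"
 proof (rule gop_diff[OF cgD(3)[OF c(3)], where ?N1.0 = m])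
  fix N x a assume N: "m <= N" and x: "x : W N"
  have O: "Op m \<eta> y = psc c (Op m ph y) + Op m ga y" if "y : W j" "m <= j" for y j
   by (rule Op_comb[OF cgD(2)[OF c(1)] cgD(2)[OF c(2)] cgD(2)[OF c(3)] _ that]) (rule eq)
  show "psc c (Op (Suc m) (dop m p ph) (x * v a)) + Op (Suc m) (dop m p ga) (x * v a)
    = eps (int N - d + 1) (Op m \<eta> (R a x) - R a (Op m \<eta> x))"
   by (simp add: cg_dop[OF c(1) x N] cg_dop[OF c(2) x N] O[OF x N] O[OF R_mem[OF x] N] plin_add[OF plin_R0] plin_psc[OF plin_R0]
    eps_psc eps_add[symmetric] psc_diff add_diff_add)
 qed (intro plin_intros)
 then show "Csg_diff d (c \<odot>\<^bsub>Csg d\<^esub> X \<oplus>\<^bsub>Csg d\<^esub> Y) = c \<odot>\<^bsub>Csg (d + 1)\<^esub> Csg_diff d X \<oplus>\<^bsub>Csg (d + 1)\<^esub> Csg_diff d Y"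
  by (rule gop_eqI[OF _ gop_add[OF gop_smult[OF cgD(3)[OF cg_diff[OF c(1)]]] cgD(3)[OF cg_diff[OF c(2)]]] refl])
qed

text \<open>The operator of a differential commutes with the right action: on y followed by
  \<open>v b\<close> the terms in which \<open>R\<close> acts twice on one side cancel by
  \<open>R_R\<close>.\<close>

lemma Csg_d_d: "X : carrier (Csg d) ==> Csg_diff (d + 1) (Csg_diff d X) = \<zero>\<^bsub>Csg (d + 2)\<^esub>"
proof -
 assume "X : carrier (Csg d)"
 then obtain m p ph where X: "cg d m p ph X" by (rule cg_ex[where ?P0.0 = 0])
 note c = cgD(2)[OF X]
 let ?d = "Op (Suc m) (dop m p ph)"
 have "gop (d + 1 + 1) (Csg_diff (d + 1) (Csg_diff d X)) (%x. 0)"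
 proof (rule gop_diff[OF cgD(3)[OF cg_diff[OF X]] plin_const_0, where ?N1.0 = "Suc m"])
  fix N x a assume N: "Suc m <= N" and x: "x : W N"
  obtain K where K: "N = Suc K" using N by (cases N) auto
  have "?d (R a x) = R a (?d x)"
  proof (rule W_Suc_eqI[OF _ _ x[unfolded K], where f = "%x. ?d (R a x)"])
   fix y b assume y: "y : W K"
   have m: "m <= K" using N K by simp
   show "?d (R a (y * v b)) = R a (?d (y * v b))"
    by (simp add: R_v[OF y] plin_diff[OF plin_Op0] cg_dop[OF X y m] cg_dop[OF X R_mem[OF y] m] R_R[OF y]
     plin_eps_out[OF plin_R0] plin_diff[OF plin_R0] R_R[OF Op_mem'[OF c y m]] eps_diff)
  qed (intro plin_intros)+
  then show "0 = eps (int N - (d + 1) + 1) (?d (R a x) - R a (?d x))" by simp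
 qed
 from gop_eqI[OF this gop_zero refl] show ?thesis by (simp add: add.assoc)
qed

lemma Csg_cup_bil: "bilinear_map (Csg d) (Csg e) (Csg (d + e)) (Csg_cup d e)"
 unfolding bilinear_map_def
proof (intro conjI ballI linear_combI[OF Csg_vs Csg_vs])
 fix X Y Z c assume X: "X : carrier (Csg d)" and YZ: "Y : carrier (Csg e)" "Z : carrier (Csg e)"
 obtain m p ph where X: "cg d m p ph X" by (rule cg_ex[OF X, of 0])
 obtain n q ga ga' \<eta> where c: "cg e n q ga Y" "cg e n q ga' Z" "cg e n q \<eta> (c \<odot>\<^bsub>Csg e\<^esub> Y \<oplus>\<^bsub>Csg e\<^esub> Z)"
  and eq: "!!w. w : V n ==> \<eta> w = psc c (ga w) + ga' w" by (rule cg_comb[OF YZ, where c = c]) blast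
 show "Csg_cup d e X (c \<odot>\<^bsub>Csg e\<^esub> Y \<oplus>\<^bsub>Csg e\<^esub> Z) = c \<odot>\<^bsub>Csg (d + e)\<^esub> Csg_cup d e X Y \<oplus>\<^bsub>Csg (d + e)\<^esub> Csg_cup d e X Z"
  by (rule gop_eqI[OF gop_cup[OF X c(3)] gop_add[OF gop_smult[OF gop_cup[OF X c(1)]] gop_cup[OF X c(2)]], of n])
   (simp add: Op_comb[OF cgD(2)[OF c(1)] cgD(2)[OF c(2)] cgD(2)[OF c(3)] eq] plin_add[OF plin_Op0] plin_psc[OF plin_Op0])
next
 fix X Y Z c assume X: "X : carrier (Csg e)" and YZ: "Y : carrier (Csg d)" "Z : carrier (Csg d)"
 obtain m p ph where X: "cg e m p ph X" by (rule cg_ex[OF X, of 0])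
 obtain n q ga ga' \<eta> where c: "cg d n q ga Y" "cg d n q ga' Z" "cg d n q \<eta> (c \<odot>\<^bsub>Csg d\<^esub> Y \<oplus>\<^bsub>Csg d\<^esub> Z)"
  and eq: "!!w. w : V n ==> \<eta> w = psc c (ga w) + ga' w" by (rule cg_comb[OF YZ, where c = c]) blast
 show "Csg_cup d e (c \<odot>\<^bsub>Csg d\<^esub> Y \<oplus>\<^bsub>Csg d\<^esub> Z) X = c \<odot>\<^bsub>Csg (d + e)\<^esub> Csg_cup d e Y X \<oplus>\<^bsub>Csg (d + e)\<^esub> Csg_cup d e Z X"
 proof (rule gop_eqI[OF gop_cup[OF c(3) X] gop_add[OF gop_smult[OF gop_cup[OF c(1) X]] gop_cup[OF c(2) X]], of "n + m"])
  fix N x assume N: "n + m <= N" and x: "x : W N"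
  have "Op m ph x : W (N - m + p)" "n <= N - m + p" using Op_mem'[OF cgD(2)[OF X] x] N by simp_all
  from Op_comb[OF cgD(2)[OF c(1)] cgD(2)[OF c(2)] cgD(2)[OF c(3)] eq this]
  show "Op n \<eta> (Op m ph x) = psc c (Op n ga (Op m ph x)) + Op n ga' (Op m ph x)" .
 qed
qed (rule Csg_cup_mem; assumption)+

text \<open>A graded commutator with \<open>R\<close> is a derivation for composition of
  operators.\<close>

lemma Csg_cup_d:
 assumes X: "X : carrier (Csg d)" and Y: "Y : carrier (Csg e)"
 shows "Csg_diff (d + e) (Csg_cup d e X Y) = Csg_cup (d + 1) e (Csg_diff d X) Y
  \<oplus>\<^bsub>Csg (d + e + 1)\<^esub> signed (Csg (d + e + 1)) d (Csg_cup d (e + 1) X (Csg_diff e Y))"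
proof -
 obtain m p ph where X: "cg d m p ph X" by (rule cg_ex[OF X, of 0])
 obtain n q ga where Y: "cg e n q ga Y" by (rule cg_ex[OF Y, of 0])
 note f = cgD(2)[OF X] and g = cgD(2)[OF Y]
 let ?dX = "Op (Suc m) (dop m p ph)" and ?dY = "Op (Suc n) (dop n q ga)"
 have "gop (d + e + 1) (Csg_diff (d + e) (Csg_cup d e X Y)) (%x. ?dX (Op n ga x) + eps d (Op m ph (?dY x)))"
 proof (rule gop_diff[OF gop_cup[OF X Y], where ?N1.0 = "m + n"])
  fix N x a assume N: "m + n <= N" and x: "x : W N"
  have nN: "n <= N" using N by simp
  let ?y = "Op n ga x"
  have y: "?y : W (N - n + q)" "m <= N - n + q" using Op_mem'[OF g x nN] N by simp_all
  have i: "int (N - n + q) - d + 1 = int N - (d + e) + 1" using nN cgD(1)[OF Y] by (simp add: of_nat_diff)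
  have s: "eps d (eps (int N - e + 1) t) = eps (int N - (d + e) + 1) t" for t :: "'a list \<Rightarrow>\<^sub>0 'k"
   unfolding eps_eps by (rule eps_cong) simp
  show "?dX (Op n ga (x * v a)) + eps d (Op m ph (?dY (x * v a)))
   = eps (int N - (d + e) + 1) (Op m ph (Op n ga (R a x)) - R a (Op m ph (Op n ga x)))"
   unfolding Op_mult[OF g x nN] cg_dop[OF X y] cg_dop[OF Y x nN] i plin_eps_out[OF plin_Op0] s plin_diff[OF plin_Op0]
   by (simp add: eps_diff)
 qed (intro plin_intros)
 then show ?thesis
  by (rule gop_eqI[OF _ gop_add[OF gop_deg[OF gop_cup[OF cg_diff[OF X] Y]] gop_signed[OF gop_deg[OF gop_cup[OF X cg_diff[OF Y]]]]] refl]) simp_all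
qed

lemma Csg_cup_assoc:
 "[| X : carrier (Csg d); Y : carrier (Csg e); Z : carrier (Csg s) |] ==>
  Csg_cup (d + e) s (Csg_cup d e X Y) Z = Csg_cup d (e + s) X (Csg_cup e s Y Z)"
proof -
 assume "X : carrier (Csg d)" "Y : carrier (Csg e)" "Z : carrier (Csg s)"
 then obtain ph \<psi> cx where "gop d X ph" "gop e Y \<psi>" "gop s Z cx" by (meson gop_ex)
 note g = this
 show ?thesis
  by (rule gop_eqI[OF gop_cup'[OF gop_cup'[OF g(1,2)] g(3)] gop_deg[OF gop_cup'[OF g(1) gop_cup'[OF g(2,3)]]] refl]) simp
qed

lemma gop_one: "gop 0 (sg_class 0 0 one_cochain) (%x. x)"
 by (rule gop_cong[OF gop_rp[of 0 0 0 one_cochain], of 0]) (simp_all add: rp_def one_cch one_Op)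

lemma Csg_one_d: "Csg_diff 0 (sg_class 0 0 one_cochain) = \<zero>\<^bsub>Csg 1\<^esub>"
proof -
 have "gop (0 + 1) (Csg_diff 0 (sg_class 0 0 one_cochain)) (%x. 0)"
  by (rule gop_diff[OF gop_one plin_const_0]) simp
 from gop_eqI[OF this gop_zero refl] show ?thesis by simp
qed

lemma Csg_one: "X : carrier (Csg d) ==> Csg_cup 0 d (sg_class 0 0 one_cochain) X = X"
 "X : carrier (Csg d) ==> Csg_cup d 0 X (sg_class 0 0 one_cochain) = X"
proof -
 assume "X : carrier (Csg d)"
 then obtain ph where g: "gop d X ph" by (rule gop_ex)
 show "Csg_cup 0 d (sg_class 0 0 one_cochain) X = X"
  by (rule gop_eqI[OF gop_deg[OF gop_cup'[OF gop_one g]] g refl]) simp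
 show "Csg_cup d 0 X (sg_class 0 0 one_cochain) = X"
  by (rule gop_eqI[OF gop_deg[OF gop_cup'[OF g gop_one]] g refl]) simp
qed

lemma Csg_bracket_anti:
 assumes X: "X : carrier (Csg d)" and Y: "Y : carrier (Csg e)"
 shows "Csg_bracket d e X Y = \<ominus>\<^bsub>Csg (d + e - 1)\<^esub> signed (Csg (d + e - 1)) ((d - 1) * (e - 1)) (Csg_bracket e d Y X)"
proof -
 obtain m p ph where X: "cg d m p ph X" by (rule cg_ex[OF X, of 0])
 obtain n q ga where Y: "cg e n q ga Y" by (rule cg_ex[OF Y, of 0])
 have "A - eps ((d - 1) * (e - 1)) B = - eps ((d - 1) * (e - 1)) (B - eps ((e - 1) * (d - 1)) A)" for A B :: "'a list \<Rightarrow>\<^sub>0 'k"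
  by (simp add: eps_def mult.commute)
 then show ?thesis
  by (intro gop_eqI[OF gop_bracket[OF X Y] gop_neg[OF gop_signed[OF gop_deg[OF gop_bracket[OF Y X]]]]]) simp_all
qed

lemma Csg_bracket_lin: assumes X: "X : carrier (Csg d)" shows "linear_map (Csg e) (Csg (d + e - 1)) (Csg_bracket d e X)"
proof (rule linear_combI[OF Csg_vs Csg_vs Csg_bracket_mem[OF X]])
 fix Y Z c assume YZ: "Y : carrier (Csg e)" "Z : carrier (Csg e)"
 obtain m p ph where X: "cg d m p ph X" by (rule cg_ex[OF X, of 0])
 obtain n q ga ga' \<eta> where c: "cg e n q ga Y" "cg e n q ga' Z" "cg e n q \<eta> (c \<odot>\<^bsub>Csg e\<^esub> Y \<oplus>\<^bsub>Csg e\<^esub> Z)"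
  and eq: "!!w. w : V n ==> \<eta> w = psc c (ga w) + ga' w" by (rule cg_comb[OF YZ, where c = c]) blast
 note C = circ0_comb[OF cgD(2)[OF X] cgD(2)[OF c(1)] cgD(2)[OF c(2)] cgD(2)[OF c(3)] eq]
 show "Csg_bracket d e X (c \<odot>\<^bsub>Csg e\<^esub> Y \<oplus>\<^bsub>Csg e\<^esub> Z) = c \<odot>\<^bsub>Csg (d + e - 1)\<^esub> Csg_bracket d e X Y \<oplus>\<^bsub>Csg (d + e - 1)\<^esub> Csg_bracket d e X Z"
  by (rule gop_eqI[OF gop_bracket[OF X c(3)] gop_add[OF gop_smult[OF gop_bracket[OF X c(1)]] gop_bracket[OF X c(2)]], of "m + n"])
   (simp add: C psc_diff eps_add eps_psc)
qed assumption

text \<open>Linearity in the first argument is obtained from the second by antisymmetry.\<close>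

lemma Csg_bracket_bil: "bilinear_map (Csg d) (Csg e) (Csg (d + e - 1)) (Csg_bracket d e)"
 unfolding bilinear_map_def
proof (intro conjI ballI)
 show "linear_map (Csg e) (Csg (d + e - 1)) (Csg_bracket d e X)" if "X : carrier (Csg d)" for X by (rule Csg_bracket_lin[OF that])
 fix Y assume Y: "Y : carrier (Csg e)"
 let ?C = "Csg (d + e - 1)"
 note l = Csg_bracket_lin[OF Y, of d, unfolded add.commute[of e d]]
 show "linear_map (Csg d) ?C (%X. Csg_bracket d e X Y)"
 proof (rule linear_mapI)
  fix X assume X: "X : carrier (Csg d)"
  show "Csg_bracket d e X Y : carrier ?C" by (rule Csg_bracket_mem[OF X Y])
  note lX = linear_mapD(1)[OF l X]
  show "Csg_bracket d e (c \<odot>\<^bsub>Csg d\<^esub> X) Y = c \<odot>\<^bsub>?C\<^esub> Csg_bracket d e X Y" for c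
   unfolding Csg_bracket_anti[OF X Y] Csg_bracket_anti[OF Csg.smult_mem[OF X] Y] linear_mapD(3)[OF l X]
   by (simp add: Csg.signed_smult lX Csg.smult_mem Csg.neg_smult Csg.smult_smult mult.commute)
  fix Z assume Z: "Z : carrier (Csg d)"
  show "Csg_bracket d e (X \<oplus>\<^bsub>Csg d\<^esub> Z) Y = Csg_bracket d e X Y \<oplus>\<^bsub>?C\<^esub> Csg_bracket d e Z Y"
   unfolding Csg_bracket_anti[OF X Y] Csg_bracket_anti[OF Z Y] Csg_bracket_anti[OF Csg.a_closed[OF X Z] Y] linear_mapD(2)[OF l X Z]
   by (simp add: Csg.signed_smult lX linear_mapD(1)[OF l Z] Csg.smult_mem Csg.neg_smult Csg.smult_add)
 qed
qed

text \<open>The circle product satisfies the Leibniz rule only up to the commutator of the two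
  operators. Antisymmetrisation makes these defects cancel, so the bracket satisfies it
  exactly.\<close>

lemma Csg_bracket_d:
 assumes X: "X : carrier (Csg d)" and Y: "Y : carrier (Csg e)"
 shows "Csg_diff (d + e - 1) (Csg_bracket d e X Y) = Csg_bracket (d + 1) e (Csg_diff d X) Y
  \<oplus>\<^bsub>Csg (d + e)\<^esub> signed (Csg (d + e)) (d - 1) (Csg_bracket d (e + 1) X (Csg_diff e Y))"
proof -
 obtain m p ph where X: "cg d m p ph X" by (rule cg_ex[OF X, of 0])
 obtain n q ga where Y: "cg e n q ga Y" by (rule cg_ex[OF Y, of 0])
 let ?dX = "dop m p ph" and ?dY = "dop n q ga"
 let ?psi = "%x. (circ0 (Suc m) p ?dX n q ga x - eps ((d + 1 - 1) * (e - 1)) (circ0 n q ga (Suc m) p ?dX x))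
  + eps (d - 1) (circ0 m p ph (Suc n) q ?dY x - eps ((d - 1) * (e + 1 - 1)) (circ0 (Suc n) q ?dY m p ph x))"
 have "gop (d + e - 1 + 1) (Csg_diff (d + e - 1) (Csg_bracket d e X Y)) ?psi"
 proof (rule gop_diff[OF gop_bracket[OF X Y], where ?N1.0 = "m + n"])
  fix N x a assume N: "m + n <= N" and x: "x : W N"
  note de = cgD(1)[OF X, symmetric] cgD(1)[OF Y, symmetric]
  have key: "(P1 - eps ((d + 1 - 1) * (e - 1)) P4) + eps (d - 1) (P2 - eps ((d - 1) * (e + 1 - 1)) P3)
   = eps (int N - (d + e - 1) + 1) (A + eps (int N - d - e) (P1 - eps d P2 + eps d (FG - eps (d * e) GF))
    - eps ((d - 1) * (e - 1)) (B + eps (int N - e - d) (P3 - eps e P4 + eps e (GF - eps (e * d) FG))) - (A - eps ((d - 1) * (e - 1)) B))"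
   for A B P1 P2 P3 P4 FG GF :: "'a list \<Rightarrow>\<^sub>0 'k"
   by (cases "even d"; cases "even e"; cases "even (int N)"; simp add: eps_def algebra_simps)
  have N': "n + m <= N" using N by simp
  show "?psi (x * v a) = eps (int N - (d + e - 1) + 1)
   (circ0 m p ph n q ga (R a x) - eps ((d - 1) * (e - 1)) (circ0 n q ga m p ph (R a x))
   - R a (circ0 m p ph n q ga x - eps ((d - 1) * (e - 1)) (circ0 n q ga m p ph x)))"
   unfolding circ0_R[OF cgD(2)[OF X] cgD(2)[OF Y] x N, of a] circ0_R[OF cgD(2)[OF Y] cgD(2)[OF X] x N', of a]
    plin_diff[OF plin_R0] plin_eps_out[OF plin_R0] de
   by (rule key)
 qed (intro plin_intros)
 then show ?thesis
  by (intro gop_eqI[OF _ gop_add[OF gop_deg[OF gop_bracket[OF cg_diff[OF X] Y]] gop_signed[OF gop_deg[OF gop_bracket[OF X cg_diff[OF Y]]]]] refl]) simp_all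
qed

text \<open>The iterated circle product of three cochains as an operator, formed without choosing a
  cochain for the inner product.\<close>

definition TT where "TT m p ph n q ga l r cx x = circ0 m p ph n q ga (Sg l r cx x)
 - eps ((int m - int p + int n - int q - 1) * (int l - int r - 1)) (Sg l r cx (circ0 m p ph n q ga x))"

text \<open>The inner bracket is realised by a cochain with K arguments, K at least n + l as
  \<open>circ0_jacobi\<close> demands. When it is inserted, that lemma expands the result; when it
  acts as an operator, its germ already determines everything.\<close>

lemma gop_bracket_bracket:
 assumes X: "cg d m p ph X" and Y: "cg e n q ga Y" and Z: "cg s l r cx Z"
 shows "gop (d + (e + s - 1) - 1) (Csg_bracket d (e + s - 1) X (Csg_bracket e s Y Z))
  (%x. TT m p ph n q ga l r cx x - eps ((e - 1) * (s - 1)) (TT m p ph l r cx n q ga x)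
   - eps ((d - 1) * (e + s - 1 - 1)) (TT n q ga l r cx m p ph x - eps ((e - 1) * (s - 1)) (TT l r cx n q ga m p ph x)))"
proof -
 obtain K L h where h: "rp (e + s - 1) K L h" "Csg_bracket e s Y Z = sg_class (e + s - 1) L h" "n + l <= K"
  "!!N x. K <= N ==> x : W N ==> circ0 n q ga l r cx x - eps ((e - 1) * (s - 1)) (circ0 l r cx n q ga x) = OP K L h x"
  by (rule cg_exact[OF gop_bracket[OF Y Z], of "n + l"]) blast
 let ?k = "lf K L h"
 note H = cg_rp[OF h(1), folded h(2)]
 have deg: "int K - int L = e + s - 1" using h(1) by (simp add: rp_def)
 note D = cgD(1)[OF X] cgD(1)[OF Y] cgD(1)[OF Z]
 show ?thesis
 proof (rule gop_cong[OF gop_bracket[OF X H], of "m + K"])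
  fix N x assume N: "m + K <= N" and x: "x : W N"
  have mN: "m <= N" "K <= N" using N by auto
  have 1: "circ0 m p ph K L ?k x = TT m p ph n q ga l r cx x - eps ((e - 1) * (s - 1)) (TT m p ph l r cx n q ga x)"
   unfolding TT_def D
   by (rule circ0_jacobi[OF cgD(2)[OF X] cgD(2)[OF Y] cgD(2)[OF Z] cgD(2)[OF H] _ _ h(3) x N])
    (use h(1) D h(4)[symmetric] in \<open>auto simp: rp_def\<close>)
  have Sx: "Sg m p ph x : W (N - m + p + 1)" "K <= N - m + p + 1" using Sg_mem[OF cgD(2)[OF X] x mN(1)] N by simp_all
  have 2: "circ0 K L ?k m p ph x = TT n q ga l r cx m p ph x - eps ((e - 1) * (s - 1)) (TT l r cx n q ga m p ph x)"
  proof -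
   have e: "(int K - int L) * (int m - int p - 1) = (e + s - 1) * (d - 1)" "(int n - int q + int l - int r - 1) * (int m - int p - 1) = (e + s - 1) * (d - 1)"
    "(int l - int r + int n - int q - 1) * (int m - int p - 1) = (e + s - 1) * (d - 1)"
   proof -
    have i: "int n - int q + int l - int r - 1 = e + s - 1" "int l - int r + int n - int q - 1 = e + s - 1" "int m - int p = d"
     using D by simp_all
    show "(int K - int L) * (int m - int p - 1) = (e + s - 1) * (d - 1)" "(int n - int q + int l - int r - 1) * (int m - int p - 1) = (e + s - 1) * (d - 1)"
     "(int l - int r + int n - int q - 1) * (int m - int p - 1) = (e + s - 1) * (d - 1)" unfolding i deg by (rule refl)+
   qed
   show ?thesis
    unfolding circ0_def[of K] h(4)[OF mN(2) x, symmetric] h(4)[OF Sx(2,1), symmetric] TT_def e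
    by (simp add: plin_diff[OF plin_Sg0] plin_eps_out[OF plin_Sg0] eps_diff add.commute)
  qed
  show "TT m p ph n q ga l r cx x - eps ((e - 1) * (s - 1)) (TT m p ph l r cx n q ga x)
   - eps ((d - 1) * (e + s - 1 - 1)) (TT n q ga l r cx m p ph x - eps ((e - 1) * (s - 1)) (TT l r cx n q ga m p ph x))
   = circ0 m p ph K L ?k x - eps ((d - 1) * (e + s - 1 - 1)) (circ0 K L ?k m p ph x)"
   unfolding 1 2 ..
 qed
qed

text \<open>The three double brackets involve six iterated circle products, each occurring in two of
  them; the identity is then a matter of signs.\<close>

lemma Csg_jacobi:
 assumes X: "X : carrier (Csg d)" and Y: "Y : carrier (Csg e)" and Z: "Z : carrier (Csg s)"
 shows "Csg_bracket d (e + s - 1) X (Csg_bracket e s Y Z) = Csg_bracket (d + e - 1) s (Csg_bracket d e X Y) Z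
  \<oplus>\<^bsub>Csg (d + e + s - 2)\<^esub> signed (Csg (d + e + s - 2)) ((d - 1) * (e - 1)) (Csg_bracket e (d + s - 1) Y (Csg_bracket d s X Z))"
proof -
 let ?C = "Csg (d + e + s - 2)"
 \<comment> \<open>Antisymmetry moves the inner bracket to the second argument, the position that
   \<open>gop_bracket_bracket\<close> expands.\<close>
 have a: "Csg_bracket (d + e - 1) s (Csg_bracket d e X Y) Z
  = \<ominus>\<^bsub>?C\<^esub> signed ?C ((d + e - 1 - 1) * (s - 1)) (Csg_bracket s (d + e - 1) Z (Csg_bracket d e X Y))"
 proof -
  have i: "d + e - 1 + s - 1 = d + e + s - 2" by simp
  show ?thesis using Csg_bracket_anti[OF Csg_bracket_mem[OF X Y] Z] unfolding i .
 qed
 obtain m p ph where X: "cg d m p ph X" by (rule cg_ex[OF X, of 0])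
 obtain n q ga where Y: "cg e n q ga Y" by (rule cg_ex[OF Y, of 0])
 obtain l r cx where Z: "cg s l r cx Z" by (rule cg_ex[OF Z, of 0])
 have key: "T1 - eps ((e - 1) * (s - 1)) T2 - eps ((d - 1) * (e + s - 1 - 1)) (T3 - eps ((e - 1) * (s - 1)) T4)
  = - eps ((d + e - 1 - 1) * (s - 1)) (T5 - eps ((d - 1) * (e - 1)) T4 - eps ((s - 1) * (d + e - 1 - 1)) (T1 - eps ((d - 1) * (e - 1)) T6))
  + eps ((d - 1) * (e - 1)) (T6 - eps ((d - 1) * (s - 1)) T3 - eps ((e - 1) * (d + s - 1 - 1)) (T2 - eps ((d - 1) * (s - 1)) T5))"
  for T1 T2 T3 T4 T5 T6 :: "'a list \<Rightarrow>\<^sub>0 'k"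
  by (cases "even d"; cases "even e"; cases "even s"; simp add: eps_def algebra_simps)
 show ?thesis
  unfolding a
  by (rule gop_eqI[OF gop_deg[OF gop_bracket_bracket[OF X Y Z]]
    gop_add[OF gop_neg[OF gop_signed[OF gop_deg[OF gop_bracket_bracket[OF Z X Y]]]] gop_signed[OF gop_deg[OF gop_bracket_bracket[OF Y X Z]]]] key]) simp_all
qed


section \<open>Graded commutativity and the Poisson identity for cocycles\<close>

lemma ev_zero:
 assumes c: "coch m p ph" and ev: "!!N x. N0 <= N ==> x : W N ==> Op m ph x = 0"
  and P: "bS ~= {} | 1 <= p" and w: "w : V m"
 shows "ph w = 0"
proof (rule ev_inj[OF c _ _ P w, where \<psi> = "%_. 0"])
 have c0: "coch m p (%_. 0)" by (simp add: coch_def plin_const_0 psub_0[OF psub_W])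
 then show "coch m p (%_. 0)" .
 have z: "Op m (%_. 0) x = 0" if "x : W N" "m <= N" for x N
  by (rule Op_crit[OF c0 plin_const_0 _ _ _ that]) (simp_all add: plin_0[OF plin_Lm0])
 show "Op m ph x = Op m (%_. 0) x" if "N0 + m <= N" "x : W N" for N x using ev[OF _ that(2)] that(1) z[OF that(2)] by simp
qed

text \<open>A vanishing class only gives a vanishing germ; \<open>ev_zero\<close> strengthens this
  to vanishing on all arguments. That is possible at positive stages, and at every stage when A/k is
  nonzero.\<close>

lemma cocy_rep:
 assumes r: "rp d m p f" and z: "Csg_diff d (sg_class d p f) = \<zero>\<^bsub>Csg (d + 1)\<^esub>" and P: "bS ~= {} | 1 <= p"
 shows "cocy m p (lf m p f)"
 unfolding cocy_def
proof (intro conjI ballI)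
 show c: "coch m p (lf m p f)" by (rule rp_coch[OF r])
 obtain N0 where N0: "!!N x. N0 <= N ==> x : W N ==> Op (Suc m) (dop m p (lf m p f)) x = 0"
  using gop_uniq[OF cgD(3)[OF cg_diff[OF cg_rp[OF r]]] gop_zero[of "d + 1", folded z]] by blast
 show "dop m p (lf m p f) w = 0" if "w : V (Suc m)" for w by (rule ev_zero[OF coch_dop[OF c] N0 P that])
qed


lemma cp_comm_key:
 assumes f: "rp d m p f" and g: "rp e n q g" and cf: "cocy m p (lf m p f)" and cg: "cocy n q (lf n q g)"
  and T: "gop (d + e - 1) T (circ0 m p (lf m p f) n q (lf n q g))"
 shows "Csg_cup d e (sg_class d p f) (sg_class e q g)
  = signed (Csg (d + e)) (d * e) (Csg_cup e d (sg_class e q g) (sg_class d p f))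
   \<oplus>\<^bsub>Csg (d + e)\<^esub> Csg_diff (d + e - 1) (signed (Csg (d + e - 1)) d T)"
proof -
 let ?f = "lf m p f" and ?g = "lf n q g"
 let ?psi = "%x. Op m ?f (Op n ?g x) - eps (d * e) (Op n ?g (Op m ?f x))"
 have D: "d = int m - int p" "e = int n - int q" using f g by (simp_all add: rp_def)
 have dT: "gop (d + e - 1 + 1) (Csg_diff (d + e - 1) (signed (Csg (d + e - 1)) d T)) ?psi"
 proof (rule gop_diff[OF gop_signed[OF T], where ?N1.0 = "m + n"])
  fix N x a assume N: "m + n <= N" and x: "x : W N"
  have s: "S = eps (int N - (d + e - 1) + 1) (eps d (A + eps (int N - e) S) - eps d A)" for A S :: "'a list \<Rightarrow>\<^sub>0 'k"
   by (cases "even d"; cases "even e"; cases "even (int N)"; simp add: eps_def)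
  show "?psi (x * v a) = eps (int N - (d + e - 1) + 1) (eps d (circ0 m p ?f n q ?g (R a x)) - R a (eps d (circ0 m p ?f n q ?g x)))"
   unfolding circ0_R_c[OF cf cg x N, of a] plin_eps_out[OF plin_R0] D[symmetric] by (rule s)
 qed (intro plin_intros)
 show ?thesis
  by (rule gop_eqI[OF gop_cup[OF cg_rp[OF f] cg_rp[OF g]]
    gop_add[OF gop_signed[OF gop_deg[OF gop_cup[OF cg_rp[OF g] cg_rp[OF f]]], where k = "d * e"] gop_deg[OF dT]], where ?N1.0 = 0]) simp_all
qed

text \<open>The circle product of the cup product with f is a commutator with a composite, so this
  half of the bracket obeys the Leibniz rule exactly. The other half obeys it up to the differential
  of T, computed in \<open>Kop_R\<close>.\<close>

lemma br_cp_key: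
 assumes f: "rp d m p f" and g: "rp e n q g" and h: "rp s l r h"
  and cf: "cocy m p (lf m p f)" and cg: "cocy n q (lf n q g)" and ch: "cocy l r (lf l r h)" and n: "n = Suc r"
  and T: "gop (d + e + s - 2) T (Kop m p (lf m p f) n q (lf n q g) l r (lf l r h))"
 defines "X \<equiv> sg_class d p f" and "Y \<equiv> sg_class e q g" and "Z \<equiv> sg_class s r h"
 shows "Csg_bracket d (e + s) X (Csg_cup e s Y Z)
  = (Csg_cup (d + e - 1) s (Csg_bracket d e X Y) Z
   \<oplus>\<^bsub>Csg (d + e + s - 1)\<^esub> signed (Csg (d + e + s - 1)) ((d - 1) * e) (Csg_cup e (d + s - 1) Y (Csg_bracket d s X Z)))
   \<oplus>\<^bsub>Csg (d + e + s - 1)\<^esub> Csg_diff (d + e + s - 2) (\<ominus>\<^bsub>Csg (d + e + s - 2)\<^esub> signed (Csg (d + e + s - 2)) (d + e) T)"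
proof -
 let ?f = "lf m p f" and ?g = "lf n q g" and ?h = "lf l r h"
 let ?k = "cupo n ?g l ?h"
 note F = rp_coch[OF f] and G = rp_coch[OF g] and H = rp_coch[OF h]
 have D: "int m - int p = d" "int n - int q = e" "int l - int r = s" using f g h by (simp_all add: rp_def)
 note X = cg_rp[OF f, folded X_def] and Y = cg_rp[OF g, folded Y_def] and Z = cg_rp[OF h, folded Z_def]
 \<comment> \<open>Because n = r + 1, the cup product is represented with one argument more than
   \<open>h\<close>; it is this representative whose circle product occurs in
   \<open>Kop_R\<close>.\<close>
 have kc: "coch (Suc l) q ?k" using coch_cupo[OF G H, of 1] n by simp
 have kO: "Op (Suc l) ?k x = Op n ?g (Op l ?h x)" if "x : W N" "Suc l <= N" for x N
  using Op_cupo[OF G H, of 1 x N] that n by simp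
 have YZ: "cg (e + s) (Suc l) q ?k (Csg_cup e s Y Z)"
  unfolding cg_def
 proof (intro conjI kc)
  show "e + s = int (Suc l) - int q" using D n by simp
  show "gop (e + s) (Csg_cup e s Y Z) (Op (Suc l) ?k)" by (rule gop_cong[OF gop_cup[OF Y Z]]) (rule kO, assumption+)
 qed
 let ?psi = "%x. - eps (d + e) (eps (d + d * e) (Op n ?g (circ0 m p ?f l r ?h x)) - eps (d + e) (circ0 m p ?f (Suc l) q ?k x)
   + eps (d + e) (circ0 m p ?f n q ?g (Op l ?h x)))"
 have dT: "gop (d + e + s - 2 + 1) (Csg_diff (d + e + s - 2) (\<ominus>\<^bsub>Csg (d + e + s - 2)\<^esub> signed (Csg (d + e + s - 2)) (d + e) T)) ?psi"
 proof (rule gop_diff[OF gop_neg[OF gop_signed[OF T]], where ?N1.0 = "m + n + l"])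
  fix N x a assume N: "m + n + l <= N" and x: "x : W N"
  have s: "- eps (d + e) (eps (d + d * e) A - eps (d + e) B + eps (d + e) C)
   = eps (int N - (d + e + s - 2) + 1) (- eps (d + e) (K + eps (int N - (s - 1) - e + d * e) A - eps (int N - (s - 1)) B - eps (int N - s) C) - - eps (d + e) K)"
   for A B C K :: "'a list \<Rightarrow>\<^sub>0 'k"
   by (cases "even d"; cases "even e"; cases "even s"; cases "even (int N)"; simp add: eps_def algebra_simps)
  show "?psi (x * v a) = eps (int N - (d + e + s - 2) + 1) (- eps (d + e) (Kop m p ?f n q ?g l r ?h (R a x)) - R a (- eps (d + e) (Kop m p ?f n q ?g l r ?h x)))"
   unfolding Kop_R[OF cf cg ch n x N, of a] plin_minus[OF plin_R0] plin_eps_out[OF plin_R0] D by (rule s)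
 qed (intro plin_intros)
 note rhs = gop_add[OF gop_add[OF gop_deg[OF gop_cup'[OF gop_bracket[OF X Y] cgD(3)[OF Z]]]
  gop_signed[OF gop_deg[OF gop_cup'[OF cgD(3)[OF Y] gop_deg[OF gop_bracket[OF X Z]]]], where k = "(d - 1) * e"]] gop_deg[OF dT]]
 have key: "C1 - eps ((d - 1) * (e + s - 1)) (C2 + eps (s * (d - 1)) C3)
  = (C4 - eps ((d - 1) * (e - 1)) C3) + eps ((d - 1) * e) (C5 - eps ((d - 1) * (s - 1)) C2)
   + - eps (d + e) (eps (d + d * e) C5 - eps (d + e) C1 + eps (d + e) C4)" for C1 C2 C3 C4 C5 :: "'a list \<Rightarrow>\<^sub>0 'k"
  by (cases "even d"; cases "even e"; cases "even s"; simp add: eps_def algebra_simps)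
 show ?thesis
 proof (rule gop_eqI[OF gop_deg[OF gop_bracket[OF X YZ]] rhs, where ?N1.0 = "m + n + l + 1"])
  fix N x assume N: "m + n + l + 1 <= N" and x: "x : W N"
  have mN: "m <= N" "l <= N" "Suc l <= N" using N by auto
  have Sx: "Sg m p ?f x : W (N - m + p + 1)" "Suc l <= N - m + p + 1" using Sg_mem[OF F x mN(1)] N by simp_all
  have 1: "circ0 (Suc l) q ?k m p ?f x = Op n ?g (circ0 l r ?h m p ?f x) + eps (s * (d - 1)) (circ0 n q ?g m p ?f (Op l ?h x))"
  proof -
   have i: "int (Suc l) - int q = e + s" using D n by simp
   show ?thesis
    unfolding circ0_def D i kO[OF Sx] kO[OF x mN(3)] plin_diff[OF plin_Op0] plin_eps_out[OF plin_Op0] eps_diff eps_eps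
    by (cases "even d"; cases "even e"; cases "even s"; simp add: eps_def algebra_simps)
  qed
  show "circ0 m p ?f (Suc l) q ?k x - eps ((d - 1) * (e + s - 1)) (circ0 (Suc l) q ?k m p ?f x)
   = (circ0 m p ?f n q ?g (Op l ?h x) - eps ((d - 1) * (e - 1)) (circ0 n q ?g m p ?f (Op l ?h x)))
    + eps ((d - 1) * e) (Op n ?g (circ0 m p ?f l r ?h x - eps ((d - 1) * (s - 1)) (circ0 l r ?h m p ?f x))) + ?psi x"
   unfolding 1 plin_diff[OF plin_Op0] plin_eps_out[OF plin_Op0] by (rule key)
 qed simp_all
qed

text \<open>Every summand of \<open>Kop_fin\<close> is the operator of an iterated insertion, and
  these exist as cochains; so the homotopy is the germ of an element of the colimit.\<close>

lemma Kop_real: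
 assumes f: "rp d m p f" and g: "rp e n q g" and h: "rp s l r h" and nl: "1 <= n" "1 <= l"
 shows "\<exists>T. gop (d + e + s - 2) T (Kop m p (lf m p f) n q (lf n q g) l r (lf l r h))"
proof -
 let ?f = "lf m p f" and ?g = "lf n q g" and ?h = "lf l r h" and ?D = "d + e + s - 2"
 have fc: "f : cch m p" and gc: "g : cch n q" and hc: "h : cch l r" and D: "d = int m - int p" "e = int n - int q" "s = int l - int r"
  using f g h by (simp_all add: rp_def)
 note F = coch_lf[OF fc] and G = coch_lf[OF gc] and H = coch_lf[OF hc]
 have A: "\<exists>T. gop ?D T (%x. Op m ?f (gi i n ?g (gi j l ?h x)))" if i: "i : {1..m}" and j: "j : {1..<i}" for i j
 proof -
  have i': "1 <= i" "i <= m" and j': "1 <= j" "j <= m + n - 1" using i j nl by auto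
  let ?c = "circ_pos m p f i n q g" and ?M = "m + n - 1"
  note cc = circ_pos_cch[OF fc gc i']
  let ?t = "circ_pos ?M (p + q) ?c j l r h"
  have r: "rp ?D (?M + l - 1) (p + q + r) ?t"
   using circ_pos_cch[OF cc hc j'] D nl i' by (simp add: rp_def of_nat_diff)
  show ?thesis
  proof (rule exI, rule gop_cong[OF gop_rp[OF r], of "m + n + l + j"])
   fix N x assume N: "m + n + l + j <= N" and x: "x : W N"
   define k where "k = N - ((j - 1) + l)"
   have k: "N = (j - 1) + l + k" using N by (simp add: k_def)
   have y: "gi j l ?h x : W ((j - 1) + Suc r + k)" using gi_W_mem[OF H x[unfolded k]] j' by simp
   show "Op m ?f (gi i n ?g (gi j l ?h x)) = OP (?M + l - 1) (p + q + r) ?t x"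
    using circ_pos_Op[OF cc hc j' x] circ_pos_Op[OF fc gc i' y] N k by simp
  qed
 qed
 \<comment> \<open>The circle product is realised with at least p outputs, so that the insertions
   into its output at the places up to p are among the negative insertions of that cochain.\<close>
 obtain K L c where c: "rp (d + s - 1) K L c" "p <= L" "!!N x. K <= N ==> x : W N ==> circ0 m p ?f l r ?h x = OP K L c x"
  by (rule cg_exact[OF gop_circ[OF f h], of p]) blast
 have cc: "c : cch K L" and cd: "d + s - 1 = int K - int L" using c(1) by (simp_all add: rp_def)
 have B: "\<exists>T. gop ?D T (%x. gi i n ?g (circ0 m p ?f l r ?h x))" if i: "i : {1..p}" for i
 proof -
  have i': "1 <= i" "i <= L" using i c(2) by auto
  have r: "rp ?D (K + n - 1) (L + q) (circ_neg K L c i n q g)"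
   using circ_neg_cch[OF cc gc i' nl(1)] cd D nl by (simp add: rp_def of_nat_diff)
  show ?thesis
  proof (rule exI, rule gop_cong[OF gop_rp[OF r], of "K + n"])
   fix N x assume "K + n <= N" and x: "x : W N"
   then show "gi i n ?g (circ0 m p ?f l r ?h x) = OP (K + n - 1) (L + q) (circ_neg K L c i n q g) x"
    using circ_neg_Op[OF cc gc i' nl(1) x] c(3)[OF _ x] by simp
  qed
 qed
 have C: "\<exists>T. gop ?D T (%x. gi i n ?g (gi j l ?h (Op m ?f x)))" if i: "i : {1..p}" and j: "j : {1..<i}" for i j
 proof -
  have i': "1 <= i" "i <= p + r" and j': "1 <= j" "j <= p" using i j by auto
  let ?c = "circ_neg m p f j l r h" and ?M = "m + l - 1"
  note c2 = circ_neg_cch[OF fc hc j' nl(2)]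
  have r: "rp ?D (?M + n - 1) (p + r + q) (circ_neg ?M (p + r) ?c i n q g)"
   using circ_neg_cch[OF c2 gc i' nl(1)] D nl by (simp add: rp_def of_nat_diff)
  show ?thesis
   by (rule exI, rule gop_cong[OF gop_rp[OF r], of "m + n + l"])
    (use circ_neg_Op[OF c2 gc i' nl(1)] circ_neg_Op[OF fc hc j' nl(2)] in simp)
 qed
 have sum: "\<exists>T. gop ?D T (%x. \<Sum>i\<in>I. ph i x)" if "finite I" "!!i. i : I ==> \<exists>T. gop ?D T (ph i)" for I :: "nat set" and ph
  using bchoice[of I "%i T. gop ?D T (ph i)"] that gop_finsum[OF that(1), of ?D _ ph] by blast
 have sgn: "\<exists>T. gop ?D T (%x. eps k (ph x))" if "\<exists>T. gop ?D T ph" for k ph using that gop_signed by blast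
 have "\<exists>T. gop ?D T (%x. \<Sum>i = 1..m. \<Sum>j = 1..<i. eps ((e - 1) * (int i - 1) + (s - 1) * (int j - 1)) (Op m ?f (gi i n ?g (gi j l ?h x))))"
  by (intro sum sgn A) auto
 then obtain T1 where T1: "gop ?D T1 (%x. \<Sum>i = 1..m. \<Sum>j = 1..<i. eps ((e - 1) * (int i - 1) + (s - 1) * (int j - 1)) (Op m ?f (gi i n ?g (gi j l ?h x))))" ..
 have "\<exists>T. gop ?D T (%x. \<Sum>i = 1..p. eps (d * (e - 1) + (e - 1) * (int i - 1)) (gi i n ?g (circ0 m p ?f l r ?h x)))"
  by (intro sum sgn B) auto
 then obtain T2 where T2: "gop ?D T2 (%x. \<Sum>i = 1..p. eps (d * (e - 1) + (e - 1) * (int i - 1)) (gi i n ?g (circ0 m p ?f l r ?h x)))" ..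
 have "\<exists>T. gop ?D T (%x. \<Sum>i = 1..p. \<Sum>j = 1..<i. eps (d * (e - 1 + (s - 1)) + (e - 1) * (int i - 1) + (s - 1) * (int j - 1)) (gi i n ?g (gi j l ?h (Op m ?f x))))"
  by (intro sum sgn C) auto
 then obtain T3 where T3: "gop ?D T3 (%x. \<Sum>i = 1..p. \<Sum>j = 1..<i. eps (d * (e - 1 + (s - 1)) + (e - 1) * (int i - 1) + (s - 1) * (int j - 1)) (gi i n ?g (gi j l ?h (Op m ?f x))))" ..
 show ?thesis
  by (rule exI, rule gop_cong[OF gop_add[OF gop_add[OF gop_neg[OF T1] T2] T3], where ?N1.0 = "m + l"])
   (subst Kop_fin[OF F G H _ _ D(1), of _ _ "e - 1" "s - 1"], auto simp: D)
qed

theorem gerst_Csg: "gerst_complex Csg Csg_diff Csg_cup (sg_class 0 0 one_cochain) Csg_bracket"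
proof (rule gerst_complex.intro)
 fix d e s X Y Z
 assume X: "X : carrier (Csg d)" and Y: "Y : carrier (Csg e)" and dX: "Csg_diff d X = \<zero>\<^bsub>Csg (d + 1)\<^esub>" and dY: "Csg_diff e Y = \<zero>\<^bsub>Csg (e + 1)\<^esub>"
 obtain m p f where f: "rp d m p f" "X = sg_class d p f" "1 <= m" "1 <= p" by (rule Csg_rep[OF X])
 note cf = cocy_rep[OF f(1) dX[unfolded f(2)] disjI2[OF f(4)]]
 {
  obtain n q g where g: "rp e n q g" "Y = sg_class e q g" "1 <= n" "1 <= q" by (rule Csg_rep[OF Y])
  note cg = cocy_rep[OF g(1) dY[unfolded g(2)] disjI2[OF g(4)]]
  note T = gop_circ[OF f(1) g(1)]
  show "\<exists>t\<in>carrier (Csg (d + e - 1)). Csg_cup d e X Y = signed (Csg (d + e)) (d * e) (Csg_cup e d Y X) \<oplus>\<^bsub>Csg (d + e)\<^esub> Csg_diff (d + e - 1) t"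
   using cp_comm_key[OF f(1) g(1) cf cg T] gop_carrier[OF gop_signed[OF T, of d]] unfolding f(2) g(2) by blast
 }
 assume Z: "Z : carrier (Csg s)" and dZ: "Csg_diff s Z = \<zero>\<^bsub>Csg (s + 1)\<^esub>"
 obtain q0 where q0: "!!q. q0 <= q ==> \<exists>n g. rp e n q g & Y = sg_class e q g" by (rule Csg_rep_at[OF Y]) blast
 obtain r0 where r0: "!!r. r0 <= r ==> \<exists>l h. rp s l r h & Z = sg_class s r h" by (rule Csg_rep_at[OF Z]) blast
 \<comment> \<open>The stage r is large enough for both elements to have representatives and for all
   counts to be positive; q is then forced by the requirement that \<open>g\<close> have e + q = r +
   1 arguments.\<close>
 define r where "r = r0 + q0 + nat \<bar>e\<bar> + nat \<bar>s\<bar> + 1"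
 define q where "q = nat (int r + 1 - e)"
 have q: "q0 <= q" "1 <= q" "int q = int r + 1 - e" by (auto simp: q_def r_def)
 obtain l h where h: "rp s l r h" "Z = sg_class s r h" using r0[of r] by (auto simp: r_def)
 obtain n g where g: "rp e n q g" "Y = sg_class e q g" using q0[OF q(1)] by auto
 have "int n = int r + 1" "int l = s + int r" using g(1) h(1) q(3) by (simp_all add: rp_def)
 moreover have "\<bar>s\<bar> + 1 <= int r" by (simp add: r_def)
 ultimately have n: "n = Suc r" "1 <= n" "1 <= l" "1 <= r" by linarith+
 note cg = cocy_rep[OF g(1) dY[unfolded g(2)] disjI2[OF q(2)]] and ch = cocy_rep[OF h(1) dZ[unfolded h(2)] disjI2[OF n(4)]]
 obtain T where T: "gop (d + e + s - 2) T (Kop m p (lf m p f) n q (lf n q g) l r (lf l r h))" using Kop_real[OF f(1) g(1) h(1) n(2,3)] by blast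
 show "\<exists>t\<in>carrier (Csg (d + e + s - 2)). Csg_bracket d (e + s) X (Csg_cup e s Y Z)
    = (Csg_cup (d + e - 1) s (Csg_bracket d e X Y) Z \<oplus>\<^bsub>Csg (d + e + s - 1)\<^esub> signed (Csg (d + e + s - 1)) ((d - 1) * e) (Csg_cup e (d + s - 1) Y (Csg_bracket d s X Z)))
     \<oplus>\<^bsub>Csg (d + e + s - 1)\<^esub> Csg_diff (d + e + s - 2) t"
  using br_cp_key[OF f(1) g(1) h(1) cf cg ch n(1) T] gop_carrier[OF gop_neg[OF gop_signed[OF T, of "d + e"]]] unfolding f(2) g(2) h(2) by blast
qed (rule Csg_vs Csg_diff_lin Csg_d_d Csg_cup_bil Csg_cup_d Csg_cup_assoc sg_mem[of 0 0 0 one_cochain] Csg_one_d Csg_one Csg_bracket_bil Csg_bracket_d Csg_bracket_anti Csg_jacobi;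
  (assumption | simp add: rp_def one_cch))+


section \<open>The bar complex inside the colimit\<close>

lemma bil_zero:
 assumes b: "bilinear_map A B C b" and A: "vector_space_on A" and B: "vector_space_on B" and C: "vector_space_on C"
 shows "x : carrier A ==> b x \<zero>\<^bsub>B\<^esub> = \<zero>\<^bsub>C\<^esub>" and "y : carrier B ==> b \<zero>\<^bsub>A\<^esub> y = \<zero>\<^bsub>C\<^esub>"
proof -
 note v = vs.intro[OF A] vs.intro[OF B] vs.intro[OF C]
 show "b x \<zero>\<^bsub>B\<^esub> = \<zero>\<^bsub>C\<^esub>" if "x : carrier A"
  by (rule lin.zero[OF lin.intro[OF v(2,3)]], rule lin_axioms.intro) (use b that in \<open>simp add: bilinear_map_def\<close>)
 show "b \<zero>\<^bsub>A\<^esub> y = \<zero>\<^bsub>C\<^esub>" if "y : carrier B"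
  by (rule lin.zero[OF lin.intro[OF v(1,3)], where f = "%x. b x y"], rule lin_axioms.intro) (use b that in \<open>simp add: bilinear_map_def\<close>)
qed

sublocale S: gerst_complex Csg Csg_diff Csg_cup "sg_class 0 0 one_cochain" Csg_bracket by (rule gerst_Csg)

lemma HC_vs: "vector_space_on (HC d)" unfolding HC_def by (rule Cnc_vs)
sublocale HCv: vs "HC d" for d by (rule vs.intro[OF HC_vs])

lemma HC_int: "HC (int m) = Hc m 0" by (simp add: HC_def Cnc_eq)
lemma HC_int_carrier: "carrier (HC (int m)) = cch m 0" by (simp add: HC_int Hc_carrier)
lemma HC_neg: "d < 0 ==> x : carrier (HC d) ==> x = \<zero>\<^bsub>HC d\<^esub>"
 by (simp add: HC_def Cnc_def zero_space_def)
lemma int_cases': obtains m where "d = int m" | "d < 0" by (metis nonneg_int_cases not_less)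

lemma HC_rp: "f : carrier (HC (int m)) ==> rp (int m) m 0 f" by (simp add: rp_def HC_int_carrier)

abbreviation \<iota> where "\<iota> d f \<equiv> sg_class d 0 f"

lemma i_lin: "linear_map (HC d) (Csg d) (\<iota> d)"
 by (rule linear_mapI) (auto simp: HC_def Csg_def sg_class_def cl.L_add cl.L_smult intro: cl.L_mem)
sublocale i: lin "HC d" "Csg d" "\<iota> d" for d by unfold_locales (rule i_lin)

text \<open>For A/k = 0 there are no nonempty words of arguments, so the bar complex is concentrated
  in degree 0.\<close>

lemma triv: assumes "bS = {}" "d ~= 0" "x : carrier (HC d)" shows "x = \<zero>\<^bsub>HC d\<^esub>"
proof (cases rule: int_cases'[of d])
 case (1 m)
 then have "VL m = {}" using assms(1,2) by (auto simp: VL_def)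
 then have "V m = {0}" by (auto simp: V_def Kset_def)
 moreover have "lf m 0 f 0 = 0" for f by (simp add: lf_def plin_0[OF plin_lft0])
 ultimately show ?thesis using assms(3) HCv.zero_closed[of d] unfolding 1 HC_int_carrier by (intro cch_eqI) auto
next
 case 2
 then show ?thesis using HC_neg assms(3) by blast
qed

text \<open>Cochains of the bar complex are recovered from their germs except when A/k = 0 and the
  degree is 0. The exception is the reason for the separate treatment of particular degrees in the
  identities that follow.\<close>

lemma HC_inj: assumes nd: "bS ~= {} | d ~= 0" and x: "x : carrier (HC d)" and y: "y : carrier (HC d)" and eq: "\<iota> d x = \<iota> d y"
 shows "x = y"
proof (cases "bS = {}")
 case True
 then show ?thesis using triv[OF True _ x] triv[OF True _ y] nd by metis
next
 case False
 show ?thesis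
 proof (cases rule: int_cases'[of d])
  case 2
  then show ?thesis using HC_neg[OF 2 x] HC_neg[OF 2 y] by metis
 next
  case (1 m)
  let ?z = "x \<ominus>\<^bsub>HC d\<^esub> y"
  have zm: "?z : carrier (HC d)" using x y by simp
  have z: "\<iota> d ?z = \<zero>\<^bsub>Csg d\<^esub>" using i.minus[OF x y] i.mem[OF x] eq by (simp add: a_minus_def Csg.r_neg)
  obtain N0 where N0: "!!N x. N0 <= N ==> x : W N ==> OP m 0 ?z x = 0"
   using gop_uniq[OF gop_rp[OF HC_rp[OF zm[unfolded 1]], folded 1, unfolded z] gop_zero] by blast
  note zc = zm[unfolded 1 HC_int_carrier]
  have "?z = \<zero>\<^bsub>HC d\<^esub>"
  proof (unfold 1 HC_int, rule cch_eqI[OF zc[unfolded HC_int] Hc_mem(3)])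
   fix w assume w: "w : V m"
   show "lf m 0 (x \<ominus>\<^bsub>Hc m 0\<^esub> y) w = lf m 0 \<zero>\<^bsub>Hc m 0\<^esub> w"
    using ev_zero[OF coch_lf[OF zc] N0[unfolded 1] _ w] False by (simp add: lf_Hc(3)[OF w] HC_int)
  qed
  then show ?thesis using HCv.diff_eq_zero[OF x y] by blast
 qed
qed

lemma HC_cup_int: "HC_cup (int m) (int n) f g = cup m 0 f n 0 g" by (simp add: HC_cup_def)
lemma HC_cup_neg: "m < 0 | n < 0 ==> HC_cup m n f g = \<zero>\<^bsub>HC (m + n)\<^esub>" by (simp add: HC_cup_def)
lemma HC_bracket_neg: "m < 0 | n < 0 ==> HC_bracket m n f g = \<zero>\<^bsub>HC (m + n - 1)\<^esub>" by (simp add: HC_bracket_def)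

lemma HC_cup_mem: "f : carrier (HC m) ==> g : carrier (HC n) ==> HC_cup m n f g : carrier (HC (m + n))"
proof (cases "m < 0 | n < 0")
 case False
 then obtain M N where mn: "m = int M" "n = int N" by (metis nonneg_int_cases not_less)
 assume "f : carrier (HC m)" "g : carrier (HC n)"
 moreover have "carrier (HC (int M + int N)) = cch (M + N) 0" using HC_int_carrier[of "M + N"] by simp
 ultimately show ?thesis using cup_cch[of f M 0 g N 0] unfolding mn HC_int_carrier HC_cup_int by simp
qed (simp add: HC_cup_neg)

lemma i_cup: assumes f: "f : carrier (HC m)" and g: "g : carrier (HC n)" shows "\<iota> (m + n) (HC_cup m n f g) = Csg_cup m n (\<iota> m f) (\<iota> n g)"
proof (cases "m < 0 | n < 0")
 case False
 then obtain M N where mn: "m = int M" "n = int N" by (metis nonneg_int_cases not_less)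
 note f' = f[unfolded mn HC_int_carrier] and g' = g[unfolded mn HC_int_carrier]
 have r: "rp (m + n) (M + N) 0 (HC_cup m n f g)" using cup_cch[OF f' g'] by (simp add: rp_def mn HC_cup_int)
 show ?thesis
  by (rule gop_eqI[OF gop_rp[OF r] gop_cup'[OF gop_rp[OF HC_rp[OF f[unfolded mn(1)]], folded mn] gop_rp[OF HC_rp[OF g[unfolded mn(2)]], folded mn]], of "M + N"])
   (use cup_Op[OF f' g'] in \<open>simp add: mn HC_cup_int\<close>)
next
 case True
 have "Csg_cup m n (\<iota> m f) (\<iota> n g) = \<zero>\<^bsub>Csg (m + n)\<^esub>"
 proof -
  obtain ph \<psi> where g: "gop m (\<iota> m f) ph" "gop n (\<iota> n g) \<psi>" by (meson gop_ex i.mem f g)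
  have "\<iota> m f = \<zero>\<^bsub>Csg m\<^esub> | \<iota> n g = \<zero>\<^bsub>Csg n\<^esub>"
   using True HC_neg[OF _ f] HC_neg[OF _ assms(2)] i.zero[of m] i.zero[of n] by (elim disjE) simp_all
  then show ?thesis
   using bil_zero[OF S.cp_bil[of m n] Csg_vs Csg_vs Csg_vs] i.mem[OF f] i.mem[OF assms(2)] by (elim disjE) simp_all
 qed
 then show ?thesis using True by (simp add: HC_cup_neg i.zero)
qed

text \<open>In the bar complex the only output is the factor A, so the sum of negative insertions is
  empty; the positive ones stay in the bar complex, and the inclusion is linear.\<close>

lemma HC_circ:
 assumes f: "f : cch m 0" and g: "g : cch n 0" and t: "t = int m + int n - 1"
 shows "circ (HC t) (%_ h. h) m 0 f n 0 g : carrier (HC t)"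
  and "\<iota> t (circ (HC t) (%_ h. h) m 0 f n 0 g) = circ (Csg t) (sg_class t) m 0 f n 0 g"
proof -
 have c: "signed (HC t) k (circ_pos m 0 f i n 0 g) : carrier (HC t)" "\<iota> t (signed (HC t) k (circ_pos m 0 f i n 0 g)) = signed (Csg t) k (\<iota> t (circ_pos m 0 f i n 0 g))"
  if "i : {1..m}" for i k
 proof -
  have i: "1 <= i" "i <= m" "t = int (m + n - 1)" using that t by auto
  have "circ_pos m 0 f i n 0 g : carrier (HC t)" unfolding i(3) HC_int_carrier using circ_pos_cch[OF f g i(1,2)] by simp
  then show "signed (HC t) k (circ_pos m 0 f i n 0 g) : carrier (HC t)" "\<iota> t (signed (HC t) k (circ_pos m 0 f i n 0 g)) = signed (Csg t) k (\<iota> t (circ_pos m 0 f i n 0 g))"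
   by (simp_all add: HCv.signed_mem i.signed)
 qed
 let ?s = "%T j. (\<Oplus>\<^bsub>T\<^esub>i\<in>{1..m}. signed T ((int n - int 0 - 1) * (int i - 1)) (j (circ_pos m 0 f i n 0 g)))"
 have e: "{1..0::nat} = {}" by simp
 have s: "?s (HC t) (%h. h) : carrier (HC t)" by (rule HCv.finsum_closed) (rule Pi_I, rule c(1))
 have iss: "\<iota> t (?s (HC t) (%h. h)) = ?s (Csg t) (\<iota> t)"
 proof -
  have "\<iota> t (?s (HC t) (%h. h)) = (\<Oplus>\<^bsub>Csg t\<^esub>i\<in>{1..m}. \<iota> t (signed (HC t) ((int n - int 0 - 1) * (int i - 1)) (circ_pos m 0 f i n 0 g)))"
   by (rule i.finsum) (rule c(1))
  also have "\<dots> = ?s (Csg t) (\<iota> t)"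
   by (rule Csg.finsum_cong'[OF refl _ c(2)]) (rule Pi_I, subst c(2)[symmetric], assumption, rule i.mem[OF c(1)])
  finally show ?thesis .
 qed
 show "circ (HC t) (%_ h. h) m 0 f n 0 g : carrier (HC t)" unfolding circ_def e HCv.finsum_empty using s by (simp add: HCv.minus_mem)
 show "\<iota> t (circ (HC t) (%_ h. h) m 0 f n 0 g) = circ (Csg t) (sg_class t) m 0 f n 0 g"
  unfolding circ_def e HCv.finsum_empty Csg.finsum_empty i.minus[OF s HCv.zero_closed] iss i.zero add_0 ..
qed

lemma HC_bracket: assumes f: "f : carrier (HC m)" and g: "g : carrier (HC n)"
 shows "HC_bracket m n f g : carrier (HC (m + n - 1))" and "\<iota> (m + n - 1) (HC_bracket m n f g) = Csg_bracket m n (\<iota> m f) (\<iota> n g)"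
proof -
 have "HC_bracket m n f g : carrier (HC (m + n - 1)) & \<iota> (m + n - 1) (HC_bracket m n f g) = Csg_bracket m n (\<iota> m f) (\<iota> n g)"
 proof (cases "m < 0 | n < 0")
  case False
  then obtain M N where mn: "m = int M" "n = int N" by (metis nonneg_int_cases not_less)
  note f' = f[unfolded mn HC_int_carrier] and g' = g[unfolded mn HC_int_carrier]
  note rf = HC_rp[OF f[unfolded mn]] and rg = HC_rp[OF g[unfolded mn]]
  let ?D = "int M + int N - 1"
  have D2: "?D = int N + int M - 1" by simp
  note c1 = HC_circ[OF f' g' refl] and c2 = HC_circ[OF g' f' D2]
  have H: "HC_bracket m n f g = bracket (HC ?D) (%_ h. h) M 0 f N 0 g" by (simp add: HC_bracket_def mn)
  have mem: "HC_bracket m n f g : carrier (HC ?D)"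
   unfolding H bracket_def by (intro HCv.minus_mem HCv.signed_mem c1 c2)
  have "\<iota> ?D (HC_bracket m n f g) = bracket (Csg ?D) (sg_class ?D) M 0 f N 0 g"
   unfolding H bracket_def by (simp only: i.minus[OF c1(1) HCv.signed_mem[OF c2(1)]] i.signed[OF c2(1)] c1(2) c2(2))
  moreover have "gop ?D (bracket (Csg ?D) (sg_class ?D) M 0 f N 0 g) (%x. circ0 M 0 (lf M 0 f) N 0 (lf N 0 g) x
    - eps ((int M - int 0 - 1) * (int N - int 0 - 1)) (circ0 N 0 (lf N 0 g) M 0 (lf M 0 f) x))"
   unfolding bracket_def
   by (rule gop_minus[OF gop_circ[OF rf rg] gop_signed]) (use gop_circ[OF rg rf] in \<open>simp only: D2[symmetric]\<close>)
  then have "bracket (Csg ?D) (sg_class ?D) M 0 f N 0 g = Csg_bracket m n (\<iota> m f) (\<iota> n g)"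
   unfolding mn by (rule gop_eqI[OF _ gop_bracket[OF cg_rp[OF rf] cg_rp[OF rg]]]) simp
  ultimately show ?thesis using mem by (simp add: mn)
 next
  case True
  have "\<iota> m f = \<zero>\<^bsub>Csg m\<^esub> | \<iota> n g = \<zero>\<^bsub>Csg n\<^esub>"
   using True HC_neg[OF _ f] HC_neg[OF _ g] i.zero[of m] i.zero[of n] by (elim disjE) simp_all
  then have "Csg_bracket m n (\<iota> m f) (\<iota> n g) = \<zero>\<^bsub>Csg (m + n - 1)\<^esub>"
   using bil_zero[OF S.br_bil[of m n] Csg_vs Csg_vs Csg_vs] i.mem[OF f] i.mem[OF g] by (elim disjE) simp_all
  then show ?thesis using True by (simp add: HC_bracket_neg i.zero)
 qed
 then show "HC_bracket m n f g : carrier (HC (m + n - 1))" "\<iota> (m + n - 1) (HC_bracket m n f g) = Csg_bracket m n (\<iota> m f) (\<iota> n g)" by auto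
qed

abbreviation dH where "dH d f \<equiv> C_diff 0 d f"

lemma HC_diff: assumes f: "f : carrier (HC d)"
 shows "dH d f : carrier (HC (d + 1))" and "\<iota> (d + 1) (dH d f) = Csg_diff d (\<iota> d f)"
proof -
 have "dH d f : carrier (HC (d + 1)) & \<iota> (d + 1) (dH d f) = Csg_diff d (\<iota> d f)"
 proof (cases rule: int_cases'[of d])
  case (1 m)
  have "HC (d + 1) = HC (int (Suc m))" by (simp add: 1 add.commute)
  then show ?thesis using diff_cch[OF f[unfolded 1 HC_int_carrier]] Csg_diff_rp[OF HC_rp[OF f[unfolded 1]]]
   by (simp add: HC_int_carrier del: of_nat_Suc) (simp add: 1 C_diff_def)
 next
  case 2
  have e: "dH d f = \<zero>\<^bsub>HC (d + 1)\<^esub>" using 2 by (simp add: C_diff_def HC_def)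
  show ?thesis unfolding e unfolding HC_neg[OF 2 f] i.zero S.dl.zero by simp
 qed
 then show "dH d f : carrier (HC (d + 1))" "\<iota> (d + 1) (dH d f) = Csg_diff d (\<iota> d f)" by auto
qed

text \<open>From degree -1 the differential leads to degree 0, where the inclusion need not be
  injective; but there it is zero by its definition. In all other degrees the colimit
  decides.\<close>

lemma HC_diff_zero: "dH d \<zero>\<^bsub>HC d\<^esub> = \<zero>\<^bsub>HC (d + 1)\<^esub>"
proof (cases "d = -1")
 case True
 then show ?thesis by (simp add: C_diff_def HC_def)
next
 case False
 then show ?thesis using HC_diff[OF HCv.zero_closed[of d]] by (intro HC_inj[of "d + 1"]) (auto simp: i.zero S.dl.zero)
qed

text \<open>Replaces the colimit for brackets that land in degree 0 when A/k = 0: the inserted value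
  is projected to A/k and hence zero.\<close>

lemma HC_deg: assumes "bS = {}" "m + n = 1" and f: "f : carrier (HC m)" and g: "g : carrier (HC n)"
 shows "HC_bracket m n f g = \<zero>\<^bsub>HC (m + n - 1)\<^esub>"
proof (cases "m < 0 | n < 0")
 case True
 then show ?thesis by (rule HC_bracket_neg)
next
 case False
 have "VL 1 = {}" using assms(1) by (auto simp: VL_def)
 then have V1: "V 1 = {0}" by (auto simp: V_def Kset_def)
 have circ: "circ (HC 0) (%_ h. h) 1 0 f 0 0 g = \<zero>\<^bsub>HC 0\<^esub>" if f: "f : cch 1 0" and g: "g : cch 0 0" for f g
 proof -
  note c = circ_pos_cch[OF f g order_refl order_refl] and l = circ_pos_lf[OF f g order_refl order_refl]
  have "circ_pos 1 0 f 1 0 0 g = \<zero>\<^bsub>Hc 0 0\<^esub>"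
  proof (rule cch_eqI[of _ 0 0])
   show "circ_pos 1 0 f 1 0 0 g : cch 0 0" using c by simp
   fix w assume w: "w : V 0"
   have "gi 0 0 (lf 0 0 g) w : V 1" using gi_V_mem[OF coch_lf[OF g], of w 0 0] w by simp
   then show "lf 0 0 (circ_pos 1 0 f 1 0 0 g) w = lf 0 0 \<zero>\<^bsub>Hc 0 0\<^esub> w" using l[of w] w V1 by (simp add: lf_Hc(3) plin_0[OF plin_ins0])
  qed (rule Hc_mem(3))
  then have z: "circ_pos 1 0 f 1 0 0 g = \<zero>\<^bsub>HC 0\<^esub>" using HC_int[of 0] by simp
  have e: "{1..1::nat} = {1}" "{1..0::nat} = {}" by auto
  show ?thesis unfolding circ_def e by (simp add: z signed_def a_minus_def del: One_nat_def)
 qed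
 have circ': "circ (HC 0) (%_ h. h) 0 0 g 1 0 f = \<zero>\<^bsub>HC 0\<^esub>" for f g
  unfolding circ_def by (simp add: a_minus_def)
 have zz: "\<zero>\<^bsub>HC 0\<^esub> \<oplus>\<^bsub>HC 0\<^esub> \<ominus>\<^bsub>HC 0\<^esub> \<zero>\<^bsub>HC 0\<^esub> = \<zero>\<^bsub>HC 0\<^esub>" by (rule HCv.r_neg[OF HCv.zero_closed])
 have "(m = 1 & n = 0) | (m = 0 & n = 1)" using False assms(2) by auto
 then show ?thesis
  using f g HC_int_carrier[of 0] HC_int_carrier[of 1]
  by (auto simp: HC_bracket_def bracket_def circ[unfolded One_nat_def] circ'[unfolded One_nat_def] signed_def a_minus_def zz)
qed


text \<open>Degrees are tied by equations between integers, so that the rules collected in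
  \<open>pull\<close> and \<open>mems\<close> apply to degrees that are equal but written
  differently.\<close>

lemma i_cup': "k = m + n ==> f : carrier (HC m) ==> g : carrier (HC n) ==> \<iota> k (HC_cup m n f g) = Csg_cup m n (\<iota> m f) (\<iota> n g)"
 and cup_mem': "k = m + n ==> f : carrier (HC m) ==> g : carrier (HC n) ==> HC_cup m n f g : carrier (HC k)"
 and i_br': "k = m + n - 1 ==> f : carrier (HC m) ==> g : carrier (HC n) ==> \<iota> k (HC_bracket m n f g) = Csg_bracket m n (\<iota> m f) (\<iota> n g)"
 and br_mem': "k = m + n - 1 ==> f : carrier (HC m) ==> g : carrier (HC n) ==> HC_bracket m n f g : carrier (HC k)"
 and i_diff': "k = m + 1 ==> f : carrier (HC m) ==> \<iota> k (dH m f) = Csg_diff m (\<iota> m f)"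
 and diff_mem': "k = m + 1 ==> f : carrier (HC m) ==> dH m f : carrier (HC k)"
 by (simp_all add: i_cup HC_cup_mem HC_bracket HC_diff)

lemmas pull = i_cup' i_br' i_diff' i.add i.signed i.neg i.smult i.zero
lemmas mems = cup_mem' br_mem' diff_mem' HCv.signed_mem HCv.smult_mem i.mem

lemma HC_neg_zero: "\<ominus>\<^bsub>HC d\<^esub> \<zero>\<^bsub>HC d\<^esub> = \<zero>\<^bsub>HC d\<^esub>"
 by (simp add: HCv.neg_smult[OF HCv.zero_closed] HCv.smult_zero)
lemma HC_signed_zero: "signed (HC d) k \<zero>\<^bsub>HC d\<^esub> = \<zero>\<^bsub>HC d\<^esub>"
 by (simp add: signed_def HC_neg_zero)

lemma HC_d_lin: "linear_map (HC d) (HC (d + 1)) (dH d)"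
proof (rule linear_combI[OF HC_vs HC_vs HC_diff(1)])
 fix c x y assume x: "x : carrier (HC d)" and y: "y : carrier (HC d)"
 have m: "c \<odot>\<^bsub>HC d\<^esub> x \<oplus>\<^bsub>HC d\<^esub> y : carrier (HC d)" using x y by (simp add: mems)
 show "dH d (c \<odot>\<^bsub>HC d\<^esub> x \<oplus>\<^bsub>HC d\<^esub> y) = c \<odot>\<^bsub>HC (d + 1)\<^esub> dH d x \<oplus>\<^bsub>HC (d + 1)\<^esub> dH d y"
 proof (cases "d < 0")
  case True
  have "dH d f = \<zero>\<^bsub>HC (d + 1)\<^esub>" for f using True by (simp add: C_diff_def HC_def)
  then show ?thesis by (simp add: HCv.smult_zero)
 next
  case False
  show ?thesis
   by (rule HC_inj[of "d + 1"])
    (use False x y m in \<open>auto simp: mems pull S.dl.add S.dl.smult Csg.smult_mem\<close>)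
 qed
qed

lemma HC_d_d: "x : carrier (HC d) ==> dH (d + 1) (dH d x) = \<zero>\<^bsub>HC (d + 2)\<^esub>"
proof (cases "d < 0")
 case True
 assume "x : carrier (HC d)"
 then have "x = \<zero>\<^bsub>HC d\<^esub>" by (rule HC_neg[OF True])
 then show ?thesis using HC_diff_zero[of d] HC_diff_zero[of "d + 1"] by (simp add: add.assoc)
next
 case False
 assume x: "x : carrier (HC d)"
 show ?thesis
  by (rule HC_inj[of "d + 2"]) (use False x in \<open>auto simp: mems pull S.d_d\<close>)
qed

lemma HC_OP_eqI:
 "[| f : carrier (HC (int m)); g : carrier (HC (int m)); !!x. x : W m ==> OP m 0 f x = OP m 0 g x |] ==> f = g"
 unfolding HC_int_carrier by (rule cch_eqI_OP)

lemma HC_cup_OP: "f : carrier (HC (int m)) ==> g : carrier (HC (int n)) ==> x : W N ==> m + n <= N ==>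
 OP (m + n) 0 (HC_cup (int m) (int n) f g) x = OP m 0 f (OP n 0 g x)"
 unfolding HC_int_carrier HC_cup_int using cup_Op[of f m 0 g n 0 x N] by simp

lemma OP_HC_comb:
 assumes f: "f : carrier (HC (int m))" and g: "g : carrier (HC (int m))" and x: "x : W N" and N: "m <= N"
 shows "OP m 0 (c \<odot>\<^bsub>HC (int m)\<^esub> f \<oplus>\<^bsub>HC (int m)\<^esub> g) x = psc c (OP m 0 f x) + OP m 0 g x"
 using OP_Hc(1)[OF Hc_mem(2) _ x N] OP_Hc(2)[OF _ _ x N] f g unfolding HC_int_carrier unfolding HC_int by simp

text \<open>The comparison is made with operators on words of \<open>W\<close> of the shortest
  admissible length and not with germs, which covers degree 0 for A/k = 0 as well. Associativity and
  the unit laws are treated likewise.\<close>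

lemma HC_cup_bil: "bilinear_map (HC m) (HC n) (HC (m + n)) (HC_cup m n)"
proof (cases "m < 0 | n < 0")
 case True
 then show ?thesis unfolding bilinear_map_def by (auto simp: HC_cup_neg HCv.smult_zero intro!: linear_mapI)
next
 case False
 then obtain M N where mn: "m = int M" "n = int N" by (metis nonneg_int_cases not_less)
 have s: "int M + int N = int (M + N)" by simp
 show ?thesis
  unfolding bilinear_map_def mn
 proof (intro conjI ballI linear_combI[OF HC_vs HC_vs HC_cup_mem])
  fix f g h c assume f: "f : carrier (HC (int M))" and g: "g : carrier (HC (int N))" and h: "h : carrier (HC (int N))"
  have gh: "c \<odot>\<^bsub>HC (int N)\<^esub> g \<oplus>\<^bsub>HC (int N)\<^esub> h : carrier (HC (int N))" using g h by (simp add: HCv.smult_mem)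
  note c1 = HC_cup_mem[OF f g, unfolded s] and c2 = HC_cup_mem[OF f h, unfolded s] and c3 = HC_cup_mem[OF f gh, unfolded s]
  show "HC_cup (int M) (int N) f (c \<odot>\<^bsub>HC (int N)\<^esub> g \<oplus>\<^bsub>HC (int N)\<^esub> h)
   = c \<odot>\<^bsub>HC (int M + int N)\<^esub> HC_cup (int M) (int N) f g \<oplus>\<^bsub>HC (int M + int N)\<^esub> HC_cup (int M) (int N) f h"
   unfolding s
  proof (rule HC_OP_eqI[OF c3])
   fix x assume x: "x : W (M + N)"
   show "OP (M + N) 0 (HC_cup (int M) (int N) f (c \<odot>\<^bsub>HC (int N)\<^esub> g \<oplus>\<^bsub>HC (int N)\<^esub> h)) x
    = OP (M + N) 0 (c \<odot>\<^bsub>HC (int (M + N))\<^esub> HC_cup (int M) (int N) f g \<oplus>\<^bsub>HC (int (M + N))\<^esub> HC_cup (int M) (int N) f h) x"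
    using OP_HC_comb[OF c1 c2 x order_refl] OP_HC_comb[OF g h x] HC_cup_OP[OF f gh x] HC_cup_OP[OF f g x] HC_cup_OP[OF f h x]
    by (simp add: plin_add[OF plin_Op0] plin_psc[OF plin_Op0])
  qed (use c1 c2 in \<open>simp add: HCv.smult_mem\<close>)
 next
  fix f g h c assume f: "f : carrier (HC (int N))" and g: "g : carrier (HC (int M))" and h: "h : carrier (HC (int M))"
  have gh: "c \<odot>\<^bsub>HC (int M)\<^esub> g \<oplus>\<^bsub>HC (int M)\<^esub> h : carrier (HC (int M))" using g h by (simp add: HCv.smult_mem)
  note c1 = HC_cup_mem[OF g f, unfolded s] and c2 = HC_cup_mem[OF h f, unfolded s] and c3 = HC_cup_mem[OF gh f, unfolded s]
  show "HC_cup (int M) (int N) (c \<odot>\<^bsub>HC (int M)\<^esub> g \<oplus>\<^bsub>HC (int M)\<^esub> h) f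
   = c \<odot>\<^bsub>HC (int M + int N)\<^esub> HC_cup (int M) (int N) g f \<oplus>\<^bsub>HC (int M + int N)\<^esub> HC_cup (int M) (int N) h f"
   unfolding s
  proof (rule HC_OP_eqI[OF c3])
   fix x assume x: "x : W (M + N)"
   have y: "OP N 0 f x : W M" using Op_mem'[OF coch_lf[OF f[unfolded HC_int_carrier]] x] by simp
   show "OP (M + N) 0 (HC_cup (int M) (int N) (c \<odot>\<^bsub>HC (int M)\<^esub> g \<oplus>\<^bsub>HC (int M)\<^esub> h) f) x
    = OP (M + N) 0 (c \<odot>\<^bsub>HC (int (M + N))\<^esub> HC_cup (int M) (int N) g f \<oplus>\<^bsub>HC (int (M + N))\<^esub> HC_cup (int M) (int N) h f) x"
    using OP_HC_comb[OF c1 c2 x order_refl] OP_HC_comb[OF g h y order_refl] HC_cup_OP[OF gh f x] HC_cup_OP[OF g f x] HC_cup_OP[OF h f x]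
    by simp
  qed (use c1 c2 in \<open>simp add: HCv.smult_mem\<close>)
 qed
qed

lemma HC_cup_zero: "x : carrier (HC m) ==> HC_cup m n x \<zero>\<^bsub>HC n\<^esub> = \<zero>\<^bsub>HC (m + n)\<^esub>"
 "y : carrier (HC n) ==> HC_cup m n \<zero>\<^bsub>HC m\<^esub> y = \<zero>\<^bsub>HC (m + n)\<^esub>"
 by (rule bil_zero[OF HC_cup_bil HC_vs HC_vs HC_vs]; assumption)+

lemma HC_cup_assoc: assumes f: "f : carrier (HC m)" and g: "g : carrier (HC n)" and h: "h : carrier (HC l)"
 shows "HC_cup (m + n) l (HC_cup m n f g) h = HC_cup m (n + l) f (HC_cup n l g h)"
proof (cases "0 <= m & 0 <= n & 0 <= l")
 case True
 then obtain a b c where i: "m = int a" "n = int b" "l = int c" by (metis nonneg_int_cases)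
 note f' = f[unfolded i] and g' = g[unfolded i] and h' = h[unfolded i]
 have s: "int a + int b = int (a + b)" "int b + int c = int (b + c)" by simp_all
 note fg = HC_cup_mem[OF f' g', unfolded s] and gh = HC_cup_mem[OF g' h', unfolded s]
 have s2: "int (a + b) + int c = int (a + b + c)" "int a + int (b + c) = int (a + b + c)" by simp_all
 show ?thesis
  unfolding i s
 proof (rule HC_OP_eqI[OF HC_cup_mem[OF fg h', unfolded s2] HC_cup_mem[OF f' gh, unfolded s2]])
  fix x assume x: "x : W (a + b + c)"
  have y: "OP c 0 (h) x : W (a + b)" using Op_mem'[OF coch_lf[OF h'[unfolded HC_int_carrier]] x] by simp
  show "OP (a + b + c) 0 (HC_cup (int (a + b)) (int c) (HC_cup (int a) (int b) f g) h) x = OP (a + b + c) 0 (HC_cup (int a) (int (b + c)) f (HC_cup (int b) (int c) g h)) x"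
   using HC_cup_OP[OF fg h' x order_refl] HC_cup_OP[OF f' gh x] HC_cup_OP[OF f' g' y order_refl] HC_cup_OP[OF g' h' x] by (simp add: add.assoc)
 qed
next
 case False
 then have "f = \<zero>\<^bsub>HC m\<^esub> | g = \<zero>\<^bsub>HC n\<^esub> | h = \<zero>\<^bsub>HC l\<^esub>" using HC_neg f g h by (meson not_less)
 then show ?thesis using f g h by (elim disjE) (simp_all add: HC_cup_zero HC_cup_mem add.assoc)
qed

lemma HC_one: "one_cochain : carrier (HC 0)" using one_cch HC_int_carrier[of 0] by simp

lemma HC_one_cup: assumes x: "x : carrier (HC m)" shows "HC_cup 0 m one_cochain x = x" "HC_cup m 0 x one_cochain = x"
proof -
 have "HC_cup 0 m one_cochain x = x & HC_cup m 0 x one_cochain = x"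
 proof (cases rule: int_cases'[of m])
  case (1 a)
  note x' = x[unfolded 1]
  have o: "one_cochain : carrier (HC (int 0))" using HC_one by simp
  have "HC_cup (int 0) (int a) one_cochain x = x"
  proof (rule HC_OP_eqI[of _ a, OF _ x'])
   show "HC_cup (int 0) (int a) one_cochain x : carrier (HC (int a))" using HC_cup_mem[OF o x'] by simp
   fix y assume y: "y : W a"
   note xy = Op_mem'[OF coch_lf[OF x'[unfolded HC_int_carrier]] y order_refl]
   show "OP a 0 (HC_cup (int 0) (int a) one_cochain x) y = OP a 0 x y" using HC_cup_OP[OF o x' y] one_Op[OF xy] by simp
  qed
  moreover have "HC_cup (int a) (int 0) x one_cochain = x"
  proof (rule HC_OP_eqI[of _ a, OF _ x'])
   show "HC_cup (int a) (int 0) x one_cochain : carrier (HC (int a))" using HC_cup_mem[OF x' o] by simp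
   fix y assume y: "y : W a"
   show "OP a 0 (HC_cup (int a) (int 0) x one_cochain) y = OP a 0 x y" using HC_cup_OP[OF x' o y] one_Op[OF y] by simp
  qed
  ultimately show ?thesis by (simp add: 1)
 next
  case 2
  then show ?thesis using HC_neg[OF 2 x] HC_cup_neg[of 0 m one_cochain x] HC_cup_neg[of m 0 x one_cochain] by auto
 qed
 then show "HC_cup 0 m one_cochain x = x" "HC_cup m 0 x one_cochain = x" by auto
qed

text \<open>For nonnegative m and n the identity lies in the positive degree m + n + 1, where the
  inclusion is injective.\<close>

lemma HC_cup_d: assumes f: "f : carrier (HC m)" and g: "g : carrier (HC n)"
 shows "dH (m + n) (HC_cup m n f g) = HC_cup (m + 1) n (dH m f) g \<oplus>\<^bsub>HC (m + n + 1)\<^esub> signed (HC (m + n + 1)) m (HC_cup m (n + 1) f (dH n g))"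
proof (cases "m < 0 | n < 0")
 case False
 show ?thesis
 proof (rule HC_inj[of "m + n + 1"])
  show "\<iota> (m + n + 1) (dH (m + n) (HC_cup m n f g)) = \<iota> (m + n + 1) (HC_cup (m + 1) n (dH m f) g \<oplus>\<^bsub>HC (m + n + 1)\<^esub> signed (HC (m + n + 1)) m (HC_cup m (n + 1) f (dH n g)))"
   using S.cp_d[OF i.mem[OF f] i.mem[OF g]] f g by (simp add: pull mems)
 qed (use False f g in \<open>auto simp: mems\<close>)
next
 case True
 then have "f = \<zero>\<^bsub>HC m\<^esub> | g = \<zero>\<^bsub>HC n\<^esub>" using HC_neg f g by blast
 moreover have e: "HC (m + 1 + n) = HC (m + n + 1)" "HC (m + (n + 1)) = HC (m + n + 1)" by (simp_all add: algebra_simps)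
 ultimately show ?thesis using f g HC_cup_zero(2)[of _ n "m + 1"] HC_cup_zero(1)[of _ m "n + 1"]
  by (elim disjE) (simp_all add: HC_cup_zero HC_diff_zero HC_diff(1) HC_signed_zero e)
qed

lemma HC_bracket_bil: "bilinear_map (HC m) (HC n) (HC (m + n - 1)) (HC_bracket m n)"
proof -
 have Cl: "linear_map (Csg n) (Csg (m + n - 1)) (Csg_bracket m n X)" if "X : carrier (Csg m)" for X using S.br_bil[of m n] that by (simp add: bilinear_map_def)
 have Cr: "linear_map (Csg m) (Csg (m + n - 1)) (%X. Csg_bracket m n X Y)" if "Y : carrier (Csg n)" for Y using S.br_bil[of m n] that by (simp add: bilinear_map_def)
 show ?thesis
  unfolding bilinear_map_def
 proof (intro conjI ballI linear_combI[OF HC_vs HC_vs HC_bracket(1)])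
  fix f g h c assume f: "f : carrier (HC m)" and g: "g : carrier (HC n)" and h: "h : carrier (HC n)"
  have gh: "c \<odot>\<^bsub>HC n\<^esub> g \<oplus>\<^bsub>HC n\<^esub> h : carrier (HC n)" using g h by (simp add: HCv.smult_mem)
  show "HC_bracket m n f (c \<odot>\<^bsub>HC n\<^esub> g \<oplus>\<^bsub>HC n\<^esub> h) = c \<odot>\<^bsub>HC (m + n - 1)\<^esub> HC_bracket m n f g \<oplus>\<^bsub>HC (m + n - 1)\<^esub> HC_bracket m n f h"
  proof (cases "bS = {} & m + n = 1")
   case True
   then show ?thesis using HC_deg[OF _ _ f g] HC_deg[OF _ _ f h] HC_deg[OF _ _ f gh] by (simp add: HCv.smult_zero)
  next
   case False
   show ?thesis
    by (rule HC_inj[of "m + n - 1"])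
     (use False f g h gh in \<open>auto simp: mems pull linear_mapD[OF Cl] Csg.smult_mem\<close>)
  qed
 next
  fix f g h c assume f: "f : carrier (HC n)" and g: "g : carrier (HC m)" and h: "h : carrier (HC m)"
  have gh: "c \<odot>\<^bsub>HC m\<^esub> g \<oplus>\<^bsub>HC m\<^esub> h : carrier (HC m)" using g h by (simp add: HCv.smult_mem)
  show "HC_bracket m n (c \<odot>\<^bsub>HC m\<^esub> g \<oplus>\<^bsub>HC m\<^esub> h) f = c \<odot>\<^bsub>HC (m + n - 1)\<^esub> HC_bracket m n g f \<oplus>\<^bsub>HC (m + n - 1)\<^esub> HC_bracket m n h f"
  proof (cases "bS = {} & m + n = 1")
   case True
   then show ?thesis using HC_deg[OF _ _ g f] HC_deg[OF _ _ h f] HC_deg[OF _ _ gh f] by (simp add: HCv.smult_zero)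
  next
   case False
   show ?thesis
    by (rule HC_inj[of "m + n - 1"])
     (use False f g h gh in \<open>auto simp: mems pull linear_mapD[OF Cr] Csg.smult_mem\<close>)
  qed
 qed
qed

lemma HC_bracket_zero: "x : carrier (HC m) ==> HC_bracket m n x \<zero>\<^bsub>HC n\<^esub> = \<zero>\<^bsub>HC (m + n - 1)\<^esub>"
 "y : carrier (HC n) ==> HC_bracket m n \<zero>\<^bsub>HC m\<^esub> y = \<zero>\<^bsub>HC (m + n - 1)\<^esub>"
 by (rule bil_zero[OF HC_bracket_bil HC_vs HC_vs HC_vs]; assumption)+

lemma HC_bracket_d: assumes f: "f : carrier (HC m)" and g: "g : carrier (HC n)"
 shows "dH (m + n - 1) (HC_bracket m n f g) = HC_bracket (m + 1) n (dH m f) g \<oplus>\<^bsub>HC (m + n)\<^esub> signed (HC (m + n)) (m - 1) (HC_bracket m (n + 1) f (dH n g))"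
proof (cases "bS = {} & m + n = 0")
 case True
 have e: "HC (m + 1 + n - 1) = HC (m + n)" "HC (m + (n + 1) - 1) = HC (m + n)" by simp_all
 have "HC_bracket m n f g = \<zero>\<^bsub>HC (m + n - 1)\<^esub>" by (rule HC_neg[OF _ HC_bracket(1)[OF f g]]) (use True in simp)
 then show ?thesis
  using True HC_deg[OF _ _ HC_diff(1)[OF f] g] HC_deg[OF _ _ f HC_diff(1)[OF g]] HC_diff_zero[of "m + n - 1"] by (simp add: e HC_signed_zero)
next
 case False
 show ?thesis
 proof (rule HC_inj[of "m + n"])
  show "\<iota> (m + n) (dH (m + n - 1) (HC_bracket m n f g)) = \<iota> (m + n) (HC_bracket (m + 1) n (dH m f) g \<oplus>\<^bsub>HC (m + n)\<^esub> signed (HC (m + n)) (m - 1) (HC_bracket m (n + 1) f (dH n g)))"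
   using S.br_d[OF i.mem[OF f] i.mem[OF g]] f g by (simp add: pull mems)
 qed (use False f g in \<open>auto simp: mems\<close>)
qed

lemma HC_bracket_anti: assumes f: "f : carrier (HC m)" and g: "g : carrier (HC n)"
 shows "HC_bracket m n f g = \<ominus>\<^bsub>HC (m + n - 1)\<^esub> signed (HC (m + n - 1)) ((m - 1) * (n - 1)) (HC_bracket n m g f)"
proof (cases "bS = {} & m + n = 1")
 case True
 then show ?thesis using HC_deg[OF _ _ f g] HC_deg[OF _ _ g f] by (simp add: HC_signed_zero HC_neg_zero add.commute)
next
 case False
 show ?thesis
 proof (rule HC_inj[of "m + n - 1"])
  show "\<iota> (m + n - 1) (HC_bracket m n f g) = \<iota> (m + n - 1) (\<ominus>\<^bsub>HC (m + n - 1)\<^esub> signed (HC (m + n - 1)) ((m - 1) * (n - 1)) (HC_bracket n m g f))"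
   using S.br_anti[OF i.mem[OF f] i.mem[OF g]] f g by (simp add: pull mems)
 qed (use False f g in \<open>auto simp: mems\<close>)
qed

lemma HC_jacobi: assumes f: "f : carrier (HC m)" and g: "g : carrier (HC n)" and h: "h : carrier (HC l)"
 shows "HC_bracket m (n + l - 1) f (HC_bracket n l g h) = HC_bracket (m + n - 1) l (HC_bracket m n f g) h
  \<oplus>\<^bsub>HC (m + n + l - 2)\<^esub> signed (HC (m + n + l - 2)) ((m - 1) * (n - 1)) (HC_bracket n (m + l - 1) g (HC_bracket m l f h))"
proof (cases "bS = {} & m + n + l = 2")
 case True
 then have d: "bS = {}" "m + (n + l - 1) = 1" "m + n - 1 + l = 1" "n + (m + l - 1) = 1" by simp_all
 have deg: "m + (n + l - 1) - 1 = m + n + l - 2" "m + n - 1 + l - 1 = m + n + l - 2" "n + (m + l - 1) - 1 = m + n + l - 2" by simp_all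
 show ?thesis
  unfolding HC_deg[OF d(1,2) f HC_bracket(1)[OF g h], unfolded deg] HC_deg[OF d(1,3) HC_bracket(1)[OF f g] h, unfolded deg]
   HC_deg[OF d(1,4) g HC_bracket(1)[OF f h], unfolded deg] HC_signed_zero
  by (simp only: HCv.l_zero[OF HCv.zero_closed])
next
 case False
 show ?thesis
 proof (rule HC_inj[of "m + n + l - 2"])
  show "\<iota> (m + n + l - 2) (HC_bracket m (n + l - 1) f (HC_bracket n l g h)) = \<iota> (m + n + l - 2) (HC_bracket (m + n - 1) l (HC_bracket m n f g) h
   \<oplus>\<^bsub>HC (m + n + l - 2)\<^esub> signed (HC (m + n + l - 2)) ((m - 1) * (n - 1)) (HC_bracket n (m + l - 1) g (HC_bracket m l f h)))"
   using S.br_jacobi[OF i.mem[OF f] i.mem[OF g] i.mem[OF h]] f g h by (simp add: pull mems)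
 qed (use False f g h in \<open>auto simp: mems\<close>)
qed


lemma W_0_scalar: assumes "bS = {}" "y : W 0" obtains c where "y = psc c (u 1)"
proof -
 let ?S = "range (%c. psc c (u 1))"
 have S: "psub ?S"
  unfolding psub_def
 proof (intro conjI ballI allI)
  show "0 : ?S" by (rule range_eqI[of _ _ 0]) simp
  show "x + y : ?S" if "x : ?S" "y : ?S" for x y using that by (auto simp: psc_add_left[symmetric])
  show "psc c x : ?S" if "x : ?S" for c x using that by auto
 qed
 have "u a : ?S" for a
 proof (rule alin_memI[OF alin_u S])
  fix b assume "b : bB"
  then have "b = 1" using assms(1) by (auto simp: bS_def)
  then show "u b : ?S" by (auto intro: range_eqI[of _ _ 1])
 qed
 then have "W 0 \<subseteq> ?S" by (rule W_0_subI[OF S])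
 then show ?thesis using assms(2) that by blast
qed

text \<open>For A/k = 0 the space \<open>W 0\<close> is spanned by \<open>u 1\<close>, so cochains
  of degree 0 act on it by scalars, and scalars commute.\<close>

lemma HC_cup_comm_deg: assumes "bS = {}" and f: "f : carrier (HC (int 0))" and g: "g : carrier (HC (int 0))"
 shows "HC_cup (int 0) (int 0) f g = HC_cup (int 0) (int 0) g f"
proof -
 have m: "HC_cup (int 0) (int 0) a b : carrier (HC (int 0))" if "a : carrier (HC (int 0))" "b : carrier (HC (int 0))" for a b
  using HC_cup_mem[OF that] by simp
 have s: "\<exists>c. OP 0 0 a (u 1) = psc c (u 1)" if "a : carrier (HC (int 0))" for a
  using W_0_scalar[OF assms(1)] Op_mem'[OF coch_lf[OF that[unfolded HC_int_carrier]] u_mem[of 1]] by (metis le_refl diff_self_eq_0 add_0)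
 obtain a b where ab: "OP 0 0 f (u 1) = psc a (u 1)" "OP 0 0 g (u 1) = psc b (u 1)" using s[OF f] s[OF g] by blast
 show ?thesis
 proof (rule HC_OP_eqI[OF m[OF f g] m[OF g f]])
  fix x assume x: "x : W 0"
  then obtain c where c: "x = psc c (u 1)" using W_0_scalar[OF assms(1)] by blast
  show "OP 0 0 (HC_cup (int 0) (int 0) f g) x = OP 0 0 (HC_cup (int 0) (int 0) g f) x"
   using HC_cup_OP[OF f g x] HC_cup_OP[OF g f x] by (simp add: c plin_psc[OF plin_Op0] ab mult.commute mult.left_commute)
 qed
qed

text \<open>The homotopy of the colimit is a circle product, and by \<open>HC_circ\<close> that of
  two elements of the bar complex comes from the bar complex. Injectivity then brings the identity
  back, apart from A/k = 0 in degree 0.\<close>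

lemma HC_cup_comm:
 assumes f: "f : carrier (HC m)" and g: "g : carrier (HC n)" and df: "dH m f = \<zero>\<^bsub>HC (m + 1)\<^esub>" and dg: "dH n g = \<zero>\<^bsub>HC (n + 1)\<^esub>"
 shows "\<exists>t\<in>carrier (HC (m + n - 1)). HC_cup m n f g = signed (HC (m + n)) (m * n) (HC_cup n m g f) \<oplus>\<^bsub>HC (m + n)\<^esub> dH (m + n - 1) t"
proof -
 let ?k = "m + n - 1"
 have z: "\<zero>\<^bsub>HC ?k\<^esub> : carrier (HC ?k)" "dH ?k \<zero>\<^bsub>HC ?k\<^esub> = \<zero>\<^bsub>HC (m + n)\<^esub>" using HC_diff_zero[of ?k] by simp_all
 have gf: "HC_cup n m g f : carrier (HC (m + n))" using HC_cup_mem[OF g f] by (simp add: add.commute)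
 consider "m < 0 | n < 0" | "0 <= m" "0 <= n" "bS ~= {}" | "bS = {}" "m + n ~= 0" | "0 <= m" "0 <= n" "bS = {}" "m + n = 0" by linarith
 then show ?thesis
 proof cases
  case 1
  then have "HC_cup n m g f = \<zero>\<^bsub>HC (m + n)\<^esub>" using HC_cup_neg[of n m g f] by (auto simp: add.commute)
  then show ?thesis using 1 by (intro bexI[OF _ z(1)]) (simp only: HC_cup_neg HC_signed_zero z(2) HCv.l_zero[OF HCv.zero_closed])
 next
  case 2
  then obtain M N where mn: "m = int M" "n = int N" by (metis nonneg_int_cases)
  note rf = HC_rp[OF f[unfolded mn(1)], folded mn(1)] and rg = HC_rp[OF g[unfolded mn(2)], folded mn(2)]
  have cf: "cocy M 0 (lf M 0 f)" by (rule cocy_rep[OF rf _ disjI1[OF 2(3)]]) (simp add: HC_diff(2)[OF f, symmetric] df i.zero)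
  have cg: "cocy N 0 (lf N 0 g)" by (rule cocy_rep[OF rg _ disjI1[OF 2(3)]]) (simp add: HC_diff(2)[OF g, symmetric] dg i.zero)
  let ?c = "circ (HC ?k) (%_ h. h) M 0 f N 0 g"
  have k: "?k = int M + int N - 1" by (simp add: mn)
  note c = HC_circ[OF f[unfolded mn HC_int_carrier] g[unfolded mn HC_int_carrier] k]
  note key = cp_comm_key[OF rf rg cf cg gop_circ[OF rf rg], folded c(2)]
  have tm: "signed (HC ?k) m ?c : carrier (HC ?k)" using c(1) by (rule HCv.signed_mem)
  have dt: "dH ?k (signed (HC ?k) m ?c) : carrier (HC (m + n))" using HC_diff(1)[OF tm] by simp
  have "HC_cup m n f g = signed (HC (m + n)) (m * n) (HC_cup n m g f) \<oplus>\<^bsub>HC (m + n)\<^esub> dH ?k (signed (HC ?k) m ?c)"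
  proof (rule HC_inj[OF disjI1[OF 2(3)] HC_cup_mem[OF f g]])
   show "signed (HC (m + n)) (m * n) (HC_cup n m g f) \<oplus>\<^bsub>HC (m + n)\<^esub> dH ?k (signed (HC ?k) m ?c) : carrier (HC (m + n))"
    using gf dt by (simp add: HCv.signed_mem)
   have 1: "\<iota> (m + n) (HC_cup n m g f) = Csg_cup n m (\<iota> n g) (\<iota> m f)" by (rule i_cup'[OF add.commute g f])
   have 2: "\<iota> (m + n) (dH ?k (signed (HC ?k) m ?c)) = Csg_diff ?k (signed (Csg ?k) m (\<iota> ?k ?c))"
    using i_diff'[OF _ tm, of "m + n"] i.signed[OF c(1)] by simp
   show "\<iota> (m + n) (HC_cup m n f g) = \<iota> (m + n) (signed (HC (m + n)) (m * n) (HC_cup n m g f) \<oplus>\<^bsub>HC (m + n)\<^esub> dH ?k (signed (HC ?k) m ?c))"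
    unfolding i.add[OF HCv.signed_mem[OF gf] dt] i.signed[OF gf] 1 2 i_cup[OF f g] by (rule key)
  qed
  then show ?thesis using tm by blast
 next
  case 3
  have "HC_cup m n f g = \<zero>\<^bsub>HC (m + n)\<^esub>" "HC_cup n m g f = \<zero>\<^bsub>HC (m + n)\<^esub>"
   using triv[OF 3 HC_cup_mem[OF f g]] triv[OF 3 gf] by simp_all
  then show ?thesis by (intro bexI[OF _ z(1)]) (simp only: HC_signed_zero z(2) HCv.l_zero[OF HCv.zero_closed])
 next
  case 4
  then have mn: "m = int 0" "n = int 0" by simp_all
  show ?thesis using HC_cup_comm_deg[OF 4(3), of f g] f g gf z(2) HCv.r_zero[OF gf]
   by (intro bexI[OF _ z(1)]) (simp add: mn signed_def)
 qed
qed

text \<open>For a cochain without form outputs only the first double sum of \<open>Kop_fin\<close>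
  is left, and it consists of positive insertions, which do not leave the bar complex. The sum is
  formed with later stages g' and h'; insertions at bounded places depend only on germs, so g and h
  may be put in their place.\<close>

lemma HC_Kop:
 assumes f: "rp m M 0 f" and g: "rp n N 0 g" and h: "rp l L 0 h"
  and g': "rp n n' q g'" "sg_class n q g' = \<iota> n g" and h': "rp l l' r h'" "sg_class l r h' = \<iota> l h"
 shows "\<exists>t\<in>carrier (HC (m + n + l - 2)). gop (m + n + l - 2) (\<iota> (m + n + l - 2) t) (Kop M 0 (lf M 0 f) n' q (lf n' q g') l' r (lf l' r h'))"
proof -
 let ?D = "m + n + l - 2" and ?f = "lf M 0 f" and ?g = "lf N 0 g" and ?h = "lf L 0 h" and ?g' = "lf n' q g'" and ?h' = "lf l' r h'"
 have fc: "f : cch M 0" and gc: "g : cch N 0" and hc: "h : cch L 0" and D: "m = int M" "n = int N" "l = int L" using f g h by (simp_all add: rp_def)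
 define hg where "hg ph \<longleftrightarrow> (\<exists>t\<in>carrier (HC ?D). gop ?D (\<iota> ?D t) ph)" for ph
 obtain Ng where Ng: "!!N1 x. Ng <= N1 ==> x : W N1 ==> OP n' q g' x = OP N 0 g x" using gop_uniq[OF gop_rp[OF g'(1), unfolded g'(2)] gop_rp[OF g]] by blast
 obtain Nh where Nh: "!!N1 x. Nh <= N1 ==> x : W N1 ==> OP l' r h' x = OP L 0 h x" using gop_uniq[OF gop_rp[OF h'(1), unfolded h'(2)] gop_rp[OF h]] by blast
 have A: "hg (%x. Op M ?f (gi i n' ?g' (gi j l' ?h' x)))" if i: "i : {1..M}" and j: "j : {1..<i}" for i j
 proof -
  have i': "1 <= i" "i <= M" and j': "1 <= j" "j <= M + N - 1" and M: "2 <= M" using i j by auto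
  let ?c = "circ_pos M 0 f i N 0 g" and ?M = "M + N - 1"
  have cc: "?c : cch ?M 0" using circ_pos_cch[OF fc gc i'] by simp
  let ?t = "circ_pos ?M 0 ?c j L 0 h"
  have tc: "?t : cch (?M + L - 1) 0" using circ_pos_cch[OF cc hc j'] by simp
  have k: "?D = int (?M + L - 1)" using D M by (simp add: of_nat_diff)
  have tm: "?t : carrier (HC ?D)" unfolding k HC_int_carrier by (rule tc)
  have r: "rp ?D (?M + L - 1) 0 ?t" using tc k by (simp add: rp_def)
  have "gop ?D (\<iota> ?D ?t) (%x. Op M ?f (gi i n' ?g' (gi j l' ?h' x)))"
  proof (rule gop_cong[OF gop_rp[OF r], of "M + N + L + j + Nh + l' + (Ng + n' + i) + L"])
   fix K x assume K: "M + N + L + j + Nh + l' + (Ng + n' + i) + L <= K" and x: "x : W K"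
   define k where "k = K - ((j - 1) + L)"
   have k: "K = (j - 1) + L + k" using K by (simp add: k_def)
   have y: "gi j L ?h x : W ((j - 1) + Suc 0 + k)" using gi_W_mem[OF coch_lf[OF hc] x[unfolded k]] j' by simp
   have 1: "gi (Suc (j - 1)) l' ?h' x = gi (Suc (j - 1)) L ?h x"
    by (rule gi_cong[OF rp_coch[OF h'(1)] coch_lf[OF hc] Nh x]) (use K in auto)
   have 2: "gi (Suc (i - 1)) n' ?g' (gi j L ?h x) = gi (Suc (i - 1)) N ?g (gi j L ?h x)"
    by (rule gi_cong[OF rp_coch[OF g'(1)] coch_lf[OF gc] Ng y]) (use K k i' j' in auto)
   have kN: "M + N - 1 <= (j - 1) + Suc 0 + k" using K k by auto
   show "Op M ?f (gi i n' ?g' (gi j l' ?h' x)) = OP (?M + L - 1) 0 ?t x"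
    using circ_pos_Op[OF cc hc j' x] circ_pos_Op[OF fc gc i' y kN] 1 2 i' j' K by simp
  qed
  then show ?thesis using tm unfolding hg_def by blast
 qed
 have sum: "hg (%x. \<Sum>i\<in>I. ph i x)" if "finite I" "!!i. i : I ==> hg (ph i)" for I :: "nat set" and ph
  using that
 proof (induct I rule: finite_induct)
  case empty
  show ?case unfolding hg_def using gop_zero[of ?D] i.zero[of ?D] by (intro bexI[of _ "\<zero>\<^bsub>HC ?D\<^esub>"]) simp_all
 next
  case (insert i I)
  obtain s t where s: "s : carrier (HC ?D)" "gop ?D (\<iota> ?D s) (ph i)" and t: "t : carrier (HC ?D)" "gop ?D (\<iota> ?D t) (%x. \<Sum>i\<in>I. ph i x)"
   using insert unfolding hg_def by blast
  show ?case unfolding hg_def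
   by (rule bexI[of _ "s \<oplus>\<^bsub>HC ?D\<^esub> t"]) (use gop_add[OF s(2) t(2)] insert(1,2) s t in \<open>simp_all add: i.add\<close>)
 qed
 have sgn: "hg (%x. eps k (ph x))" if "hg ph" for k ph
  using that gop_signed[of ?D _ ph k] unfolding hg_def by (metis i.signed HCv.signed_mem)
 have neg: "hg (%x. - ph x)" if "hg ph" for ph
  using that gop_neg[of ?D _ ph] unfolding hg_def by (metis i.neg HCv.a_inv_closed)
 have "hg (%x. - (\<Sum>i = 1..M. \<Sum>j = 1..<i. eps ((n - 1) * (int i - 1) + (l - 1) * (int j - 1)) (Op M ?f (gi i n' ?g' (gi j l' ?h' x)))))"
  by (intro neg sum sgn A) auto
 then obtain t where t: "t : carrier (HC ?D)" "gop ?D (\<iota> ?D t) (%x. - (\<Sum>i = 1..M. \<Sum>j = 1..<i. eps ((n - 1) * (int i - 1) + (l - 1) * (int j - 1)) (Op M ?f (gi i n' ?g' (gi j l' ?h' x)))))"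
  unfolding hg_def by blast
 have kg: "n - 1 = int n' - int q - 1" "l - 1 = int l' - int r - 1" using g'(1) h'(1) by (simp_all add: rp_def)
 show ?thesis
 proof (rule bexI[OF _ t(1)], rule gop_cong[OF t(2), of "M + l'"])
  fix K x assume K: "M + l' <= K" and x: "x : W K"
  show "Kop M 0 ?f n' q ?g' l' r ?h' x = - (\<Sum>i = 1..M. \<Sum>j = 1..<i. eps ((n - 1) * (int i - 1) + (l - 1) * (int j - 1)) (Op M ?f (gi i n' ?g' (gi j l' ?h' x))))"
   using Kop_fin[OF coch_lf[OF fc] rp_coch[OF g'(1)] rp_coch[OF h'(1)] x K refl kg] by simp
 qed
qed

lemma HC_bracket_cup:
 assumes f: "f : carrier (HC m)" and g: "g : carrier (HC n)" and h: "h : carrier (HC l)"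
  and df: "dH m f = \<zero>\<^bsub>HC (m + 1)\<^esub>" and dg: "dH n g = \<zero>\<^bsub>HC (n + 1)\<^esub>" and dh: "dH l h = \<zero>\<^bsub>HC (l + 1)\<^esub>"
 shows "\<exists>t\<in>carrier (HC (m + n + l - 2)). HC_bracket m (n + l) f (HC_cup n l g h)
  = (HC_cup (m + n - 1) l (HC_bracket m n f g) h
    \<oplus>\<^bsub>HC (m + n + l - 1)\<^esub> signed (HC (m + n + l - 1)) ((m - 1) * n) (HC_cup n (m + l - 1) g (HC_bracket m l f h)))
   \<oplus>\<^bsub>HC (m + n + l - 1)\<^esub> dH (m + n + l - 2) t"
proof -
 let ?k = "m + n + l - 2" and ?C = "HC (m + n + l - 1)"
 let ?A = "HC_bracket m (n + l) f (HC_cup n l g h)" and ?B = "HC_cup (m + n - 1) l (HC_bracket m n f g) h"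
  and ?E = "HC_cup n (m + l - 1) g (HC_bracket m l f h)"
 have zk: "?k + 1 = m + n + l - 1" by simp
 have z: "\<zero>\<^bsub>HC ?k\<^esub> : carrier (HC ?k)" "dH ?k \<zero>\<^bsub>HC ?k\<^esub> = \<zero>\<^bsub>?C\<^esub>" using HC_diff_zero[of ?k, unfolded zk] by simp_all
 have deg: "m + (n + l) - 1 = m + n + l - 1" "m + n - 1 + l = m + n + l - 1" "n + (m + l - 1) = m + n + l - 1" by simp_all
 have Am: "?A : carrier ?C" using HC_bracket(1)[OF f HC_cup_mem[OF g h]] unfolding deg .
 have Bm: "?B : carrier ?C" using HC_cup_mem[OF HC_bracket(1)[OF f g] h] unfolding deg .
 have Em: "?E : carrier ?C" using HC_cup_mem[OF g HC_bracket(1)[OF f h]] unfolding deg .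
 have zero: ?thesis if "?A = \<zero>\<^bsub>?C\<^esub>" "?B = \<zero>\<^bsub>?C\<^esub>" "?E = \<zero>\<^bsub>?C\<^esub>"
  using z(1) unfolding that HC_signed_zero by (intro bexI[OF _ z(1)]) (simp only: z(2) HCv.l_zero[OF HCv.zero_closed])
 show ?thesis
 proof (cases "0 <= m & 0 <= n & 0 <= l")
  case False
  then have "f = \<zero>\<^bsub>HC m\<^esub> | g = \<zero>\<^bsub>HC n\<^esub> | h = \<zero>\<^bsub>HC l\<^esub>" using HC_neg f g h by (meson not_less)
  then have "?A = \<zero>\<^bsub>HC (m + (n + l) - 1)\<^esub> & ?B = \<zero>\<^bsub>HC (m + n - 1 + l)\<^esub> & ?E = \<zero>\<^bsub>HC (n + (m + l - 1))\<^esub>"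
   using f g h HC_bracket(1)[OF f g] HC_bracket(1)[OF f h] HC_cup_mem[OF g h]
   by (elim disjE) (simp_all only: HC_bracket_zero HC_cup_zero simp_thms)
  then show ?thesis unfolding deg using zero by blast
 next
  case True
  note nn = True
  show ?thesis
  proof (cases "bS = {}")
   case True
   show ?thesis
   \<comment> \<open>The identity lives in degree m + n + l - 1, so for A/k = 0 every total other
     than 1 is settled by \<open>triv\<close>.\<close>
   proof (cases "m + n + l = 1")
    case False
    then show ?thesis using triv[OF True _ Am] triv[OF True _ Bm] triv[OF True _ Em] by (intro zero) simp_all
   next
    case e: True
    have A: "?A = \<zero>\<^bsub>?C\<^esub>" using HC_deg[OF True _ f HC_cup_mem[OF g h]] e unfolding deg by simp
    have B: "?B = \<zero>\<^bsub>?C\<^esub>"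
    proof (cases "l = 0")
     case l: True
     have "HC_bracket m n f g = \<zero>\<^bsub>HC (m + n - 1)\<^esub>" by (rule HC_deg[OF True _ f g]) (use e l in simp)
     then show ?thesis using HC_cup_zero(2)[OF h, of "m + n - 1"] unfolding deg by simp
    next
     case False
     then show ?thesis using nn e HC_cup_neg[of "m + n - 1" l "HC_bracket m n f g" h] unfolding deg by simp
    qed
    have "?E = \<zero>\<^bsub>?C\<^esub>"
    proof (cases "n = 0")
     case n: True
     have "HC_bracket m l f h = \<zero>\<^bsub>HC (m + l - 1)\<^esub>" by (rule HC_deg[OF True _ f h]) (use e n in simp)
     then show ?thesis using HC_cup_zero(1)[OF g, of "m + l - 1"] unfolding deg by simp
    next
     case False
     then show ?thesis using nn e HC_cup_neg[of n "m + l - 1" g "HC_bracket m l f h"] unfolding deg by simp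
    qed
    then show ?thesis by (rule zero[OF A B])
   qed
  next
   case ne: False
   obtain M N L where i: "m = int M" "n = int N" "l = int L" using nn by (metis nonneg_int_cases)
   note rf = HC_rp[OF f[unfolded i(1)], folded i(1)] and rg = HC_rp[OF g[unfolded i(2)], folded i(2)] and rh = HC_rp[OF h[unfolded i(3)], folded i(3)]
   have cz: "Csg_diff k (\<iota> k x) = \<zero>\<^bsub>Csg (k + 1)\<^esub>" if "x : carrier (HC k)" "dH k x = \<zero>\<^bsub>HC (k + 1)\<^esub>" for k x
    using HC_diff(2)[OF that(1)] that(2) i.zero by simp
   \<comment> \<open>Two steps give \<open>g\<close> N + 2 arguments, and N + 1 steps give
     \<open>h\<close> the form degree N + 1. This establishes the relation n = r + 1 without leaving
     the classes of \<open>g\<close> and \<open>h\<close>.\<close>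
   note rg' = push_rp[OF rg, of 2] and rh' = push_rp[OF rh, of "N + 1"]
   have sg: "sg_class n (0 + 2) (push (C_theta n) 0 2 g) = \<iota> n g" "sg_class l (0 + (N + 1)) (push (C_theta l) 0 (N + 1) h) = \<iota> l h"
    unfolding sg_class_def by (rule cl.cls_push[OF rp_carrier[OF rg]], rule cl.cls_push[OF rp_carrier[OF rh]])
   have cf: "cocy M 0 (lf M 0 f)" by (rule cocy_rep[OF rf cz[OF f df] disjI1[OF ne]])
   note cg = cocy_rep[OF rg' cz[OF g dg, folded sg(1)] disjI1[OF ne]] and ch = cocy_rep[OF rh' cz[OF h dh, folded sg(2)] disjI1[OF ne]]
   have n: "N + 2 = Suc (0 + (N + 1))" by simp
   obtain T where T: "T : carrier (HC ?k)" "gop ?k (\<iota> ?k T) (Kop M 0 (lf M 0 f) (N + 2) (0 + 2) (lf (N + 2) (0 + 2) (push (C_theta n) 0 2 g))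
     (L + (N + 1)) (0 + (N + 1)) (lf (L + (N + 1)) (0 + (N + 1)) (push (C_theta l) 0 (N + 1) h)))"
    using HC_Kop[OF rf rg rh rg' sg(1) rh' sg(2)] by blast
   note key = br_cp_key[OF rf rg' rh' cf cg ch n T(2), unfolded sg]
   let ?t = "\<ominus>\<^bsub>HC ?k\<^esub> signed (HC ?k) (m + n) T"
   have sm: "signed (HC ?k) (m + n) T : carrier (HC ?k)" using T(1) by (rule HCv.signed_mem)
   have tm: "?t : carrier (HC ?k)" using sm by simp
   have dt: "dH ?k ?t : carrier ?C" "\<iota> (m + n + l - 1) (dH ?k ?t) = Csg_diff ?k (\<ominus>\<^bsub>Csg ?k\<^esub> signed (Csg ?k) (m + n) (\<iota> ?k T))"
    using diff_mem'[OF _ tm, of "m + n + l - 1"] i_diff'[OF _ tm, of "m + n + l - 1"] by (simp_all add: i.neg[OF sm] i.signed[OF T(1)])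
   have iA: "\<iota> (m + n + l - 1) ?A = Csg_bracket m (n + l) (\<iota> m f) (Csg_cup n l (\<iota> n g) (\<iota> l h))"
    using i_br'[OF deg(1)[symmetric] f HC_cup_mem[OF g h]] i_cup[OF g h] by simp
   have iB: "\<iota> (m + n + l - 1) ?B = Csg_cup (m + n - 1) l (Csg_bracket m n (\<iota> m f) (\<iota> n g)) (\<iota> l h)"
    using i_cup'[OF deg(2)[symmetric] HC_bracket(1)[OF f g] h] HC_bracket(2)[OF f g] by simp
   have iE: "\<iota> (m + n + l - 1) ?E = Csg_cup n (m + l - 1) (\<iota> n g) (Csg_bracket m l (\<iota> m f) (\<iota> l h))"
    using i_cup'[OF deg(3)[symmetric] g HC_bracket(1)[OF f h]] HC_bracket(2)[OF f h] by simp
   have "?A = (?B \<oplus>\<^bsub>?C\<^esub> signed ?C ((m - 1) * n) ?E) \<oplus>\<^bsub>?C\<^esub> dH ?k ?t"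
   proof (rule HC_inj[OF disjI1[OF ne] Am])
    note sE = HCv.signed_mem[OF Em, of "(m - 1) * n"]
    note BE = HCv.a_closed[OF Bm sE]
    show "(?B \<oplus>\<^bsub>?C\<^esub> signed ?C ((m - 1) * n) ?E) \<oplus>\<^bsub>?C\<^esub> dH ?k ?t : carrier ?C" by (rule HCv.a_closed[OF BE dt(1)])
    show "\<iota> (m + n + l - 1) ?A = \<iota> (m + n + l - 1) ((?B \<oplus>\<^bsub>?C\<^esub> signed ?C ((m - 1) * n) ?E) \<oplus>\<^bsub>?C\<^esub> dH ?k ?t)"
     unfolding i.add[OF BE dt(1)] i.add[OF Bm sE] i.signed[OF Em] iA iB iE dt(2) by (rule key)
   qed
   then show ?thesis using tm by blast
  qed
 qed
qed

theorem gerst_HC: "gerst_complex HC (C_diff 0) HC_cup one_cochain HC_bracket"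
proof (rule gerst_complex.intro)
 have "\<iota> (0 + 1) (dH 0 one_cochain) = \<zero>\<^bsub>Csg 1\<^esub>" using HC_diff(2)[OF HC_one] Csg_one_d by simp
 then show "dH 0 one_cochain = \<zero>\<^bsub>HC 1\<^esub>"
  using HC_diff(1)[OF HC_one] by (intro HC_inj[of 1]) (simp_all add: i.zero)
qed (rule HC_vs HC_d_lin HC_d_d HC_cup_bil HC_cup_d HC_cup_assoc HC_one HC_one_cup HC_bracket_bil HC_bracket_d HC_bracket_anti HC_jacobi HC_cup_comm HC_bracket_cup; assumption)+

sublocale inc: gerst_complex_hom HC "C_diff 0" HC_cup one_cochain HC_bracket Csg Csg_diff Csg_cup "sg_class 0 0 one_cochain" Csg_bracket \<iota>
 by (intro gerst_complex_hom.intro gerst_HC gerst_Csg gerst_complex_hom_axioms.intro i_lin i_cup HC_bracket(2) HC_diff(2) refl)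

end

theorem corollary5p3:
  fixes scale :: "'k::field \<Rightarrow> 'a::{ring, monoid_mult} \<Rightarrow> 'a"
  assumes "algebra_over_field scale"
  shows "gerstenhaber_algebra (algebra_over_field.HH_sg scale) \<and>
    gerstenhaber_morphism (algebra_over_field.HH scale) (algebra_over_field.HH_sg scale)
      (algebra_over_field.rho scale)"
proof -
 interpret algebra_over_field scale by fact
 have "rho = (%d \<xi>. \<Union>f\<in>\<xi>. cohomology_class Csg Csg_diff d (\<iota> d f))" by (simp add: fun_eq_iff rho_def)
 then show ?thesis
  using S.gerstenhaber_algebra_cohomology inc.gerstenhaber_morphism_cohomology by (simp add: HH_def HH_sg_def)
qed

end
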